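(* Let $\xi(s)=\tfrac12 s(s-1)\pi^{-s/2}\Gamma(s/2)\zeta(s)$ be the Riemann $\xi$-function. For real $h$ and $0\le\theta<2\pi$ define the entire functions $$A_{h,\theta}(s)=\tfrac12(\cos\theta)\big(\xi(s+h)+\xi(s-h)\big)-\tfrac1{2i}(\sin\theta)\big(\xi(s+h)-\xi(s-h)\big),$$ $$B_{h,\theta}(s)=-\tfrac12(\sin\theta)\big(\xi(s+h)+\xi(s-h)\big)-\tfrac1{2i}(\cos\theta)\big(\xi(s+h)-\xi(s-h)\big).$$ Let $k\ge1$ be an integer. (1) For every real $h$ with $|h|\ge\tfrac12$ and every $0\le\theta<2\pi$, each of the functions $A_{h,\theta}(s)$ and $B_{h,\theta}(s)$ has a limiting joint distribution, as $T\to\infty$, of its $k$ consecutive normalized zero spacings $(\delta_n,\delta_{n+1},\dots,\delta_{n+k-1})$, and this limiting distribution is the delta (unit point) mass located at $(x_1,x_2,\dots,x_k)=(1,1,\dots,1)$. (2) Assume the Riemann hypothesis. Then the same conclusion holds for every real $h$ with $0<|h|<\tfrac12$ and every $0\le\theta<2\pi$: the limiting joint distribution exists for both $A_{h,\theta}$ and $B_{h,\theta}$ and is the unit point mass at $(1,1,\dots,1)$.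
   Context: Under the hypotheses of (1) or (2), all zeros of $A_{h,\theta}$ and $B_{h,\theta}$ are simple and lie on $\Re(s)=\tfrac12$. For $F\in\{A_{h,\theta},B_{h,\theta}\}$ write the zeros as $\tfrac12+i\gamma_n$, $n\in\mathbb Z$, with $\gamma_n<\gamma_{n+1}$. The normalized zero spacing is $$\delta_n:=(\gamma_{n+1}-\gamma_n)\,\frac1{2\pi}\log\frac{|\gamma_n|}{2\pi}$$ (defined for $\gamma_n\ne0$). For given $T$, put the uniform probability distribution on the finite family of vectors $(\delta_n,\dots,\delta_{n+k-1})\in\mathbb R^k$ indexed by those $n$ with $|\gamma_n|\le T$ (discarding the finitely many $n$ for which one of the entries is undefined because the corresponding $\gamma$ is $0$). The function has a limiting joint distribution of $k$ consecutive normalized zero spacings if these probability measures converge weakly, as $T\to\infty$, to a probability measure on $\mathbb R^k$, which is then the limiting distribution. *)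

theory Defs
  imports "HOL-Probability.Probability" "HOL-Complex_Analysis.Complex_Analysis"
begin

text \<open>The Riemann zeta function: the unique holomorphic continuation of the Dirichlet series to
  the plane without 1. The value at the pole is fixed to 0 only to make the total function unique.\<close>

definition riemann_zeta :: "complex \<Rightarrow> complex" where
  "riemann_zeta = (THE f. f holomorphic_on (- {1}) \<and>
     (\<forall>s. Re s > 1 \<longrightarrow> (\<lambda>n. 1 / of_nat (Suc n) powr s) sums f s) \<and> f 1 = 0)"

definition riemann_hypothesis :: bool where
  "riemann_hypothesis \<longleftrightarrow>
     (\<forall>s. riemann_zeta s = 0 \<and> 0 < Re s \<and> Re s < 1 \<longrightarrow> Re s = 1 / 2)"

text \<open>The product formula has removable singularities at 1 (pole of zeta) and at 0, -2, -4, ...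
  (poles of \<open>Gamma (s / 2)\<close>), where the library functions take conventional values;
  \<open>remove_sings\<close> replaces these by the limits, which gives the entire function.\<close>

definition riemann_xi :: "complex \<Rightarrow> complex" where
  "riemann_xi = remove_sings (\<lambda>s. 1 / 2 * s * (s - 1) * complex_of_real pi powr (- s / 2)
     * Gamma (s / 2) * riemann_zeta s)"

definition A_fun :: "real \<Rightarrow> real \<Rightarrow> complex \<Rightarrow> complex" where
  "A_fun h \<theta> s =
     1 / 2 * of_real (cos \<theta>) * (riemann_xi (s + of_real h) + riemann_xi (s - of_real h))
     - 1 / (2 * \<i>) * of_real (sin \<theta>) * (riemann_xi (s + of_real h) - riemann_xi (s - of_real h))"

definition B_fun :: "real \<Rightarrow> real \<Rightarrow> complex \<Rightarrow> complex" where
  "B_fun h \<theta> s =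
     - (1 / 2) * of_real (sin \<theta>) * (riemann_xi (s + of_real h) + riemann_xi (s - of_real h))
     - 1 / (2 * \<i>) * of_real (cos \<theta>) * (riemann_xi (s + of_real h) - riemann_xi (s - of_real h))"

text \<open>\<open>\<gamma>\<close> lists all zeros of \<open>F\<close>, as \<open>1/2 + \<i> \<gamma>\<^sub>n\<close>. Such a list is unique up to a shift of the index.\<close>

definition enumerates_zeros :: "(complex \<Rightarrow> complex) \<Rightarrow> (int \<Rightarrow> real) \<Rightarrow> bool" where
  "enumerates_zeros F \<gamma> \<longleftrightarrow>
     strict_mono \<gamma> \<and> {s. F s = 0} = range (\<lambda>n. Complex (1 / 2) (\<gamma> n))"

definition normalized_spacing :: "(int \<Rightarrow> real) \<Rightarrow> int \<Rightarrow> real" where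
  "normalized_spacing \<gamma> n = (\<gamma> (n + 1) - \<gamma> n) * (1 / (2 * pi)) * ln (\<bar>\<gamma> n\<bar> / (2 * pi))"

text \<open>The index type \<open>'k\<close> is finite and linearly ordered; its element \<open>i\<close> with \<open>j\<close> predecessors
  stands for coordinate number \<open>j\<close> (counted from 0), so that the vector below is
  \<open>(\<delta>\<^sub>n, \<dots>, \<delta>\<^sub>n\<^sub>+\<^sub>k\<^sub>-\<^sub>1)\<close> with \<open>k = CARD('k)\<close>.\<close>

definition spacing_vector :: "(int \<Rightarrow> real) \<Rightarrow> int \<Rightarrow> real ^ 'k::{finite, linorder}" where
  "spacing_vector \<gamma> n = (\<chi> i. normalized_spacing \<gamma> (n + int (card {j. j < i})))"

definition spacing_indices :: "nat \<Rightarrow> (int \<Rightarrow> real) \<Rightarrow> real \<Rightarrow> int set" where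
  "spacing_indices k \<gamma> T = {n. \<bar>\<gamma> n\<bar> \<le> T \<and> (\<forall>j<k. \<gamma> (n + int j) \<noteq> 0)}"

definition spacing_distribution ::
    "(int \<Rightarrow> real) \<Rightarrow> real \<Rightarrow> (real ^ 'k::{finite, linorder}) measure" where
  "spacing_distribution \<gamma> T =
     distr (uniform_count_measure (spacing_indices CARD('k) \<gamma> T)) borel (spacing_vector \<gamma>)"

text \<open>The library's \<open>weak_conv_m\<close> covers only sequences of measures on the real line.\<close>

definition converges_weakly ::
    "(real \<Rightarrow> 'a::topological_space measure) \<Rightarrow> 'a measure \<Rightarrow> bool" where
  "converges_weakly M L \<longleftrightarrow>
     (\<forall>f :: 'a \<Rightarrow> real. continuous_on UNIV f \<and> bounded (range f) \<longrightarrow>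
        ((\<lambda>T. integral\<^sup>L (M T) f) \<longlongrightarrow> integral\<^sup>L L f) at_top)"

definition limiting_joint_spacing_distribution ::
    "(complex \<Rightarrow> complex) \<Rightarrow> (real ^ 'k::{finite, linorder}) measure \<Rightarrow> bool" where
  "limiting_joint_spacing_distribution F L \<longleftrightarrow>
     prob_space L \<and> sets L = sets borel \<and>
     (\<exists>\<gamma>. enumerates_zeros F \<gamma>) \<and>
     (\<forall>\<gamma>. enumerates_zeros F \<gamma> \<longrightarrow> converges_weakly (spacing_distribution \<gamma>) L)"

end

theory Submission
  imports Defs "HOL-Real_Asymp.Real_Asymp"
begin

text \<open>On the critical line \<open>A\<^sub>h\<^sub>,\<^sub>\<theta>(1/2 + i t)\<close> is the real part of \<open>exp(i \<theta>) \<xi>(1/2 + h + i t)\<close>, so its zeros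
  are the points where the phase \<open>\<phi>(t) = arg \<xi>(1/2 + h + i t)\<close> takes the values \<open>\<pi> n + c\<close>; off the line the
  two summands have different absolute values. The same comparison shows that \<open>\<phi>\<close> is increasing. By Stirling's
  formula \<open>\<phi> = \<vartheta> + S\<close> with \<open>\<vartheta>' ~ (1/2) log t\<close> and \<open>S(t) = arg ((s - 1) \<zeta>(s))\<close> at \<open>s = 1/2 + h + i t\<close>.
  If for most \<open>t\<close> the function \<open>S\<close> varies by \<open>o(1)\<close> over distances of order \<open>1 / log t\<close>, most gaps
  are \<open>(1 + o(1)) 2 \<pi> / log t\<close>.

  For \<open>h > 1/2\<close>, or \<open>0 < h < 1/2\<close> under the Riemann hypothesis, \<open>\<zeta>'/\<zeta> = o(log t)\<close> gives this for all \<open>t\<close>.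
  For \<open>h = 1/2\<close> the line has real part 1. There \<open>\<zeta>\<close> and \<open>\<zeta>'\<close> have bounded mean squares,
  and the mean of \<open>log |\<zeta>|\<close> is bounded from below, so \<open>|\<zeta>|\<close> is small only on a set of small density; elsewhere
  the variation of \<open>S\<close> over a short window is controlled by the integral of \<open>|\<zeta>'|\<close>.
  The lower bound for the mean of \<open>log |\<zeta>|\<close> follows by integrating \<open>log ((s - 1) \<zeta>(s))\<close> over
  \<open>1 \<le> Re s \<le> 2\<close>; its imaginary part is \<open>O(t)\<close> because the phase is monotone and its mean over unit
  intervals is controlled by \<open>log |\<zeta>|\<close>.\<close>

subsection \<open>The zeta function by Euler--Maclaurin summation\<close>

text \<open>Convergence to a point mass only asks that the proportion of gaps away from 1 tends to
  0, so an exceptional set of small density is harmless. That set is measured in \<open>t\<close>,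
  however, and a short set might contain many zeros. A count excludes this: the good gaps have
  length at most \<open>(1 + 5 \<epsilon>) 2 \<pi> / log T\<close> and cover almost all of
  \<open>[-T, T]\<close>, so they are almost as many as all zeros there, whose number is bounded
  above by the variation of the phase.

  On the line of real part 1 the bound \<open>o(log t)\<close> for the logarithmic derivative is out
  of reach of the method used elsewhere, because the discs on which it rests need a zero-free margin
  to the left of the line; hence the mean values. The comparison of the two summands survives there
  as a limit from larger \<open>h\<close>.

  Changing the sign of \<open>h\<close> and passing from \<open>A\<close> to \<open>B\<close> are
  changes of \<open>\<theta>\<close>, so only \<open>A\<close> with \<open>h > 0\<close> is treated.
  The analysis is carried out for \<open>(s - 1) \<zeta>(s)\<close>, which has no pole and is 1 at
  \<open>s = 1\<close>.\<close>

definition zeta_term :: "nat \<Rightarrow> complex \<Rightarrow> complex" where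
  "zeta_term n s = (s - 1) / 2 * (of_nat n powr (-s) + of_nat (Suc n) powr (-s))
     + (of_nat (Suc n) powr (1 - s) - of_nat n powr (1 - s))"

text \<open>Euler-Maclaurin summation gives \<open>(s - 1) \<zeta>(s)\<close> as the following series, which converges for \<open>Re s > -1\<close>.\<close>

definition zeta_reg :: "complex \<Rightarrow> complex" where
  "zeta_reg s = 1 + (s - 1) / 2 + (\<Sum>n. zeta_term (Suc n) s)"

text \<open>The term is the error of a trapezoidal rule, hence an integral against \<open>u (1 - u)\<close>.\<close>

lemma zeta_term_bound:
  assumes n: "n \<ge> 1" and s: "Re s \<ge> -2"
  shows "norm (zeta_term n s) \<le> norm ((s - 1) * s * (s + 1)) / 8 * real n powr (- Re s - 2)"
proof -
  \<comment> \<open>\<open>H\<close> arises from the integral of \<open>H'\<close> by two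
    integrations by parts. The terms with \<open>u (1 - u)\<close> vanish at both ends, and what
    remains of \<open>H 1 - H 0\<close> is the trapezoidal error.\<close>
  define H where "H = (\<lambda>u::complex. - ((s - 1) * s / 2) * (u * (1 - u)) * (of_nat n + u) powr (-s - 1)
     - (s - 1) / 2 * (1 - 2 * u) * (of_nat n + u) powr (-s) + (of_nat n + u) powr (1 - s))"
  define H' where "H' = (\<lambda>u::complex. (s - 1) * s * (s + 1) / 2 * (u * (1 - u)) * (of_nat n + u) powr (-s - 2))"
  let ?B = "norm ((s - 1) * s * (s + 1)) / 8 * real n powr (- Re s - 2)"
  have "norm (H 1 - H 0) \<le> ?B * norm (1 - 0 :: complex)"
  proof (rule field_differentiable_bound[where S = "closed_segment 0 1" and f' = H'])
    fix z :: complex assume "z \<in> closed_segment 0 1"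
    then obtain u where u: "u \<in> {0..1}" "z = of_real u"
      by (auto simp: in_segment scaleR_conv_of_real)
    have pos: "real n + u > 0" using u n by auto
    have nz: "of_nat n + z \<notin> \<real>\<^sub>\<le>\<^sub>0" using pos u by (auto simp: complex_nonpos_Reals_iff)
    have nz0: "of_nat n + z \<noteq> 0" using nz by auto
    have "(H has_field_derivative H' z) (at z)"
    proof -
      have d: "((\<lambda>u. (of_nat n + u) powr c) has_field_derivative c * (of_nat n + z) powr (c - 1)) (at z)" for c
        using has_field_derivative_powr[OF nz, of c]
        by (auto intro!: derivative_eq_intros nz)
      have p3: "(of_nat n + z) powr (1 - s - 1) = (of_nat n + z) powr (-s)" by simp
      have "(H has_field_derivative
          (- ((s - 1) * s / 2) * (1 - 2 * z) * (of_nat n + z) powr (-s - 1)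
           + - ((s - 1) * s / 2) * (z * (1 - z)) * ((-s - 1) * (of_nat n + z) powr (-s - 1 - 1)))
          - ((s - 1) / 2 * (-2) * (of_nat n + z) powr (-s)
           + (s - 1) / 2 * (1 - 2 * z) * (-s * (of_nat n + z) powr (-s - 1)))
          + (1 - s) * (of_nat n + z) powr (1 - s - 1)) (at z)"
        unfolding H_def
        by (rule DERIV_cong, (rule DERIV_add DERIV_diff DERIV_mult d derivative_eq_intros refl)+) (simp add: algebra_simps)
      also have "- ((s - 1) * s / 2) * (1 - 2 * z) * (of_nat n + z) powr (-s - 1)
           + - ((s - 1) * s / 2) * (z * (1 - z)) * ((-s - 1) * (of_nat n + z) powr (-s - 1 - 1))
          - ((s - 1) / 2 * (-2) * (of_nat n + z) powr (-s)
           + (s - 1) / 2 * (1 - 2 * z) * (-s * (of_nat n + z) powr (-s - 1)))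
          + (1 - s) * (of_nat n + z) powr (1 - s - 1) = H' z"
      proof -
        have "- ((s - 1) * s / 2) * (1 - 2 * z) * B + - ((s - 1) * s / 2) * (z * (1 - z)) * ((-s - 1) * C)
          - ((s - 1) / 2 * (-2) * A + (s - 1) / 2 * (1 - 2 * z) * (-s * B)) + (1 - s) * A
          = (s - 1) * s * (s + 1) / 2 * (z * (1 - z)) * C" for A B C :: complex
          by (simp add: divide_simps) (simp add: algebra_simps)
        moreover have "- s - 1 - 1 = - s - 2" by simp
        ultimately show ?thesis unfolding H'_def p3 by (simp only:)
      qed
      finally show ?thesis .
    qed
    thus "(H has_field_derivative H' z) (at z within closed_segment 0 1)"
      by (rule has_field_derivative_at_within)
    have "u * (1 - u) \<le> 1 / 4"
      using zero_le_power2[of "u - 1/2"] by (simp add: power2_eq_square algebra_simps)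
    moreover have "z * (1 - z) = of_real (u * (1 - u))" using u by simp
    ultimately have a: "norm (z * (1 - z)) \<le> 1 / 4"
      using u by (simp only: norm_of_real) auto
    have "norm ((of_nat n + z) powr (-s - 2)) = (real n + u) powr (- Re s - 2)"
      using pos u by (subst norm_powr_real_powr) auto
    also have "\<dots> \<le> real n powr (- Re s - 2)"
      using u n s by (intro powr_mono2') auto
    finally have b: "norm ((of_nat n + z) powr (-s - 2)) \<le> real n powr (- Re s - 2)" .
    have "norm (H' z) = norm ((s - 1) * s * (s + 1)) / 2 * (norm (z * (1 - z)) * norm ((of_nat n + z) powr (-s - 2)))"
      unfolding H'_def by (simp add: norm_mult norm_divide)
    also have "\<dots> \<le> norm ((s - 1) * s * (s + 1)) / 2 * (1 / 4 * real n powr (- Re s - 2))"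
      by (intro mult_left_mono mult_mono a b) auto
    finally show "norm (H' z) \<le> ?B" by simp
  qed auto
  moreover have "H 1 - H 0 = zeta_term n s"
    unfolding H_def zeta_term_def by (simp add: field_simps)
  ultimately show ?thesis by simp
qed

lemma summable_powr_shift:
  assumes "a < -1" shows "summable (\<lambda>n. real (Suc n) powr a)"
  using assms by (subst summable_Suc_iff) (simp add: summable_real_powr_iff)

lemma summable_norm_zeta_term:
  assumes "Re s > -1" shows "summable (\<lambda>n. norm (zeta_term (Suc n) s))"
proof (rule summable_comparison_test')
  show "summable (\<lambda>n. norm ((s - 1) * s * (s + 1)) / 8 * real (Suc n) powr (- Re s - 2))"
    using assms by (intro summable_mult summable_powr_shift) auto
  show "norm (norm (zeta_term (Suc n) s)) \<le> norm ((s - 1) * s * (s + 1)) / 8 * real (Suc n) powr (- Re s - 2)"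
    if "n \<ge> 0" for n using zeta_term_bound[of "Suc n" s] assms by simp
qed

lemma holomorphic_zeta_reg: "zeta_reg holomorphic_on {s. Re s > -1}"
proof -
  have op: "open {s. Re s > -1}" by (rule open_halfspace_Re_gt)
  have "(\<lambda>s. \<Sum>n. zeta_term (Suc n) s) holomorphic_on {s. Re s > -1}"
  proof (rule holomorphic_uniform_sequence[OF op, where f = "\<lambda>N s. \<Sum>n<N. zeta_term (Suc n) s"])
    show "(\<lambda>s. \<Sum>n<N. zeta_term (Suc n) s) holomorphic_on {s. Re s > -1}" for N
      unfolding zeta_term_def by (intro holomorphic_intros) (auto simp: complex_nonpos_Reals_iff)
  next
    fix x assume "x \<in> {s. Re s > -1}"
    hence x: "Re x > -1" by simp
    \<comment> \<open>Half the distance to the boundary line, so that on the whole disc the exponent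
      \<open>- Re s - 2\<close> stays below a fixed number less than \<open>- 1\<close>.\<close>
    define d where "d = (Re x + 1) / 2"
    have d: "d > 0" using x by (simp add: d_def)
    have re: "Re s \<ge> (Re x - 1) / 2" if "s \<in> cball x d" for s
      using that abs_Re_le_cmod[of "x - s"] unfolding d_def by (simp add: dist_norm field_simps)
    have nm: "norm s \<le> norm x + d" if "s \<in> cball x d" for s
      using that norm_triangle_ineq2[of s x] by (simp add: dist_norm norm_minus_commute)
    have "cball x d \<subseteq> {s. Re s > -1}" using re x by (fastforce simp: field_simps)
    moreover have "uniform_limit (cball x d) (\<lambda>N s. \<Sum>n<N. zeta_term (Suc n) s) (\<lambda>s. \<Sum>n. zeta_term (Suc n) s) sequentially"
    proof (rule Weierstrass_m_test[where M = "\<lambda>n. (norm x + d + 1)^3 / 8 * real (Suc n) powr (- ((Re x - 1) / 2) - 2)"])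
      show "summable (\<lambda>n. (norm x + d + 1)^3 / 8 * real (Suc n) powr (- ((Re x - 1) / 2) - 2))"
        using x by (intro summable_mult summable_powr_shift) auto
      fix n s assume s: "s \<in> cball x d"
      have "norm ((s - 1) * s * (s + 1)) \<le> (norm x + d + 1) * (norm x + d + 1) * (norm x + d + 1)"
        unfolding norm_mult using nm[OF s] d norm_triangle_ineq4[of s 1] norm_triangle_ineq[of s 1]
        by (intro mult_mono) auto
      moreover have "real (Suc n) powr (- Re s - 2) \<le> real (Suc n) powr (- ((Re x - 1) / 2) - 2)"
        using re[OF s] by (intro powr_mono) auto
      ultimately have *: "norm ((s - 1) * s * (s + 1)) / 8 * real (Suc n) powr (- Re s - 2) \<le>
          (norm x + d + 1)^3 / 8 * real (Suc n) powr (- ((Re x - 1) / 2) - 2)"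
        using d by (intro mult_mono divide_right_mono) (auto simp: power3_eq_cube)
      thus "norm (zeta_term (Suc n) s) \<le> (norm x + d + 1)^3 / 8 * real (Suc n) powr (- ((Re x - 1) / 2) - 2)"
      proof -
        have "Re s \<ge> -2" using re[OF s] x by argo
        thus ?thesis using zeta_term_bound[of "Suc n" s] *
          by linarith
      qed
    qed
    ultimately show "\<exists>d>0. cball x d \<subseteq> {s. Re s > -1} \<and> uniform_limit (cball x d) (\<lambda>N s. \<Sum>n<N. zeta_term (Suc n) s) (\<lambda>s. \<Sum>n. zeta_term (Suc n) s) sequentially"
      using d by blast
  qed
  thus ?thesis unfolding zeta_reg_def by (intro holomorphic_intros) auto
qed

lemma sum_zeta_term:
  "(\<Sum>n<N. zeta_term (Suc n) s) = (s - 1) * ((\<Sum>n<Suc N. of_nat (Suc n) powr (-s)) - 1 / 2 - of_nat (Suc N) powr (-s) / 2)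
      + of_nat (Suc N) powr (1 - s) - 1"
proof (induction N)
  case (Suc N)
  show ?case unfolding sum.lessThan_Suc[of "\<lambda>n. zeta_term (Suc n) s" "N"] sum.lessThan_Suc[of _ "Suc N"] Suc
    unfolding zeta_term_def by (simp add: field_simps del: of_nat_Suc sum.lessThan_Suc)
qed (simp add: field_simps)

text \<open>The first \<open>N\<close> terms of the Euler-Maclaurin series telescope into a partial
  sum of the Dirichlet series with boundary terms. This form makes partial sums usable on and to the
  left of the line of real part 1.\<close>

lemma zeta_reg_approx:
  assumes "Re s > -1"
  shows "zeta_reg s = (s - 1) * ((\<Sum>n<Suc N. of_nat (Suc n) powr (-s)) - of_nat (Suc N) powr (-s) / 2)
      + of_nat (Suc N) powr (1 - s) + (\<Sum>n. zeta_term (Suc (n + N)) s)"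
proof -
  have "(\<Sum>n. zeta_term (Suc n) s) = (\<Sum>n. zeta_term (Suc (n + N)) s) + (\<Sum>n<N. zeta_term (Suc n) s)"
    using suminf_split_initial_segment[OF summable_norm_cancel[OF summable_norm_zeta_term[OF assms]], of N] by simp
  thus ?thesis unfolding zeta_reg_def sum_zeta_term by (simp add: algebra_simps)
qed

lemma summable_zeta_series:
  assumes "Re s > 1" shows "summable (\<lambda>n. of_nat (Suc n) powr (-s) :: complex)"
proof (rule summable_norm_cancel)
  have "norm (of_nat (Suc n) powr (-s) :: complex) = real (Suc n) powr (- Re s)" for n
    by (subst norm_powr_real_powr) auto
  thus "summable (\<lambda>n. norm (of_nat (Suc n) powr (-s) :: complex))"
    using summable_powr_shift[of "- Re s"] assms by simp
qed

lemma tendsto_of_nat_powr_0: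
  assumes "Re s < 0" shows "(\<lambda>n. of_nat (Suc n) powr s :: complex) \<longlonglongrightarrow> 0"
proof (rule tendsto_norm_zero_cancel)
  have "norm (of_nat (Suc n) powr s :: complex) = real (Suc n) powr (Re s)" for n
    by (subst norm_powr_real_powr) auto
  moreover have "(\<lambda>n. real (Suc n) powr (Re s)) \<longlonglongrightarrow> 0"
    by (rule tendsto_neg_powr[OF assms]) (rule filterlim_compose[OF filterlim_real_sequentially filterlim_Suc])
  ultimately show "(\<lambda>n. norm (of_nat (Suc n) powr s :: complex)) \<longlonglongrightarrow> 0" by simp
qed

lemma zeta_reg_eq_series:
  assumes "Re s > 1"
  shows "zeta_reg s = (s - 1) * (\<Sum>n. of_nat (Suc n) powr (-s))"
proof -
  have "(\<lambda>N. \<Sum>n<Suc N. of_nat (Suc n) powr (-s) :: complex) \<longlonglongrightarrow> (\<Sum>n. of_nat (Suc n) powr (-s))"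
    using summable_LIMSEQ[OF summable_zeta_series[OF assms]] LIMSEQ_Suc by blast
  hence "(\<lambda>N. \<Sum>n<N. zeta_term (Suc n) s) \<longlonglongrightarrow>
      (s - 1) * ((\<Sum>n. of_nat (Suc n) powr (-s)) - 1 / 2 - 0 / 2) + 0 - 1"
    unfolding sum_zeta_term using assms
    by (intro tendsto_intros tendsto_of_nat_powr_0) auto
  moreover have "(\<lambda>N. \<Sum>n<N. zeta_term (Suc n) s) \<longlonglongrightarrow> (\<Sum>n. zeta_term (Suc n) s)"
    by (rule summable_LIMSEQ) (use summable_norm_cancel[OF summable_norm_zeta_term] assms in auto)
  ultimately have "(\<Sum>n. zeta_term (Suc n) s) = (s - 1) * ((\<Sum>n. of_nat (Suc n) powr (-s)) - 1 / 2 - 0 / 2) + 0 - 1"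
    using LIMSEQ_unique by blast
  thus ?thesis unfolding zeta_reg_def by (simp add: algebra_simps)
qed

text \<open>The cube comes from the factor \<open>(s - 1) s (s + 1)\<close> in the estimate of the
  terms. The degree is immaterial later: the bound enters through logarithms and through the
  polynomial growth condition of the Phragmen-Lindelof principle.\<close>

lemma zeta_reg_bound:
  obtains C where "C \<ge> 1" "\<And>s. Re s \<ge> 0 \<Longrightarrow> norm (zeta_reg s) \<le> C * (1 + norm s) ^ 3"
proof
  define S where "S = (\<Sum>n. real (Suc n) powr (-2))"
  have sm: "summable (\<lambda>n. real (Suc n) powr (-2))" by (rule summable_powr_shift) simp
  have S0: "S \<ge> 0" unfolding S_def by (rule suminf_nonneg[OF sm]) auto
  show "2 + S \<ge> 1" using S0 by simp
  fix s :: complex assume s: "Re s \<ge> 0"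
  define r where "r = 1 + norm s"
  have r: "r \<ge> 1" by (simp add: r_def)
  have n3: "norm ((s - 1) * s * (s + 1)) \<le> r * r * r"
    unfolding norm_mult r_def using norm_triangle_ineq4[of s 1] norm_triangle_ineq[of s 1]
    by (intro mult_mono) auto
  have sm': "summable (\<lambda>n. norm (zeta_term (Suc n) s))" using s by (intro summable_norm_zeta_term) auto
  have "norm (\<Sum>n. zeta_term (Suc n) s) \<le> (\<Sum>n. norm (zeta_term (Suc n) s))"
    by (rule summable_norm[OF sm'])
  also have "\<dots> \<le> (\<Sum>n. r^3 * real (Suc n) powr (-2))"
  proof (rule suminf_le[OF _ sm' summable_mult[OF sm]])
    fix n
    have "norm (zeta_term (Suc n) s) \<le> norm ((s - 1) * s * (s + 1)) / 8 * real (Suc n) powr (- Re s - 2)"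
      using s by (intro zeta_term_bound) auto
    also have "\<dots> \<le> r^3 * real (Suc n) powr (-2)"
    proof (intro mult_mono powr_mono)
      show "norm ((s - 1) * s * (s + 1)) / 8 \<le> r^3"
        using n3 norm_ge_zero[of "(s - 1) * s * (s + 1)"] unfolding power3_eq_cube by linarith
    qed (use s r in auto)
    finally show "norm (zeta_term (Suc n) s) \<le> r^3 * real (Suc n) powr (-2)" .
  qed
  also have "\<dots> = r^3 * S" unfolding S_def by (rule suminf_mult[OF sm])
  finally have *: "norm (\<Sum>n. zeta_term (Suc n) s) \<le> r^3 * S" .
  have "norm (zeta_reg s) \<le> 1 + r / 2 + r^3 * S"
  proof -
    have "norm (1 + (s-1)/2) \<le> 1 + r / 2"
      using norm_triangle_ineq[of 1 "(s-1)/2"] norm_triangle_ineq4[of s 1] by (simp add: norm_divide r_def field_simps)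
    thus ?thesis unfolding zeta_reg_def
      using norm_triangle_ineq[of "1 + (s-1)/2" "(\<Sum>n. zeta_term (Suc n) s)"] * by linarith
  qed
  also have "r \<le> r^3" using r by (simp add: self_le_power)
  hence "1 + r / 2 + r^3 * S \<le> (2 + S) * r^3" using r by (simp add: algebra_simps)
  finally show "norm (zeta_reg s) \<le> (2 + S) * (1 + norm s)^3" by (simp add: r_def)
qed

lemma cnj_of_nat_powr: "n > 0 \<Longrightarrow> cnj (of_nat n powr s) = of_nat n powr (cnj s)"
  by (subst cnj_powr) (auto simp: complex_nonpos_Reals_iff)

lemma cnj_zeta_reg:
  assumes "Re s > -1" shows "zeta_reg (cnj s) = cnj (zeta_reg s)"
proof -
  have "zeta_term (Suc n) (cnj s) = cnj (zeta_term (Suc n) s)" for n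
    unfolding zeta_term_def by (simp add: cnj_of_nat_powr del: of_nat_Suc)
  moreover have "cnj (\<Sum>n. zeta_term (Suc n) s) = (\<Sum>n. cnj (zeta_term (Suc n) s))"
    using bounded_linear.suminf[OF bounded_linear_cnj summable_norm_cancel[OF summable_norm_zeta_term[OF assms]]] .
  ultimately show ?thesis unfolding zeta_reg_def by simp
qed

subsection \<open>The functional equation on the real line\<close>

text \<open>Logarithmic differentiation of the reflection formula
  \<open>Gamma (1 + w) Gamma (1 - w) sin (\<pi> w) = \<pi> w\<close> at the purely imaginary point
  \<open>w = i x / (2 \<pi>)\<close>: the series of the digamma function gives the partial
  fractions, and the cotangent at an imaginary argument is a hyperbolic one.\<close>

lemma coth_partial_fractions:
  fixes x :: real assumes x: "x > 0"
  shows "(\<lambda>m. 4 * x / (x\<^sup>2 + (2 * pi * real (Suc m))\<^sup>2)) sums ((1 + exp (-x)) / (1 - exp (-x)) - 2 / x)"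
proof -
  define z where "z = \<i> * of_real (x / (2 * pi))"
  have imz: "Im z \<noteq> 0" "Re z = 0" using x by (auto simp: z_def)
  have z0: "z \<noteq> 0" using imz by auto
  have nz: "1 + z \<notin> \<int>\<^sub>\<le>\<^sub>0" "1 - z \<notin> \<int>\<^sub>\<le>\<^sub>0" "z \<notin> \<int>\<^sub>\<le>\<^sub>0"
    using imz by (auto elim!: nonpos_Ints_cases simp: complex_eq_iff)
  define g where "g = (\<lambda>w::complex. Gamma (1 + w) * Gamma (1 - w))"
  have prod: "g w * sin (of_real pi * w) = of_real pi * w" if "Im w \<noteq> 0" for w
  proof -
    have w: "w \<notin> \<int>\<^sub>\<le>\<^sub>0" using that by (auto elim!: nonpos_Ints_cases)
    have "sin (of_real pi * w) \<noteq> 0"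
    proof
      assume "sin (of_real pi * w) = 0"
      then obtain n :: int where "of_real pi * w = of_real (of_int n * pi)" by (auto simp: sin_eq_0)
      hence "Im (of_real pi * w) = 0" by simp
      thus False using that by simp
    qed
    thus ?thesis unfolding g_def
      using Gamma_reflection_complex[of w] Gamma_plus1[OF w] by (simp add: field_simps add.commute)
  qed
  have dg: "(g has_field_derivative g z * (Digamma (1 + z) - Digamma (1 - z))) (at z)"
    unfolding g_def using nz by (auto intro!: derivative_eq_intros simp: algebra_simps)
  have d1: "((\<lambda>w. g w * sin (of_real pi * w)) has_field_derivative
      g z * (Digamma (1 + z) - Digamma (1 - z)) * sin (of_real pi * z) + g z * (of_real pi * cos (of_real pi * z))) (at z)"
    by (auto intro!: derivative_eq_intros dg)
  have "\<forall>\<^sub>F w in nhds z. g w * sin (of_real pi * w) = of_real pi * w"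
  proof -
    have "open {w. Im w \<noteq> 0}" by (intro open_Collect_neq continuous_intros)
    hence "\<forall>\<^sub>F w in nhds z. w \<in> {w. Im w \<noteq> 0}" using imz by (intro eventually_nhds_in_open) auto
    thus ?thesis by eventually_elim (use prod in auto)
  qed
  hence d2: "((\<lambda>w. g w * sin (of_real pi * w)) has_field_derivative of_real pi) (at z)"
    by (subst DERIV_cong_ev[OF refl _ refl]) (auto intro!: derivative_eq_intros)
  have eq: "g z * (Digamma (1 + z) - Digamma (1 - z)) * sin (of_real pi * z) + g z * (of_real pi * cos (of_real pi * z)) = of_real pi"
    by (rule DERIV_unique[OF d1 d2])
  define S where "S = sin (of_real pi * z)" define K where "K = cos (of_real pi * z)"
  have gS: "g z * S = of_real pi * z" using prod imz S_def by simp
  hence S0: "S \<noteq> 0" using z0 by auto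
  have gz: "g z = of_real pi * z / S" using gS S0 by (simp add: field_simps)
  have dig: "Digamma (1 + z) - Digamma (1 - z) = 1 / z - of_real pi * K / S"
  proof -
    have alg: "D = 1 / z - p * K / S" if "p * z / S * D * S + p * z / S * (p * K) = p" "p \<noteq> 0" for p D :: complex
    proof -
      have "p * z / S * D * S = p * z * D" using S0 by simp
      hence "p * (z * D + z * (p * K / S)) = p * 1" using that by (simp add: algebra_simps)
      hence "z * D + z * (p * K / S) = 1" using that(2) mult_cancel_left by blast
      thus ?thesis using z0 by (simp add: field_simps)
    qed
    show ?thesis by (rule alg) (use eq in \<open>simp_all add: S_def[symmetric] K_def[symmetric] gz\<close>)
  qed
  have "(\<lambda>k. (inverse (of_nat (Suc k)) - inverse (1 + z + of_nat k)) - (inverse (of_nat (Suc k)) - inverse (1 - z + of_nat k)))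
      sums ((Digamma (1 + z) + euler_mascheroni) - (Digamma (1 - z) + euler_mascheroni))"
  proof -
    have "(\<lambda>k. inverse (of_nat (Suc k)) - inverse (w + of_nat k)) sums (Digamma w + euler_mascheroni)" if "w \<notin> \<int>\<^sub>\<le>\<^sub>0" for w :: complex
    proof -
      have "w \<noteq> 0" using that by auto
      from summable_sums[OF summable_Digamma[OF this]] show ?thesis by (simp add: Digamma_def)
    qed
    thus ?thesis using nz by (intro sums_diff) auto
  qed
  hence "(\<lambda>k. inverse (1 - z + of_nat k) - inverse (1 + z + of_nat k)) sums (Digamma (1 + z) - Digamma (1 - z))"
    by simp
  from sums_mult[OF this, of "1 / (\<i> * of_real pi)"]
  have sm: "(\<lambda>k. 1 / (\<i> * of_real pi) * (inverse (1 - z + of_nat k) - inverse (1 + z + of_nat k)))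
      sums (1 / (\<i> * of_real pi) * (1 / z - of_real pi * K / S))" unfolding dig .
  have tm: "1 / (\<i> * of_real pi) * (inverse (1 - z + of_nat k) - inverse (1 + z + of_nat k))
      = of_real (4 * x / (x\<^sup>2 + (2 * pi * real (Suc k))\<^sup>2))" for k
  proof -
    have a: "1 - z + of_nat k \<noteq> 0" "1 + z + of_nat k \<noteq> 0" using imz by (auto simp: complex_eq_iff)
    have pos: "x\<^sup>2 + (2 * pi * real (Suc k))\<^sup>2 \<noteq> 0" using x by (smt (verit) zero_less_power2 zero_le_power2)
    have "(1 - z + of_nat k) * (1 + z + of_nat k) = of_real ((x\<^sup>2 + (2 * pi * real (Suc k))\<^sup>2) / (4 * pi\<^sup>2))"
      by (simp add: z_def complex_eq_iff power2_eq_square field_simps)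
    hence "inverse (1 - z + of_nat k) - inverse (1 + z + of_nat k) = 2 * z / of_real ((x\<^sup>2 + (2 * pi * real (Suc k))\<^sup>2) / (4 * pi\<^sup>2))"
    proof -
      have "inverse p - inverse q = (q - p) / (p * q)" if "p \<noteq> 0" "q \<noteq> 0" for p q :: complex
        using that by (simp add: field_simps)
      from this[OF a] show ?thesis using \<open>(1 - z + of_nat k) * (1 + z + of_nat k) = _\<close> by simp
    qed
    also have "1 / (\<i> * of_real pi) * \<dots> = of_real (4 * x / (x\<^sup>2 + (2 * pi * real (Suc k))\<^sup>2))"
      unfolding z_def using pos by (simp add: field_simps power2_eq_square del: of_nat_Suc)
    finally show ?thesis .
  qed
  have val: "1 / (\<i> * of_real pi) * (1 / z - of_real pi * K / S) = of_real ((1 + exp (-x)) / (1 - exp (-x)) - 2 / x)"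
  proof -
    define E where "E = exp (x / 2)"
    have E: "E > 0" "E \<noteq> 0" by (auto simp: E_def)
    have E1: "E > 1" using x by (simp add: E_def)
    have iz: "\<i> * (of_real pi * z) = - of_real (x / 2)" by (simp add: z_def field_simps)
    have e1: "exp (\<i> * (of_real pi * z)) = of_real (1 / E)" unfolding iz E_def
      by (simp add: exp_minus field_simps flip: exp_of_real)
    have e2: "exp (- (\<i> * (of_real pi * z))) = of_real E" unfolding iz E_def
      by (simp flip: exp_of_real)
    have K': "K = of_real ((E + 1 / E) / 2)" unfolding K_def cos_exp_eq e1 e2 by simp
    have S': "S = \<i> * of_real ((E - 1 / E) / 2)" unfolding S_def sin_exp_eq e1 e2 by (simp add: field_simps)
    have EE: "E - 1 / E \<noteq> 0" using E1 by (simp add: field_simps) (smt (verit) mult_le_cancel_left1)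
    have ex: "exp (-x) = 1 / (E * E)" unfolding E_def by (simp add: exp_minus field_simps flip: exp_add)
    have "1 / (\<i> * of_real pi) * (1 / z - of_real pi * K / S) = of_real ((E + 1 / E) / (E - 1 / E) - 2 / x)"
    proof -
      have gen: "1 / (\<i> * of_real p) * (1 / (\<i> * of_real (x / (2 * p))) - of_real p * of_real (A / 2) / (\<i> * of_real (B / 2)))
         = complex_of_real (A / B - 2 / x)" if "B \<noteq> 0" "p > 0" for A B p :: real
        using x that by (simp add: field_simps)
      show ?thesis unfolding K' S' z_def by (rule gen[OF EE pi_gt_zero])
    qed
    also have "(E + 1 / E) / (E - 1 / E) = (1 + exp (-x)) / (1 - exp (-x))"
      unfolding ex using E EE by (simp add: divide_simps)
    finally show ?thesis .
  qed
  show ?thesis using sm by (simp only: tm val sums_of_real_iff)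
qed

text \<open>Euler's integral rescaled by \<open>y\<close>. Nonnegative integrals are used throughout
  this derivation so that sums and integrals can be exchanged without integrability
  conditions.\<close>

lemma nn_integral_powr_exp:
  fixes a y :: real assumes a: "a > 0" and y: "y > 0"
  shows "(\<integral>\<^sup>+x. ennreal (indicator {0<..} x * (x powr (a - 1) * exp (- (x * y)))) \<partial>lborel) = ennreal (Gamma a * y powr (- a))"
proof -
  let ?I = "(\<integral>\<^sup>+x. ennreal (indicator {0<..} x * (x powr (a - 1) * exp (- (x * y)))) \<partial>lborel)"
  have "ennreal (Gamma a) = (\<integral>\<^sup>+t. ennreal (indicator {0..} t * t powr (a - 1) / exp t) \<partial>lborel)"
    by (rule Gamma_conv_nn_integral_real[OF a])
  also have "\<dots> = ennreal \<bar>y\<bar> * (\<integral>\<^sup>+t. ennreal (indicator {0..} (0 + y * t) * (0 + y * t) powr (a - 1) / exp (0 + y * t)) \<partial>lborel)"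
    using y by (subst nn_integral_real_affine[where c = y and t = 0]) auto
  also have "(\<integral>\<^sup>+t. ennreal (indicator {0..} (0 + y * t) * (0 + y * t) powr (a - 1) / exp (0 + y * t)) \<partial>lborel)
      = (\<integral>\<^sup>+t. ennreal (y powr (a - 1)) * ennreal (indicator {0<..} t * (t powr (a - 1) * exp (- (t * y)))) \<partial>lborel)"
    using y by (intro nn_integral_cong)
      (auto simp: indicator_def zero_le_mult_iff powr_mult exp_minus field_simps simp flip: ennreal_mult'')
  also have "\<dots> = ennreal (y powr (a - 1)) * ?I" by (rule nn_integral_cmult) auto
  also have "ennreal \<bar>y\<bar> * (ennreal (y powr (a - 1)) * ?I) = ennreal (y powr a) * ?I"
    using y by (simp add: powr_diff mult.assoc[symmetric] flip: ennreal_mult'')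
  finally have e: "ennreal (Gamma a) = ennreal (y powr a) * ?I" .
  have "ennreal (Gamma a * y powr (- a)) = ennreal (y powr (- a)) * ennreal (Gamma a)"
    using a by (subst ennreal_mult'' [symmetric]) (auto simp: mult.commute)
  also have "\<dots> = ennreal (y powr (-a) * y powr a) * ?I" unfolding e
    by (simp add: mult.assoc[symmetric] ennreal_mult'')
  also have "y powr (-a) * y powr a = 1" using y by (simp add: powr_minus)
  finally show ?thesis by simp
qed

lemma square_powr: "x > 0 \<Longrightarrow> (x\<^sup>2) powr a = x powr (2 * a)" for x :: real
  by (simp add: powr_powr flip: powr_numeral)

text \<open>The substitution \<open>t = x\<^sup>2\<close> in Euler's integral with exponent
  \<open>(s + 1) / 2\<close>.\<close>

lemma nn_integral_gauss_powr:
  fixes s y :: real assumes s: "s > -1" and y: "y > 0"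
  shows "(\<integral>\<^sup>+x. ennreal (indicator {0<..} x * (x powr s * exp (- (x\<^sup>2 * y)))) \<partial>lborel)
     = ennreal (Gamma ((s + 1) / 2) / 2 * y powr (- ((s + 1) / 2)))"
proof -
  have "(\<integral>\<^sup>+t. ennreal (indicator {0<..} t * (t powr ((s + 1) / 2 - 1) * exp (- (t * y)))) \<partial>lborel)
     = ennreal (Gamma ((s + 1) / 2) * y powr (- ((s + 1) / 2)))"
    using s y by (intro nn_integral_powr_exp) auto
  hence "((\<lambda>t. indicator {0<..} t * (t powr ((s + 1) / 2 - 1) * exp (- (t * y)))) has_integral (Gamma ((s + 1) / 2) * y powr (- ((s + 1) / 2)))) UNIV"
    using s y by (intro nn_integral_has_integral) auto
  also have "(\<lambda>t. indicator {0<..} t * (t powr ((s + 1) / 2 - 1) * exp (- (t * y)))) =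
      (\<lambda>t. if t \<in> {0<..} then t powr ((s + 1) / 2 - 1) * exp (- (t * y)) else 0)"
    by (auto simp: indicator_def)
  finally have hi: "((\<lambda>t. t powr ((s + 1) / 2 - 1) * exp (- (t * y))) has_integral (Gamma ((s + 1) / 2) * y powr (- ((s + 1) / 2)))) {0<..}"
    by (simp only: has_integral_restrict_UNIV)
  hence ai: "(\<lambda>t. t powr ((s + 1) / 2 - 1) * exp (- (t * y))) absolutely_integrable_on {0<..}"
    by (intro nonnegative_absolutely_integrable_1) (auto simp: has_integral_integrable)
  have im: "(\<lambda>x::real. x\<^sup>2) ` {0<..} = {0<..}"
  proof safe
    fix t :: real assume "t > 0"
    thus "t \<in> (\<lambda>x. x\<^sup>2) ` {0<..}" by (intro image_eqI[of _ _ "sqrt t"]) auto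
  qed auto
  have "(\<lambda>x. \<bar>2 * x\<bar> * ((x\<^sup>2) powr ((s + 1) / 2 - 1) * exp (- (x\<^sup>2 * y)))) absolutely_integrable_on {0<..} \<and>
     integral {0<..} (\<lambda>x. \<bar>2 * x\<bar> * ((x\<^sup>2) powr ((s + 1) / 2 - 1) * exp (- (x\<^sup>2 * y)))) = Gamma ((s + 1) / 2) * y powr (- ((s + 1) / 2))"
  proof (subst has_absolute_integral_change_of_variables_1'[where g = "\<lambda>x::real. x\<^sup>2"])
    show "((\<lambda>x. x\<^sup>2) has_field_derivative 2 * x) (at x within {0<..})" for x :: real
      by (auto intro!: derivative_eq_intros)
    show "inj_on (\<lambda>x::real. x\<^sup>2) {0<..}" by (auto simp: inj_on_def)
  qed (use hi ai in \<open>auto simp: im integral_unique\<close>)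
  hence "((\<lambda>x. \<bar>2 * x\<bar> * ((x\<^sup>2) powr ((s + 1) / 2 - 1) * exp (- (x\<^sup>2 * y)))) has_integral
      (Gamma ((s + 1) / 2) * y powr (- ((s + 1) / 2)))) {0<..}"
    by (simp add: has_integral_iff set_lebesgue_integral_eq_integral(1))
  from nn_integral_has_integral_lebesgue[OF _ this]
  have h: "(\<integral>\<^sup>+x. ennreal (indicator {0<..} x * (\<bar>2 * x\<bar> * ((x\<^sup>2) powr ((s + 1) / 2 - 1) * exp (- (x\<^sup>2 * y))))) \<partial>lborel) =
      ennreal (Gamma ((s + 1) / 2) * y powr (- ((s + 1) / 2)))" by simp
  have pw: "x * (x\<^sup>2) powr ((s + 1) / 2 - 1) = x powr s" if "x > 0" for x :: real
  proof -
    have "2 * ((s + 1) / 2 - 1) = s - 1" by (simp add: field_simps)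
    hence "(x\<^sup>2) powr ((s + 1) / 2 - 1) = x powr (s - 1)"
      by (simp only: square_powr[OF that])
    thus ?thesis using that by (simp add: powr_diff)
  qed
  have "(\<integral>\<^sup>+x. ennreal (indicator {0<..} x * (x powr s * exp (- (x\<^sup>2 * y)))) \<partial>lborel) =
     (\<integral>\<^sup>+x. ennreal (1/2) * ennreal (indicator {0<..} x * (\<bar>2 * x\<bar> * ((x\<^sup>2) powr ((s + 1) / 2 - 1) * exp (- (x\<^sup>2 * y))))) \<partial>lborel)"
  proof (intro nn_integral_cong)
    fix x :: real
    have "indicator {0<..} x * (x powr s * exp (- (x\<^sup>2 * y))) =
        1/2 * (indicator {0<..} x * (\<bar>2 * x\<bar> * ((x\<^sup>2) powr ((s + 1) / 2 - 1) * exp (- (x\<^sup>2 * y)))))"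
      using pw[of x] by (auto simp: indicator_def)
    thus "ennreal (indicator {0<..} x * (x powr s * exp (- (x\<^sup>2 * y)))) =
        ennreal (1/2) * ennreal (indicator {0<..} x * (\<bar>2 * x\<bar> * ((x\<^sup>2) powr ((s + 1) / 2 - 1) * exp (- (x\<^sup>2 * y)))))"
      by (simp only: ennreal_mult'[symmetric] zero_le_divide_1_iff zero_le_numeral)
  qed
  also have "\<dots> = ennreal (1/2) * ennreal (Gamma ((s + 1) / 2) * y powr (- ((s + 1) / 2)))"
    unfolding h[symmetric] by (rule nn_integral_cmult) auto
  also have "\<dots> = ennreal (Gamma ((s + 1) / 2) / 2 * y powr (- ((s + 1) / 2)))"
    by (subst ennreal_mult'[symmetric]) auto
  finally show ?thesis .
qed

text \<open>Write \<open>1 / (x\<^sup>2 + c\<^sup>2)\<close> as the integral of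
  \<open>exp (- y (x\<^sup>2 + c\<^sup>2))\<close> over \<open>y > 0\<close> and exchange the
  integrations: the inner integral is Gaussian, the outer one is again Euler's, and each contributes
  one Gamma factor.\<close>

lemma nn_integral_powr_inverse_square:
  fixes s c :: real assumes s: "s > -1" "s < 1" and c: "c > 0"
  shows "(\<integral>\<^sup>+x. ennreal (indicator {0<..} x * (x powr s / (x\<^sup>2 + c\<^sup>2))) \<partial>lborel)
     = ennreal (c powr (s - 1) * (Gamma ((1 + s) / 2) * Gamma ((1 - s) / 2) / 2))"
proof -
  have 1: "ennreal (indicator {0<..} x * (x powr s / (x\<^sup>2 + c\<^sup>2))) =
     (\<integral>\<^sup>+y. ennreal (indicator {0<..} x * x powr s) * ennreal (indicator {0<..} y * (y powr (1 - 1) * exp (- (y * (x\<^sup>2 + c\<^sup>2))))) \<partial>lborel)" for x :: real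
  proof -
    have "x\<^sup>2 + c\<^sup>2 > 0" using c by (simp add: add_nonneg_pos)
    from nn_integral_powr_exp[OF zero_less_one this] show ?thesis
      by (subst nn_integral_cmult) (auto simp: powr_minus field_simps simp flip: ennreal_mult'')
  qed
  have "(\<integral>\<^sup>+x. ennreal (indicator {0<..} x * (x powr s / (x\<^sup>2 + c\<^sup>2))) \<partial>lborel) =
     (\<integral>\<^sup>+x. (\<integral>\<^sup>+y. ennreal (indicator {0<..} x * x powr s) * ennreal (indicator {0<..} y * (y powr (1 - 1) * exp (- (y * (x\<^sup>2 + c\<^sup>2))))) \<partial>lborel) \<partial>lborel)"
    by (subst 1) (rule refl)
  also have "\<dots> = (\<integral>\<^sup>+y. (\<integral>\<^sup>+x. ennreal (indicator {0<..} x * x powr s) * ennreal (indicator {0<..} y * (y powr (1 - 1) * exp (- (y * (x\<^sup>2 + c\<^sup>2))))) \<partial>lborel) \<partial>lborel)"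
    by (rule lborel_pair.Fubini') auto
  also have "\<dots> = (\<integral>\<^sup>+y. ennreal (Gamma ((s + 1) / 2) / 2) * ennreal (indicator {0<..} y * (y powr ((1 - s) / 2 - 1) * exp (- (y * c\<^sup>2)))) \<partial>lborel)"
  proof (intro nn_integral_cong)
    fix y :: real
    show "(\<integral>\<^sup>+x. ennreal (indicator {0<..} x * x powr s) * ennreal (indicator {0<..} y * (y powr (1 - 1) * exp (- (y * (x\<^sup>2 + c\<^sup>2))))) \<partial>lborel)
       = ennreal (Gamma ((s + 1) / 2) / 2) * ennreal (indicator {0<..} y * (y powr ((1 - s) / 2 - 1) * exp (- (y * c\<^sup>2))))"
    proof (cases "y > 0")
      case True
      have "(\<integral>\<^sup>+x. ennreal (indicator {0<..} x * x powr s) * ennreal (indicator {0<..} y * (y powr (1 - 1) * exp (- (y * (x\<^sup>2 + c\<^sup>2))))) \<partial>lborel)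
         = (\<integral>\<^sup>+x. ennreal (exp (- (y * c\<^sup>2))) * ennreal (indicator {0<..} x * (x powr s * exp (- (x\<^sup>2 * y)))) \<partial>lborel)"
      proof (intro nn_integral_cong)
        fix x :: real
        have e: "exp (- (y * (x\<^sup>2 + c\<^sup>2))) = exp (- (y * c\<^sup>2)) * exp (- (x\<^sup>2 * y))"
          by (simp add: algebra_simps flip: exp_add)
        show "ennreal (indicator {0<..} x * x powr s) * ennreal (indicator {0<..} y * (y powr (1 - 1) * exp (- (y * (x\<^sup>2 + c\<^sup>2))))) =
          ennreal (exp (- (y * c\<^sup>2))) * ennreal (indicator {0<..} x * (x powr s * exp (- (x\<^sup>2 * y))))"
          unfolding e using True by (simp add: algebra_simps flip: ennreal_mult'')
      qed
      also have "\<dots> = ennreal (exp (- (y * c\<^sup>2))) * ennreal (Gamma ((s + 1) / 2) / 2 * y powr (- ((s + 1) / 2)))"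
        using True s by (subst nn_integral_cmult) (auto simp: nn_integral_gauss_powr)
      also have "- ((s + 1) / 2) = (1 - s) / 2 - 1" by (simp add: field_simps)
      finally show ?thesis using True s
        by (simp add: algebra_simps flip: ennreal_mult'')
    qed auto
  qed
  also have "\<dots> = ennreal (Gamma ((s + 1) / 2) / 2) * ennreal (Gamma ((1 - s) / 2) * (c\<^sup>2) powr (- ((1 - s) / 2)))"
    using s c by (subst nn_integral_cmult) (auto simp: nn_integral_powr_exp)
  also have "(c\<^sup>2) powr (- ((1 - s) / 2)) = c powr (s - 1)"
  proof -
    have "2 * (- ((1 - s) / 2)) = s - 1" by (simp add: field_simps)
    thus ?thesis by (simp only: square_powr[OF c])
  qed
  finally show ?thesis using s by (simp add: algebra_simps flip: ennreal_mult'')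
qed

text \<open>The fraction \<open>(1 + exp (-x)) / (1 - exp (-x))\<close> is
  \<open>coth (x / 2)\<close>. This identity links the trapezoidal kernel of Euler-Maclaurin
  summation to the partial fractions above.\<close>

lemma trapezoid_kernel_laplace:
  fixes x :: real assumes x: "x > 0"
  shows "((\<lambda>u. u * (1 - u) * exp (- (u * x))) has_integral
     ((1 + exp (-x)) / (1 - exp (-x)) - 2 / x) * (1 - exp (-x)) / x\<^sup>2) {0..1}"
proof -
  define a b c where "a = 1 / x" and "b = 1 / x\<^sup>2" and "c = 2 / x^3"
  have abc: "x * a = 1" "x * b = a" "x * c = 2 * b"
    using x by (auto simp: a_def b_def c_def power2_eq_square power3_eq_cube)
  define F where "F = (\<lambda>u. - exp (- (u * x)) * ((u - u\<^sup>2) * a + (1 - 2 * u) * b - c))"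
  have "((\<lambda>u. u * (1 - u) * exp (- (u * x))) has_integral (F 1 - F 0)) {0..1}"
  proof (rule fundamental_theorem_of_calculus)
    fix u :: real assume "u \<in> {0..1}"
    have "(F has_field_derivative exp (- (u * x)) * ((u - u\<^sup>2) * (x * a) + (1 - 2 * u) * (x * b) - x * c - ((1 - 2 * u) * a - 2 * b))) (at u)"
      unfolding F_def by (auto intro!: derivative_eq_intros simp: algebra_simps)
    also have "(u - u\<^sup>2) * (x * a) + (1 - 2 * u) * (x * b) - x * c - ((1 - 2 * u) * a - 2 * b) = u * (1 - u)"
      unfolding abc by (simp add: algebra_simps power2_eq_square)
    finally show "(F has_vector_derivative u * (1 - u) * exp (- (u * x))) (at u within {0..1})"
      by (simp add: has_real_derivative_iff_has_vector_derivative has_vector_derivative_at_within mult.commute)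
  qed simp
  also have "F 1 - F 0 = ((1 + exp (-x)) / (1 - exp (-x)) - 2 / x) * (1 - exp (-x)) / x\<^sup>2"
  proof -
    define e where "e = exp (-x)"
    have "e \<noteq> 1" using x by (simp add: e_def)
    hence "((1 + e) / (1 - e) - 2 / x) * (1 - e) = (1 + e) - 2 / x * (1 - e)" by (simp add: field_simps)
    hence "((1 + e) / (1 - e) - 2 / x) * (1 - e) / x\<^sup>2 = (1 + e) * b - c * (1 - e)"
      using x by (simp add: b_def c_def field_simps power2_eq_square power3_eq_cube)
    thus ?thesis unfolding F_def by (simp add: e_def[symmetric] algebra_simps)
  qed
  finally show ?thesis .
qed

section \<open>The series on the real axis as a double integral\<close>

lemma zeta_term_of_real:
  fixes s :: real
  shows "n \<ge> 1 \<Longrightarrow> zeta_term n (of_real s) = of_real ((s - 1) / 2 * (real n powr (-s) + (real n + 1) powr (-s))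
     + ((real n + 1) powr (1 - s) - real n powr (1 - s)))"
  unfolding zeta_term_def by (simp add: powr_of_real[symmetric] add.commute)

text \<open>The same double integration by parts as for the complex terms, now kept as an equation
  because the functional equation requires exact values.\<close>

lemma zeta_term_has_integral:
  fixes s :: real assumes n: "n \<ge> 1"
  shows "((\<lambda>u. (s - 1) * s * (s + 1) / 2 * (u * (1 - u)) * (real n + u) powr (-s - 2)) has_integral Re (zeta_term n (of_real s))) {0..1}"
proof -
  define H where "H = (\<lambda>u. - ((s - 1) * s / 2) * (u * (1 - u)) * (real n + u) powr (-s - 1)
     - (s - 1) / 2 * (1 - 2 * u) * (real n + u) powr (-s) + (real n + u) powr (1 - s))"
  have "((\<lambda>u. (s - 1) * s * (s + 1) / 2 * (u * (1 - u)) * (real n + u) powr (-s - 2)) has_integral (H 1 - H 0)) {0..1}"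
  proof (rule fundamental_theorem_of_calculus)
    fix u :: real assume u: "u \<in> {0..1}"
    have pos: "real n + u > 0" using u n by auto
    have d: "((\<lambda>u. (real n + u) powr c) has_field_derivative c * (real n + u) powr (c - 1)) (at u)" for c
      using pos by (auto intro!: derivative_eq_intros simp: powr_diff)
    have e: "1 - s - 1 = -s" "-s - 1 - 1 = -s - 2" by simp_all
    have alg: "- ((s - 1) * s / 2) * (1 - 2 * u) * B + - ((s - 1) * s / 2) * (u * (1 - u)) * ((-s - 1) * C)
          - ((s - 1) / 2 * (-2) * A + (s - 1) / 2 * (1 - 2 * u) * (-s * B)) + (1 - s) * A
          = (s - 1) * s * (s + 1) / 2 * (u * (1 - u)) * C" for A B C :: real
      by (simp add: divide_simps) (simp add: algebra_simps)
    have "(H has_field_derivative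
          (- ((s - 1) * s / 2) * (1 - 2 * u) * (real n + u) powr (-s - 1)
           + - ((s - 1) * s / 2) * (u * (1 - u)) * ((-s - 1) * (real n + u) powr (-s - 1 - 1)))
          - ((s - 1) / 2 * (-2) * (real n + u) powr (-s)
           + (s - 1) / 2 * (1 - 2 * u) * (-s * (real n + u) powr (-s - 1)))
          + (1 - s) * (real n + u) powr (1 - s - 1)) (at u)"
      unfolding H_def
      by (rule DERIV_cong, (rule DERIV_add DERIV_diff DERIV_mult d derivative_eq_intros refl)+) (simp add: algebra_simps)
    hence "(H has_field_derivative (s - 1) * s * (s + 1) / 2 * (u * (1 - u)) * (real n + u) powr (-s - 2)) (at u)"
      unfolding e alg .
    thus "(H has_vector_derivative (s - 1) * s * (s + 1) / 2 * (u * (1 - u)) * (real n + u) powr (-s - 2)) (at u within {0..1})"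
      by (simp add: has_real_derivative_iff_has_vector_derivative has_vector_derivative_at_within)
  qed simp
  also have "H 1 - H 0 = Re (zeta_term n (of_real s))"
    unfolding H_def zeta_term_of_real[OF n] by (simp add: field_simps)
  finally show ?thesis .
qed

text \<open>For \<open>s < 0\<close> the integral also converges at \<open>n = 0\<close>, and its
  value is \<open>1 + (s - 1) / 2\<close>, precisely the part of \<open>zeta_reg\<close> outside the
  series. Hence the sum over all \<open>n \<ge> 0\<close> represents
  \<open>zeta_reg\<close>.\<close>

lemma zeta_term_0_has_integral:
  fixes s :: real assumes s: "s < 0"
  shows "((\<lambda>u. (s - 1) * s * (s + 1) / 2 * (u * (1 - u)) * (real 0 + u) powr (-s - 2)) has_integral ((s + 1) / 2)) {0..1}"
proof -
  have a: "((\<lambda>u. u powr (-s-1)) has_integral (1 powr (-s-1+1) / (-s-1+1))) {0..1::real}"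
    using s by (intro has_integral_powr_from_0) auto
  have b: "((\<lambda>u. u powr (-s)) has_integral (1 powr (-s+1) / (-s+1))) {0..1::real}"
    using s by (intro has_integral_powr_from_0) auto
  have "((\<lambda>u. (s - 1) * s * (s + 1) / 2 * (u powr (-s-1) - u powr (-s))) has_integral
     (s - 1) * s * (s + 1) / 2 * (1 powr (-s-1+1) / (-s-1+1) - 1 powr (-s+1) / (-s+1))) {0..1}"
    by (intro has_integral_mult_right has_integral_diff a b)
  also have "(s - 1) * s * (s + 1) / 2 * (1 powr (-s-1+1) / (-s-1+1) - 1 powr (-s+1) / (-s+1)) = (s + 1) / 2"
    using s by (simp add: divide_simps) (simp add: algebra_simps)
  finally have "((\<lambda>u. (s - 1) * s * (s + 1) / 2 * (u powr (-s-1) - u powr (-s))) has_integral (s + 1) / 2) {0..1}" .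
  moreover have "u powr (-s-1) - u powr (-s) = (u * (1 - u)) * (real 0 + u) powr (-s - 2)" if "u \<in> {0..1}" for u
  proof (cases "u = 0")
    case False
    hence "u powr (-s-1) = u * u powr (-s-2)" "u powr (-s) = u * (u * u powr (-s-2))"
      using that by (auto simp: powr_diff power2_eq_square)
    thus ?thesis by (simp add: algebra_simps)
  qed auto
  ultimately show ?thesis by (subst has_integral_cong[where g = "\<lambda>u. (s - 1) * s * (s + 1) / 2 * (u powr (-s-1) - u powr (-s))"]) auto
qed

lemma zeta_reg_of_real: 
  fixes s :: real assumes s: "s > -1"
  shows "(\<lambda>n. Re (zeta_term (Suc n) (of_real s))) sums (Re (zeta_reg (of_real s)) - (s + 1) / 2)"
    "zeta_reg (of_real s) = of_real (Re (zeta_reg (of_real s)))"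
proof -
  have sm: "summable (\<lambda>n. zeta_term (Suc n) (of_real s))"
    using summable_norm_cancel[OF summable_norm_zeta_term[of "of_real s"]] s by simp
  show "(\<lambda>n. Re (zeta_term (Suc n) (of_real s))) sums (Re (zeta_reg (of_real s)) - (s + 1) / 2)"
    using sums_Re[OF summable_sums[OF sm]] unfolding zeta_reg_def by (simp add: field_simps)
  have "cnj (zeta_reg (of_real s)) = zeta_reg (of_real s)" using cnj_zeta_reg[of "of_real s"] s by simp
  thus "zeta_reg (of_real s) = of_real (Re (zeta_reg (of_real s)))" by (simp add: complex_eq_iff)
qed

text \<open>Euler's integral with exponent \<open>s + 2\<close> is inserted for
  \<open>(n + u) powr (- s - 2)\<close>. The index \<open>n\<close> then occurs only in
  \<open>exp (- n x)\<close>, so the sum over \<open>n\<close> will be geometric.\<close>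

lemma nn_integral_zeta_kernel:
  fixes s :: real assumes s: "-1 < s" "s < 0"
  defines "K \<equiv> (s - 1) * s * (s + 1) / 2"
  defines "V \<equiv> \<lambda>n. if n = 0 then (s + 1) / 2 else Re (zeta_term n (of_real s))"
  shows "ennreal (Gamma (s + 2) * V n) = (\<integral>\<^sup>+x. \<integral>\<^sup>+u. ennreal (indicator {0<..} x * (K * x powr (s + 1)))
      * ennreal (exp (- (real n * x))) * ennreal (indicator {0..1} u * (u * (1 - u) * exp (- (u * x)))) \<partial>lborel \<partial>lborel)"
proof -
  have K: "K > 0" unfolding K_def using s by (intro divide_pos_pos mult_pos_pos mult_neg_neg) auto
  have hi: "((\<lambda>u. K * (u * (1 - u)) * (real n + u) powr (-s - 2)) has_integral V n) {0..1}"
    using zeta_term_has_integral[of n s] zeta_term_0_has_integral[of s] s unfolding K_def V_def by (cases "n = 0") auto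
  have "ennreal (Gamma (s + 2) * V n) = ennreal (Gamma (s + 2)) * ennreal (V n)"
    using s by (subst ennreal_mult') auto
  also have "ennreal (V n) = (\<integral>\<^sup>+u. ennreal (indicator {0..1} u * (K * (u * (1 - u)) * (real n + u) powr (-s - 2))) \<partial>lborel)"
    using nn_integral_has_integral_lebesgue[OF _ hi] K by simp
  also have "ennreal (Gamma (s + 2)) * \<dots> = (\<integral>\<^sup>+u. ennreal (Gamma (s + 2)) * ennreal (indicator {0..1} u * (K * (u * (1 - u)) * (real n + u) powr (-s - 2))) \<partial>lborel)"
    by (rule nn_integral_cmult [symmetric]) auto
  also have "\<dots> = (\<integral>\<^sup>+u. \<integral>\<^sup>+x. ennreal (indicator {0<..} x * (K * x powr (s + 1)))
      * ennreal (exp (- (real n * x))) * ennreal (indicator {0..1} u * (u * (1 - u) * exp (- (u * x)))) \<partial>lborel \<partial>lborel)"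
  \<comment> \<open>The point \<open>u = 0\<close> is left out because for \<open>n = 0\<close> the
    base \<open>n + u\<close> vanishes there.\<close>
  proof (rule nn_integral_cong_AE, rule AE_mp[OF AE_lborel_singleton[of 0]], rule AE_I2, rule impI)
    fix u :: real assume u0: "u \<noteq> 0"
    show "ennreal (Gamma (s + 2)) * ennreal (indicator {0..1} u * (K * (u * (1 - u)) * (real n + u) powr (-s - 2))) =
       (\<integral>\<^sup>+x. ennreal (indicator {0<..} x * (K * x powr (s + 1)))
      * ennreal (exp (- (real n * x))) * ennreal (indicator {0..1} u * (u * (1 - u) * exp (- (u * x)))) \<partial>lborel)"
    proof (cases "u \<in> {0..1}")
      case True
      hence pos: "real n + u > 0" using u0 by auto
      have "(\<integral>\<^sup>+x. ennreal (indicator {0<..} x * (K * x powr (s + 1)))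
           * ennreal (exp (- (real n * x))) * ennreal (indicator {0..1} u * (u * (1 - u) * exp (- (u * x)))) \<partial>lborel)
        = (\<integral>\<^sup>+x. ennreal (K * (u * (1 - u))) * ennreal (indicator {0<..} x * (x powr ((s + 2) - 1) * exp (- (x * (real n + u))))) \<partial>lborel)"
      proof (intro nn_integral_cong)
        fix x :: real
        have "indicator {0<..} x * (K * x powr (s + 1)) * exp (- (real n * x)) * (indicator {0..1} u * (u * (1 - u) * exp (- (u * x))))
          = K * (u * (1 - u)) * (indicator {0<..} x * (x powr ((s + 2) - 1) * exp (- (x * (real n + u)))))"
          using True by (simp add: algebra_simps exp_add exp_diff exp_minus divide_simps)
        moreover have "ennreal (indicator {0<..} x * (K * x powr (s + 1)))
           * ennreal (exp (- (real n * x))) * ennreal (indicator {0..1} u * (u * (1 - u) * exp (- (u * x)))) =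
           ennreal (indicator {0<..} x * (K * x powr (s + 1)) * exp (- (real n * x)) * (indicator {0..1} u * (u * (1 - u) * exp (- (u * x)))))"
          using K True by (simp add: ennreal_mult'')
        moreover have "ennreal (K * (u * (1 - u))) * ennreal (indicator {0<..} x * (x powr ((s + 2) - 1) * exp (- (x * (real n + u)))))
           = ennreal (K * (u * (1 - u)) * (indicator {0<..} x * (x powr ((s + 2) - 1) * exp (- (x * (real n + u))))))"
          using K True by (simp add: ennreal_mult'')
        ultimately show "ennreal (indicator {0<..} x * (K * x powr (s + 1)))
           * ennreal (exp (- (real n * x))) * ennreal (indicator {0..1} u * (u * (1 - u) * exp (- (u * x)))) =
          ennreal (K * (u * (1 - u))) * ennreal (indicator {0<..} x * (x powr ((s + 2) - 1) * exp (- (x * (real n + u)))))"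
          by (simp only:)
      qed
      also have "\<dots> = ennreal (K * (u * (1 - u))) * ennreal (Gamma (s + 2) * (real n + u) powr (- (s + 2)))"
      proof (subst nn_integral_cmult)
        show "ennreal (K * (u * (1 - u))) * (\<integral>\<^sup>+x. ennreal (indicator {0<..} x * (x powr ((s + 2) - 1) * exp (- (x * (real n + u))))) \<partial>lborel)
          = ennreal (K * (u * (1 - u))) * ennreal (Gamma (s + 2) * (real n + u) powr (- (s + 2)))"
          by (subst nn_integral_powr_exp) (use s pos in auto)
      qed auto
      also have "\<dots> = ennreal (Gamma (s + 2)) * ennreal (indicator {0..1} u * (K * (u * (1 - u)) * (real n + u) powr (-s - 2)))"
      proof -
        have e: "-s - 2 = - (s + 2)" by simp
        have G: "Gamma (s + 2) \<ge> 0" using s by (intro Gamma_real_nonneg) auto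
        have M: "K * (u * (1 - u)) \<ge> 0" using True K by auto
        have gen: "ennreal M * ennreal (G * p) = ennreal G * ennreal (M * p)" if "M \<ge> 0" "G \<ge> 0" "p \<ge> 0" for M G p
          using that by (simp add: ennreal_mult mult_ac)
        have "ennreal (K * (u * (1 - u))) * ennreal (Gamma (s + 2) * (real n + u) powr (- (s + 2)))
           = ennreal (Gamma (s + 2)) * ennreal (K * (u * (1 - u)) * (real n + u) powr (- (s + 2)))"
          by (rule gen[OF M G]) simp
        thus ?thesis unfolding e using True by simp
      qed
      finally show ?thesis by simp
    qed auto
  qed
  also have "\<dots> = (\<integral>\<^sup>+x. \<integral>\<^sup>+u. ennreal (indicator {0<..} x * (K * x powr (s + 1)))
      * ennreal (exp (- (real n * x))) * ennreal (indicator {0..1} u * (u * (1 - u) * exp (- (u * x)))) \<partial>lborel \<partial>lborel)"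
    by (rule lborel_pair.Fubini') auto
  finally show ?thesis .
qed

text \<open>Up to the same factor both sides evaluate the integral of \<open>x\<^sup>s\<^sup>-\<^sup>1 (coth (x/2) - 2/x)\<close> over \<open>x > 0\<close>, the right hand side by
  expanding the hyperbolic cotangent into partial fractions.\<close>

lemma zeta_reg_functional_real:
  fixes s :: real assumes s: "-1 < s" "s < 0"
  shows "Gamma (s + 2) * Re (zeta_reg (of_real s)) =
     (s - 1) * s * (s + 1) * (2 * pi) powr (s - 1) * (Gamma ((1 + s) / 2) * Gamma ((1 - s) / 2)) * (\<Sum>m. real (Suc m) powr (s - 1))"
proof -
  define K where "K = (s - 1) * s * (s + 1) / 2"
  \<comment> \<open>For \<open>- 1 < s < 0\<close> exactly two of the three factors are negative.
    Positivity of \<open>K\<close> makes every integrand nonnegative, so Tonelli's theorem covers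
    all exchanges below.\<close>
  have K: "K > 0" unfolding K_def using s by (intro divide_pos_pos mult_pos_pos mult_neg_neg) auto
  define V where "V = (\<lambda>n::nat. if n = 0 then (s + 1) / 2 else Re (zeta_term n (of_real s)))"
  define I where "I = Gamma ((1 + s) / 2) * Gamma ((1 - s) / 2) / 2"
  have I: "I \<ge> 0" unfolding I_def using s by (intro divide_nonneg_pos mult_nonneg_nonneg) auto
  have V0: "V n \<ge> 0" for n
  proof -
    have hi: "((\<lambda>u. K * (u * (1 - u)) * (real n + u) powr (-s - 2)) has_integral V n) {0..1}"
      using zeta_term_has_integral[of n s] zeta_term_0_has_integral[of s] s unfolding K_def V_def by (cases "n = 0") auto
    show ?thesis by (rule has_integral_nonneg[OF hi]) (use K in auto)
  qed
  have "(\<lambda>n. V (Suc n)) sums (Re (zeta_reg (of_real s)) - (s + 1) / 2)"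
    using zeta_reg_of_real(1)[of s] s unfolding V_def by simp
  hence Vs: "V sums Re (zeta_reg (of_real s))" by (subst (asm) sums_Suc_iff) (simp add: V_def)
  have sm: "summable (\<lambda>m. real (Suc m) powr (s - 1))" using s by (intro summable_powr_shift) auto
  have G: "Gamma (s + 2) > 0" using s by (intro Gamma_real_pos) auto
  have "ennreal (Gamma (s + 2) * Re (zeta_reg (of_real s))) = (\<Sum>n. ennreal (Gamma (s + 2) * V n))"
    using sums_mult[OF Vs, of "Gamma (s + 2)"] V0 G
    by (intro suminf_ennreal_eq[symmetric]) auto
  also have "\<dots> = (\<Sum>n. \<integral>\<^sup>+x. \<integral>\<^sup>+u. ennreal (indicator {0<..} x * (K * x powr (s + 1)))
      * ennreal (exp (- (real n * x))) * ennreal (indicator {0..1} u * (u * (1 - u) * exp (- (u * x)))) \<partial>lborel \<partial>lborel)"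
    using nn_integral_zeta_kernel[OF s] unfolding V_def K_def by simp
  also have "\<dots> = (\<integral>\<^sup>+x. (\<Sum>n. \<integral>\<^sup>+u. ennreal (indicator {0<..} x * (K * x powr (s + 1)))
      * ennreal (exp (- (real n * x))) * ennreal (indicator {0..1} u * (u * (1 - u) * exp (- (u * x)))) \<partial>lborel) \<partial>lborel)"
    by (rule nn_integral_suminf [symmetric]) measurable
  also have "\<dots> = (\<integral>\<^sup>+x. (\<Sum>m. ennreal (indicator {0<..} x * (4 * K * (x powr s / (x\<^sup>2 + (2 * pi * real (Suc m))\<^sup>2))))) \<partial>lborel)"
  proof (intro nn_integral_cong)
    fix x :: real
    show "(\<Sum>n. \<integral>\<^sup>+u. ennreal (indicator {0<..} x * (K * x powr (s + 1)))
      * ennreal (exp (- (real n * x))) * ennreal (indicator {0..1} u * (u * (1 - u) * exp (- (u * x)))) \<partial>lborel)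
      = (\<Sum>m. ennreal (indicator {0<..} x * (4 * K * (x powr s / (x\<^sup>2 + (2 * pi * real (Suc m))\<^sup>2)))))"
    proof (cases "x > 0")
      case True
      define L where "L = (1 + exp (-x)) / (1 - exp (-x)) - 2 / x"
      have e1: "1 - exp (-x) > 0" using True by simp
      have pf: "(\<lambda>m. 4 * x / (x\<^sup>2 + (2 * pi * real (Suc m))\<^sup>2)) sums L" unfolding L_def by (rule coth_partial_fractions[OF True])
      have ki: "(\<integral>\<^sup>+u. ennreal (indicator {0..1} u * (u * (1 - u) * exp (- (u * x)))) \<partial>lborel) = ennreal (L * (1 - exp (-x)) / x\<^sup>2)"
        unfolding L_def by (rule nn_integral_has_integral_lebesgue[OF _ trapezoid_kernel_laplace[OF True]]) auto
      have L0: "L \<ge> 0" by (rule sums_le[OF _ sums_zero pf]) (use True in auto)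
      have P: "(\<integral>\<^sup>+u. ennreal (indicator {0<..} x * (K * x powr (s + 1)))
      * ennreal (exp (- (real n * x))) * ennreal (indicator {0..1} u * (u * (1 - u) * exp (- (u * x)))) \<partial>lborel)
        = ennreal (K * x powr (s + 1) * (L * (1 - exp (-x)) / x\<^sup>2) * exp (-x) ^ n)" for n
      proof -
        have "(\<integral>\<^sup>+u. ennreal (indicator {0<..} x * (K * x powr (s + 1)))
          * ennreal (exp (- (real n * x))) * ennreal (indicator {0..1} u * (u * (1 - u) * exp (- (u * x)))) \<partial>lborel)
          = ennreal (K * x powr (s + 1)) * ennreal (exp (- (real n * x))) * ennreal (L * (1 - exp (-x)) / x\<^sup>2)"
          using True unfolding ki[symmetric] by (subst nn_integral_cmult[symmetric]) auto
        also have "ennreal (K * x powr (s + 1)) * ennreal (exp (- (real n * x))) * ennreal (L * (1 - exp (-x)) / x\<^sup>2)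
           = ennreal (K * x powr (s + 1) * (L * (1 - exp (-x)) / x\<^sup>2) * exp (-x) ^ n)"
        proof -
          have gen: "ennreal p * ennreal q * ennreal r = ennreal (p * r * q)" if "p \<ge> 0" "q \<ge> 0" "r \<ge> 0" for p q r
            using that by (simp add: ennreal_mult mult_ac)
          moreover have "exp (- (real n * x)) = exp (-x) ^ n" by (simp add: exp_of_nat_mult[symmetric])
          ultimately show ?thesis using K L0 e1 True by auto
        qed
        finally show ?thesis .
      qed
      \<comment> \<open>The geometric sum contributes \<open>1 / (1 - exp (-x))\<close>, which
        cancels the factor \<open>1 - exp (-x)\<close> of the kernel transform and leaves
        \<open>coth (x / 2) - 2 / x\<close>.\<close>
      have S: "(\<lambda>n. K * x powr (s + 1) * (L * (1 - exp (-x)) / x\<^sup>2) * exp (-x) ^ n) sums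
           (K * x powr (s + 1) * (L * (1 - exp (-x)) / x\<^sup>2) * (1 / (1 - exp (-x))))"
        using True by (intro sums_mult geometric_sums) auto
      have 1: "(\<Sum>n. \<integral>\<^sup>+u. ennreal (indicator {0<..} x * (K * x powr (s + 1)))
      * ennreal (exp (- (real n * x))) * ennreal (indicator {0..1} u * (u * (1 - u) * exp (- (u * x)))) \<partial>lborel)
        = ennreal (K * x powr (s + 1) * (L * (1 - exp (-x)) / x\<^sup>2) * (1 / (1 - exp (-x))))"
        unfolding P by (rule suminf_ennreal_eq[OF _ S]) (use K L0 e1 in auto)
      have px: "x powr (s + 1) = x powr s * x" "x powr (s - 1) = x powr s / x"
        using True by (auto simp: powr_add powr_diff)
      have cancel: "k * (p * x) * (l * e / x\<^sup>2) * (1 / e) = k * (p / x) * l" if "e > 0" for k p l e :: real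
        using that True by (simp add: field_simps power2_eq_square)
      have 2: "K * x powr (s + 1) * (L * (1 - exp (-x)) / x\<^sup>2) * (1 / (1 - exp (-x))) = K * x powr (s - 1) * L"
        unfolding px by (rule cancel[OF e1])
      have 3: "K * x powr (s - 1) * (4 * x / d) = indicator {0<..} x * (4 * K * (x powr s / d))" for d
        unfolding px using True by simp
      have "(\<lambda>m. indicator {0<..} x * (4 * K * (x powr s / (x\<^sup>2 + (2 * pi * real (Suc m))\<^sup>2)))) sums (K * x powr (s - 1) * L)"
        using sums_mult[OF pf, of "K * x powr (s - 1)"] unfolding 3 .
      from suminf_ennreal_eq[OF _ this, symmetric] show ?thesis unfolding 1 2
        by (rule) (use K True in \<open>auto intro!: mult_nonneg_nonneg divide_nonneg_nonneg\<close>)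
    next
      case False
      hence "indicator {0<..} x = (0::real)" by simp
      thus ?thesis by simp
    qed
  qed
  also have "\<dots> = (\<Sum>m. \<integral>\<^sup>+x. ennreal (indicator {0<..} x * (4 * K * (x powr s / (x\<^sup>2 + (2 * pi * real (Suc m))\<^sup>2)))) \<partial>lborel)"
    by (rule nn_integral_suminf) measurable
  also have "\<dots> = (\<Sum>m. ennreal (4 * K * (2 * pi) powr (s - 1) * I * real (Suc m) powr (s - 1)))"
  proof (intro suminf_cong)
    fix m
    have "(\<integral>\<^sup>+x. ennreal (indicator {0<..} x * (4 * K * (x powr s / (x\<^sup>2 + (2 * pi * real (Suc m))\<^sup>2)))) \<partial>lborel)
       = (\<integral>\<^sup>+x. ennreal (4 * K) * ennreal (indicator {0<..} x * (x powr s / (x\<^sup>2 + (2 * pi * real (Suc m))\<^sup>2))) \<partial>lborel)"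
      using K by (intro nn_integral_cong) (auto simp: indicator_def simp flip: ennreal_mult')
    also have "\<dots> = ennreal (4 * K) * ennreal ((2 * pi * real (Suc m)) powr (s - 1) * I)"
      using s nn_integral_powr_inverse_square[of s "2 * pi * real (Suc m)"]
      by (subst nn_integral_cmult) (auto simp: I_def)
    also have "(2 * pi * real (Suc m)) powr (s - 1) = (2 * pi) powr (s - 1) * real (Suc m) powr (s - 1)"
      by (subst powr_mult) auto
    finally show "(\<integral>\<^sup>+x. ennreal (indicator {0<..} x * (4 * K * (x powr s / (x\<^sup>2 + (2 * pi * real (Suc m))\<^sup>2)))) \<partial>lborel)
       = ennreal (4 * K * (2 * pi) powr (s - 1) * I * real (Suc m) powr (s - 1))"
      using K I by (simp add: algebra_simps flip: ennreal_mult')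
  qed
  also have "\<dots> = ennreal (4 * K * (2 * pi) powr (s - 1) * I * (\<Sum>m. real (Suc m) powr (s - 1)))"
    using K I sums_mult[OF summable_sums[OF sm]] by (intro suminf_ennreal_eq) auto
  finally have "Gamma (s + 2) * Re (zeta_reg (of_real s)) = 4 * K * (2 * pi) powr (s - 1) * I * (\<Sum>m. real (Suc m) powr (s - 1))"
    using K I G V0 suminf_nonneg[OF sm] sums_le[OF _ sums_zero Vs] by (subst (asm) ennreal_inj) auto
  thus ?thesis unfolding K_def I_def by (simp add: field_simps)
qed

subsection \<open>The digamma function\<close>

text \<open>The function \<open>Ln (w + u) - u / w\<close> has derivative
  \<open>1 / (w + u) - 1 / w\<close>, and \<open>|w + u| \<ge> |w|\<close> for
  \<open>u \<ge> 0\<close> in the right half plane.\<close>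

lemma Ln_step_bound:
  fixes w :: complex assumes w: "Re w \<ge> 0" "w \<noteq> 0"
  shows "norm (Ln (w + 1) - Ln w - 1 / w) \<le> 1 / (norm w)\<^sup>2"
proof -
  define f where "f = (\<lambda>u. Ln (w + u) - u / w)"
  have "norm (f 1 - f 0) \<le> 1 / (norm w)\<^sup>2 * norm (1 - 0 :: complex)"
  proof (rule field_differentiable_bound[where S = "closed_segment 0 1" and f' = "\<lambda>u. 1 / (w + u) - 1 / w"])
    fix z :: complex assume "z \<in> closed_segment 0 1"
    then obtain u where u: "u \<in> {0..1}" "z = of_real u"
      by (auto simp: in_segment scaleR_conv_of_real)
    have nz: "w + z \<notin> \<real>\<^sub>\<le>\<^sub>0" using w u by (auto simp: complex_nonpos_Reals_iff complex_eq_iff)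
    hence nz0: "w + z \<noteq> 0" by auto
    show "(f has_field_derivative 1 / (w + z) - 1 / w) (at z within closed_segment 0 1)"
      unfolding f_def
    proof (rule DERIV_diff)
      show "((\<lambda>u. Ln (w + u)) has_field_derivative 1 / (w + z)) (at z within closed_segment 0 1)"
        using nz nz0 by (auto intro!: derivative_eq_intros simp: field_simps)
      show "((\<lambda>u. u / w) has_field_derivative 1 / w) (at z within closed_segment 0 1)"
        by (rule DERIV_cdivide[OF DERIV_ident])
    qed
    have ge: "norm w \<le> norm (w + z)" 
    proof -
      have "(Re w)\<^sup>2 \<le> (Re w + u)\<^sup>2" using w u by (intro power_mono) auto
      thus ?thesis using u by (simp add: cmod_def)
    qed
    have "norm (1 / (w + z) - 1 / w) = u / (norm (w + z) * norm w)"
    proof -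
      have "1 / (w + z) - 1 / w = - z / ((w + z) * w)" using nz0 w by (simp add: field_simps)
      thus ?thesis using u by (simp add: norm_mult norm_divide)
    qed
    also have "\<dots> \<le> 1 / (norm w * norm w)" using u w ge by (intro frac_le mult_mono) auto
    finally show "norm (1 / (w + z) - 1 / w) \<le> 1 / (norm w)\<^sup>2" by (simp add: power2_eq_square)
  qed auto
  moreover have "f 1 - f 0 = Ln (w + 1) - Ln w - 1 / w" by (simp add: f_def)
  ultimately show ?thesis by simp
qed

text \<open>The partial sums of \<open>1 / (z + n)\<close> are compared with the telescoping sum of
  \<open>Ln (z + n + 1) - Ln (z + n)\<close>. The steps differ by at most
  \<open>1 / |z + n|\<^sup>2\<close>, which is dominated by a telescoping series of sum
  \<open>4 / |z|\<close>.\<close>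

lemma Digamma_Ln_bound:
  fixes z :: complex assumes z: "Re z \<ge> 0" "norm z \<ge> 1"
  shows "norm (Digamma z - Ln z) \<le> 4 / norm z"
proof -
  define r where "r = norm z"
  have r: "r \<ge> 1" using z by (simp add: r_def)
  have z0: "z \<noteq> 0" using z by auto
  have w: "Re (z + of_nat n) \<ge> 0" "z + of_nat n \<noteq> 0" for n
    using z z0 by (auto simp: complex_eq_iff)
  have ge: "(norm (z + of_nat n))\<^sup>2 \<ge> (r + real n)\<^sup>2 / 2" for n
  proof -
    have "(norm (z + of_nat n))\<^sup>2 = r\<^sup>2 + (real n)\<^sup>2 + 2 * Re z * real n"
      unfolding r_def cmod_power2 by (simp add: power2_eq_square algebra_simps)
    moreover have "(r + real n)\<^sup>2 / 2 \<le> r\<^sup>2 + (real n)\<^sup>2"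
      using zero_le_power2[of "r - real n"] by (simp add: power2_eq_square algebra_simps)
    moreover have "2 * Re z * real n \<ge> 0" using z by simp
    ultimately show ?thesis by linarith
  qed
  \<comment> \<open>One factor 2 comes from
    \<open>|z + n|\<^sup>2 \<ge> (r + n)\<^sup>2 / 2\<close>, the other from
    \<open>r + n + 1 \<le> 2 (r + n)\<close>, which needs \<open>r \<ge> 1\<close>.\<close>
  have b: "1 / (norm (z + of_nat n))\<^sup>2 \<le> 4 * (1 / (r + real n) - 1 / (r + real (Suc n)))" for n
  proof -
    have "1 / (norm (z + of_nat n))\<^sup>2 \<le> 1 / ((r + real n)\<^sup>2 / 2)"
      using r by (intro frac_le ge) (auto intro!: divide_pos_pos)
    also have "\<dots> = 2 / ((r + real n) * (r + real n))" by (simp add: power2_eq_square)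
    also have "\<dots> \<le> 4 / ((r + real n) * (r + real (Suc n)))"
      using r by (simp add: divide_simps)
    also have "\<dots> = 4 * (1 / (r + real n) - 1 / (r + real (Suc n)))"
      using r by (simp add: field_simps)
    finally show ?thesis .
  qed
  have bd: "norm ((\<Sum>n<m. 1 / (z + of_nat n)) - (Ln (z + of_nat m) - Ln z)) \<le> 4 / r" for m
  proof -
    have "(\<Sum>n<m. 1 / (z + of_nat n)) - (Ln (z + of_nat m) - Ln z) =
       (\<Sum>n<m. 1 / (z + of_nat n) - (Ln (z + of_nat (Suc n)) - Ln (z + of_nat n)))"
      using sum_lessThan_telescope[of "\<lambda>n. Ln (z + of_nat n)" m] by (simp add: sum_subtractf)
    also have "norm \<dots> \<le> (\<Sum>n<m. 4 * (1 / (r + real n) - 1 / (r + real (Suc n))))"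
    proof (rule sum_norm_le)
      fix n
      have "norm (1 / (z + of_nat n) - (Ln (z + of_nat (Suc n)) - Ln (z + of_nat n))) \<le> 1 / (norm (z + of_nat n))\<^sup>2"
        using Ln_step_bound[OF w[of n]] by (simp add: norm_minus_commute add_ac algebra_simps)
      thus "norm (1 / (z + of_nat n) - (Ln (z + of_nat (Suc n)) - Ln (z + of_nat n))) \<le> 4 * (1 / (r + real n) - 1 / (r + real (Suc n)))"
        using b[of n] by linarith
    qed
    also have "\<dots> = 4 * (1 / r - 1 / (r + real m))"
      unfolding sum_distrib_left[symmetric] using sum_lessThan_telescope'[of "\<lambda>n. 1 / (r + real n)" m] by simp
    also have "\<dots> \<le> 4 / r" using r by simp
    finally show ?thesis .
  qed
  have lim: "(\<lambda>m. Ln (z + of_nat m) - of_real (ln (real m))) \<longlonglongrightarrow> 0"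
  proof (rule Lim_transform_eventually)
    have "(\<lambda>m. z / of_nat m) \<longlonglongrightarrow> 0"
      by (rule tendsto_divide_0[OF tendsto_const]) (rule tendsto_of_nat)
    hence "(\<lambda>m. Ln (z / of_nat m + 1)) \<longlonglongrightarrow> Ln (0 + 1)"
      by (intro tendsto_Ln tendsto_add tendsto_const) auto
    thus "(\<lambda>m. Ln (z / of_nat m + 1)) \<longlonglongrightarrow> 0" by simp
    show "\<forall>\<^sub>F m in sequentially. Ln (z / of_nat m + 1) = Ln (z + of_nat m) - of_real (ln (real m))"
      using eventually_gt_at_top[of "0::nat"]
    proof eventually_elim
      case (elim m)
      have "z + of_nat m = of_real (real m) * (z / of_nat m + 1)" using elim by (simp add: field_simps)
      moreover have "z / of_nat m + 1 \<noteq> 0" using w[of m] elim by (auto simp: field_simps)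
      ultimately have "Ln (z + of_nat m) = of_real (ln (real m)) + Ln (z / of_nat m + 1)"
        using elim Ln_times_of_real[of "real m" "z / of_nat m + 1"] by simp
      thus ?case by simp
    qed
  qed
  have "(\<lambda>m. (Ln (z + of_nat m) - of_real (ln (real m))) + (of_real (ln (real m)) - (\<Sum>n<m. inverse (z + of_nat n)))) \<longlonglongrightarrow> 0 + Digamma z"
    by (intro tendsto_add lim Digamma_LIMSEQ[OF z0])
  hence "(\<lambda>m. norm (Ln (z + of_nat m) - (\<Sum>n<m. inverse (z + of_nat n)) - Ln z)) \<longlonglongrightarrow> norm (Digamma z - Ln z)"
    by (intro tendsto_intros) simp
  moreover have "norm (Ln (z + of_nat m) - (\<Sum>n<m. inverse (z + of_nat n)) - Ln z) \<le> 4 / r" for m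
    using bd[of m] by (simp add: inverse_eq_divide norm_minus_commute algebra_simps)
  ultimately show ?thesis unfolding r_def by (intro Lim_bounded) auto
qed

lemma Re_Digamma_bound:
  fixes z :: complex assumes z: "Re z \<ge> 0" "norm z \<ge> 1"
  shows "\<bar>Re (Digamma z) - ln (norm z)\<bar> \<le> 4 / norm z"
proof -
  have "Re (Digamma z - Ln z) = Re (Digamma z) - ln (norm z)" using z by (subst minus_complex.sel, subst Re_Ln) auto
  thus ?thesis using Digamma_Ln_bound[OF z] abs_Re_le_cmod[of "Digamma z - Ln z"] by linarith
qed

text \<open>Integrate \<open>Re \<psi>(z) \<ge> ln |z| - 4\<close> horizontally.\<close>

lemma norm_Gamma_shift:
  fixes z :: complex assumes z: "Re z \<ge> 1" and a: "a \<ge> 0"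
  shows "norm (Gamma z) * exp (a * (ln (norm z) - 4)) \<le> norm (Gamma (z + of_real a))"
proof -
  define g where "g = (\<lambda>u. ln (norm (Gamma (z + of_real u))) - u * (ln (norm z) - 4))"
  have g: "\<exists>D. (g has_real_derivative D) (at u) \<and> D \<ge> 0" if u: "u \<ge> 0" for u :: real
  proof -
    define w where "w = z + of_real u"
    have ge: "norm z \<le> norm w" 
    proof -
      have "(Re z)\<^sup>2 \<le> (Re z + u)\<^sup>2" using z u by (intro power_mono) auto
      thus ?thesis by (simp add: cmod_def w_def)
    qed
    have Re1: "Re z \<le> norm z" by (rule complex_Re_le_cmod)
    have w: "Re w \<ge> 0" "norm w \<ge> 1" using z u ge Re1 by (auto simp: w_def)
    have nn: "w \<notin> \<int>\<^sub>\<le>\<^sub>0" "w \<notin> \<real>\<^sub>\<le>\<^sub>0" using z u by (auto simp: w_def elim!: nonpos_Ints_cases simp: complex_eq_iff complex_nonpos_Reals_iff)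
    have G0: "Gamma w \<noteq> 0" using nn by (simp add: Gamma_eq_zero_iff)
    have d: "((\<lambda>u. Gamma (z + of_real u)) has_vector_derivative (Gamma w * Digamma w)) (at u)"
    proof -
      have "((\<lambda>x. Gamma (z + x)) has_field_derivative (Gamma w * Digamma w)) (at (of_real u))"
        using nn unfolding w_def by (auto intro!: derivative_eq_intros)
      thus ?thesis by (rule has_vector_derivative_real_field)
    qed
    have "((\<lambda>u. (norm (Gamma (z + of_real u)))\<^sup>2) has_real_derivative 2 * (norm (Gamma w))\<^sup>2 * Re (Digamma w)) (at u)"
    proof -
      have dR: "((\<lambda>u. Re (Gamma (z + of_real u))) has_real_derivative Re (Gamma w * Digamma w)) (at u)"
        and dI: "((\<lambda>u. Im (Gamma (z + of_real u))) has_real_derivative Im (Gamma w * Digamma w)) (at u)"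
        using d by (auto simp: has_vector_derivative_complex_iff has_real_derivative_iff_has_vector_derivative)
      show ?thesis unfolding cmod_power2
        by (rule derivative_eq_intros dR dI refl)+ (simp add: w_def[symmetric] power2_eq_square algebra_simps)
    qed
    hence "((\<lambda>u. ln ((norm (Gamma (z + of_real u)))\<^sup>2) / 2) has_real_derivative Re (Digamma w)) (at u)"
    proof -
      have "((\<lambda>u. ln (N u) / 2) has_real_derivative Re (Digamma w)) (at u)"
        if "(N has_real_derivative 2 * (norm (Gamma w))\<^sup>2 * Re (Digamma w)) (at u)" "N u = (norm (Gamma w))\<^sup>2" for N
        using that(2) G0 by (auto intro!: derivative_eq_intros that(1))
      from this[OF \<open>(_ has_real_derivative _) (at u)\<close>] show ?thesis by (simp add: w_def)
    qed
    hence "((\<lambda>u. ln (norm (Gamma (z + of_real u)))) has_real_derivative Re (Digamma w)) (at u)"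
      by (simp add: ln_realpow)
    from DERIV_diff[OF this DERIV_cmult_right[OF DERIV_ident, of "ln (norm z) - 4"]]
    have "(g has_real_derivative Re (Digamma w) - (ln (norm z) - 4)) (at u)"
      unfolding g_def by simp
    moreover have "ln (norm z) \<le> ln (norm w)" using ge z Re1 by (intro ln_mono) auto
    moreover have "4 / norm w \<le> 4" using w frac_le[of 4 4 1 "norm w"] by simp
    ultimately show ?thesis using Re_Digamma_bound[OF w] by (intro exI[of _ "Re (Digamma w) - (ln (norm z) - 4)"]) auto
  qed
  have "g 0 \<le> g a"
    by (rule DERIV_nonneg_imp_nondecreasing[OF a]) (use g in auto)
  moreover have "Gamma z \<noteq> 0" "Gamma (z + of_real a) \<noteq> 0"
    unfolding Gamma_eq_zero_iff using z a by (auto elim!: nonpos_Ints_cases dest!: arg_cong[where f = Re])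
  ultimately have "ln (norm (Gamma z)) + a * (ln (norm z) - 4) \<le> ln (norm (Gamma (z + of_real a)))"
    by (simp add: g_def)
  hence "exp (ln (norm (Gamma z)) + a * (ln (norm z) - 4)) \<le> exp (ln (norm (Gamma (z + of_real a))))" by simp
  thus ?thesis using \<open>Gamma z \<noteq> 0\<close> \<open>Gamma (z + of_real a) \<noteq> 0\<close> by (simp add: exp_add)
qed

subsection \<open>The xi function as an entire function\<close>

text \<open>The defining product of \<open>\<xi>\<close> with \<open>s / 2\<close> absorbed into the
  Gamma function and \<open>s - 1\<close> into \<open>zeta_reg\<close>; in this form it has no
  singularity for real part above \<open>- 1\<close>.\<close>

definition xi_right :: "complex \<Rightarrow> complex" where
  "xi_right s = of_real pi powr (- s / 2) * Gamma (s / 2 + 1) * zeta_reg s"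

lemma holomorphic_xi_right: "xi_right holomorphic_on {s. Re s > -1}"
  unfolding xi_right_def
  by (intro holomorphic_intros holomorphic_zeta_reg)
     (auto simp: complex_nonpos_Reals_iff elim!: nonpos_Ints_cases dest!: arg_cong[where f = Re])

text \<open>Legendre's duplication formula at \<open>s / 2 + 1\<close>, arranged in the Gamma
  factors that separate the asymmetric functional equation from the symmetric one.\<close>

lemma Gamma_duplication_real:
  fixes s :: real assumes s: "s > -1"
  shows "Gamma (s / 2 + 1) * ((s + 1) / 2 * Gamma ((1 + s) / 2)) = 2 powr (-1 - s) * sqrt pi * Gamma (s + 2)"
proof -
  define z where "z = complex_of_real (s / 2 + 1)"
  have "Re z > 0" using s by (simp add: z_def)
  hence "z \<notin> \<int>\<^sub>\<le>\<^sub>0" "z + 1/2 \<notin> \<int>\<^sub>\<le>\<^sub>0"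
    by (auto elim!: nonpos_Ints_cases dest!: arg_cong[where f = Re])
  hence "Gamma z * Gamma (z + 1/2) = exp ((1 - 2*z) * of_real (ln 2)) * of_real (sqrt pi) * Gamma (2*z)"
    by (rule Gamma_legendre_duplication)
  also have "z + 1/2 = of_real (s / 2 + 3 / 2)" by (simp add: z_def)
  also have "2 * z = of_real (s + 2)" by (simp add: z_def)
  also have "exp ((1 - of_real (s + 2)) * complex_of_real (ln 2)) = of_real (exp ((-1 - s) * ln 2))"
    by (simp add: exp_of_real[symmetric] algebra_simps)
  finally have "complex_of_real (Gamma (s / 2 + 1) * Gamma (s / 2 + 3 / 2)) = of_real (exp ((-1 - s) * ln 2) * sqrt pi * Gamma (s + 2))"
    unfolding z_def Gamma_complex_of_real by simp
  hence "Gamma (s / 2 + 1) * Gamma (s / 2 + 3 / 2) = exp ((-1 - s) * ln 2) * sqrt pi * Gamma (s + 2)"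
    by (simp only: of_real_eq_iff)
  moreover have "Gamma (s / 2 + 3 / 2) = (s + 1) / 2 * Gamma ((1 + s) / 2)"
  proof -
    have "(1 + s) / 2 \<notin> \<int>\<^sub>\<le>\<^sub>0" using s by (auto elim!: nonpos_Ints_cases)
    moreover have e: "s / 2 + 3 / 2 = (1 + s) / 2 + 1" by (simp add: field_simps)
    ultimately show ?thesis unfolding e by (subst Gamma_plus1) (auto simp: add.commute)
  qed
  ultimately show ?thesis by (simp add: powr_def)
qed

text \<open>The sum in the real functional equation is the Dirichlet series at \<open>1 - s\<close>,
  hence a multiple of \<open>zeta_reg (1 - s)\<close>; the duplication formula then makes the Gamma
  factors symmetric.\<close>

lemma xi_right_functional_real:
  fixes s :: real assumes s: "-1 < s" "s < 0"
  shows "xi_right (of_real s) = xi_right (1 - of_real s)"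
proof -
  define Z Z' where "Z = Re (zeta_reg (of_real s))" and "Z' = Re (zeta_reg (of_real (1 - s)))"
  define G1 G2 where "G1 = Gamma ((1 + s) / 2)" and "G2 = Gamma ((1 - s) / 2)"
  define G G3 where "G = Gamma (s / 2 + 1)" and "G3 = Gamma (s + 2)"
  define p where "p = pi powr (s - 1)"
  have Zs: "zeta_reg (of_real s) = of_real Z" "zeta_reg (of_real (1 - s)) = of_real Z'"
    unfolding Z_def Z'_def using zeta_reg_of_real(2)[of s] zeta_reg_of_real(2)[of "1 - s"] s by auto
  have "zeta_reg (of_real (1 - s)) = (of_real (1 - s) - 1) * (\<Sum>n. of_nat (Suc n) powr (- of_real (1 - s)))"
    using s by (intro zeta_reg_eq_series) auto
  also have "(\<lambda>n. of_nat (Suc n) powr (- of_real (1 - s)) :: complex) = (\<lambda>n. of_real (real (Suc n) powr (s - 1)))"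
    by (auto simp: powr_of_real[symmetric] simp del: of_nat_Suc)
  also have "(\<Sum>n. complex_of_real (real (Suc n) powr (s - 1))) = of_real (\<Sum>n. real (Suc n) powr (s - 1))"
    using s by (intro suminf_of_real[symmetric] summable_powr_shift) auto
  finally have Z': "Z' = - s * (\<Sum>n. real (Suc n) powr (s - 1))"
    unfolding Z'_def by simp
  have 1: "G3 * Z = (1 - s) * (s + 1) * (2 * pi) powr (s - 1) * (G1 * G2) * Z'"
    using zeta_reg_functional_real[OF s] unfolding Z' Z_def G1_def G2_def G3_def by (simp add: algebra_simps)
  have 2: "G * ((s + 1) / 2 * G1) = 2 powr (-1 - s) * sqrt pi * G3"
    using Gamma_duplication_real[of s] s unfolding G_def G1_def G3_def by simp
  have G1: "G1 > 0" unfolding G1_def using s by (intro Gamma_real_pos) auto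
  have "(2 powr (-1 - s) * sqrt pi * G3) * Z = 2 powr (-1 - s) * sqrt pi * ((1 - s) * (s + 1) * (2 * pi) powr (s - 1) * (G1 * G2) * Z')"
    unfolding 1[symmetric] by simp
  hence "((s + 1) * G1) * (G / 2 * Z) = ((s + 1) * G1) * (2 powr (-1 - s) * sqrt pi * ((1 - s) * (2 * pi) powr (s - 1) * G2 * Z'))"
    unfolding 2[symmetric] by (simp add: algebra_simps)
  hence "G / 2 * Z = 2 powr (-1 - s) * sqrt pi * ((1 - s) * (2 * pi) powr (s - 1) * G2 * Z')"
    using s G1 by (subst (asm) mult_left_cancel) auto
  also have "(2 * pi) powr (s - 1) = 2 powr (s - 1) * pi powr (s - 1)" by (subst powr_mult) auto
  also have "2 powr (-1 - s) * sqrt pi * ((1 - s) * (2 powr (s - 1) * pi powr (s - 1)) * G2 * Z') =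
     (2 powr (-1 - s) * 2 powr (s - 1)) * (sqrt pi * pi powr (s - 1)) * (1 - s) * G2 * Z'" by (simp add: algebra_simps)
  also have "2 powr (-1 - s) * 2 powr (s - 1) = (1 / 4 :: real)" by (simp add: powr_add[symmetric] powr_minus)
  also have "sqrt pi * pi powr (s - 1) = pi powr (s - 1 / 2)" by (simp add: powr_half_sqrt[symmetric] powr_add[symmetric])
  finally have 3: "G * Z = pi powr (s - 1 / 2) * ((1 - s) / 2 * G2) * Z'" by (simp add: field_simps)
  have 4: "Gamma ((1 - s) / 2 + 1) = (1 - s) / 2 * G2"
  proof -
    have "(1 - s) / 2 \<notin> \<int>\<^sub>\<le>\<^sub>0" using s by (auto elim!: nonpos_Ints_cases)
    from Gamma_plus1[OF this] show ?thesis by (simp add: G2_def)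
  qed
  have "pi powr (- s / 2) * G * Z = (pi powr (- s / 2) * pi powr (s - 1 / 2)) * Gamma ((1 - s) / 2 + 1) * Z'"
    unfolding 4 using 3 by (simp add: mult.assoc)
  also have "pi powr (- s / 2) * pi powr (s - 1 / 2) = pi powr (- (1 - s) / 2)"
    unfolding powr_add[symmetric] by (rule arg_cong[where f = "\<lambda>x. pi powr x"]) (simp add: field_simps)
  finally have 5: "pi powr (- s / 2) * G * Z = pi powr (- (1 - s) / 2) * Gamma ((1 - s) / 2 + 1) * Z'" .
  have r: "xi_right (of_real u) = of_real (pi powr (- u / 2) * Gamma (u / 2 + 1) * Re (zeta_reg (of_real u)))"
    if "u > -1" for u :: real
  proof -
    have "complex_of_real pi powr (- of_real u / 2) = of_real (pi powr (- u / 2))"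
      by (simp add: powr_of_real[symmetric])
    moreover have "Gamma (complex_of_real u / 2 + 1) = of_real (Gamma (u / 2 + 1))"
      by (simp add: Gamma_complex_of_real[symmetric])
    ultimately show ?thesis unfolding xi_right_def using zeta_reg_of_real(2)[OF that] by (metis of_real_mult)
  qed
  have "xi_right (of_real s) = xi_right (of_real (1 - s))"
    using s 5 unfolding G_def Z_def Z'_def by (subst (1 2) r) auto
  thus ?thesis by simp
qed

text \<open>The identity theorem extends the equation from the segment \<open>(-1, 0)\<close> to the
  strip in which \<open>s\<close> and \<open>1 - s\<close> both lie to the right of
  \<open>- 1\<close>.\<close>

lemma xi_right_functional:
  assumes "-1 < Re s" "Re s < 2" shows "xi_right s = xi_right (1 - s)"
proof -
  define S where "S = {s::complex. -1 < Re s} \<inter> {s. Re s < 2}"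
  have S: "open S" "connected S" unfolding S_def
    by (auto intro!: open_Int open_halfspace_Re_gt open_halfspace_Re_lt convex_connected convex_Int
          convex_halfspace_Re_gt convex_halfspace_Re_lt)
  have "xi_right s - xi_right (1 - s) = 0"
  proof (rule analytic_continuation[where f = "\<lambda>s. xi_right s - xi_right (1 - s)" and S = S
        and U = "complex_of_real ` {-1<..<0}" and \<xi> = "of_real (-1/2)"])
    have "(\<lambda>s. xi_right (1 - s)) holomorphic_on S"
      by (rule holomorphic_on_compose_gen[OF _ holomorphic_xi_right, unfolded o_def])
         (auto intro!: holomorphic_intros simp: S_def)
    moreover have "xi_right holomorphic_on S"
      by (rule holomorphic_on_subset[OF holomorphic_xi_right]) (auto simp: S_def)
    ultimately show "(\<lambda>s. xi_right s - xi_right (1 - s)) holomorphic_on S" by (intro holomorphic_intros)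
    show "complex_of_real (-1/2) islimpt complex_of_real ` {-1<..<0}"
      unfolding islimpt_approachable
    proof (intro allI impI)
      fix e :: real assume e: "e > 0"
      define d where "d = min (e / 2) (1 / 4)"
      have d: "d > 0" "d < e" "d < 1/2" using e by (auto simp: d_def)
      show "\<exists>x'\<in>complex_of_real ` {-1<..<0}. x' \<noteq> complex_of_real (-1/2) \<and> dist x' (complex_of_real (-1/2)) < e"
      proof (intro bexI conjI)
        show "complex_of_real (-1/2 + d) \<noteq> complex_of_real (-1/2)" using d by (simp only: of_real_eq_iff)
        show "dist (complex_of_real (-1/2 + d)) (complex_of_real (-1/2)) < e" using d by (simp only: dist_of_real dist_real_def)
        show "complex_of_real (-1/2 + d) \<in> complex_of_real ` {-1<..<0}" using d by (intro imageI) auto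
      qed
    qed
  qed (use S assms xi_right_functional_real in \<open>auto simp: S_def\<close>)
  thus ?thesis by simp
qed

text \<open>Both branches agree on the strip \<open>-1 < Re s < 2\<close> by the functional
  equation, so the two half planes are glued holomorphically.\<close>

definition xi_entire :: "complex \<Rightarrow> complex" where
  "xi_entire s = (if Re s > -1 then xi_right s else xi_right (1 - s))"

lemma xi_entire_reflect: "xi_entire (1 - s) = xi_entire s"
proof (cases "-1 < Re s \<and> Re s < 2")
  case True
  hence "xi_entire (1 - s) = xi_right (1 - s)" "xi_entire s = xi_right s" by (auto simp: xi_entire_def)
  thus ?thesis using xi_right_functional[of s] True by (simp only:)
qed (auto simp: xi_entire_def)

lemma holomorphic_xi_entire: "xi_entire holomorphic_on A"
proof -
  have "xi_entire holomorphic_on ({s. Re s > -1} \<union> {s. Re s < 2})"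
  proof (rule holomorphic_on_Un)
    show "xi_entire holomorphic_on {s. Re s > -1}"
      by (rule holomorphic_transform[OF holomorphic_xi_right]) (auto simp: xi_entire_def)
    have "(\<lambda>s. xi_right (1 - s)) holomorphic_on {s. Re s < 2}"
      by (rule holomorphic_on_compose_gen[OF _ holomorphic_xi_right, unfolded o_def])
         (auto intro!: holomorphic_intros)
    thus "xi_entire holomorphic_on {s. Re s < 2}"
    proof (rule holomorphic_transform)
      fix s :: complex assume "s \<in> {s. Re s < 2}"
      thus "xi_right (1 - s) = xi_entire s"
        using xi_right_functional[of s] by (cases "Re s > -1") (auto simp: xi_entire_def)
    qed
  qed (auto intro: open_halfspace_Re_gt open_halfspace_Re_lt)
  moreover have "{s::complex. Re s > -1} \<union> {s. Re s < 2} = UNIV" by auto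
  ultimately show ?thesis by (metis holomorphic_on_subset subset_UNIV)
qed

text \<open>Solving the product formula of \<open>\<xi>\<close> for \<open>\<zeta>\<close> exhibits
  a continuation to the plane without 1, and the identity theorem shows that it is the only one,
  which resolves the definite description. At 1 the division by zero yields the conventional value
  0.\<close>

lemma riemann_zeta_eq_xi_entire:
  "riemann_zeta = (\<lambda>s. xi_entire s * of_real pi powr (s / 2) * rGamma (s / 2 + 1) / (s - 1))"
    (is "_ = ?Z")
  and zeta_reg_conv: "Re s > -1 \<Longrightarrow> riemann_zeta s = zeta_reg s / (s - 1)"
proof -
  have right: "?Z s = zeta_reg s / (s - 1)" if "Re s > -1" for s
  proof -
    have "Gamma (s / 2 + 1) \<noteq> 0" unfolding Gamma_eq_zero_iff using that
      by (auto elim!: nonpos_Ints_cases dest!: arg_cong[where f = Re])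
    thus ?thesis using that by (simp add: xi_entire_def xi_right_def rGamma_inverse_Gamma powr_minus field_simps)
  qed
  have hol: "?Z holomorphic_on (- {1})"
    by (intro holomorphic_intros holomorphic_xi_entire) (auto simp: complex_nonpos_Reals_iff)
  have ser: "(\<lambda>n. 1 / of_nat (Suc n) powr s) sums ?Z s" if "Re s > 1" for s
  proof -
    have "?Z s = (\<Sum>n. of_nat (Suc n) powr (-s))"
      using that zeta_reg_eq_series[OF that] right[of s] by auto
    thus ?thesis using summable_sums[OF summable_zeta_series[OF that]]
      by (simp add: powr_minus inverse_eq_divide del: of_nat_Suc)
  qed
  show *: "riemann_zeta = ?Z" unfolding riemann_zeta_def
  proof (rule the_equality)
    show "?Z holomorphic_on - {1} \<and> (\<forall>s. Re s > 1 \<longrightarrow> (\<lambda>n. 1 / of_nat (Suc n) powr s) sums ?Z s) \<and> ?Z 1 = 0"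
      using hol ser by auto
    fix f :: "complex \<Rightarrow> complex"
    assume f: "f holomorphic_on - {1} \<and> (\<forall>s. Re s > 1 \<longrightarrow> (\<lambda>n. 1 / of_nat (Suc n) powr s) sums f s) \<and> f 1 = 0"
    show "f = ?Z"
    proof
      fix z show "f z = ?Z z"
      proof (cases "z = 1")
        case False
        show ?thesis
        proof (rule analytic_continuation_open[where s = "{s. Re s > 1}" and s' = "- {1}" and f = f and g = ?Z])
          show "connected (- {1::complex})"
            using connected_open_delete[OF open_UNIV connected_UNIV, of "1::complex"] by (simp add: Compl_eq_Diff_UNIV)
          show "{s::complex. Re s > 1} \<noteq> {}" by (auto intro!: exI[of _ 2])
          show "f z = ?Z z" if "z \<in> {s. Re s > 1}" for z
            using that f ser[of z] sums_unique2 by blast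
        qed (use f hol False in \<open>auto intro: open_halfspace_Re_gt\<close>)
      qed (use f in auto)
    qed
  qed
  show "riemann_zeta s = zeta_reg s / (s - 1)" if "Re s > -1" using right[OF that] unfolding * .
qed

text \<open>The poles of \<open>Gamma (w / 2)\<close> are isolated. Near each point the product
  formula is therefore valid on a punctured neighbourhood, which is all that the removal of
  singularities sees.\<close>

lemma eventually_half_not_nonpos_Ints: "\<forall>\<^sub>F w in at z. (w::complex) / 2 \<notin> \<int>\<^sub>\<le>\<^sub>0"
proof -
  have "\<forall>\<^sub>F w in at z. w \<in> ball z 1 - {z}" by (intro eventually_at_in_open) auto
  moreover have "\<forall>\<^sub>F w in at z. z / 2 \<in> \<int>\<^sub>\<le>\<^sub>0 \<or> w / 2 \<notin> \<int>\<^sub>\<le>\<^sub>0"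
  proof (cases "z / 2 \<in> \<int>\<^sub>\<le>\<^sub>0")
    case False
    have "((\<lambda>w. w / 2) \<longlongrightarrow> z / 2) (at z)" by (intro tendsto_intros) auto
    hence "\<forall>\<^sub>F w in at z. w / 2 \<in> - \<int>\<^sub>\<le>\<^sub>0" using False
      by (intro topological_tendstoD) (auto intro: open_Compl)
    thus ?thesis by eventually_elim auto
  qed auto
  ultimately show ?thesis
  proof eventually_elim
    case (elim w)
    show ?case
    proof
      assume w: "w / 2 \<in> \<int>\<^sub>\<le>\<^sub>0"
      with elim have "z / 2 \<in> \<int>\<^sub>\<le>\<^sub>0" by auto
      then obtain m n :: int where mn: "z / 2 = of_int m" "w / 2 = of_int n" using w by (auto elim!: nonpos_Ints_cases)
      have "norm (z / 2 - w / 2) < 1" using elim by (auto simp: dist_norm norm_divide simp flip: diff_divide_distrib)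
      hence "\<bar>m - n\<bar> < 1" unfolding mn using norm_of_int[of "m - n", where 'a = complex] by (simp del: norm_of_int)
      hence "z = w" using mn by simp
      thus False using elim by auto
    qed
  qed
qed

lemma riemann_xi_eq_xi_entire: "riemann_xi = xi_entire"
proof
  fix z
  have "\<forall>\<^sub>F w in at z. (w::complex) / 2 \<notin> \<int>\<^sub>\<le>\<^sub>0" by (rule eventually_half_not_nonpos_Ints)
  moreover have "\<forall>\<^sub>F w in at z. w \<noteq> 1" by (rule eventually_neq_at_within)
  ultimately have "\<forall>\<^sub>F w in at z. xi_entire w = 1 / 2 * w * (w - 1) * complex_of_real pi powr (- w / 2)
     * Gamma (w / 2) * riemann_zeta w"
  proof eventually_elim
    case (elim w)
    have "w \<noteq> 0" using elim by auto
    hence G: "Gamma (w / 2 + 1) = w / 2 * Gamma (w / 2)" "Gamma (w / 2) \<noteq> 0"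
      using elim by (auto simp: Gamma_plus1 Gamma_eq_zero_iff)
    show ?case unfolding riemann_zeta_eq_xi_entire rGamma_inverse_Gamma G(1)
      using G(2) elim \<open>w \<noteq> 0\<close> by (simp add: powr_minus field_simps)
  qed
  moreover have "isCont xi_entire z"
    using holomorphic_on_imp_continuous_on[OF holomorphic_xi_entire[of UNIV]] by (simp add: continuous_on_eq_continuous_at)
  hence "xi_entire \<midarrow>z\<rightarrow> xi_entire z" by (simp add: isCont_def)
  ultimately have "(\<lambda>w. 1 / 2 * w * (w - 1) * complex_of_real pi powr (- w / 2) * Gamma (w / 2) * riemann_zeta w) \<midarrow>z\<rightarrow> xi_entire z"
    by (rule Lim_transform_eventually[rotated])
  thus "riemann_xi z = xi_entire z" unfolding riemann_xi_def by (rule remove_sings_eqI)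
qed

lemma holomorphic_riemann_xi: "riemann_xi holomorphic_on A"
  unfolding riemann_xi_eq_xi_entire by (rule holomorphic_xi_entire)

lemma riemann_xi_reflect: "riemann_xi (1 - s) = riemann_xi s"
  unfolding riemann_xi_eq_xi_entire by (rule xi_entire_reflect)

lemma riemann_xi_right:
  "Re s > -1 \<Longrightarrow> riemann_xi s = of_real pi powr (- s / 2) * Gamma (s / 2 + 1) * zeta_reg s"
  unfolding riemann_xi_eq_xi_entire by (simp add: xi_entire_def xi_right_def)

lemma cnj_riemann_xi: "riemann_xi (cnj s) = cnj (riemann_xi s)"
proof -
  have *: "riemann_xi (cnj s) = cnj (riemann_xi s)" if "Re s > -1" for s
  proof -
    have "cnj (of_real pi powr (- s / 2)) = of_real pi powr (- cnj s / 2)"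
    proof -
      have "cnj (of_real pi powr (- s / 2)) = cnj (of_real pi) powr cnj (- s / 2)" by (rule cnj_powr) simp
      thus ?thesis by simp
    qed
    moreover have "cnj (Gamma (s / 2 + 1)) = Gamma (cnj s / 2 + 1)" by (simp add: cnj_Gamma)
    ultimately show ?thesis using that cnj_zeta_reg[OF that] riemann_xi_right[of s] riemann_xi_right[of "cnj s"]
      by simp
  qed
  show ?thesis
  proof (cases "Re s > -1")
    case False
    hence "riemann_xi (cnj (1 - s)) = cnj (riemann_xi (1 - s))" by (intro *) auto
    thus ?thesis using riemann_xi_reflect[of s] riemann_xi_reflect[of "cnj s"] by (simp del: complex_cnj_diff) simp
  qed (rule *)
qed

subsection \<open>Non-vanishing on the line of real part 1\<close>

text \<open>A sieve, one prime at a time: the numbers free of primes in \<open>P\<close> are those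
  also prime to \<open>p\<close> together with \<open>p\<close> times the numbers free of primes in
  \<open>P\<close>. Complete multiplicativity turns the second part into the factor
  \<open>a p\<close>.\<close>

lemma infsum_rough:
  fixes a :: "nat \<Rightarrow> 'a :: {real_normed_field, banach}"
  assumes mult: "\<And>m n. a (m * n) = a m * a n" and sm: "a abs_summable_on UNIV"
    and P: "finite P" "\<And>p. p \<in> P \<Longrightarrow> prime p"
  shows "infsum a {n. \<forall>p\<in>P. \<not> p dvd n} = (\<Prod>p\<in>P. 1 - a p) * infsum a UNIV"
  using P
proof (induction P rule: finite_induct)
  case (insert p P)
  have sub: "a summable_on A" for A
    using abs_summable_summable[OF sm] by (rule summable_on_subset_banach) auto
  let ?R = "\<lambda>P. {n::nat. \<forall>p\<in>P. \<not> p dvd n}"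
  have "n \<in> ?R P \<longleftrightarrow> n \<in> ?R (insert p P) \<union> (\<lambda>n. p * n) ` ?R P" for n
  proof (cases "p dvd n")
    case True
    then obtain m where m: "n = p * m" by auto
    have pp: "prime p" "p > 0" using insert.prems[of p] by (auto simp: prime_gt_0_nat)
    have "q dvd n \<longleftrightarrow> q dvd m" if "q \<in> P" for q
    proof -
      have "prime q" "q \<noteq> p" using that insert by auto
      thus ?thesis unfolding m using pp by (metis prime_dvd_mult_iff primes_dvd_imp_eq)
    qed
    hence "n \<in> ?R P \<longleftrightarrow> m \<in> ?R P" by auto
    moreover have "n \<in> (\<lambda>n. p * n) ` ?R P \<longleftrightarrow> m \<in> ?R P" using pp by (auto simp: m)
    ultimately show ?thesis using True by auto
  qed auto
  hence "?R P = ?R (insert p P) \<union> (\<lambda>n. p * n) ` ?R P" by blast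
  moreover have "?R (insert p P) \<inter> (\<lambda>n. p * n) ` ?R P = {}" by auto
  ultimately have "infsum a (?R P) = infsum a (?R (insert p P)) + infsum a ((\<lambda>n. p * n) ` ?R P)"
    using infsum_Un_disjoint[OF sub sub, of "?R (insert p P)" "(\<lambda>n. p * n) ` ?R P"] by simp
  also have "infsum a ((\<lambda>n. p * n) ` ?R P) = infsum (a \<circ> (\<lambda>n. p * n)) (?R P)"
    using insert.prems[of p] by (intro infsum_reindex) (auto simp: inj_on_def)
  also have "\<dots> = a p * infsum a (?R P)" by (simp add: o_def mult infsum_cmult_right')
  finally have "infsum a (?R P) = infsum a (?R (insert p P)) + a p * infsum a (?R P)" .
  moreover have "x = (1 - c) * y" if "y = x + c * y" for x y c :: 'a
    using that by (simp add: left_diff_distrib) (metis add_diff_cancel_right')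
  ultimately have "infsum a (?R (insert p P)) = (1 - a p) * infsum a (?R P)" by blast
  moreover have "infsum a (?R P) = (\<Prod>p\<in>P. 1 - a p) * infsum a UNIV" using insert.IH insert.prems by blast
  ultimately show ?case by (simp only: prod.insert[OF insert.hyps] mult.assoc)
qed auto

text \<open>Apart from 1, a number without prime factors up to \<open>N\<close> exceeds
  \<open>N\<close>, so the sum differs from \<open>a 1\<close> by at most a tail of the series. The
  number 0 is sieved out as a multiple of 2, hence the condition \<open>N \<ge> 2\<close>
  inside.\<close>

lemma infsum_rough_tendsto:
  fixes a :: "nat \<Rightarrow> 'a :: {real_normed_field, banach}"
  assumes a: "a 0 = 0" "a 1 = 1" and sm: "a abs_summable_on UNIV"
  shows "(\<lambda>N. infsum a {n. \<forall>p\<in>{p. prime p \<and> p \<le> N}. \<not> p dvd n}) \<longlonglongrightarrow> 1"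
proof -
  have sm': "summable (\<lambda>n. norm (a n))"
    using sm by (subst (asm) summable_on_UNIV_nonneg_real_iff) auto
  have sub: "a summable_on A" for A
    using abs_summable_summable[OF sm] by (rule summable_on_subset_banach) auto
  let ?R = "\<lambda>N. {n::nat. \<forall>p\<in>{p. prime p \<and> p \<le> N}. \<not> p dvd n}"
  have bd: "norm (infsum a (?R N) - 1) \<le> (\<Sum>n. norm (a (n + N)))" if N: "N \<ge> 2" for N
  proof -
    have R: "?R N \<subseteq> insert 1 {N..}"
    proof
      fix n assume n: "n \<in> ?R N"
      show "n \<in> insert 1 {N..}"
      proof (cases "n = 1")
        case False
        then obtain p where p: "prime p" "p dvd n" using prime_factor_nat by blast
        hence "p > N" using n by auto
        moreover have "n \<noteq> 0"
        proof
          assume "n = 0"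
          with n have "\<not> (2::nat) dvd 0" using N two_is_prime_nat by blast
          thus False by simp
        qed
        ultimately show ?thesis using dvd_imp_le[OF p(2)] by auto
      qed auto
    qed
    have 1: "1 \<in> ?R N" by auto
    have "infsum a (?R N) = a 1 + infsum a (?R N - {1})"
      using infsum_Un_disjoint[OF sub sub, of "{1}" "?R N - {1}"] 1 by (simp add: insert_absorb)
    hence "norm (infsum a (?R N) - 1) = norm (infsum a (?R N - {1}))" using a by simp
    also have "\<dots> \<le> infsum (\<lambda>n. norm (a n)) (?R N - {1})"
      by (rule norm_infsum_bound) (use sm in \<open>auto intro: summable_on_subset_banach\<close>)
    also have "\<dots> \<le> infsum (\<lambda>n. norm (a n)) {N..}"
      using R sm by (intro infsum_mono2) (auto intro: summable_on_subset_banach)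
    also have "{N..} = (\<lambda>n. n + N) ` UNIV" by (auto simp: image_def) (metis add.commute le_Suc_ex)
    also have "infsum (\<lambda>n. norm (a n)) ((\<lambda>n. n + N) ` UNIV) = infsum ((\<lambda>n. norm (a n)) \<circ> (\<lambda>n. n + N)) UNIV"
      by (rule infsum_reindex) (auto simp: inj_on_def)
    also have "\<dots> = (\<Sum>n. norm (a (n + N)))"
    proof -
      have "summable (\<lambda>n. norm (a (n + N)))" using sm' by (subst summable_iff_shift)
      hence "((\<lambda>n. norm (a (n + N))) has_sum (\<Sum>n. norm (a (n + N)))) UNIV"
        by (intro norm_summable_imp_has_sum) (auto simp: summable_sums)
      thus ?thesis by (simp add: infsumI o_def)
    qed
    finally show ?thesis .
  qed
  have "(\<lambda>N. \<Sum>n. norm (a (n + N))) \<longlonglongrightarrow> 0" by (rule suminf_exist_split2[OF sm'])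
  hence "(\<lambda>N. infsum a (?R N) - 1) \<longlonglongrightarrow> 0"
    by (rule Lim_null_comparison[rotated]) (use bd in \<open>auto intro: eventually_sequentiallyI[of 2]\<close>)
  thus ?thesis by (simp add: LIM_zero_iff)
qed

text \<open>The Euler product is stated with the product on the other side, so no inverse occurs and
  the sum is seen to be nonzero at once.\<close>

lemma euler_product_tendsto:
  fixes a :: "nat \<Rightarrow> 'a :: {real_normed_field, banach}"
  assumes mult: "\<And>m n. a (m * n) = a m * a n" and a: "a 0 = 0" "a 1 = 1" and sm: "summable (\<lambda>n. norm (a (Suc n)))"
  shows "(\<lambda>N. (\<Prod>p | prime p \<and> p \<le> N. 1 - a p) * (\<Sum>n. a (Suc n))) \<longlonglongrightarrow> 1"
proof -
  have sm': "summable (\<lambda>n. norm (a n))" using sm by (subst (asm) summable_Suc_iff)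
  hence abs: "a abs_summable_on UNIV" by (subst summable_on_UNIV_nonneg_real_iff) auto
  have "infsum a UNIV = (\<Sum>n. a n)"
    by (intro infsumI norm_summable_imp_has_sum sm' summable_sums summable_norm_cancel)
  also have "\<dots> = (\<Sum>n. a (Suc n))" using suminf_split_head[OF summable_norm_cancel[OF sm']] a by simp
  finally have e: "infsum a UNIV = (\<Sum>n. a (Suc n))" .
  have "infsum a {n. \<forall>p\<in>{p. prime p \<and> p \<le> N}. \<not> p dvd n} = (\<Prod>p | prime p \<and> p \<le> N. 1 - a p) * infsum a UNIV" for N
    by (intro infsum_rough mult abs) auto
  thus ?thesis using infsum_rough_tendsto[OF a abs] unfolding e by simp
qed

section \<open>Estimates from the Euler product\<close>

definition zeta_series :: "complex \<Rightarrow> complex" where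
  "zeta_series s = (\<Sum>n. of_nat (Suc n) powr (-s))"

definition zeta_real :: "real \<Rightarrow> real" where
  "zeta_real x = (\<Sum>n. real (Suc n) powr (-x))"

lemma norm_of_nat_powr: "norm (of_nat (Suc n) powr s :: complex) = real (Suc n) powr (Re s)"
  by (subst norm_powr_real_powr) auto

lemma zeta_real_ge_1: assumes "x > 1" shows "zeta_real x \<ge> 1"
proof -
  have "(\<Sum>n<1. real (Suc n) powr (-x)) \<le> zeta_real x"
    unfolding zeta_real_def using assms by (intro sum_le_suminf summable_powr_shift) auto
  thus ?thesis by simp
qed

lemma zeta_series_euler:
  assumes "Re s > 1"
  shows "(\<lambda>N. (\<Prod>p | prime p \<and> p \<le> N. 1 - of_nat p powr (-s)) * zeta_series s) \<longlonglongrightarrow> 1"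
  unfolding zeta_series_def
proof (rule euler_product_tendsto)
  show "of_nat (m * n) powr (-s) = of_nat m powr (-s) * (of_nat n powr (-s) :: complex)" for m n
    using powr_times_real[of "of_nat m" "of_nat n" "-s"] by simp
  show "summable (\<lambda>n. norm (of_nat (Suc n) powr (-s) :: complex))"
    using summable_powr_shift[of "- Re s"] assms unfolding norm_of_nat_powr by simp
qed auto

lemma zeta_real_euler:
  assumes "x > 1"
  shows "(\<lambda>N. (\<Prod>p | prime p \<and> p \<le> N. 1 - real p powr (-x)) * zeta_real x) \<longlonglongrightarrow> 1"
  unfolding zeta_real_def
proof (rule euler_product_tendsto)
  show "summable (\<lambda>n. norm (real (Suc n) powr (-x)))"
    using summable_powr_shift[of "- x"] assms by (simp del: of_nat_Suc)
qed (auto simp: powr_mult)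

lemma norm_zeta_series_le: assumes "Re s > 1" shows "norm (zeta_series s) \<le> zeta_real (Re s)"
  unfolding zeta_series_def zeta_real_def using summable_norm[of "\<lambda>n. of_nat (Suc n) powr (-s) :: complex"]
    summable_powr_shift[of "- Re s"] assms by (simp add: norm_of_nat_powr del: of_nat_Suc)

text \<open>Each Euler factor satisfies \<open>|1 - p powr (-s)| \<le> 1 + p powr (-x) \<le> 1 / (1
  - p powr (-x))\<close> with \<open>x = Re s\<close>. In the limit this says
  \<open>|1 / \<zeta>(s)| \<le> \<zeta>(x)\<close>.\<close>

lemma norm_zeta_series_ge: assumes s: "Re s > 1" shows "1 \<le> zeta_real (Re s) * norm (zeta_series s)"
proof -
  define x where "x = Re s"
  have x: "x > 1" using s by (simp add: x_def)
  have 1: "(\<lambda>N. norm ((\<Prod>p | prime p \<and> p \<le> N. 1 - of_nat p powr (-s)) * zeta_series s)) \<longlonglongrightarrow> norm (1::complex)"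
    by (intro tendsto_norm zeta_series_euler s)
  have 2: "(\<lambda>N. norm (zeta_series s) * zeta_real x / ((\<Prod>p | prime p \<and> p \<le> N. 1 - real p powr (-x)) * zeta_real x)) \<longlonglongrightarrow> norm (zeta_series s) * zeta_real x / 1"
    by (intro tendsto_intros zeta_real_euler x) auto
  have "norm (1::complex) \<le> norm (zeta_series s) * zeta_real x / 1"
  proof (rule LIMSEQ_le[OF 1 2], intro exI allI impI)
    fix N :: nat
    let ?P = "{p. prime p \<and> p \<le> N}"
    have y: "real p powr (-x) < 1" "real p powr (-x) > 0" if "p \<in> ?P" for p
      using that x prime_gt_1_nat[of p] by (auto intro!: powr_less_one)
    have "norm (\<Prod>p\<in>?P. 1 - of_nat p powr (-s) :: complex) \<le> (\<Prod>p\<in>?P. 1 / (1 - real p powr (-x)))"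
      unfolding prod_norm[symmetric]
    proof (intro prod_mono conjI)
      fix p assume p: "p \<in> ?P"
      have n: "norm (of_nat p powr (-s) :: complex) = real p powr (-x)"
        unfolding x_def by (subst norm_powr_real_powr) auto
      have "norm (1 - of_nat p powr (-s) :: complex) \<le> 1 + real p powr (-x)"
        using norm_triangle_ineq4[of 1 "of_nat p powr (-s) :: complex"] n by simp
      also have "\<dots> \<le> 1 / (1 - real p powr (-x))" using y[OF p] by (simp add: field_simps)
      finally show "norm (1 - of_nat p powr (-s) :: complex) \<le> 1 / (1 - real p powr (-x))" .
    qed auto
    also have "\<dots> = 1 / (\<Prod>p\<in>?P. 1 - real p powr (-x))" by (simp add: prod_dividef)
    finally have "norm (\<Prod>p\<in>?P. 1 - of_nat p powr (-s) :: complex) * norm (zeta_series s) \<le> 1 / (\<Prod>p\<in>?P. 1 - real p powr (-x)) * norm (zeta_series s)"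
      by (rule mult_right_mono) auto
    thus "norm ((\<Prod>p\<in>?P. 1 - of_nat p powr (-s)) * zeta_series s) \<le> norm (zeta_series s) * zeta_real x / ((\<Prod>p\<in>?P. 1 - real p powr (-x)) * zeta_real x)"
      using zeta_real_ge_1[OF x] by (simp add: norm_mult mult.commute)
  qed
  thus ?thesis by (simp add: x_def mult.commute)
qed

text \<open>The logarithm of the left hand side is \<open>- \<Sum> x\<^sup>n (3 + 4 cos (n \<alpha>) + cos (2 n \<alpha>)) / n\<close> for \<open>u = exp (\<i> \<alpha>)\<close>.\<close>

lemma euler_factor_341:
  fixes x :: real and u :: complex assumes x: "0 \<le> x" "x < 1" and u: "norm u = 1"
  shows "norm (1 - of_real x :: complex) ^ 3 * norm (1 - of_real x * u) ^ 4 * norm (1 - of_real x * u\<^sup>2) \<le> 1"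
proof -
  have ser: "(\<lambda>n. - (Re (w ^ n) / real n)) sums ln (norm (1 - w))" if "norm w < 1" for w :: complex
  proof -
    have "(\<lambda>n. Re ((-1) ^ Suc n / of_nat n * (- w) ^ n)) sums Re (Ln (1 + (- w)))"
      using that by (intro sums_Re Ln_series) auto
    moreover have "Re ((-1) ^ Suc n / of_nat n * (- w) ^ n) = - (Re (w ^ n) / real n)" for n
    proof -
      have "(-1) ^ n * (- w) ^ n = w ^ n" by (simp flip: power_mult_distrib)
      hence e: "(-1) ^ Suc n / of_nat n * (- w) ^ n = - (w ^ n / of_nat n)" by (simp add: field_simps)
      show ?thesis unfolding e by (simp add: Re_divide_of_nat)
    qed
    moreover have "Re (Ln (1 + (- w))) = ln (norm (1 - w))"
    proof -
      have "1 + (- w) \<noteq> 0" using that by auto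
      thus ?thesis by (subst Re_Ln) auto
    qed
    ultimately show ?thesis by (simp only:)
  qed
  have nn: "norm (of_real x :: complex) < 1" "norm (of_real x * u) < 1" "norm (of_real x * u\<^sup>2) < 1"
    using x u by (auto simp: norm_mult norm_power)
  have S: "(\<lambda>n. 3 * (- (Re (of_real x ^ n) / real n)) + 4 * (- (Re ((of_real x * u) ^ n) / real n)) + (- (Re ((of_real x * u\<^sup>2) ^ n) / real n)))
     sums (3 * ln (norm (1 - of_real x :: complex)) + 4 * ln (norm (1 - of_real x * u)) + ln (norm (1 - of_real x * u\<^sup>2)))"
    by (intro sums_add sums_mult ser nn)
  have N: "3 * (- (Re (of_real x ^ n) / real n)) + 4 * (- (Re ((of_real x * u) ^ n) / real n)) + (- (Re ((of_real x * u\<^sup>2) ^ n) / real n)) \<le> 0" for n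
  proof -
    define v where "v = u ^ n"
    have v: "(Re v)\<^sup>2 + (Im v)\<^sup>2 = 1" using u by (simp add: v_def norm_power flip: cmod_power2)
    have "(of_real x * u) ^ n = of_real (x ^ n) * v" "(of_real x * u\<^sup>2) ^ n = of_real (x ^ n) * v\<^sup>2"
      by (simp_all add: v_def power_mult_distrib power_mult[symmetric] mult.commute[of n 2])
    hence "3 * (- (Re (of_real x ^ n) / real n)) + 4 * (- (Re ((of_real x * u) ^ n) / real n)) + (- (Re ((of_real x * u\<^sup>2) ^ n) / real n))
       = - (x ^ n / real n * (3 + 4 * Re v + Re (v\<^sup>2)))"
    proof -
      assume a: "(of_real x * u) ^ n = of_real (x ^ n) * v" "(of_real x * u\<^sup>2) ^ n = of_real (x ^ n) * v\<^sup>2"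
      show ?thesis unfolding a by (simp add: algebra_simps add_divide_distrib flip: of_real_power)
    qed
    also have "Re (v\<^sup>2) = 2 * (Re v)\<^sup>2 - 1" using v by (simp add: power2_eq_square)
    also have "3 + 4 * Re v + (2 * (Re v)\<^sup>2 - 1) = 2 * (1 + Re v)\<^sup>2" by (simp add: power2_eq_square algebra_simps)
    finally show ?thesis using x by simp
  qed
  have "3 * ln (norm (1 - of_real x :: complex)) + 4 * ln (norm (1 - of_real x * u)) + ln (norm (1 - of_real x * u\<^sup>2)) \<le> 0"
    by (rule sums_le[OF N S sums_zero])
  moreover have "norm (1 - of_real x :: complex) > 0" "norm (1 - of_real x * u) > 0" "norm (1 - of_real x * u\<^sup>2) > 0"
    using nn by auto
  ultimately show ?thesis
  proof -
    have "a ^ 3 * b ^ 4 * c \<le> 1" if "3 * ln a + 4 * ln b + ln c \<le> 0" "a > 0" "b > 0" "c > 0" for a b c :: real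
    proof -
      have "ln (a ^ 3 * b ^ 4 * c) = 3 * ln a + 4 * ln b + ln c"
        using that by (simp add: ln_mult ln_realpow)
      thus ?thesis using that by (metis ln_le_zero_iff mult_pos_pos zero_less_power)
    qed
    thus "3 * ln (norm (1 - of_real x :: complex)) + 4 * ln (norm (1 - of_real x * u)) + ln (norm (1 - of_real x * u\<^sup>2)) \<le> 0
      \<Longrightarrow> 0 < norm (1 - of_real x :: complex) \<Longrightarrow> 0 < norm (1 - of_real x * u) \<Longrightarrow> 0 < norm (1 - of_real x * u\<^sup>2) \<Longrightarrow> ?thesis" by blast
  qed
qed

text \<open>The local inequality is multiplied over the primes up to \<open>N\<close>, with
  \<open>u = p powr (- i t)\<close> as the unimodular factor at \<open>p\<close>. The Euler products
  then tend to the reciprocals of the three values.\<close>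

lemma zeta_series_341:
  assumes x: "x > 1"
  shows "1 \<le> norm (zeta_series (of_real x)) ^ 3 * norm (zeta_series (Complex x t)) ^ 4 * norm (zeta_series (Complex x (2 * t)))"
proof -
  let ?E = "\<lambda>s N. (\<Prod>p | prime p \<and> p \<le> N. 1 - of_nat p powr (-s)) * zeta_series s"
  have l: "(\<lambda>N. norm (?E (of_real x) N) ^ 3 * norm (?E (Complex x t) N) ^ 4 * norm (?E (Complex x (2 * t)) N)) \<longlonglongrightarrow>
     norm (1::complex) ^ 3 * norm (1::complex) ^ 4 * norm (1::complex)"
    using x by (intro tendsto_intros zeta_series_euler) auto
  have "norm (?E (of_real x) N) ^ 3 * norm (?E (Complex x t) N) ^ 4 * norm (?E (Complex x (2 * t)) N)
     \<le> norm (zeta_series (of_real x)) ^ 3 * norm (zeta_series (Complex x t)) ^ 4 * norm (zeta_series (Complex x (2 * t)))" for N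
  proof -
    let ?P = "{p. prime p \<and> p \<le> N}"
    have "(\<Prod>p\<in>?P. norm (1 - of_nat p powr (- of_real x) :: complex)) ^ 3 * (\<Prod>p\<in>?P. norm (1 - of_nat p powr (- Complex x t) :: complex)) ^ 4
        * (\<Prod>p\<in>?P. norm (1 - of_nat p powr (- Complex x (2 * t)) :: complex)) =
      (\<Prod>p\<in>?P. norm (1 - of_nat p powr (- of_real x) :: complex) ^ 3 * norm (1 - of_nat p powr (- Complex x t) :: complex) ^ 4
        * norm (1 - of_nat p powr (- Complex x (2 * t)) :: complex))"
      by (simp add: prod.distrib prod_power_distrib)
    also have "\<dots> \<le> 1"
    proof (intro prod_le_1 conjI)
      fix p assume "p \<in> ?P"
      hence p: "p > 1" using prime_gt_1_nat by auto
      define y u where "y = real p powr (-x)" and "u = exp (- (\<i> * of_real (t * ln (real p))))"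
      have e: "of_nat p powr (- Complex x r) = of_real y * exp (- (\<i> * of_real (r * ln (real p))))" for r
      proof -
        have c: "Complex x r = of_real x + \<i> * of_real r" by (simp add: complex_eq_iff)
        have "of_nat p powr (- Complex x r) = of_nat p powr (- of_real x) * of_nat p powr (- (\<i> * of_real r) :: complex)"
          unfolding c by (simp add: powr_add[symmetric])
        also have "of_nat p powr (- of_real x) = complex_of_real y"
          unfolding y_def by (simp add: powr_of_real[symmetric])
        also have "of_nat p powr (- (\<i> * of_real r) :: complex) = exp (- (\<i> * of_real (r * ln (real p))))"
        proof -
          have "Ln (of_nat p) = of_real (ln (real p))" using Ln_of_real[of "real p"] p by simp
          thus ?thesis using p by (simp add: powr_def mult_ac)
        qed
        finally show ?thesis .
      qed
      have y: "0 \<le> y" "y < 1" using p x by (auto simp: y_def intro!: powr_less_one)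
      have u: "norm u = 1" unfolding u_def by (simp add: norm_exp_eq_Re)
      have "of_nat p powr (- of_real x) = complex_of_real y" unfolding y_def by (simp add: powr_of_real[symmetric])
      moreover have "of_nat p powr (- Complex x t) = of_real y * u" unfolding e u_def ..
      moreover have "of_nat p powr (- Complex x (2 * t)) = of_real y * u\<^sup>2" unfolding e u_def
        by (simp add: exp_double[symmetric] algebra_simps)
      ultimately show "norm (1 - of_nat p powr (- of_real x) :: complex) ^ 3 * norm (1 - of_nat p powr (- Complex x t) :: complex) ^ 4
        * norm (1 - of_nat p powr (- Complex x (2 * t)) :: complex) \<le> 1"
        using euler_factor_341[OF y u] by simp
    qed auto
    finally have "((\<Prod>p\<in>?P. norm (1 - of_nat p powr (- of_real x) :: complex)) ^ 3 * (\<Prod>p\<in>?P. norm (1 - of_nat p powr (- Complex x t) :: complex)) ^ 4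
        * (\<Prod>p\<in>?P. norm (1 - of_nat p powr (- Complex x (2 * t)) :: complex))) *
        (norm (zeta_series (of_real x)) ^ 3 * norm (zeta_series (Complex x t)) ^ 4 * norm (zeta_series (Complex x (2 * t))))
        \<le> 1 * (norm (zeta_series (of_real x)) ^ 3 * norm (zeta_series (Complex x t)) ^ 4 * norm (zeta_series (Complex x (2 * t))))"
      by (rule mult_right_mono) auto
    thus ?thesis by (simp add: norm_mult prod_norm[symmetric] power_mult_distrib mult_ac)
  qed
  from Lim_bounded[OF l, of 0] this show ?thesis by simp
qed

lemma zeta_reg_conv_series: "Re s > 1 \<Longrightarrow> zeta_reg s = (s - 1) * zeta_series s"
  unfolding zeta_series_def by (rule zeta_reg_eq_series)

lemma zeta_reg_1: "zeta_reg 1 = 1"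
  unfolding zeta_reg_def zeta_term_def by (simp del: of_nat_Suc)

lemma zeta_reg_nonzero_gt_1: "Re s > 1 \<Longrightarrow> zeta_reg s \<noteq> 0"
  using norm_zeta_series_ge[of s] zeta_reg_conv_series[of s] by auto

text \<open>A zero at \<open>1 + i t\<close> would contribute four factors \<open>x - 1\<close> to
  the 3-4-1 product, while the pole at 1 takes away only three. The product would tend to 0 as
  \<open>x\<close> decreases to 1, although it is at least 1.\<close>

lemma zeta_reg_nonzero:
  assumes "Re s \<ge> 1" shows "zeta_reg s \<noteq> 0"
proof
  assume z: "zeta_reg s = 0"
  hence re: "Re s = 1" using assms zeta_reg_nonzero_gt_1[of s] by (cases "Re s > 1") auto
  define t where "t = Im s"
  have s: "s = Complex 1 t" using re by (simp add: complex_eq_iff t_def)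
  have t: "t \<noteq> 0" using z zeta_reg_1 s by (auto simp: Complex_eq)
  have der: "(zeta_reg has_field_derivative deriv zeta_reg s) (at s)"
    using holomorphic_derivI[OF holomorphic_zeta_reg open_halfspace_Re_gt, of s] re by simp
  have cont: "isCont zeta_reg w" if "Re w > -1" for w
    using holomorphic_on_imp_continuous_on[OF holomorphic_zeta_reg] that
    by (simp add: continuous_on_eq_continuous_at open_halfspace_Re_gt)
  \<comment> \<open>The 3-4-1 product in terms of \<open>zeta_reg\<close>: the fourth power contains
    the difference quotient at the supposed zero, which stays bounded, and one factor
    \<open>x - 1\<close> is left over. The denominator collects the factors \<open>|t|\<close> and
    \<open>2 |t|\<close> that bound \<open>|s - 1|\<close> from below.\<close>
  define f where "f = (\<lambda>x. norm (zeta_reg (of_real x)) ^ 3 * norm (zeta_reg (Complex x t) / of_real (x - 1)) ^ 4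
       * norm (zeta_reg (Complex x (2 * t))) * (x - 1) / (2 * \<bar>t\<bar> ^ 5))"
  have x: "((\<lambda>x. Complex x r) \<longlongrightarrow> Complex 1 r) (at_right 1)" for r
    unfolding Complex_eq by (intro tendsto_intros)
  have q: "((\<lambda>x. zeta_reg (Complex x t) / of_real (x - 1)) \<longlongrightarrow> deriv zeta_reg s) (at_right 1)"
  proof -
    have "((\<lambda>w. (zeta_reg w - zeta_reg s) / (w - s)) \<longlongrightarrow> deriv zeta_reg s) (at s)"
      using der by (simp add: has_field_derivative_iff)
    moreover have "filterlim (\<lambda>x. Complex x t) (at s) (at_right 1)"
      unfolding filterlim_at using x[of t] s by (auto simp: eventually_at_filter)
    ultimately have "((\<lambda>x. (zeta_reg (Complex x t) - zeta_reg s) / (Complex x t - s)) \<longlongrightarrow> deriv zeta_reg s) (at_right 1)"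
      by (rule filterlim_compose)
    moreover have "Complex x t - s = of_real (x - 1)" for x by (simp add: s complex_eq_iff)
    ultimately show ?thesis by (simp add: z)
  qed
  have c1: "((\<lambda>x. zeta_reg (complex_of_real x)) \<longlongrightarrow> zeta_reg (of_real 1)) (at_right 1)"
    by (intro isCont_tendsto_compose[OF cont] tendsto_intros) auto
  have c2: "((\<lambda>x. zeta_reg (Complex x (2 * t))) \<longlongrightarrow> zeta_reg (Complex 1 (2 * t))) (at_right 1)"
    by (intro isCont_tendsto_compose[OF cont] x) auto
  have "(f \<longlongrightarrow> norm (zeta_reg (of_real 1)) ^ 3 * norm (deriv zeta_reg s) ^ 4
       * norm (zeta_reg (Complex 1 (2 * t))) * (1 - 1) / (2 * \<bar>t\<bar> ^ 5)) (at_right 1)"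
    unfolding f_def using t by (intro tendsto_intros q c1 c2) auto
  hence lim: "(f \<longlongrightarrow> 0) (at_right 1)" by simp
  have "f x \<ge> 1" if xx: "x > 1" for x
  proof -
    have a: "norm (zeta_series (of_real x)) = norm (zeta_reg (of_real x)) / (x - 1)"
    proof -
      have e: "norm (complex_of_real x - 1) = x - 1"
        using xx norm_of_real[of "x - 1", where 'a = complex] by simp
      have "norm (zeta_reg (of_real x)) = (x - 1) * norm (zeta_series (of_real x))"
        using xx zeta_reg_conv_series[of "of_real x"] e by (simp add: norm_mult)
      thus ?thesis using xx by simp
    qed
    have b: "norm (zeta_series (Complex x r)) \<le> norm (zeta_reg (Complex x r)) / \<bar>r\<bar>" if r: "r \<noteq> 0" for r
    proof -
      have "\<bar>r\<bar> \<le> norm (Complex x r - 1)" using abs_Im_le_cmod[of "Complex x r - 1"] by simp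
      hence "\<bar>r\<bar> * norm (zeta_series (Complex x r)) \<le> norm (zeta_reg (Complex x r))"
        using xx zeta_reg_conv_series[of "Complex x r"] by (simp add: norm_mult mult_right_mono)
      thus ?thesis using r by (simp add: field_simps)
    qed
    have "1 \<le> norm (zeta_series (of_real x)) ^ 3 * norm (zeta_series (Complex x t)) ^ 4 * norm (zeta_series (Complex x (2 * t)))"
      by (rule zeta_series_341[OF xx])
    also have "\<dots> \<le> (norm (zeta_reg (of_real x)) / (x - 1)) ^ 3 * (norm (zeta_reg (Complex x t)) / \<bar>t\<bar>) ^ 4 * (norm (zeta_reg (Complex x (2 * t))) / \<bar>2 * t\<bar>)"
      unfolding a using b[of t] b[of "2 * t"] t xx by (intro mult_mono power_mono) auto
    also have "\<dots> = f x"
    proof -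
      have "(A / d) ^ 3 * (B / r) ^ 4 * (C / (2 * r)) = A ^ 3 * (B / d) ^ 4 * C * d / (2 * r ^ 5)" if "d > 0" "r > 0" for A B C d r :: real
        using that by (simp add: power_divide field_simps eval_nat_numeral)
      moreover have "norm (zeta_reg (Complex x t) / of_real (x - 1)) = norm (zeta_reg (Complex x t)) / (x - 1)"
        unfolding norm_divide norm_of_real using xx by simp
      moreover have "\<bar>2 * t\<bar> = 2 * \<bar>t\<bar>" by (simp add: abs_mult)
      ultimately show ?thesis unfolding f_def using xx t by simp
    qed
    finally show ?thesis .
  qed
  hence "\<forall>\<^sub>F x in at_right 1. f x \<ge> 1" by (auto simp: eventually_at_filter)
  from tendsto_lowerbound[OF lim this] show False by simp
qed

subsection \<open>Bounds for holomorphic functions\<close>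

text \<open>The map \<open>v / (2 M - v)\<close> sends the half plane \<open>Re v < M\<close> into
  the unit disc and fixes 0, so Schwarz's lemma applies to the composition with \<open>f\<close>
  after rescaling the disc.\<close>

lemma borel_caratheodory:
  fixes f :: "complex \<Rightarrow> complex"
  assumes holf: "f holomorphic_on ball 0 R" and f0: "f 0 = 0"
    and Re: "\<And>z. z \<in> ball 0 R \<Longrightarrow> Re (f z) < M" and z: "z \<in> ball 0 R"
  shows "norm (f z) \<le> 2 * M * norm z / (R - norm z)"
proof -
  have R: "R > 0" using z by (smt (verit) mem_ball_0 norm_ge_zero)
  have M: "M > 0" using Re[of 0] R f0 by simp
  define g where "g = (\<lambda>w. f (of_real R * w) / (2 * of_real M - f (of_real R * w)))"
  have inb: "of_real R * w \<in> ball 0 R" if "norm w < 1" for w :: complex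
    using that R by (simp add: norm_mult)
  have nz: "2 * of_real M - f (of_real R * w) \<noteq> 0" if "norm w < 1" for w
    using Re[OF inb[OF that]] M by (auto simp: complex_eq_iff)
  have lt: "norm (f (of_real R * w)) < norm (2 * of_real M - f (of_real R * w))" if "norm w < 1" for w
  proof -
    define u where "u = f (of_real R * w)"
    have "Re u < M" unfolding u_def by (rule Re[OF inb[OF that]])
    hence "M * Re u < M * M" using M by simp
    hence "(norm u)\<^sup>2 < (norm (2 * of_real M - u))\<^sup>2"
      unfolding cmod_power2 by (simp add: power2_eq_square algebra_simps)
    thus ?thesis unfolding u_def by (rule power2_less_imp_less) auto
  qed
  define w where "w = z / of_real R"
  have w: "norm w < 1" using z R by (simp add: w_def norm_divide)
  have zw: "z = of_real R * w" using R by (simp add: w_def)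
  have "norm (g w) \<le> norm w"
  proof (rule Schwarz_Lemma(1))
    show "g holomorphic_on ball 0 1" unfolding g_def
    proof -
      have "(\<lambda>w. f (of_real R * w)) holomorphic_on ball 0 1"
      proof (rule holomorphic_on_compose_gen[OF _ holf, unfolded o_def])
        show "(\<lambda>w. complex_of_real R * w) ` ball 0 1 \<subseteq> ball 0 R"
          using inb by (auto simp del: mem_ball)
      qed (intro holomorphic_intros)
      thus "(\<lambda>w. f (of_real R * w) / (2 * of_real M - f (of_real R * w))) holomorphic_on ball 0 1"
        by (intro holomorphic_intros) (use nz in auto)
    qed
    show "g 0 = 0" by (simp add: g_def f0)
    show "norm (g v) < 1" if "norm v < 1" for v
      using lt[OF that] unfolding g_def norm_divide by (subst divide_less_eq_1_pos) (auto intro: le_less_trans[OF norm_ge_zero])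
  qed (rule w)
  have "g w * (2 * of_real M - f z) = f z" using nz[OF w] by (simp add: g_def zw)
  hence "f z = 2 * of_real M * g w - f z * g w" by (simp add: algebra_simps)
  hence "norm (f z) \<le> norm (2 * of_real M * g w) + norm (f z * g w)" by (metis norm_triangle_ineq4)
  also have "\<dots> \<le> 2 * M * norm w + norm (f z) * norm w"
    unfolding norm_mult using \<open>norm (g w) \<le> norm w\<close> M by (intro add_mono mult_mono) auto
  finally have "norm (f z) * (1 - norm w) \<le> 2 * M * norm w" by (simp add: algebra_simps)
  hence "norm (f z) * (1 - norm w) * R \<le> 2 * M * norm w * R" using R by simp
  moreover have "norm z = R * norm w" using R by (simp add: zw norm_mult)
  ultimately have "norm (f z) * (R - norm z) \<le> 2 * M * norm z" by (simp add: algebra_simps)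
  thus ?thesis using z by (simp add: field_simps)
qed

lemma caratheodory_higher_deriv:
  fixes f :: "complex \<Rightarrow> complex"
  assumes holf: "f holomorphic_on ball 0 R" and f0: "f 0 = 0"
    and Re: "\<And>z. z \<in> ball 0 R \<Longrightarrow> Re (f z) < M" and r: "0 < r" "r < R"
  shows "norm ((deriv ^^ n) f 0) \<le> fact n * (2 * M * r / (R - r)) / r ^ n"
proof (rule Cauchy_inequality)
  show "f holomorphic_on ball 0 r" using holf by (rule holomorphic_on_subset) (use r in auto)
  show "continuous_on (cball 0 r) f"
    using holomorphic_on_imp_continuous_on[OF holf] by (rule continuous_on_subset) (use r in auto)
  show "norm (f x) \<le> 2 * M * r / (R - r)" if "norm (0 - x) = r" for x
    using borel_caratheodory[OF holf f0 Re, of x] that r by simp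
qed (rule r)

text \<open>The Taylor coefficients of \<open>deriv f\<close> up to any fixed order are bounded through \<open>M\<^sub>0\<close> alone,
  while the remaining ones contribute only a small multiple of \<open>M\<close>.\<close>

lemma deriv_bound_two_scales:
  fixes \<rho> R r M0 \<epsilon> :: real
  assumes r: "0 \<le> r" "r < R" and R: "R > 1" and \<epsilon>: "\<epsilon> > 0"
  obtains A where "\<And>(f :: complex \<Rightarrow> complex) M z. f holomorphic_on ball 0 R \<Longrightarrow> f 0 = 0 \<Longrightarrow>
     (\<And>z. z \<in> ball 0 R \<Longrightarrow> Re (f z) < M) \<Longrightarrow> (\<And>z. z \<in> ball 0 1 \<Longrightarrow> Re (f z) < M0) \<Longrightarrow>
     norm z \<le> r \<Longrightarrow> norm (deriv f z) \<le> A + \<epsilon> * M"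
proof -
  define \<rho> where "\<rho> = (r + R) / 2"
  have \<rho>: "r < \<rho>" "\<rho> < R" "\<rho> > 0" using r by (auto simp: \<rho>_def)
  define K where "K = 2 * \<rho> / (R - \<rho>) / \<rho>"
  have K: "K > 0" using \<rho> by (auto simp: K_def)
  define q where "q = r / \<rho>"
  have q: "0 \<le> q" "q < 1" using \<rho> r by (auto simp: q_def)
  have sm: "summable (\<lambda>n. real (Suc n) * q ^ n)"
    using geometric_deriv_sums[of q] q by (simp add: sums_iff)
  \<comment> \<open>\<open>N\<close> depends only on \<open>r\<close>, \<open>R\<close> and
    \<open>\<epsilon>\<close>. The coefficients from \<open>N\<close> on are estimated on the large
    disc through \<open>M\<close>, those below \<open>N\<close> on the unit disc through
    \<open>M0\<close>; hence \<open>A\<close> is the same for all \<open>f\<close>, \<open>M\<close>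
    and \<open>z\<close>.\<close>
  have "\<exists>N. \<forall>m\<ge>N. norm ((\<Sum>n. real (Suc (n + m)) * q ^ (n + m)) - 0) < \<epsilon> / K"
    using suminf_exist_split2[OF sm] \<epsilon> K unfolding LIMSEQ_iff by (meson divide_pos_pos)
  then obtain N where "norm ((\<Sum>n. real (Suc (n + N)) * q ^ (n + N)) - 0) < \<epsilon> / K" by blast
  hence N: "(\<Sum>n. real (Suc (n + N)) * q ^ (n + N)) < \<epsilon> / K" by (simp only: diff_0_right real_norm_def abs_less_iff)
  define A where "A = (\<Sum>n<N. real (Suc n) * (2 * M0 * (1/2) / (1 - 1/2)) / (1/2) ^ Suc n * r ^ n)"
  show ?thesis
  proof
    fix f :: "complex \<Rightarrow> complex" and M :: real and z :: complex
    assume f: "f holomorphic_on ball 0 R" "f 0 = 0" and Re: "\<And>z. z \<in> ball 0 R \<Longrightarrow> Re (f z) < M"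
      and Re0: "\<And>z. z \<in> ball 0 1 \<Longrightarrow> Re (f z) < M0" and z: "norm z \<le> r"
    have M: "M > 0" using Re[of 0] R f by simp
    define b where "b = (\<lambda>n. (deriv ^^ n) (deriv f) 0 / fact n)"
    have "deriv f holomorphic_on ball 0 R" by (intro holomorphic_deriv f) auto
    hence ser: "(\<lambda>n. b n * (z - 0) ^ n) sums deriv f z"
      unfolding b_def by (rule holomorphic_power_series) (use z r in auto)
    have gen: "(fact (Suc n) * X / Y) / fact n = real (Suc n) * X / Y" for X Y :: real and n
      by (simp add: fact_Suc del: of_nat_Suc)
    have b1: "norm (b n) \<le> real (Suc n) * (2 * M * \<rho> / (R - \<rho>)) / \<rho> ^ Suc n" for n
    proof -
      have "norm (b n) = norm ((deriv ^^ Suc n) f 0) / fact n"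
        by (simp add: b_def norm_divide funpow_Suc_right del: funpow.simps)
      also have "\<dots> \<le> (fact (Suc n) * (2 * M * \<rho> / (R - \<rho>)) / \<rho> ^ Suc n) / fact n"
        by (intro divide_right_mono caratheodory_higher_deriv[OF f Re]) (use \<rho> in auto)
      finally show ?thesis unfolding gen .
    qed
    have f': "f holomorphic_on ball 0 1" using f(1) by (rule holomorphic_on_subset) (use R in auto)
    have b2: "norm (b n) \<le> real (Suc n) * (2 * M0 * (1/2) / (1 - 1/2)) / (1/2) ^ Suc n" for n
    proof -
      have "norm (b n) = norm ((deriv ^^ Suc n) f 0) / fact n"
        by (simp add: b_def norm_divide funpow_Suc_right del: funpow.simps)
      also have "\<dots> \<le> (fact (Suc n) * (2 * M0 * (1/2) / (1 - 1/2)) / (1/2) ^ Suc n) / fact n"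
        by (intro divide_right_mono caratheodory_higher_deriv[OF f' f(2) Re0]) auto
      finally show ?thesis unfolding gen .
    qed
    have t1: "norm (b n * z ^ n) \<le> K * M * (real (Suc n) * q ^ n)" for n
    proof -
      have "norm (b n * z ^ n) \<le> (real (Suc n) * (2 * M * \<rho> / (R - \<rho>)) / \<rho> ^ Suc n) * r ^ n"
        unfolding norm_mult norm_power using z b1[of n] \<rho> M by (intro mult_mono power_mono) auto
      also have "\<dots> = K * M * (real (Suc n) * q ^ n)"
        using \<rho> by (simp add: K_def q_def power_divide field_simps)
      finally show ?thesis .
    qed
    have sms: "summable (\<lambda>n. b n * z ^ n)" using ser by (simp add: sums_iff)
    have smN: "summable (\<lambda>n. K * M * (real (Suc (n + N)) * q ^ (n + N)))"
      using summable_ignore_initial_segment[OF sm, of N] by (intro summable_mult)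
    have "deriv f z = (\<Sum>n. b (n + N) * z ^ (n + N)) + (\<Sum>n<N. b n * z ^ n)"
      using ser suminf_split_initial_segment[OF sms, of N] by (simp add: sums_iff)
    hence "norm (deriv f z) \<le> norm (\<Sum>n. b (n + N) * z ^ (n + N)) + norm (\<Sum>n<N. b n * z ^ n)"
      by (simp add: norm_triangle_ineq)
    also have "norm (\<Sum>n. b (n + N) * z ^ (n + N)) \<le> (\<Sum>n. K * M * (real (Suc (n + N)) * q ^ (n + N)))"
      by (rule norm_suminf_le[OF t1 smN])
    also have "\<dots> = K * M * (\<Sum>n. real (Suc (n + N)) * q ^ (n + N))"
      by (rule suminf_mult) (rule summable_ignore_initial_segment[OF sm])
    also have "\<dots> \<le> K * M * (\<epsilon> / K)" using N K M by (intro mult_left_mono) auto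
    also have "\<dots> = \<epsilon> * M" using K by simp
    also have "norm (\<Sum>n<N. b n * z ^ n) \<le> A"
      unfolding A_def
    proof (rule sum_norm_le)
      fix n
      show "norm (b n * z ^ n) \<le> real (Suc n) * (2 * M0 * (1/2) / (1 - 1/2)) / (1/2) ^ Suc n * r ^ n"
        unfolding norm_mult norm_power using z b2[of n] order_trans[OF norm_ge_zero b2[of n]]
        by (intro mult_mono power_mono) auto
    qed
    finally show "norm (deriv f z) \<le> A + \<epsilon> * M" by simp
  qed
qed

subsection \<open>The logarithmic derivative of zeta\<close>

lemma zeta_real_antimono:
  assumes "1 < x" "x \<le> y" shows "zeta_real y \<le> zeta_real x"
  unfolding zeta_real_def
proof (rule suminf_le)
  show "real (Suc n) powr (-y) \<le> real (Suc n) powr (-x)" for n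
    using assms by (intro powr_mono) auto
qed (rule summable_powr_shift; use assms in simp)+

lemma norm_zeta_series_bounds:
  assumes "Re s \<ge> x" "x > 1"
  shows "norm (zeta_series s) \<le> zeta_real x" "1 / zeta_real x \<le> norm (zeta_series s)"
proof -
  have a: "Re s > 1" using assms by auto
  have z: "zeta_real (Re s) \<le> zeta_real x" using assms by (intro zeta_real_antimono) auto
  have z1: "zeta_real x \<ge> 1" using assms by (intro zeta_real_ge_1)
  show "norm (zeta_series s) \<le> zeta_real x" using norm_zeta_series_le[OF a] z by linarith
  have "1 \<le> zeta_real x * norm (zeta_series s)"
    using norm_zeta_series_ge[OF a] mult_right_mono[OF z, of "norm (zeta_series s)"] by simp
  thus "1 / zeta_real x \<le> norm (zeta_series s)" using z1 by (simp add: field_simps)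
qed

lemma norm_zeta_reg_ge:
  assumes "Re s \<ge> 2" shows "norm (zeta_reg s) \<ge> 1 / zeta_real 2"
proof -
  have "1 * (1 / zeta_real 2) \<le> norm (s - 1) * norm (zeta_series s)"
    using norm_zeta_series_bounds(2)[of 2 s] zeta_real_ge_1[of 2] complex_Re_le_cmod[of "s - 1"] assms
    by (intro mult_mono) auto
  thus ?thesis using zeta_reg_conv_series[of s] assms by (simp add: norm_mult)
qed

text \<open>Supplies the height-independent bound on the unit disc that the two-scale estimate
  needs. The Dirichlet series is bounded above and below here, and \<open>|s - 1|\<close> at most
  doubles within distance 1.\<close>

lemma norm_zeta_reg_ratio:
  assumes w: "Re w \<ge> 5/2" and z: "norm z \<le> 1"
  shows "norm (zeta_reg (w + z)) \<le> 2 * zeta_real (3/2) * zeta_real 2 * norm (zeta_reg w)"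
proof -
  have re: "Re (w + z) \<ge> 3/2" using w z abs_Re_le_cmod[of z] by auto
  have w1: "norm (w - 1) \<ge> 1" using w complex_Re_le_cmod[of "w - 1"] by auto
  have "norm (w + z - 1) \<le> norm (w - 1) + norm z" using norm_triangle_ineq[of "w - 1" z] by (simp add: algebra_simps)
  hence a: "norm (w + z - 1) \<le> 2 * norm (w - 1)" using z w1 by linarith
  have "1 / zeta_real 2 \<le> norm (zeta_series w)" using w by (intro norm_zeta_series_bounds) auto
  hence "1 \<le> zeta_real 2 * norm (zeta_series w)" using zeta_real_ge_1[of 2] by (simp add: field_simps)
  hence "zeta_real (3/2) * 1 \<le> zeta_real (3/2) * (zeta_real 2 * norm (zeta_series w))"
    using zeta_real_ge_1[of "3/2"] by (intro mult_left_mono) auto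
  hence b: "norm (zeta_series (w + z)) \<le> zeta_real (3/2) * (zeta_real 2 * norm (zeta_series w))"
    using norm_zeta_series_bounds(1)[OF re] by simp
  have "norm (zeta_reg (w + z)) = norm (w + z - 1) * norm (zeta_series (w + z))"
    using re zeta_reg_conv_series[of "w + z"] by (simp add: norm_mult)
  also have "\<dots> \<le> (2 * norm (w - 1)) * (zeta_real (3/2) * (zeta_real 2 * norm (zeta_series w)))"
    by (intro mult_mono a b) auto
  also have "\<dots> = 2 * zeta_real (3/2) * zeta_real 2 * norm (zeta_reg w)"
    using w zeta_reg_conv_series[of w] by (simp add: norm_mult)
  finally show ?thesis .
qed

text \<open>The disc is centred at \<open>s + 2\<close>, where the Euler product bounds the modulus
  from below. Its radius exceeds 2, so \<open>s\<close> lies inside, yet it stays to the right of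
  \<open>(a + b) / 2\<close> and thus in the zero-free region. The logarithm has real part
  \<open>O(log |s|)\<close> on the whole disc but \<open>O(1)\<close> on the unit disc.\<close>

lemma zeta_reg_log:
  assumes nz: "\<And>s. Re s > b \<Longrightarrow> zeta_reg s \<noteq> 0" and b: "b \<ge> 1/2" and ab: "a > b" and s: "Re s \<ge> a"
    and C: "C \<ge> 1" "\<And>s. Re s \<ge> 0 \<Longrightarrow> norm (zeta_reg s) \<le> C * (1 + norm s) ^ 3"
  defines "R \<equiv> 2 + (a - b) / 2"
  defines "M \<equiv> ln (2 * C * zeta_real 2) + 3 * ln (3 + R + norm s)"
  obtains f where "f holomorphic_on ball 0 R" "f 0 = 0" "\<And>z. z \<in> ball 0 R \<Longrightarrow> Re (f z) < M"
    "\<And>z. z \<in> ball 0 1 \<Longrightarrow> Re (f z) < ln (4 * zeta_real (3/2) * zeta_real 2)"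
    "\<And>z. z \<in> ball 0 R \<Longrightarrow> zeta_reg (s + 2 + z) = zeta_reg (s + 2) * exp (f z)"
    "norm (zeta_reg (s + 2)) \<ge> 1 / zeta_real 2"
proof -
  define w where "w = s + 2"
  have rew: "Re w \<ge> a + 2" using s by (simp add: w_def)
  have R: "R > 2" using ab by (simp add: R_def)
  have reb: "Re (w + z) > b" if "z \<in> ball 0 R" for z
  proof -
    have "\<bar>Re z\<bar> < 2 + (a - b) / 2" using that abs_Re_le_cmod[of z] by (simp add: R_def)
    thus ?thesis using rew ab by (simp add: field_simps abs_less_iff)
  qed
  have inw: "w + z \<in> ball w R" if "z \<in> ball 0 R" for z using that by (simp add: dist_norm)
  have ballb: "Re z > b" if "z \<in> ball w R" for z
  proof -
    have "z - w \<in> ball 0 R" using that by (simp add: dist_norm norm_minus_commute)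
    from reb[OF this] show ?thesis by simp
  qed
  have z2: "zeta_real 2 \<ge> 1" by (rule zeta_real_ge_1) simp
  have z32: "zeta_real (3/2) \<ge> 1" by (rule zeta_real_ge_1) simp
  have hol: "zeta_reg holomorphic_on ball w R"
    by (rule holomorphic_on_subset[OF holomorphic_zeta_reg]) (use ballb b in force)
  obtain g where g: "g holomorphic_on ball w R" "\<And>z. z \<in> ball w R \<Longrightarrow> exp (g z) = zeta_reg z"
    using holomorphic_logarithm_exists[OF convex_ball open_ball hol, of w] ballb nz R
    by (metis centre_in_ball less_trans zero_less_numeral)
  define f where "f = (\<lambda>z. g (w + z) - g w)"
  have ww: "w \<in> ball w R" using R by simp
  have wnz: "zeta_reg w \<noteq> 0" using nz rew ab by auto
  have e: "zeta_reg (w + z) = zeta_reg w * exp (f z)" if "z \<in> ball 0 R" for z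
    unfolding f_def exp_diff g(2)[OF inw[OF that]] g(2)[OF ww] using wnz by simp
  have lnorm: "exp (Re (f z)) = norm (zeta_reg (w + z)) / norm (zeta_reg w)" if "z \<in> ball 0 R" for z
    using e[OF that] wnz by (simp add: norm_mult)
  have wge: "norm (zeta_reg w) \<ge> 1 / zeta_real 2" using rew b ab by (intro norm_zeta_reg_ge) auto
  show ?thesis
  proof
    show "f holomorphic_on ball 0 R" unfolding f_def
      by (intro holomorphic_intros holomorphic_on_compose_gen[OF _ g(1), unfolded o_def])
        (use inw in \<open>auto simp del: mem_ball\<close>)
    show "f 0 = 0" by (simp add: f_def)
    show "zeta_reg (s + 2 + z) = zeta_reg (s + 2) * exp (f z)" if "z \<in> ball 0 R" for z
      using e[OF that] by (simp add: w_def)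
    show "norm (zeta_reg (s + 2)) \<ge> 1 / zeta_real 2" using wge by (simp add: w_def)
    show "Re (f z) < M" if z: "z \<in> ball 0 R" for z
    proof -
      define N where "N = 3 + R + norm s"
      have N: "N > 1" using R by (auto simp: N_def intro: add_pos_nonneg) 
      have "norm (w + z) \<le> norm s + 2 + R"
        unfolding w_def using z norm_triangle_ineq[of "s + 2" z] norm_triangle_ineq[of s 2] by simp
      hence le: "1 + norm (w + z) \<le> N" by (simp add: N_def)
      have "norm (zeta_reg (w + z)) \<le> C * (1 + norm (w + z)) ^ 3"
        using reb[OF z] b by (intro C) auto
      also have "\<dots> \<le> C * N ^ 3" using C le by (intro mult_left_mono power_mono) auto
      finally have 1: "norm (zeta_reg (w + z)) \<le> C * N ^ 3" .
      have "exp (Re (f z)) \<le> C * N ^ 3 / (1 / zeta_real 2)"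
        unfolding lnorm[OF z] using 1 wge z2 C N by (intro frac_le) auto
      also have "\<dots> < 2 * C * zeta_real 2 * N ^ 3" using C z2 N by simp
      also have "\<dots> = exp M"
      proof -
        have "3 * ln N = ln (N ^ 3)" using N by (simp add: ln_realpow)
        thus ?thesis unfolding M_def N_def[symmetric] using C z2 N by (simp add: exp_add)
      qed
      finally show ?thesis by simp
    qed
    show "Re (f z) < ln (4 * zeta_real (3/2) * zeta_real 2)" if z: "z \<in> ball 0 1" for z
    proof -
      have zR: "z \<in> ball 0 R" using z R by auto
      have "exp (Re (f z)) \<le> 2 * zeta_real (3/2) * zeta_real 2"
        unfolding lnorm[OF zR] using norm_zeta_reg_ratio[of w z] rew ab b z wnz by (simp add: field_simps)
      also have "\<dots> < 4 * zeta_real (3/2) * zeta_real 2" using z2 z32 by simp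
      also have "\<dots> = exp (ln (4 * zeta_real (3/2) * zeta_real 2))" using z2 z32 by simp
      finally show ?thesis by (simp only: exp_less_cancel_iff)
    qed
  qed
qed

text \<open>Borel-Caratheodory applied to the logarithm at \<open>- 2\<close>, the offset of
  \<open>s\<close> from the centre, costs a factor \<open>4 / \<kappa>\<close> on
  \<open>3 log |s| + O(1)\<close>; this explains the exponent \<open>12 / \<kappa>\<close>. It
  bounds the denominator of the quotient of shifted values of \<open>\<xi>\<close>.\<close>

lemma zeta_reg_lower_bound:
  assumes nz: "\<And>s. Re s > b \<Longrightarrow> zeta_reg s \<noteq> 0" and b: "b \<ge> 1/2" and ab: "a > b"
  obtains K k where "K > 0" "k \<ge> 0" "\<And>s. Re s \<ge> a \<Longrightarrow> norm (zeta_reg s) \<ge> K * (1 + norm s) powr (-k)"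
proof -
  obtain C where C: "C \<ge> 1" "\<And>s. Re s \<ge> 0 \<Longrightarrow> norm (zeta_reg s) \<le> C * (1 + norm s) ^ 3"
    using zeta_reg_bound by blast
  define \<kappa> where "\<kappa> = (a - b) / 2"
  define R where "R = 2 + \<kappa>"
  have k: "\<kappa> > 0" "R > 2" using ab by (auto simp: \<kappa>_def R_def)
  have z2: "zeta_real 2 \<ge> 1" by (rule zeta_real_ge_1) simp
  define K where "K = 1 / zeta_real 2 * exp (- (4 / \<kappa>) * (ln (2 * C * zeta_real 2) + 3 * ln (3 + R)))"
  show ?thesis
  proof
    show "K > 0" unfolding K_def using z2 by (intro mult_pos_pos) auto
    show "12 / \<kappa> \<ge> 0" using k by simp
    fix s assume s: "Re s \<ge> a"
    define M where "M = ln (2 * C * zeta_real 2) + 3 * ln (3 + R + norm s)"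
    obtain f where f: "f holomorphic_on ball 0 R" "f 0 = 0" "\<And>z. z \<in> ball 0 R \<Longrightarrow> Re (f z) < M"
      "\<And>z. z \<in> ball 0 R \<Longrightarrow> zeta_reg (s + 2 + z) = zeta_reg (s + 2) * exp (f z)"
      "norm (zeta_reg (s + 2)) \<ge> 1 / zeta_real 2"
      using zeta_reg_log[OF nz b ab s C] unfolding M_def R_def \<kappa>_def by metis
    have in2: "-2 \<in> ball (0::complex) R" using k by simp
    have "norm (f (-2)) \<le> 2 * M * norm (-2::complex) / (R - norm (-2::complex))"
      by (rule borel_caratheodory[OF f(1-3) in2])
    hence "norm (f (-2)) \<le> 4 / \<kappa> * M" by (simp add: R_def)
    hence "Re (f (-2)) \<ge> - (4 / \<kappa> * M)" using abs_Re_le_cmod[of "f (-2)"] by linarith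
    moreover have "3 + R + norm s \<le> (3 + R) * (1 + norm s)" using k by (simp add: algebra_simps)
    hence "ln (3 + R + norm s) \<le> ln (3 + R) + ln (1 + norm s)"
      using k by (subst ln_mult_pos[symmetric]) (auto intro!: ln_mono add_pos_nonneg)
    hence "M \<le> ln (2 * C * zeta_real 2) + 3 * ln (3 + R) + 3 * ln (1 + norm s)" by (simp add: M_def)
    hence "4 / \<kappa> * M \<le> 4 / \<kappa> * (ln (2 * C * zeta_real 2) + 3 * ln (3 + R) + 3 * ln (1 + norm s))"
      using k by (intro mult_left_mono) auto
    ultimately have "Re (f (-2)) \<ge> - (4 / \<kappa>) * (ln (2 * C * zeta_real 2) + 3 * ln (3 + R)) + (- (12 / \<kappa>)) * ln (1 + norm s)"
      by (simp add: algebra_simps)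
    hence "exp (- (4 / \<kappa>) * (ln (2 * C * zeta_real 2) + 3 * ln (3 + R)) + (- (12 / \<kappa>)) * ln (1 + norm s)) \<le> norm (exp (f (-2)))"
      by simp
    hence "exp (- (4 / \<kappa>) * (ln (2 * C * zeta_real 2) + 3 * ln (3 + R))) * (1 + norm s) powr (- (12 / \<kappa>)) \<le> norm (exp (f (-2)))"
      unfolding exp_add by (simp add: powr_def add_nonneg_eq_0_iff)
    hence "1 / zeta_real 2 * (exp (- (4 / \<kappa>) * (ln (2 * C * zeta_real 2) + 3 * ln (3 + R))) * (1 + norm s) powr (- (12 / \<kappa>)))
       \<le> norm (zeta_reg (s + 2)) * norm (exp (f (-2)))"
      using f(5) z2 by (intro mult_mono) auto
    also have "\<dots> = norm (zeta_reg s)" using f(4)[OF in2] by (simp add: norm_mult)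
    finally show "K * (1 + norm s) powr (- (12 / \<kappa>)) \<le> norm (zeta_reg s)" by (simp add: K_def mult.assoc)
  qed
qed

text \<open>The two-scale estimate is applied to the logarithm at \<open>- 2\<close>. There
  \<open>M\<close> is \<open>3 log |s| + O(1)\<close>, so the weight \<open>\<epsilon> / 3\<close>
  produces \<open>\<epsilon> log |s|\<close>.\<close>

lemma zeta_reg_log_deriv_small:
  assumes nz: "\<And>s. Re s > b \<Longrightarrow> zeta_reg s \<noteq> 0" and b: "b \<ge> 1/2" and ab: "a > b" and \<epsilon>: "\<epsilon> > 0"
  obtains A where "\<And>s. Re s \<ge> a \<Longrightarrow> norm (deriv zeta_reg s / zeta_reg s) \<le> A + \<epsilon> * ln (1 + norm s)"
proof -
  obtain C where C: "C \<ge> 1" "\<And>s. Re s \<ge> 0 \<Longrightarrow> norm (zeta_reg s) \<le> C * (1 + norm s) ^ 3"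
    using zeta_reg_bound by blast
  define R where "R = 2 + (a - b) / 2"
  have R: "2 < R" using ab by (simp add: R_def)
  hence "R > 1" by simp
  note R = R this
  define M0 where "M0 = ln (4 * zeta_real (3/2) * zeta_real 2)"
  obtain A where A: "\<And>(f :: complex \<Rightarrow> complex) M z. f holomorphic_on ball 0 R \<Longrightarrow> f 0 = 0 \<Longrightarrow>
     (\<And>z. z \<in> ball 0 R \<Longrightarrow> Re (f z) < M) \<Longrightarrow> (\<And>z. z \<in> ball 0 1 \<Longrightarrow> Re (f z) < M0) \<Longrightarrow>
     norm z \<le> 2 \<Longrightarrow> norm (deriv f z) \<le> A + \<epsilon> / 3 * M"
    using deriv_bound_two_scales[of 2 R "\<epsilon> / 3" M0] R \<epsilon> by auto
  show ?thesis
  proof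
    fix s assume s: "Re s \<ge> a"
    define M where "M = ln (2 * C * zeta_real 2) + 3 * ln (3 + R + norm s)"
    obtain f where f: "f holomorphic_on ball 0 R" "f 0 = 0" "\<And>z. z \<in> ball 0 R \<Longrightarrow> Re (f z) < M"
      "\<And>z. z \<in> ball 0 1 \<Longrightarrow> Re (f z) < M0"
      "\<And>z. z \<in> ball 0 R \<Longrightarrow> zeta_reg (s + 2 + z) = zeta_reg (s + 2) * exp (f z)"
      using zeta_reg_log[OF nz b ab s C] unfolding M_def R_def M0_def by metis
    have in2: "-2 \<in> ball (0::complex) R" using R by simp
    have "norm (deriv f (-2)) \<le> A + \<epsilon> / 3 * M" using A[OF f(1-4), of "-2"] by simp
    moreover have "deriv f (-2) = deriv zeta_reg s / zeta_reg s"
    proof -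
      have d1: "((\<lambda>z. zeta_reg (s + 2 + z)) has_field_derivative deriv zeta_reg s) (at (-2))"
      proof -
        have "(zeta_reg has_field_derivative deriv zeta_reg s) (at s)"
          using holomorphic_derivI[OF holomorphic_zeta_reg open_halfspace_Re_gt, of s] s ab b by simp
        thus ?thesis using DERIV_shift[of zeta_reg "deriv zeta_reg s" "-2" "s + 2"] by (simp add: add.commute)
      qed
      have "(f has_field_derivative deriv f (-2)) (at (-2))"
        by (rule holomorphic_derivI[OF f(1) open_ball in2])
      hence "((\<lambda>z. zeta_reg (s + 2) * exp (f z)) has_field_derivative zeta_reg (s + 2) * (exp (f (-2)) * deriv f (-2))) (at (-2))"
        by (auto intro!: derivative_eq_intros)
      moreover have "\<forall>\<^sub>F z in nhds (-2). zeta_reg (s + 2 + z) = zeta_reg (s + 2) * exp (f z)"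
        using eventually_nhds_in_open[OF open_ball in2] by eventually_elim (rule f(5))
      ultimately have "((\<lambda>z. zeta_reg (s + 2 + z)) has_field_derivative zeta_reg (s + 2) * (exp (f (-2)) * deriv f (-2))) (at (-2))"
        by (subst DERIV_cong_ev[OF refl _ refl])
      from DERIV_unique[OF d1 this] have "deriv zeta_reg s = zeta_reg s * deriv f (-2)"
        using f(5)[OF in2] by simp
      moreover have "zeta_reg s \<noteq> 0" using nz s ab by auto
      ultimately show ?thesis by simp
    qed
    moreover have "\<epsilon> / 3 * M \<le> \<epsilon> / 3 * (ln (2 * C * zeta_real 2) + 3 * ln (3 + R)) + \<epsilon> * ln (1 + norm s)"
    proof -
      have "3 + R + norm s \<le> (3 + R) * (1 + norm s)" using R by (simp add: algebra_simps)
      hence "ln (3 + R + norm s) \<le> ln (3 + R) + ln (1 + norm s)"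
        using R by (subst ln_mult_pos[symmetric]) (auto intro!: ln_mono add_pos_nonneg)
      hence "M \<le> ln (2 * C * zeta_real 2) + 3 * ln (3 + R) + 3 * ln (1 + norm s)" by (simp add: M_def)
      hence "\<epsilon> / 3 * M \<le> \<epsilon> / 3 * (ln (2 * C * zeta_real 2) + 3 * ln (3 + R) + 3 * ln (1 + norm s))"
        using \<epsilon> by (intro mult_left_mono) auto
      thus ?thesis by (simp add: algebra_simps)
    qed
    ultimately show "norm (deriv zeta_reg s / zeta_reg s) \<le> (A + \<epsilon> / 3 * (ln (2 * C * zeta_real 2) + 3 * ln (3 + R))) + \<epsilon> * ln (1 + norm s)"
      by simp
  qed
qed

subsection \<open>Horizontal monotonicity of xi\<close>

lemma norm_powr_pi: "norm (complex_of_real pi powr s) = pi powr (Re s)"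
  by (subst norm_powr_real_powr) auto

text \<open>A shift by \<open>d\<close> to the right gains a Gamma factor of order
  \<open>|w| powr (d / 2)\<close>. The inequality is written without quotients so that zeros of
  \<open>zeta_reg\<close> are allowed.\<close>

lemma riemann_xi_shift:
  assumes w: "Re w \<ge> 1/2" and d: "d \<ge> 0"
  shows "norm (riemann_xi w) * norm (zeta_reg (w + of_real d)) * exp (d / 2 * (ln (norm (w / 2 + 1)) - 4))
    \<le> pi powr (d / 2) * norm (zeta_reg w) * norm (riemann_xi (w + of_real d))"
proof -
  define G where "G = norm (Gamma (w / 2 + 1))"
  define G' where "G' = norm (Gamma (w / 2 + 1 + of_real (d / 2)))"
  define E where "E = exp (d / 2 * (ln (norm (w / 2 + 1)) - 4))"
  have "G * E \<le> G'" unfolding G_def G'_def E_def using w d by (intro norm_Gamma_shift) auto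
  have x1: "norm (riemann_xi w) = pi powr (- Re w / 2) * G * norm (zeta_reg w)"
    using w by (simp add: riemann_xi_right norm_mult norm_powr_pi G_def)
  have "(w + of_real d) / 2 + 1 = w / 2 + 1 + of_real (d / 2)" by (simp add: field_simps)
  note e = this
  have x2: "norm (riemann_xi (w + of_real d)) = pi powr (- (Re w + d) / 2) * G' * norm (zeta_reg (w + of_real d))"
    unfolding G'_def e[symmetric] using w d by (subst riemann_xi_right) (auto simp: norm_mult norm_powr_pi simp del: of_real_divide)
  have p: "pi powr (d / 2) * pi powr (- (Re w + d) / 2) = pi powr (- Re w / 2)"
    unfolding powr_add[symmetric] by (rule arg_cong[where f = "\<lambda>x. pi powr x"]) (simp add: field_simps)
  have "norm (riemann_xi w) * norm (zeta_reg (w + of_real d)) * E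
     = pi powr (- Re w / 2) * norm (zeta_reg w) * norm (zeta_reg (w + of_real d)) * (G * E)" by (simp add: x1)
  also have "\<dots> \<le> pi powr (- Re w / 2) * norm (zeta_reg w) * norm (zeta_reg (w + of_real d)) * G'"
    using \<open>G * E \<le> G'\<close> by (intro mult_left_mono) auto
  also have "\<dots> = pi powr (d / 2) * norm (zeta_reg w) * norm (riemann_xi (w + of_real d))"
    unfolding x2 p[symmetric] by simp
  finally show ?thesis unfolding E_def .
qed

lemma riemann_xi_nonzero_iff: "Re s > -1 \<Longrightarrow> riemann_xi s = 0 \<longleftrightarrow> zeta_reg s = 0"
proof -
  assume s: "Re s > -1"
  hence "s / 2 + 1 \<notin> \<int>\<^sub>\<le>\<^sub>0" by (auto elim!: nonpos_Ints_cases dest!: arg_cong[where f = Re])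
  thus ?thesis using s by (simp add: riemann_xi_right Gamma_eq_zero_iff)
qed

lemma norm_riemann_xi_reflect: "norm (riemann_xi (1 - cnj s)) = norm (riemann_xi s)"
  by (simp add: riemann_xi_reflect cnj_riemann_xi)

text \<open>\<open>G\<close> is divided by \<open>(1 + \<epsilon> (s - x)) ^ (m + 1)\<close>, which
  has modulus at least 1 in the half plane and outgrows the polynomial bound. The maximum principle
  on a large half disc bounds the quotient by 1, and then \<open>\<epsilon>\<close> tends to
  0.\<close>

lemma phragmen_lindelof_half_plane:
  fixes G :: "complex \<Rightarrow> complex"
  assumes hol: "G holomorphic_on {s. Re s > x}" and cont: "continuous_on {s. Re s \<ge> x} G"
    and bd: "\<And>s. Re s = x \<Longrightarrow> norm (G s) \<le> 1"
    and gr: "\<And>s. Re s \<ge> x \<Longrightarrow> norm (G s) \<le> K * (1 + norm (s - of_real x)) ^ m"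
    and s: "Re s0 \<ge> x"
  shows "norm (G s0) \<le> 1"
proof -
  define c where "c = complex_of_real x"
  have key: "norm (G s0) \<le> norm (1 + of_real \<epsilon> * (s0 - c)) ^ Suc m" if e: "\<epsilon> > 0" for \<epsilon> :: real
  proof -
    have re1: "Re (1 + of_real \<epsilon> * (s - c)) \<ge> 1" if "Re s \<ge> x" for s using that e by (simp add: c_def)
    have nz: "1 + of_real \<epsilon> * (s - c) \<noteq> 0" if "Re s \<ge> x" for s
      using re1[OF that] by (metis zero_complex.sel(1) not_one_le_zero)
    have ge1: "norm (1 + of_real \<epsilon> * (s - c)) \<ge> 1" if "Re s \<ge> x" for s
      using re1[OF that] complex_Re_le_cmod[of "1 + of_real \<epsilon> * (s - c)"] by linarith
    have ge2: "norm (1 + of_real \<epsilon> * (s - c)) \<ge> \<epsilon> * norm (s - c)" if "Re s \<ge> x" for s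
    proof -
      define v where "v = of_real \<epsilon> * (s - c)"
      have v: "Re v \<ge> 0" using that e by (simp add: v_def c_def)
      have "norm v \<le> norm (1 + v)" unfolding cmod_def
        by (intro real_sqrt_le_mono) (use v in \<open>simp add: power2_eq_square algebra_simps\<close>)
      thus ?thesis using e by (simp add: v_def norm_mult)
    qed
    have "((\<lambda>R. K * (1 + R) ^ m / (\<epsilon> * R) ^ Suc m) \<longlongrightarrow> 0) at_top"
    proof -
      have l: "((\<lambda>R::real. 1 / R) \<longlongrightarrow> 0) at_top" by real_asymp
      have "((\<lambda>R. K / \<epsilon> ^ Suc m * (1 / R + 1) ^ m * (1 / R)) \<longlongrightarrow> K / \<epsilon> ^ Suc m * (0 + 1) ^ m * 0) at_top"
        by (intro tendsto_intros l)
      moreover have "\<forall>\<^sub>F R in at_top. K / \<epsilon> ^ Suc m * (1 / R + 1) ^ m * (1 / R) = K * (1 + R) ^ m / (\<epsilon> * R) ^ Suc m"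
        using eventually_gt_at_top[of "0::real"]
      proof eventually_elim
        case (elim R)
        have "1 / R + 1 = (1 + R) / R" using elim by (simp add: field_simps)
        thus ?case using elim e by (simp add: power_divide power_mult_distrib)
      qed
      ultimately show ?thesis by (auto elim: Lim_transform_eventually)
    qed
    hence "\<forall>\<^sub>F R in at_top. K * (1 + R) ^ m / (\<epsilon> * R) ^ Suc m < 1"
      by (rule order_tendstoD) simp
    moreover have "\<forall>\<^sub>F R in at_top. R > norm (s0 - c)" by (rule eventually_gt_at_top)
    ultimately have "\<forall>\<^sub>F R in at_top. K * (1 + R) ^ m / (\<epsilon> * R) ^ Suc m < 1 \<and> R > norm (s0 - c)"
      by eventually_elim simp
    from eventually_happens'[OF _ this]
    obtain R where R: "K * (1 + R) ^ m / (\<epsilon> * R) ^ Suc m < 1" "R > norm (s0 - c)" by auto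
    have R0: "R > 0" using R(2) norm_ge_zero[of "s0 - c"] by linarith
    define S where "S = cball c R \<inter> {s. Re s \<ge> x}"
    define g where "g = (\<lambda>s. G s / (1 + of_real \<epsilon> * (s - c)) ^ Suc m)"
    have clS: "closed S" unfolding S_def by (intro closed_Int closed_cball closed_halfspace_Re_ge)
    have sub: "ball c R \<inter> {s. Re s > x} \<subseteq> interior S"
      by (rule interior_maximal) (auto simp: S_def intro!: open_Int open_halfspace_Re_gt)
    have subi: "interior S \<subseteq> {s. Re s > x}"
    proof -
      show "interior S \<subseteq> {s. Re s > x}"
      proof
        fix z assume "z \<in> interior S"
        then obtain e where e: "e > 0" "ball z e \<subseteq> S" by (auto simp: mem_interior)
        have "z - of_real (e / 2) \<in> ball z e" using e(1) by (simp add: dist_norm)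
        hence "z - of_real (e / 2) \<in> S" using e(2) by blast
        hence "Re (z - of_real (e / 2)) \<ge> x" unfolding S_def by blast
        thus "z \<in> {s. Re s > x}" using e(1) by simp
      qed
    qed
    have "norm (g s0) \<le> 1"
    proof (rule maximum_modulus_frontier[where f = g and S = S and \<xi> = s0])
      show "g holomorphic_on interior S" unfolding g_def
        by (intro holomorphic_intros holomorphic_on_subset[OF hol subi]) (use subi nz in force)
      show "continuous_on (closure S) g" unfolding g_def closure_closed[OF clS]
        by (intro continuous_intros continuous_on_subset[OF cont]) (use nz in \<open>auto simp: S_def\<close>)
      show "bounded S" unfolding S_def by (intro bounded_Int) auto
      show "s0 \<in> S" using R s by (simp add: S_def dist_norm norm_minus_commute)
      fix z assume "z \<in> frontier S"
      hence z: "z \<in> S" "z \<notin> interior S" using clS by (auto simp: frontier_def closure_closed)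
      hence zx: "Re z \<ge> x" by (simp add: S_def)
      have "Re z = x \<or> norm (z - c) = R"
      proof (rule ccontr)
        assume "\<not> (Re z = x \<or> norm (z - c) = R)"
        hence "z \<in> ball c R \<inter> {s. Re s > x}" using z(1) by (auto simp: S_def dist_norm norm_minus_commute)
        thus False using sub z(2) by blast
      qed
      thus "norm (g z) \<le> 1"
      proof
        assume "Re z = x"
        hence "norm (G z) \<le> 1" by (rule bd)
        moreover have "1 \<le> norm (1 + of_real \<epsilon> * (z - c)) ^ Suc m" using ge1[OF zx] by (rule one_le_power)
        ultimately show ?thesis unfolding g_def norm_divide norm_power
          by (subst divide_le_eq_1_pos) (auto intro: less_le_trans[OF zero_less_one])
      next
        assume zR: "norm (z - c) = R"
        have "norm (G z) \<le> K * (1 + R) ^ m" using gr[OF zx] zR by (simp add: c_def)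
        moreover have "(\<epsilon> * R) ^ Suc m \<le> norm (1 + of_real \<epsilon> * (z - c)) ^ Suc m"
          using ge2[OF zx] zR e R0 by (intro power_mono) auto
        moreover have "(\<epsilon> * R) ^ Suc m > 0" using e R0 by simp
        moreover have "K * (1 + R) ^ m \<ge> 0" using \<open>norm (G z) \<le> K * (1 + R) ^ m\<close> norm_ge_zero order_trans by blast
        ultimately have "norm (g z) \<le> K * (1 + R) ^ m / (\<epsilon> * R) ^ Suc m"
          unfolding g_def norm_divide norm_power by (intro frac_le) auto
        thus ?thesis using R(1) by linarith
      qed
    qed
    moreover have "norm (1 + of_real \<epsilon> * (s0 - c)) ^ Suc m > 0" using ge1[OF s] by (intro zero_less_power) linarith
    ultimately show ?thesis unfolding g_def norm_divide norm_power by (simp add: divide_le_eq_1_pos)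
  qed
  have l: "((\<lambda>\<epsilon>. norm (1 + of_real \<epsilon> * (s0 - c)) ^ Suc m) \<longlongrightarrow> norm (1 + of_real 0 * (s0 - c)) ^ Suc m) (at_right 0)"
    by (intro tendsto_intros)
  have "norm (G s0) \<le> norm (1 + of_real 0 * (s0 - c)) ^ Suc m"
  proof (rule tendsto_lowerbound[OF l])
    have "\<forall>\<^sub>F \<epsilon>::real in at_right 0. 0 < \<epsilon>" by (rule eventually_at_right_less)
    thus "\<forall>\<^sub>F \<epsilon> in at_right 0. norm (G s0) \<le> norm (1 + of_real \<epsilon> * (s0 - c)) ^ Suc m"
      by eventually_elim (rule key)
  qed simp
  thus ?thesis by simp
qed

text \<open>On the critical line \<open>s - h\<close> and \<open>s + h\<close> are mirror images, so
  the quotient \<open>G\<close> of the values of \<open>\<xi>\<close> has modulus 1 there.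
  Stirling's formula and the polynomial bounds for zeta from both sides make its growth polynomial,
  and Phragmen-Lindelof applies.\<close>

lemma xi_shift_le_strip:
  assumes nz: "\<And>s. Re s > b \<Longrightarrow> zeta_reg s \<noteq> 0" and b: "b \<ge> 1/2" and h: "b < 1/2 + h" and s0: "Re s0 \<ge> 1/2"
  shows "norm (riemann_xi (s0 - of_real h)) \<le> norm (riemann_xi (s0 + of_real h))"
proof -
  have h0: "h > 0" using b h by simp
  obtain C where C: "C \<ge> 1" "\<And>s. Re s \<ge> 0 \<Longrightarrow> norm (zeta_reg s) \<le> C * (1 + norm s) ^ 3"
    using zeta_reg_bound by blast
  obtain K k where K: "K > 0" "k \<ge> 0" "\<And>s. Re s \<ge> 1/2 + h \<Longrightarrow> norm (zeta_reg s) \<ge> K * (1 + norm s) powr (-k)"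
    using zeta_reg_lower_bound[OF nz b h] by blast
  define m where "m = nat \<lceil>k\<rceil>"
  have m: "k \<le> real m" unfolding m_def by linarith
  define G where "G = (\<lambda>s. riemann_xi (s - of_real h) / riemann_xi (s + of_real h))"
  have xnz: "riemann_xi (s + of_real h) \<noteq> 0" if "Re s \<ge> 1/2" for s
    using that h0 h nz[of "s + of_real h"] b by (subst riemann_xi_nonzero_iff) auto
  define Q where "Q = pi powr h * exp (4 * h) * C / K * (3 + h) ^ (3 + m)"
  have hol: "G holomorphic_on {s. 1/2 < Re s}" and cont: "continuous_on {s. 1/2 \<le> Re s} G"
  proof -
    have hh: "(\<lambda>s. riemann_xi (s - of_real h)) holomorphic_on A" "(\<lambda>s. riemann_xi (s + of_real h)) holomorphic_on A" for A
      by (rule holomorphic_on_compose_gen[OF _ holomorphic_riemann_xi[of UNIV], unfolded o_def]; (intro holomorphic_intros | simp))+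
    show "G holomorphic_on {s. 1/2 < Re s}" unfolding G_def
      by (intro holomorphic_intros hh) (use xnz in auto)
    show "continuous_on {s. 1/2 \<le> Re s} G" unfolding G_def
      by (intro continuous_intros holomorphic_on_imp_continuous_on hh) (use xnz in auto)
  qed
  have line: "norm (G s) \<le> 1" if "Re s = 1/2" for s
    proof -
      have "1 - cnj (s + of_real h) = s - of_real h" using that by (simp add: complex_eq_iff)
      hence "norm (riemann_xi (s - of_real h)) = norm (riemann_xi (s + of_real h))"
        using norm_riemann_xi_reflect[of "s + of_real h"] by (simp only:)
      thus ?thesis by (simp add: G_def norm_divide)
    qed
  have growth: "norm (G s) \<le> Q * (1 + norm (s - complex_of_real (1/2))) ^ (3 + m)" if s: "1/2 \<le> Re s" for s
  proof -
    \<comment> \<open>If \<open>s - h\<close> lies to the left of the critical line, it is replaced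
      by its mirror image, at the same height and with the same modulus of \<open>\<xi>\<close>.
      Thus \<open>s + h\<close> is always reached from \<open>w\<close> by a horizontal shift with
      \<open>0 \<le> d \<le> 2 h\<close>.\<close>
    define w where "w = (if Re (s - of_real h) \<ge> 1/2 then s - of_real h else 1 - cnj (s - of_real h))"
    define d where "d = Re (s + of_real h) - Re w"
    have xw: "norm (riemann_xi w) = norm (riemann_xi (s - of_real h))"
      unfolding w_def using norm_riemann_xi_reflect[of "s - of_real h"] by simp
    have rew: "Re w \<ge> 1/2" unfolding w_def by auto
    have d: "0 \<le> d" "d \<le> 2 * h" using s h0 unfolding d_def w_def by auto
    have wd: "w + of_real d = s + of_real h" unfolding d_def w_def by (auto simp: complex_eq_iff)
    have nw: "norm w \<le> 1 + norm s + h"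
    proof -
      have "norm (s - of_real h) \<le> norm s + h" using norm_triangle_ineq4[of s "of_real h"] h0 by simp
      moreover have "norm (1 - cnj (s - of_real h)) \<le> 1 + norm (s - of_real h)"
        using norm_triangle_ineq4[of 1 "cnj (s - of_real h)"] by (metis complex_mod_cnj norm_one)
      ultimately show ?thesis by (auto simp: w_def)
    qed
    define N where "N = 1 + norm (s - complex_of_real (1/2))"
    have sN: "norm s \<le> N" unfolding N_def using norm_triangle_ineq[of "s - 1/2" "1/2"] by (simp add: norm_divide)
    have N1: "N \<ge> 1" by (simp add: N_def)
    have "norm (zeta_reg w) \<le> C * (1 + norm w) ^ 3" using rew by (intro C) auto
    also have "\<dots> \<le> C * ((3 + h) * N) ^ 3"
    proof -
      have "1 + norm w \<le> 2 + h + N" using nw sN by simp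
      also have "\<dots> \<le> (3 + h) * N"
        using mult_left_mono[OF N1, of "2 + h"] h0 by (simp add: algebra_simps)
      finally show ?thesis using C by (intro mult_left_mono power_mono) auto
    qed
    finally have zw: "norm (zeta_reg w) \<le> C * ((3 + h) * N) ^ 3" .
    have zs: "norm (zeta_reg (s + of_real h)) \<ge> K / ((3 + h) * N) ^ m"
    proof -
      have "1 + norm (s + of_real h) \<le> 1 + (norm s + h)" using norm_triangle_ineq[of s "of_real h"] h0 by simp
      also have "\<dots> \<le> 1 + h + N" using sN by simp
      also have "\<dots> \<le> (3 + h) * N"
        using mult_left_mono[OF N1, of "2 + h"] h0 by (simp add: algebra_simps)
      finally have a: "1 + norm (s + of_real h) \<le> (3 + h) * N" .
      have "K / ((3 + h) * N) ^ m \<le> K / (1 + norm (s + of_real h)) ^ m"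
        using a K h0 N1 by (intro divide_left_mono power_mono mult_pos_pos zero_less_power add_pos_nonneg) auto
      also have "\<dots> = K * (1 + norm (s + of_real h)) powr (- real m)"
        by (subst powr_minus, subst powr_realpow) (auto intro: add_pos_nonneg simp: field_simps)
      also have "\<dots> \<le> K * (1 + norm (s + of_real h)) powr (- k)"
        using m K by (intro mult_left_mono powr_mono) auto
      also have "\<dots> \<le> norm (zeta_reg (s + of_real h))" using s by (intro K) auto
      finally show ?thesis .
    qed
    have E: "exp (d / 2 * (ln (norm (w / 2 + 1)) - 4)) \<ge> exp (- (4 * h))"
    proof -
      have "norm (w / 2 + 1) \<ge> 1" using rew complex_Re_le_cmod[of "w / 2 + 1"] by simp
      hence "d / 2 * (ln (norm (w / 2 + 1)) - 4) \<ge> d / 2 * (0 - 4)" using d by (intro mult_left_mono diff_right_mono) auto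
      thus ?thesis using d by simp
    qed
    define X where "X = norm (riemann_xi (s + of_real h))"
    have X: "X > 0" using xnz[OF s] by (simp add: X_def)
    have big: "(3 + h) * N > 0" using h0 N1 by (intro mult_pos_pos) auto
    have "norm (riemann_xi w) * (K / ((3 + h) * N) ^ m) * exp (- (4 * h))
      \<le> norm (riemann_xi w) * norm (zeta_reg (s + of_real h)) * exp (d / 2 * (ln (norm (w / 2 + 1)) - 4))"
      using zs E K big by (intro mult_mono) auto
    also have "\<dots> \<le> pi powr (d / 2) * norm (zeta_reg w) * X"
      using riemann_xi_shift[OF rew d(1)] unfolding wd X_def .
    also have "\<dots> \<le> pi powr h * (C * ((3 + h) * N) ^ 3) * X"
      using zw d X pi_ge_two C big by (intro mult_mono powr_mono mult_nonneg_nonneg) auto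
    finally have "norm (riemann_xi w) * (K / ((3 + h) * N) ^ m) * exp (- (4 * h)) \<le> pi powr h * (C * ((3 + h) * N) ^ 3) * X" .
    hence "norm (riemann_xi w) / X \<le> pi powr h * exp (4 * h) * C / K * ((3 + h) * N) ^ (3 + m)"
      using X big K by (simp add: exp_minus field_simps power_add)
    also have "\<dots> = Q * N ^ (3 + m)" by (simp add: Q_def power_mult_distrib)
    finally show ?thesis
      unfolding G_def N_def norm_divide xw X_def .
  qed
  have "norm (G s0) \<le> 1" by (rule phragmen_lindelof_half_plane[OF hol cont line growth s0])
  thus ?thesis unfolding G_def norm_divide using xnz[OF s0] by (simp add: divide_le_eq_1_pos)
qed

definition xi_admissible :: "real \<Rightarrow> bool" where
  "xi_admissible h \<longleftrightarrow> h > 0 \<and> (h \<ge> 1/2 \<or> riemann_hypothesis)"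

lemma zeta_reg_nonzero_RH:
  assumes riemann_hypothesis "Re s > 1/2" shows "zeta_reg s \<noteq> 0"
proof
  assume z: "zeta_reg s = 0"
  show False
  proof (cases "Re s \<ge> 1")
    case False
    moreover have "riemann_zeta s = 0" using assms z by (subst zeta_reg_conv) auto
    ultimately show False using assms unfolding riemann_hypothesis_def by force
  qed (use z zeta_reg_nonzero in blast)
qed

lemma zeta_reg_nonzero_admissible:
  assumes "xi_admissible h" "Re s \<ge> 1/2 + h" shows "zeta_reg s \<noteq> 0"
proof (cases "h \<ge> 1/2")
  case True
  thus ?thesis using assms by (intro zeta_reg_nonzero) auto
next
  case False
  thus ?thesis using assms by (intro zeta_reg_nonzero_RH) (auto simp: xi_admissible_def)
qed

text \<open>The strip version requires a zero-free margin to the left of \<open>1/2 + h\<close>. For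
  \<open>h = 1/2\<close> this is missing, but the weak inequality passes to the limit from larger
  \<open>h\<close> by continuity.\<close>

lemma xi_shift_le:
  assumes h: "xi_admissible h" and s: "Re s \<ge> 1/2"
  shows "norm (riemann_xi (s - of_real h)) \<le> norm (riemann_xi (s + of_real h))"
proof -
  have gt: "norm (riemann_xi (s - of_real h)) \<le> norm (riemann_xi (s + of_real h))" if "h > 1/2" for h
    using that s by (intro xi_shift_le_strip[where b = 1] zeta_reg_nonzero_gt_1) auto
  consider "h > 1/2" | "h = 1/2" | "h < 1/2" "h > 0" riemann_hypothesis
    using h unfolding xi_admissible_def by linarith
  thus ?thesis
  proof cases
    case 2
    have c: "isCont riemann_xi z" for z
      using holomorphic_on_imp_continuous_on[OF holomorphic_riemann_xi[of UNIV]] by (simp add: continuous_on_eq_continuous_at)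
    have l: "((\<lambda>h. norm (riemann_xi (s + of_real h)) - norm (riemann_xi (s - of_real h))) \<longlongrightarrow>
        norm (riemann_xi (s + of_real (1/2))) - norm (riemann_xi (s - of_real (1/2)))) (at_right (1/2))"
      by (intro tendsto_intros isCont_tendsto_compose[OF c])
    have "0 \<le> norm (riemann_xi (s + of_real (1/2))) - norm (riemann_xi (s - of_real (1/2)))"
      by (rule tendsto_lowerbound[OF l]) (use gt in \<open>auto simp: eventually_at_filter\<close>)
    thus ?thesis unfolding 2 by simp
  next
    case 3
    show ?thesis
    proof (rule xi_shift_le_strip[where b = "1/2"])
      show "zeta_reg s \<noteq> 0" if "Re s > 1/2" for s using zeta_reg_nonzero_RH 3 that by blast
    qed (use 3 s in auto)
  qed (use gt in auto)
qed

text \<open>One point of strict inequality, to exclude a quotient of constant modulus 1. Far out on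
  the real axis the Gamma gain \<open>exp (h (ln (y / 2 + 1) - 4))\<close> exceeds every constant,
  while the ratio of zeta values stays bounded.\<close>

lemma xi_shift_real_small:
  assumes h: "xi_admissible h" obtains x where "x > 1/2" "norm (riemann_xi (of_real x - of_real h)) < norm (riemann_xi (of_real x + of_real h))"
proof -
  have h0: "h > 0" using h by (simp add: xi_admissible_def)
  define Z where "Z = zeta_real 2"
  have Z: "Z \<ge> 1" unfolding Z_def by (rule zeta_real_ge_1) simp
  have "filterlim (\<lambda>y. exp (h * (ln (y / 2 + 1) - 4))) at_top at_top" using h0 by real_asymp
  hence "\<forall>\<^sub>F y in at_top. exp (h * (ln (y / 2 + 1) - 4)) > pi powr h * (Z * Z)" by (simp add: filterlim_at_top_dense)
  moreover have "\<forall>\<^sub>F y in at_top. y \<ge> (2::real)" by (rule eventually_ge_at_top)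
  ultimately have "\<forall>\<^sub>F y in at_top. exp (h * (ln (y / 2 + 1) - 4)) > pi powr h * (Z * Z) \<and> y \<ge> (2::real)" by eventually_elim simp
  from eventually_happens'[OF _ this]
  obtain y :: real where y: "exp (h * (ln (y / 2 + 1) - 4)) > pi powr h * (Z * Z)" "y \<ge> 2" by auto
  define w where "w = complex_of_real y"
  define w' where "w' = w + of_real (2 * h)"
  have re: "Re w \<ge> 2" "Re w' \<ge> 2" using y h0 by (auto simp: w_def w'_def)
  have nw: "norm (w / 2 + 1) = y / 2 + 1" 
    using y norm_of_real[of "y / 2 + 1", where 'a = complex] by (simp add: w_def)
  have zle: "norm (zeta_reg w) \<le> Z * Z * norm (zeta_reg w')"
  proof -
    have "norm (w - 1) \<le> norm (w' - 1)"
    proof -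
      have "w - 1 = of_real (y - 1)" "w' - 1 = of_real (y + 2 * h - 1)" by (auto simp: w_def w'_def)
      thus ?thesis using y h0 by (simp only: norm_of_real)
    qed
    moreover have "norm (zeta_series w) \<le> Z" unfolding Z_def by (intro norm_zeta_series_bounds) (use re in auto)
    moreover have "1 / Z \<le> norm (zeta_series w')" unfolding Z_def by (intro norm_zeta_series_bounds) (use re in auto)
    hence "Z * 1 \<le> Z * (Z * norm (zeta_series w'))" using Z by (intro mult_left_mono) (auto simp: field_simps)
    ultimately have "norm (w - 1) * norm (zeta_series w) \<le> norm (w' - 1) * (Z * (Z * norm (zeta_series w')))"
      using Z by (intro mult_mono[of "norm (w - 1)"]) (linarith | simp)+
    moreover have "norm (zeta_reg w) = norm (w - 1) * norm (zeta_series w)"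
      "norm (zeta_reg w') = norm (w' - 1) * norm (zeta_series w')"
      using re zeta_reg_conv_series[of w] zeta_reg_conv_series[of w'] by (auto simp: norm_mult)
    ultimately show ?thesis by (simp add: mult_ac)
  qed
  have pos: "norm (riemann_xi w') > 0" "norm (zeta_reg w') > 0"
    using re zeta_reg_nonzero_gt_1[of w'] by (auto simp: riemann_xi_nonzero_iff)
  have "norm (riemann_xi w) * norm (zeta_reg w') * exp (h * (ln (y / 2 + 1) - 4)) \<le> pi powr h * norm (zeta_reg w) * norm (riemann_xi w')"
    using riemann_xi_shift[of w "2 * h"] re h0 unfolding nw w'_def by simp
  also have "\<dots> \<le> pi powr h * (Z * Z * norm (zeta_reg w')) * norm (riemann_xi w')"
    using zle by (intro mult_right_mono mult_left_mono) auto
  also have "\<dots> = norm (riemann_xi w') * norm (zeta_reg w') * (pi powr h * (Z * Z))" by simp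
  also have "\<dots> < norm (riemann_xi w') * norm (zeta_reg w') * exp (h * (ln (y / 2 + 1) - 4))"
    using y pos by (intro mult_strict_left_mono mult_pos_pos) auto
  finally have lt: "norm (riemann_xi w) < norm (riemann_xi w')" using pos by (simp add: mult_less_cancel_right)
  have "of_real (y + h) - of_real h = w" "of_real (y + h) + of_real h = w'" by (auto simp: w_def w'_def)
  with lt show ?thesis using y h0 by (intro that[of "y + h"]) simp_all
qed

text \<open>Equality at an interior point would make the quotient constant by the maximum principle,
  contradicting the strict inequality found on the real axis.\<close>

lemma xi_shift_less:
  assumes h: "xi_admissible h" and s: "Re s > 1/2"
  shows "norm (riemann_xi (s - of_real h)) < norm (riemann_xi (s + of_real h))"
proof (rule ccontr)
  assume "\<not> ?thesis"
  hence eq: "norm (riemann_xi (s - of_real h)) = norm (riemann_xi (s + of_real h))"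
    using xi_shift_le[OF h, of s] s by auto
  have h0: "h > 0" using h by (simp add: xi_admissible_def)
  define G where "G = (\<lambda>s. riemann_xi (s - of_real h) / riemann_xi (s + of_real h))"
  define S where "S = {s::complex. Re s > 1/2}"
  have xnz: "riemann_xi (s + of_real h) \<noteq> 0" if "s \<in> S" for s
    using that h0 zeta_reg_nonzero_admissible[OF h, of "s + of_real h"] by (subst riemann_xi_nonzero_iff) (auto simp: S_def)
  have hh: "(\<lambda>s. riemann_xi (s - of_real h)) holomorphic_on A" "(\<lambda>s. riemann_xi (s + of_real h)) holomorphic_on A" for A
    by (rule holomorphic_on_compose_gen[OF _ holomorphic_riemann_xi[of UNIV], unfolded o_def]; (intro holomorphic_intros | simp))+
  have Gs: "norm (G s) = 1" using eq xnz[of s] s by (simp add: G_def S_def norm_divide)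
  have "G constant_on S"
  proof (rule maximum_modulus_principle[where U = S and \<xi> = s])
    show "G holomorphic_on S" unfolding G_def by (intro holomorphic_intros hh) (use xnz in auto)
    show "open S" unfolding S_def by (rule open_halfspace_Re_gt)
    thus "open S" .
    show "connected S" unfolding S_def by (intro convex_connected convex_halfspace_Re_gt)
    show "norm (G z) \<le> norm (G s)" if "z \<in> S" for z
      unfolding Gs using xi_shift_le[OF h, of z] that xnz[OF that]
      by (simp add: G_def S_def norm_divide divide_le_eq_1_pos)
  qed (use s in \<open>auto simp: S_def\<close>)
  moreover obtain x where x: "x > 1/2" "norm (riemann_xi (of_real x - of_real h)) < norm (riemann_xi (of_real x + of_real h))"
    using xi_shift_real_small[OF h] by blast
  have "of_real x \<in> S" "s \<in> S" using x s by (auto simp: S_def)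
  ultimately have "G (of_real x) = G s" unfolding constant_on_def by metis
  hence "norm (G (of_real x)) = 1" using Gs by simp
  hence "norm (riemann_xi (of_real x - of_real h)) / norm (riemann_xi (of_real x + of_real h)) = 1"
    unfolding G_def norm_divide .
  moreover have "norm (riemann_xi (of_real x + of_real h)) > 0" using x(2) by (rule le_less_trans[OF norm_ge_zero])
  ultimately show False using x(2) by simp
qed

subsection \<open>The phase of xi on a vertical line\<close>

lemma antiderivative_real_line:
  fixes f :: "real \<Rightarrow> complex"
  assumes f: "continuous_on UNIV f"
  obtains F where "F 0 = 0" "\<And>t. (F has_vector_derivative f t) (at t)"
proof -
  define F where "F = (\<lambda>t. if t \<ge> 0 then integral {0..t} f else - integral {t..0} f)"
  have int: "f integrable_on {x..y}" for x y
    by (rule integrable_continuous_real) (rule continuous_on_subset[OF f], simp)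
  have F: "F t = integral {-b..t} f - integral {-b..0} f" if "\<bar>t\<bar> \<le> b" for t b
  proof (cases "t \<ge> 0")
    case True
    have "integral {-b..0} f + integral {0..t} f = integral {-b..t} f"
      using True that int by (intro Henstock_Kurzweil_Integration.integral_combine) auto
    thus ?thesis using True by (simp add: F_def algebra_simps)
  next
    case False
    have "integral {-b..t} f + integral {t..0} f = integral {-b..0} f"
      using False that int by (intro Henstock_Kurzweil_Integration.integral_combine) auto
    thus ?thesis using False by (simp add: F_def algebra_simps)
  qed
  show ?thesis
  proof
    show "F 0 = 0" by (simp add: F_def)
    fix t :: real
    define b where "b = \<bar>t\<bar> + 1"
    have "((\<lambda>u. integral {-b..u} f) has_vector_derivative f t) (at t within {-b..b})"
      by (intro integral_has_vector_derivative continuous_on_subset[OF f]) (auto simp: b_def)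
    hence "((\<lambda>u. integral {-b..u} f) has_vector_derivative f t) (at t)"
    proof -
      have "t \<in> interior {-b..b}" unfolding interior_atLeastAtMost_real b_def by auto
      thus ?thesis using \<open>(_ has_vector_derivative f t) (at t within {-b..b})\<close> by (simp only: at_within_interior)
    qed
    hence d: "((\<lambda>u. integral {-b..u} f - integral {-b..0} f) has_vector_derivative f t) (at t)"
      by (auto intro!: derivative_eq_intros)
    show "(F has_vector_derivative f t) (at t)"
    proof (rule has_vector_derivative_transform_within_open[OF d, of "{-b<..<b}"])
      show "integral {-b..u} f - integral {-b..0} f = F u" if "u \<in> {-b<..<b}" for u
        using F[of u b] that by auto
    qed (auto simp: b_def abs_less_iff)
  qed
qed

lemma has_vector_derivative_vertical:
  assumes "(f has_field_derivative f') (at (Complex a t))"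
  shows "((\<lambda>t. f (Complex a t)) has_vector_derivative (\<i> * f')) (at t)"
proof -
  have e: "Complex a t = of_real a + \<i> * of_real t" for t by (simp add: Complex_eq)
  have "((\<lambda>z. f (of_real a + \<i> * z)) has_field_derivative f' * \<i>) (at (of_real t))"
    by (rule DERIV_chain'[where f = "\<lambda>z. of_real a + \<i> * z" and g = f]) (use assms[unfolded e] in \<open>auto intro!: derivative_eq_intros\<close>)
  hence "((\<lambda>t. f (of_real a + \<i> * of_real t)) has_vector_derivative (f' * \<i>)) (at t)"
    by (rule has_vector_derivative_real_field)
  thus ?thesis by (simp add: e mult.commute)
qed

lemma has_real_derivative_Im:
  "(F has_vector_derivative D) (at t) \<Longrightarrow> ((\<lambda>t. Im (F t)) has_real_derivative Im D) (at t)"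
  by (auto simp: has_vector_derivative_complex_iff has_real_derivative_iff_has_vector_derivative)

lemma continuous_on_Complex: "continuous_on A (Complex a)"
  unfolding Complex_eq by (intro continuous_intros)

text \<open>Integrating the logarithmic derivative produces a continuous logarithm along the line
  without any choice of branch, normalized to 0 on the real axis. Its imaginary part is the
  continuous argument relative to the value there.\<close>

lemma vertical_phase:
  assumes f: "f analytic_on {s. Re s = a}" and nz: "\<And>t. f (Complex a t) \<noteq> 0"
  obtains F where "F 0 = 0" "\<And>t. (F has_vector_derivative (\<i> * (deriv f (Complex a t) / f (Complex a t)))) (at t)"
    "\<And>t. f (Complex a t) = f (of_real a) * exp (F t)"
proof -
  have ca: "continuous_on {s. Re s = a} (\<lambda>s. \<i> * (deriv f s / f s))"
  proof (intro continuous_intros analytic_imp_holomorphic[THEN holomorphic_on_imp_continuous_on] analytic_deriv f)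
    show "\<forall>s\<in>{s. Re s = a}. f s \<noteq> 0"
    proof
      fix s assume "s \<in> {s. Re s = a}"
      hence "s = Complex a (Im s)" by (simp add: complex_eq_iff)
      thus "f s \<noteq> 0" using nz by metis
    qed
  qed
  have c: "continuous_on UNIV (\<lambda>t. \<i> * (deriv f (Complex a t) / f (Complex a t)))"
    by (rule continuous_on_compose2[OF ca continuous_on_Complex]) auto
  obtain F where F: "F 0 = 0" "\<And>t. (F has_vector_derivative (\<i> * (deriv f (Complex a t) / f (Complex a t)))) (at t)"
    using antiderivative_real_line[OF c] by auto
  have df: "(f has_field_derivative deriv f (Complex a t)) (at (Complex a t))" for t
    using f by (intro analytic_derivI) (auto intro: analytic_on_subset)
  define G where "G = (\<lambda>t. f (Complex a t) * exp (- F t))"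
  have "(G has_vector_derivative 0) (at t)" for t
  proof -
    have "(G has_vector_derivative (f (Complex a t) * (- (\<i> * (deriv f (Complex a t) / f (Complex a t))) * exp (- F t))
        + (\<i> * deriv f (Complex a t)) * exp (- F t))) (at t)"
      unfolding G_def
    proof (rule has_vector_derivative_mult[OF has_vector_derivative_vertical[OF df]])
      have "((\<lambda>t. - F t) has_vector_derivative (- (\<i> * (deriv f (Complex a t) / f (Complex a t))))) (at t)"
        by (intro has_vector_derivative_minus F)
      from field_vector_diff_chain_at[OF this DERIV_exp]
      show "((\<lambda>t. exp (- F t)) has_vector_derivative (- (\<i> * (deriv f (Complex a t) / f (Complex a t))) * exp (- F t))) (at t)"
        by (simp add: o_def)
    qed
    thus ?thesis using nz[of t] by simp
  qed
  hence "\<exists>c. \<forall>t. G t = c"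
    using has_vector_derivative_zero_constant[of UNIV G] by force
  then obtain c where c: "\<And>t. G t = c" by blast
  have "c = f (of_real a)" using c[of 0] F(1) by (simp add: G_def complex_of_real_def)
  hence "f (Complex a t) = f (of_real a) * exp (F t)" for t
    using c[of t] by (simp add: G_def exp_minus field_simps)
  with F show ?thesis by (rule that)
qed

section \<open>The function A on and off the critical line\<close>

lemma A_fun_exp:
  "A_fun h \<theta> s = 1/2 * (exp (\<i> * of_real \<theta>) * riemann_xi (s + of_real h) + exp (- (\<i> * of_real \<theta>)) * riemann_xi (s - of_real h))"
proof -
  have e: "exp (\<i> * of_real \<theta>) = of_real (cos \<theta>) + \<i> * of_real (sin \<theta>)" by (simp add: exp_Euler cos_of_real sin_of_real)
  have e': "exp (- (\<i> * of_real \<theta>)) = of_real (cos \<theta>) - \<i> * of_real (sin \<theta>)"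
    using exp_Euler[of "- of_real \<theta>"] by (simp add: cos_of_real sin_of_real)
  show ?thesis unfolding A_fun_def e e' by (simp add: field_simps)
qed

lemma A_fun_nonzero_off_line:
  assumes h: "xi_admissible h" and s: "Re s \<noteq> 1/2" shows "A_fun h \<theta> s \<noteq> 0"
proof
  assume "A_fun h \<theta> s = 0"
  hence "exp (\<i> * of_real \<theta>) * riemann_xi (s + of_real h) = - (exp (- (\<i> * of_real \<theta>)) * riemann_xi (s - of_real h))"
    unfolding A_fun_exp by (simp add: eq_neg_iff_add_eq_0)
  hence "norm (exp (\<i> * of_real \<theta>) * riemann_xi (s + of_real h)) = norm (exp (- (\<i> * of_real \<theta>)) * riemann_xi (s - of_real h))"
    by (metis norm_minus_cancel)
  hence eq: "norm (riemann_xi (s + of_real h)) = norm (riemann_xi (s - of_real h))"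
    by (simp add: norm_mult norm_exp_eq_Re)
  show False
  proof (cases "Re s > 1/2")
    case True
    thus False using xi_shift_less[OF h True] eq by simp
  next
    case False
    hence "Re (1 - s) > 1/2" using s by simp
    from xi_shift_less[OF h this] have "norm (riemann_xi (1 - (s + of_real h))) < norm (riemann_xi (1 - (s - of_real h)))"
      by (simp add: algebra_simps)
    thus False using eq by (simp add: riemann_xi_reflect)
  qed
qed

text \<open>The point \<open>1/2 + i t - h\<close> is the mirror image of
  \<open>1/2 + h + i t\<close>, so the functional equation and conjugation make the two summands
  complex conjugates of each other.\<close>

lemma A_fun_critical_line:
  "A_fun h \<theta> (Complex (1/2) t) = of_real (Re (exp (\<i> * of_real \<theta>) * riemann_xi (Complex (1/2 + h) t)))"
proof -
  have 1: "Complex (1/2) t + of_real h = Complex (1/2 + h) t" by (simp add: complex_eq_iff)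
  have 2: "Complex (1/2) t - of_real h = 1 - cnj (Complex (1/2 + h) t)" by (simp add: complex_eq_iff)
  have "exp (- (\<i> * of_real \<theta>)) * cnj (riemann_xi (Complex (1/2 + h) t)) = cnj (exp (\<i> * of_real \<theta>) * riemann_xi (Complex (1/2 + h) t))"
    by (simp add: exp_cnj)
  thus ?thesis unfolding A_fun_exp 1 2 riemann_xi_reflect cnj_riemann_xi
    by (simp only: complex_add_cnj) simp
qed

lemma holomorphic_A_fun: "A_fun h \<theta> holomorphic_on S"
proof -
  have "(\<lambda>s. riemann_xi (s - of_real h)) holomorphic_on A" "(\<lambda>s. riemann_xi (s + of_real h)) holomorphic_on A" for A
    by (rule holomorphic_on_compose_gen[OF _ holomorphic_riemann_xi[of UNIV], unfolded o_def]; (intro holomorphic_intros | simp))+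
  thus ?thesis unfolding A_fun_exp by (intro holomorphic_intros)
qed

lemma riemann_xi_analytic: "riemann_xi analytic_on A"
  by (rule analytic_on_subset[OF _ subset_UNIV]) (simp add: analytic_on_open holomorphic_riemann_xi)

lemma riemann_xi_DERIV: "(riemann_xi has_field_derivative deriv riemann_xi s) (at s)"
  by (rule holomorphic_derivI[OF holomorphic_riemann_xi open_UNIV UNIV_I])

section \<open>The logarithmic derivative of xi\<close>

lemma riemann_xi_log_deriv:
  assumes s: "Re s > -1" and nz: "zeta_reg s \<noteq> 0"
  shows "deriv riemann_xi s / riemann_xi s = - of_real (ln pi) / 2 + Digamma (s / 2 + 1) / 2 + deriv zeta_reg s / zeta_reg s"
proof -
  have ni: "s / 2 + 1 \<notin> \<int>\<^sub>\<le>\<^sub>0" using s by (auto elim!: nonpos_Ints_cases dest!: arg_cong[where f = Re])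
  have dz: "(zeta_reg has_field_derivative deriv zeta_reg s) (at s)"
    using holomorphic_derivI[OF holomorphic_zeta_reg open_halfspace_Re_gt, of s] s by simp
  have dG: "((\<lambda>s. Gamma (s / 2 + 1)) has_field_derivative Gamma (s / 2 + 1) * Digamma (s / 2 + 1) / 2) (at s)"
    using ni by (auto intro!: derivative_eq_intros)
  have lp: "Ln (of_real pi) = of_real (ln pi)" by (rule Ln_of_real) simp
  have dp: "((\<lambda>s. of_real pi powr (- s / 2)) has_field_derivative of_real pi powr (- s / 2) * (- of_real (ln pi) / 2)) (at s)"
    unfolding powr_def by (auto intro!: derivative_eq_intros simp: lp)
  have "((\<lambda>s. of_real pi powr (- s / 2) * Gamma (s / 2 + 1) * zeta_reg s) has_field_derivative
     (of_real pi powr (- s / 2) * (- of_real (ln pi) / 2)) * Gamma (s / 2 + 1) * zeta_reg s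
     + of_real pi powr (- s / 2) * (Gamma (s / 2 + 1) * Digamma (s / 2 + 1) / 2) * zeta_reg s
     + of_real pi powr (- s / 2) * Gamma (s / 2 + 1) * deriv zeta_reg s) (at s)"
    by (rule DERIV_cong, rule DERIV_mult[OF DERIV_mult[OF dp dG] dz]) (simp add: algebra_simps)
  moreover have "\<forall>\<^sub>F w in nhds s. of_real pi powr (- w / 2) * Gamma (w / 2 + 1) * zeta_reg w = riemann_xi w"
    using eventually_nhds_in_open[OF open_halfspace_Re_gt, of s "-1"] s
    by (auto elim!: eventually_mono simp: riemann_xi_right)
  ultimately have "(riemann_xi has_field_derivative
     (of_real pi powr (- s / 2) * (- of_real (ln pi) / 2)) * Gamma (s / 2 + 1) * zeta_reg s
     + of_real pi powr (- s / 2) * (Gamma (s / 2 + 1) * Digamma (s / 2 + 1) / 2) * zeta_reg s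
     + of_real pi powr (- s / 2) * Gamma (s / 2 + 1) * deriv zeta_reg s) (at s)"
    by (subst (asm) DERIV_cong_ev[OF refl _ refl])
  hence d: "deriv riemann_xi s = of_real pi powr (- s / 2) * Gamma (s / 2 + 1) * zeta_reg s *
     (- of_real (ln pi) / 2 + Digamma (s / 2 + 1) / 2 + deriv zeta_reg s / zeta_reg s)"
    using nz by (simp add: DERIV_imp_deriv field_simps)
  have "Gamma (s / 2 + 1) \<noteq> 0" using ni by (simp add: Gamma_eq_zero_iff)
  thus ?thesis unfolding d using s nz by (simp add: riemann_xi_right)
qed

lemma norm_horizontal_deriv:
  "((\<lambda>\<sigma>. (norm (riemann_xi (Complex \<sigma> t)))\<^sup>2) has_real_derivative
     2 * Re (deriv riemann_xi (Complex \<sigma> t) * cnj (riemann_xi (Complex \<sigma> t)))) (at \<sigma>)"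
proof -
  have e: "Complex \<sigma> t = of_real \<sigma> + \<i> * of_real t" for \<sigma> by (simp add: Complex_eq)
  have "((\<lambda>z. riemann_xi (z + \<i> * of_real t)) has_field_derivative deriv riemann_xi (Complex \<sigma> t) * 1) (at (of_real \<sigma>))"
    by (rule DERIV_chain'[where f = "\<lambda>z. z + \<i> * of_real t" and g = riemann_xi])
      (use riemann_xi_DERIV in \<open>auto intro!: derivative_eq_intros simp: e\<close>)
  hence "((\<lambda>\<sigma>. riemann_xi (of_real \<sigma> + \<i> * of_real t)) has_vector_derivative deriv riemann_xi (Complex \<sigma> t)) (at \<sigma>)"
    using has_vector_derivative_real_field by fastforce
  hence v: "((\<lambda>\<sigma>. riemann_xi (Complex \<sigma> t)) has_vector_derivative deriv riemann_xi (Complex \<sigma> t)) (at \<sigma>)"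
    by (simp add: e)
  have dR: "((\<lambda>\<sigma>. Re (riemann_xi (Complex \<sigma> t))) has_real_derivative Re (deriv riemann_xi (Complex \<sigma> t))) (at \<sigma>)"
    and dI: "((\<lambda>\<sigma>. Im (riemann_xi (Complex \<sigma> t))) has_real_derivative Im (deriv riemann_xi (Complex \<sigma> t))) (at \<sigma>)"
    using v by (auto simp: has_vector_derivative_complex_iff has_real_derivative_iff_has_vector_derivative)
  show ?thesis unfolding cmod_power2
    by (rule derivative_eq_intros dR dI refl)+ (simp add: algebra_simps)
qed

text \<open>With \<open>a = 1/2 + h\<close>, the comparison at real part
  \<open>1/2 + \<epsilon>\<close> says after reflection that \<open>|\<xi>|\<close> at
  \<open>a - \<epsilon>\<close> is at most \<open>|\<xi>|\<close> at \<open>a + \<epsilon>\<close>.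
  Hence the horizontal derivative of \<open>|\<xi>|\<close> at \<open>a\<close> cannot be negative,
  and it has the sign of this real part, which is also the vertical derivative of the phase.\<close>

lemma Re_xi_log_deriv_nonneg:
  assumes h: "xi_admissible h"
  shows "Re (deriv riemann_xi (Complex (1/2 + h) t) / riemann_xi (Complex (1/2 + h) t)) \<ge> 0"
proof -
  define a where "a = 1/2 + h"
  define f where "f = (\<lambda>\<sigma>. (norm (riemann_xi (Complex \<sigma> t)))\<^sup>2)"
  define E where "E = riemann_xi (Complex a t)"
  define E' where "E' = deriv riemann_xi (Complex a t)"
  have le: "f (a - \<epsilon>) \<le> f (a + \<epsilon>)" if "\<epsilon> > 0" for \<epsilon>
  proof -
    have "norm (riemann_xi (Complex (1/2 + \<epsilon>) t - of_real h)) \<le> norm (riemann_xi (Complex (1/2 + \<epsilon>) t + of_real h))"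
      using that by (intro xi_shift_le[OF h]) auto
    moreover have "Complex (1/2 + \<epsilon>) t + of_real h = Complex (a + \<epsilon>) t" by (simp add: complex_eq_iff a_def)
    moreover have "Complex (1/2 + \<epsilon>) t - of_real h = 1 - cnj (Complex (a - \<epsilon>) t)" by (simp add: complex_eq_iff a_def)
    ultimately show ?thesis unfolding f_def by (simp add: norm_riemann_xi_reflect power_mono)
  qed
  have der: "(f has_real_derivative 2 * Re (E' * cnj E)) (at a)"
    unfolding f_def E_def E'_def by (rule norm_horizontal_deriv)
  have "2 * Re (E' * cnj E) \<ge> 0"
  proof (rule ccontr)
    assume "\<not> ?thesis"
    hence neg: "2 * Re (E' * cnj E) < 0" by simp
    obtain d1 where d1: "d1 > 0" "\<And>\<epsilon>. 0 < \<epsilon> \<Longrightarrow> \<epsilon> < d1 \<Longrightarrow> f (a + \<epsilon>) < f a"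
      using DERIV_neg_dec_right[OF der neg] by blast
    obtain d2 where d2: "d2 > 0" "\<And>\<epsilon>. 0 < \<epsilon> \<Longrightarrow> \<epsilon> < d2 \<Longrightarrow> f a < f (a - \<epsilon>)"
      using DERIV_neg_dec_left[OF der neg] by blast
    define \<epsilon> where "\<epsilon> = min d1 d2 / 2"
    have "0 < \<epsilon>" "\<epsilon> < d1" "\<epsilon> < d2" using d1(1) d2(1) by (auto simp: \<epsilon>_def)
    thus False using d1(2)[of \<epsilon>] d2(2)[of \<epsilon>] le[of \<epsilon>] by simp
  qed
  moreover have "Re (E' / E) = Re (E' * cnj E) / (norm E)\<^sup>2"
    by (simp add: complex_div_cnj[of E' E] Re_divide_of_real flip: of_real_power)
  ultimately have "Re (E' / E) \<ge> 0" by simp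
  thus ?thesis unfolding E_def E'_def a_def .
qed

subsection \<open>Zeros determined by a monotone phase\<close>

lemma card_int_interval:
  fixes x y :: real
  shows "finite {n::int. x \<le> of_int n \<and> of_int n \<le> y}"
    "y - x - 1 \<le> real (card {n::int. x \<le> of_int n \<and> of_int n \<le> y})"
    "x \<le> y \<Longrightarrow> real (card {n::int. x \<le> of_int n \<and> of_int n \<le> y}) \<le> y - x + 1"
proof -
  have e: "{n::int. x \<le> of_int n \<and> of_int n \<le> y} = {\<lceil>x\<rceil>..\<lfloor>y\<rfloor>}" by (auto simp: ceiling_le_iff le_floor_iff)
  show "finite {n::int. x \<le> of_int n \<and> of_int n \<le> y}" unfolding e by simp
  show "y - x - 1 \<le> real (card {n::int. x \<le> of_int n \<and> of_int n \<le> y})" unfolding e by simp linarith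
  show "x \<le> y \<Longrightarrow> real (card {n::int. x \<le> of_int n \<and> of_int n \<le> y}) \<le> y - x + 1" unfolding e by simp linarith
qed

text \<open>The real-variable part of the argument; \<open>\<phi> - S\<close> is the smooth main
  term and \<open>g\<close> its derivative. In \<open>S_flat\<close> the set \<open>B\<close>
  depends on \<open>T\<close>, and only the base point \<open>t\<close> has to avoid it, while
  \<open>v\<close> ranges over the whole window.\<close>

locale phase_zeros =
  fixes \<phi> S g :: "real \<Rightarrow> real" and \<gamma> :: "int \<Rightarrow> real" and c :: real
  assumes mono: "strict_mono \<phi>"
    and der: "\<And>t. ((\<lambda>t. \<phi> t - S t) has_real_derivative g t) (at t)"
    and g_asymp: "\<And>\<epsilon>. \<epsilon> > 0 \<Longrightarrow> \<forall>\<^sub>F t in at_top. \<bar>g t - ln t / 2\<bar> \<le> \<epsilon> * ln t \<and> \<bar>g (-t) - ln t / 2\<bar> \<le> \<epsilon> * ln t"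
    and S_small: "\<And>\<epsilon>. \<epsilon> > 0 \<Longrightarrow> \<forall>\<^sub>F t in at_top. \<bar>S t\<bar> \<le> \<epsilon> * (t * ln t) \<and> \<bar>S (-t)\<bar> \<le> \<epsilon> * (t * ln t)"
    and S_flat: "\<And>\<epsilon> C. \<epsilon> > 0 \<Longrightarrow> C > 0 \<Longrightarrow> \<forall>\<^sub>F T in at_top. \<exists>B\<in>lmeasurable. measure lebesgue B \<le> \<epsilon> * T \<and>
        (\<forall>t v. \<bar>t\<bar> \<le> T \<and> t \<notin> B \<and> \<bar>v - t\<bar> \<le> C / ln T \<longrightarrow> \<bar>S v - S t\<bar> \<le> \<epsilon>)"
    and zeros: "\<And>n. \<phi> (\<gamma> n) = pi * of_int n + c"
begin

lemma gamma_less_iff: "\<gamma> m < \<gamma> n \<longleftrightarrow> m < n"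
  using strict_mono_less[OF mono, of "\<gamma> m" "\<gamma> n"] by (simp add: zeros)

lemma gamma_le_iff: "\<gamma> m \<le> \<gamma> n \<longleftrightarrow> m \<le> n"
  using strict_mono_less_eq[OF mono, of "\<gamma> m" "\<gamma> n"] by (simp add: zeros)

lemma gamma_cover: obtains n where "\<gamma> n \<le> t" "t < \<gamma> (n + 1)"
proof
  define n where "n = \<lfloor>(\<phi> t - c) / pi\<rfloor>"
  have "of_int n \<le> (\<phi> t - c) / pi" "(\<phi> t - c) / pi < of_int n + 1" unfolding n_def by linarith+
  hence "pi * of_int n + c \<le> \<phi> t" "\<phi> t < pi * of_int (n + 1) + c" by (simp_all add: field_simps)
  thus "\<gamma> n \<le> t" "t < \<gamma> (n + 1)" unfolding zeros[symmetric]
    using strict_mono_less_eq[OF mono] strict_mono_less[OF mono] by auto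
qed

lemma index_set: "{n. \<bar>\<gamma> n\<bar> \<le> T} = {n. (\<phi> (-T) - c) / pi \<le> of_int n \<and> of_int n \<le> (\<phi> T - c) / pi}"
proof -
  have "\<bar>\<gamma> n\<bar> \<le> T \<longleftrightarrow> \<phi> (-T) \<le> \<phi> (\<gamma> n) \<and> \<phi> (\<gamma> n) \<le> \<phi> T" for n
    using strict_mono_less_eq[OF mono] by (auto simp: abs_le_iff)
  thus ?thesis unfolding zeros by (auto simp: field_simps)
qed

lemma finite_index: "finite {n. \<bar>\<gamma> n\<bar> \<le> T}"
  unfolding index_set by (rule card_int_interval)

lemma theta_growth:
  assumes "\<epsilon> > 0"
  shows "\<forall>\<^sub>F T in at_top. (\<phi> T - S T) - (\<phi> (-T) - S (-T)) \<le> (1 + \<epsilon>) * (T * ln T)"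
proof -
  define \<theta> where "\<theta> = (\<lambda>t. \<phi> t - S t)"
  obtain T0 where T0: "\<And>t. t \<ge> T0 \<Longrightarrow> \<bar>g t - ln t / 2\<bar> \<le> \<epsilon> / 8 * ln t \<and> \<bar>g (-t) - ln t / 2\<bar> \<le> \<epsilon> / 8 * ln t"
    using g_asymp[of "\<epsilon> / 8"] assms by (auto simp: eventually_at_top_linorder)
  define T1 where "T1 = max T0 1"
  define A where "A = \<bar>\<theta> T1\<bar> + \<bar>\<theta> (-T1)\<bar>"
  have "((\<lambda>T. A / (T * ln T)) \<longlongrightarrow> 0) at_top" by real_asymp
  hence "\<forall>\<^sub>F T in at_top. A / (T * ln T) < \<epsilon> / 2" using assms by (intro order_tendstoD) auto
  moreover have "\<forall>\<^sub>F T in at_top. T > T1" by (rule eventually_gt_at_top)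
  ultimately show ?thesis
  proof eventually_elim
    case (elim T)
    have T: "T > 1" "T > T0" using elim by (auto simp: T1_def)
    have lT: "T * ln T > 0" using T by simp
    have A: "A \<le> \<epsilon> / 2 * (T * ln T)" using elim(1) lT by (simp add: field_simps)
    have gb: "g t \<le> (1/2 + \<epsilon> / 8) * ln T" "g (-t) \<le> (1/2 + \<epsilon> / 8) * ln T" if "T1 \<le> t" "t \<le> T" for t
    proof -
      have t: "t \<ge> T0" "t \<ge> 1" using that by (auto simp: T1_def)
      have "ln t \<le> ln T" using that t by simp
      hence "(1/2 + \<epsilon> / 8) * ln t \<le> (1/2 + \<epsilon> / 8) * ln T" using assms by (intro mult_left_mono) auto
      moreover have "g t \<le> (1/2 + \<epsilon> / 8) * ln t" "g (-t) \<le> (1/2 + \<epsilon> / 8) * ln t"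
      proof -
        have e: "(1/2 + \<epsilon> / 8) * ln t = ln t / 2 + \<epsilon> / 8 * ln t" by (simp add: field_simps)
        show "g t \<le> (1/2 + \<epsilon> / 8) * ln t" "g (-t) \<le> (1/2 + \<epsilon> / 8) * ln t"
          using T0[OF t(1)] unfolding e abs_le_iff by linarith+
      qed
      ultimately show "g t \<le> (1/2 + \<epsilon> / 8) * ln T" "g (-t) \<le> (1/2 + \<epsilon> / 8) * ln T" by linarith+
    qed
    have pos: "(1/2 + \<epsilon> / 8) * ln T \<ge> 0" using T assms by simp
    have 1: "\<theta> T - \<theta> T1 \<le> (1/2 + \<epsilon> / 8) * ln T * T"
    proof -
      obtain z where z: "z > T1" "z < T" "\<theta> T - \<theta> T1 = (T - T1) * g z"
        using MVT2[of T1 T \<theta> g] der elim unfolding \<theta>_def by auto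
      have "(T - T1) * g z \<le> (T - T1) * ((1/2 + \<epsilon> / 8) * ln T)" using z gb by (intro mult_left_mono) auto
      also have "\<dots> \<le> T * ((1/2 + \<epsilon> / 8) * ln T)" using pos by (intro mult_right_mono) (auto simp: T1_def)
      finally show ?thesis using z by (simp add: mult.commute)
    qed
    have 2: "\<theta> (-T1) - \<theta> (-T) \<le> (1/2 + \<epsilon> / 8) * ln T * T"
    proof -
      obtain z where z: "z > -T" "z < -T1" "\<theta> (-T1) - \<theta> (-T) = (-T1 - -T) * g z"
        using MVT2[of "-T" "-T1" \<theta> g] der elim unfolding \<theta>_def by auto
      have "(-T1 - -T) * g z \<le> (-T1 - -T) * ((1/2 + \<epsilon> / 8) * ln T)" using z gb(2)[of "-z"] elim by (intro mult_left_mono) auto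
      also have "\<dots> \<le> T * ((1/2 + \<epsilon> / 8) * ln T)" using pos by (intro mult_right_mono) (auto simp: T1_def)
      finally show ?thesis using z by (simp add: mult.commute)
    qed
    have "\<theta> T - \<theta> (-T) \<le> 2 * ((1/2 + \<epsilon> / 8) * ln T * T) + A" using 1 2 unfolding A_def by linarith
    also have "\<dots> \<le> 2 * ((1/2 + \<epsilon> / 8) * ln T * T) + \<epsilon> / 2 * (T * ln T)" using A by simp
    also have "\<dots> = (1 + \<epsilon> / 4 + \<epsilon> / 2) * (T * ln T)" by (simp add: algebra_simps)
    also have "\<dots> \<le> (1 + \<epsilon>) * (T * ln T)" using assms lT by (intro mult_right_mono) auto
    finally show ?case unfolding \<theta>_def .
  qed
qed

text \<open>The zeros up to height \<open>T\<close> correspond to the integers in an interval of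
  length \<open>(\<phi> T - \<phi> (-T)) / \<pi>\<close>; \<open>S\<close> and the rounding error
  are absorbed into \<open>\<epsilon>\<close>.\<close>

lemma card_upper:
  assumes e: "\<epsilon> > 0"
  shows "\<forall>\<^sub>F T in at_top. real (card {n. \<bar>\<gamma> n\<bar> \<le> T}) \<le> (1 + \<epsilon>) * (T * ln T / pi)"
proof -
  have "((\<lambda>T::real. pi / (T * ln T)) \<longlongrightarrow> 0) at_top" by real_asymp
  hence "\<forall>\<^sub>F T::real in at_top. pi / (T * ln T) < \<epsilon> / 4" using e by (intro order_tendstoD) auto
  moreover have "\<forall>\<^sub>F T in at_top. (\<phi> T - S T) - (\<phi> (-T) - S (-T)) \<le> (1 + \<epsilon> / 4) * (T * ln T)"
    using e by (intro theta_growth) auto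
  moreover have "\<forall>\<^sub>F t in at_top. \<bar>S t\<bar> \<le> \<epsilon> / 4 * (t * ln t) \<and> \<bar>S (-t)\<bar> \<le> \<epsilon> / 4 * (t * ln t)"
    using e by (intro S_small) auto
  moreover have "\<forall>\<^sub>F T in at_top. T > (1::real)" by (rule eventually_gt_at_top)
  ultimately show ?thesis
  proof eventually_elim
    case (elim T)
    have lT: "T * ln T > 0" using elim by simp
    have p: "pi \<le> \<epsilon> / 4 * (T * ln T)" using elim(1) lT by (simp add: field_simps)
    have "\<phi> (-T) \<le> \<phi> T" using strict_mono_less_eq[OF mono] elim by simp
    hence le: "(\<phi> (-T) - c) / pi \<le> (\<phi> T - c) / pi" by (simp add: divide_right_mono)
    have "real (card {n. \<bar>\<gamma> n\<bar> \<le> T}) \<le> (\<phi> T - c) / pi - (\<phi> (-T) - c) / pi + 1"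
      unfolding index_set by (rule card_int_interval(3)[OF le])
    also have "\<dots> = (\<phi> T - \<phi> (-T) + pi) / pi" by (simp add: field_simps)
    also have "\<dots> \<le> ((1 + \<epsilon>) * (T * ln T)) / pi"
    proof (intro divide_right_mono)
      have "\<phi> T - \<phi> (-T) + pi \<le> (1 + \<epsilon> / 4) * (T * ln T) + \<epsilon> / 4 * (T * ln T) + \<epsilon> / 4 * (T * ln T) + \<epsilon> / 4 * (T * ln T)"
        using elim(2,3) p by linarith
      also have "\<dots> = (1 + \<epsilon>) * (T * ln T)" by (simp add: algebra_simps)
      finally show "\<phi> T - \<phi> (-T) + pi \<le> (1 + \<epsilon>) * (T * ln T)" .
    qed simp
    finally show ?case by simp
  qed
qed

text \<open>Excluding \<open>|t| < \<epsilon> T\<close> keeps \<open>ln |t|\<close> within a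
  constant of \<open>ln T\<close>, so one normalization serves all remaining zeros. The upper limit
  \<open>2 T\<close> leaves room for the windows around points of modulus at most
  \<open>T\<close>.\<close>

lemma g_uniform:
  assumes e: "\<epsilon> > 0" "\<epsilon> \<le> 1"
  shows "\<forall>\<^sub>F T in at_top. \<forall>t. \<epsilon> * T \<le> \<bar>t\<bar> \<and> \<bar>t\<bar> \<le> 2 * T \<longrightarrow>
    \<bar>g t - ln T / 2\<bar> \<le> \<epsilon> * ln T \<and> \<bar>ln (\<bar>t\<bar> / (2 * pi)) - ln T\<bar> \<le> \<epsilon> * ln T"
proof -
  obtain T0 where T0: "\<And>t. t \<ge> T0 \<Longrightarrow> \<bar>g t - ln t / 2\<bar> \<le> \<epsilon> / 4 * ln t \<and> \<bar>g (-t) - ln t / 2\<bar> \<le> \<epsilon> / 4 * ln t"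
    using g_asymp[of "\<epsilon> / 4"] e by (auto simp: eventually_at_top_linorder)
  define A where "A = 1 + ln 2 - ln \<epsilon> + ln (2 * pi)"
  have A1: "ln 2 \<le> A" "- ln \<epsilon> \<le> A" "ln (2 * pi) - ln \<epsilon> \<le> A" "A > 0" "ln 2 - ln (2 * pi) \<le> A"
  proof -
    have "ln \<epsilon> \<le> 0" "ln (2 * pi) \<ge> 0" "ln (2::real) \<ge> 0" using e pi_ge_two by (auto intro!: ln_ge_zero)
    thus "ln 2 \<le> A" "- ln \<epsilon> \<le> A" "ln (2 * pi) - ln \<epsilon> \<le> A" "A > 0" "ln 2 - ln (2 * pi) \<le> A"
      unfolding A_def by linarith+
  qed
  have "((\<lambda>T. A / ln T) \<longlongrightarrow> 0) at_top" by real_asymp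
  hence "\<forall>\<^sub>F T in at_top. A / ln T < \<epsilon> / 4" using e by (intro order_tendstoD) auto
  moreover have "\<forall>\<^sub>F T in at_top. T > max 2 (max T0 1 / \<epsilon>)" by (rule eventually_gt_at_top)
  ultimately show ?thesis
  proof eventually_elim
    case (elim T)
    have T: "T > 2" "\<epsilon> * T > T0" "\<epsilon> * T > 1" using elim e by (auto simp: field_simps)
    have l: "ln T > 0" using T by simp
    have A: "A \<le> \<epsilon> / 4 * ln T" using elim(1) l by (simp add: field_simps)
    show ?case
    proof (intro allI impI)
      fix t assume t: "\<epsilon> * T \<le> \<bar>t\<bar> \<and> \<bar>t\<bar> \<le> 2 * T"
      have "ln (\<epsilon> * T) \<le> ln \<bar>t\<bar>" using t T by (intro ln_mono) auto
      hence a: "ln \<epsilon> + ln T \<le> ln \<bar>t\<bar>" using e T by (simp add: ln_mult)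
      have "ln \<bar>t\<bar> \<le> ln (2 * T)" using t T by (intro ln_mono) auto
      hence b: "ln \<bar>t\<bar> \<le> ln 2 + ln T" using T by (simp add: ln_mult)
      have ab: "\<bar>ln \<bar>t\<bar> - ln T\<bar> \<le> \<epsilon> / 4 * ln T" using a b A A1 by linarith
      have g: "\<bar>g t - ln \<bar>t\<bar> / 2\<bar> \<le> \<epsilon> / 4 * ln \<bar>t\<bar>"
        using T0[of "\<bar>t\<bar>"] t T by (cases "t \<ge> 0") auto
      have "\<epsilon> / 4 * ln \<bar>t\<bar> \<le> \<epsilon> / 4 * (2 * ln T)"
      proof (intro mult_left_mono)
        have "\<epsilon> / 4 * ln T \<le> 1 * ln T" using e l by (intro mult_right_mono) auto
        thus "ln \<bar>t\<bar> \<le> 2 * ln T" using ab by linarith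
      qed (use e in auto)
      hence "\<bar>g t - ln T / 2\<bar> \<le> \<epsilon> / 4 * (2 * ln T) + \<epsilon> / 4 * ln T" using g ab by linarith
      also have "\<dots> \<le> \<epsilon> * ln T" using e l by simp
      finally have 1: "\<bar>g t - ln T / 2\<bar> \<le> \<epsilon> * ln T" .
      have t0: "\<bar>t\<bar> > 0" using t T by linarith
      have "ln (\<bar>t\<bar> / (2 * pi)) = ln \<bar>t\<bar> - ln (2 * pi)" using t0 by (subst ln_div) auto
      hence "\<bar>ln (\<bar>t\<bar> / (2 * pi)) - ln T\<bar> \<le> A" using a b A1 by linarith
      also have "\<dots> \<le> \<epsilon> * ln T" 
      proof -
        have "\<epsilon> * ln T > 0" using e l by simp
        moreover have "A * 4 \<le> \<epsilon> * ln T" using A by simp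
        ultimately show ?thesis using A1 by linarith
      qed
      finally show "\<bar>g t - ln T / 2\<bar> \<le> \<epsilon> * ln T \<and> \<bar>ln (\<bar>t\<bar> / (2 * pi)) - ln T\<bar> \<le> \<epsilon> * ln T" using 1 by simp
    qed
  qed
qed

text \<open>Between consecutive zeros the phase grows by \<open>\<pi>\<close>. If \<open>S\<close>
  is almost constant near \<open>t\<close>, this growth is, up to \<open>2 \<epsilon>\<close>, the
  length of the gap times a value of \<open>g\<close>, that is, about \<open>ln T / 2\<close> times
  the length.\<close>

lemma good_index:
  assumes e: "\<epsilon> > 0" "\<epsilon> \<le> 1/20" and T: "T > 1" "20 / ln T \<le> \<epsilon> * T" "20 / ln T \<le> T"
    and gu: "\<And>t. \<epsilon> * T \<le> \<bar>t\<bar> \<Longrightarrow> \<bar>t\<bar> \<le> 2 * T \<Longrightarrow>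
        \<bar>g t - ln T / 2\<bar> \<le> \<epsilon> * ln T \<and> \<bar>ln (\<bar>t\<bar> / (2 * pi)) - ln T\<bar> \<le> \<epsilon> * ln T"
    and flat: "\<And>v. \<bar>v - t\<bar> \<le> 20 / ln T \<Longrightarrow> \<bar>S v - S t\<bar> \<le> \<epsilon>"
    and t: "2 * \<epsilon> * T \<le> \<bar>t\<bar>" "\<bar>t\<bar> \<le> T" "\<gamma> n \<le> t" "t \<le> \<gamma> (n + 1)"
  shows "\<gamma> (n + 1) - \<gamma> n \<le> (1 + 5 * \<epsilon>) * (2 * pi / ln T)" "\<bar>normalized_spacing \<gamma> n - 1\<bar> \<le> 7 * \<epsilon>"
proof -
  define l where "l = ln T"
  have l: "l > 0" using T by (simp add: l_def)
  \<comment> \<open>The slope of \<open>\<theta>\<close> is at least \<open>9/20 * l\<close> in the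
    window, so on either side of \<open>t\<close> it rises by at least 9, more than
    \<open>\<pi>\<close> plus the oscillation of \<open>S\<close>. Both zeros enclosing
    \<open>t\<close> therefore lie within distance \<open>u\<close>, where the estimates
    apply.\<close>
  define u where "u = 20 / l"
  have u: "u > 0" "u * l = 20" "u \<le> \<epsilon> * T" "u \<le> T" using l T by (auto simp: u_def l_def)
  define \<theta> where "\<theta> = (\<lambda>t. \<phi> t - S t)"
  have rng: "\<epsilon> * T \<le> \<bar>v\<bar>" "\<bar>v\<bar> \<le> 2 * T" if "\<bar>v - t\<bar> \<le> u" for v
    using that t u by auto
  have mvt: "\<exists>z. x < z \<and> z < y \<and> \<theta> y - \<theta> x = (y - x) * g z" if "x < y" for x y
    using MVT2[OF that, of \<theta> g] der unfolding \<theta>_def by auto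
  have gb: "\<bar>g v - l / 2\<bar> \<le> \<epsilon> * l" if "\<bar>v - t\<bar> \<le> u" for v
    using gu[OF rng[OF that]] by (simp add: l_def)
  have el: "\<epsilon> * l \<le> l / 20" using e l mult_right_mono[of \<epsilon> "1/20" l] by simp
  have up: "\<gamma> (n + 1) < t + u"
  proof -
    obtain z where z: "t < z" "z < t + u" "\<theta> (t + u) - \<theta> t = (t + u - t) * g z" using mvt[of t "t + u"] u by auto
    have "g z \<ge> 9 / 20 * l" using gb[of z] z el by (auto simp: abs_le_iff)
    hence "u * g z \<ge> u * (9 / 20 * l)" using u by (intro mult_left_mono) auto
    moreover have "u * (9 / 20 * l) = 9" using u(2) by (simp add: mult.commute)
    moreover have "\<theta> (t + u) - \<theta> t = u * g z" using z(3) by simp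
    ultimately have "\<theta> (t + u) - \<theta> t \<ge> 9" by linarith
    moreover have "\<bar>S (t + u) - S t\<bar> \<le> \<epsilon>" using u by (intro flat) (auto simp: u_def l_def)
    ultimately have "\<phi> (t + u) - \<phi> t > pi" unfolding \<theta>_def using e pi_less_4 by linarith
    moreover have "\<phi> (\<gamma> n) \<le> \<phi> t" using strict_mono_less_eq[OF mono] t by simp
    ultimately have "\<phi> (\<gamma> (n + 1)) < \<phi> (t + u)" by (simp add: zeros algebra_simps)
    thus ?thesis using strict_mono_less[OF mono] by simp
  qed
  have lo: "\<gamma> n > t - u"
  proof -
    obtain z where z: "t - u < z" "z < t" "\<theta> t - \<theta> (t - u) = (t - (t - u)) * g z" using mvt[of "t - u" t] u by auto
    have "g z \<ge> 9 / 20 * l" using gb[of z] z el by (auto simp: abs_le_iff)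
    hence "u * g z \<ge> u * (9 / 20 * l)" using u by (intro mult_left_mono) auto
    moreover have "u * (9 / 20 * l) = 9" using u(2) by (simp add: mult.commute)
    moreover have "\<theta> t - \<theta> (t - u) = u * g z" using z(3) by simp
    ultimately have "\<theta> t - \<theta> (t - u) \<ge> 9" by linarith
    moreover have "\<bar>S (t - u) - S t\<bar> \<le> \<epsilon>" using u by (intro flat) (auto simp: u_def l_def)
    ultimately have "\<phi> t - \<phi> (t - u) > pi" unfolding \<theta>_def using e pi_less_4 by linarith
    moreover have "\<phi> t \<le> \<phi> (\<gamma> (n + 1))" using strict_mono_less_eq[OF mono] t by simp
    ultimately have "\<phi> (t - u) < \<phi> (\<gamma> n)" by (simp add: zeros algebra_simps)
    thus ?thesis using strict_mono_less[OF mono] by simp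
  qed
  define D where "D = \<gamma> (n + 1) - \<gamma> n"
  have D: "D > 0" using gamma_less_iff[of n "n + 1"] by (simp add: D_def)
  obtain z where z: "\<gamma> n < z" "z < \<gamma> (n + 1)" "\<theta> (\<gamma> (n + 1)) - \<theta> (\<gamma> n) = D * g z"
    using mvt[of "\<gamma> n" "\<gamma> (n + 1)"] D unfolding D_def by auto
  have "\<bar>g z - l / 2\<bar> \<le> \<epsilon> * l" using z up lo by (intro gb) auto
  hence "D * \<bar>g z - l / 2\<bar> \<le> D * (\<epsilon> * l)" using D by (intro mult_left_mono) auto
  hence Dg: "\<bar>D * g z - D * l / 2\<bar> \<le> \<epsilon> * (D * l)" 
  proof -
    have e: "D * g z - D * l / 2 = D * (g z - l / 2)" by (simp add: field_simps)
    show ?thesis using D \<open>D * \<bar>g z - l / 2\<bar> \<le> D * (\<epsilon> * l)\<close> unfolding e abs_mult by (simp add: mult_ac)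
  qed
  have "\<bar>S (\<gamma> (n + 1)) - S t\<bar> \<le> \<epsilon>" "\<bar>S (\<gamma> n) - S t\<bar> \<le> \<epsilon>"
    using up lo t u by (intro flat; force simp: u_def l_def)+
  hence "\<bar>pi - D * g z\<bar> \<le> 2 * \<epsilon>"
    using z(3) unfolding \<theta>_def by (simp add: zeros algebra_simps)
  hence main: "\<bar>pi - D * l / 2\<bar> \<le> 2 * \<epsilon> + \<epsilon> * (D * l)" using Dg by linarith
  \<comment> \<open>The gap normalized by \<open>ln T\<close>, which differs from 1 by at most
    \<open>5 \<epsilon>\<close>. Replacing \<open>ln T\<close> by the logarithm at the zero itself
    costs another \<open>2 \<epsilon>\<close>, because \<open>y \<le> 2\<close>.\<close>
  define y where "y = D * l / (2 * pi)"
  have y0: "y > 0" using D l by (simp add: y_def)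
  have Dl: "D * l = 2 * pi * y" by (simp add: y_def)
  have "\<bar>pi * (1 - y)\<bar> \<le> 2 * \<epsilon> + \<epsilon> * (2 * pi * y)" using main unfolding Dl by (simp add: algebra_simps)
  hence "pi * \<bar>1 - y\<bar> \<le> pi * (\<epsilon> + 2 * \<epsilon> * y)"
  proof -
    have "\<bar>pi * (1 - y)\<bar> = pi * \<bar>1 - y\<bar>" by (simp add: abs_mult)
    moreover have "2 * \<epsilon> \<le> pi * \<epsilon>" using mult_right_mono[OF pi_ge_two, of \<epsilon>] e by simp
    moreover have "pi * (\<epsilon> + 2 * \<epsilon> * y) = pi * \<epsilon> + \<epsilon> * (2 * pi * y)" by (simp add: algebra_simps)
    ultimately show ?thesis using \<open>\<bar>pi * (1 - y)\<bar> \<le> 2 * \<epsilon> + \<epsilon> * (2 * pi * y)\<close> by linarith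
  qed
  hence yy: "\<bar>1 - y\<bar> \<le> \<epsilon> + 2 * \<epsilon> * y" by simp
  have "2 * \<epsilon> * y \<le> 1 / 10 * y" using e y0 by (intro mult_right_mono) auto
  hence y2: "y \<le> 2" using yy e by (auto simp: abs_le_iff)
  have "2 * \<epsilon> * y \<le> 2 * \<epsilon> * 2" using e y2 by (intro mult_left_mono) auto
  hence y5: "\<bar>1 - y\<bar> \<le> 5 * \<epsilon>" using yy by linarith
  have "D = y * (2 * pi / l)" using l by (simp add: y_def)
  also have "\<dots> \<le> (1 + 5 * \<epsilon>) * (2 * pi / l)" using y5 l by (intro mult_right_mono) (auto simp: abs_le_iff)
  finally show "\<gamma> (n + 1) - \<gamma> n \<le> (1 + 5 * \<epsilon>) * (2 * pi / ln T)" by (simp add: D_def l_def)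
  define r where "r = ln (\<bar>\<gamma> n\<bar> / (2 * pi))"
  have rl: "\<bar>r - l\<bar> \<le> \<epsilon> * l" unfolding r_def l_def
    using gu[OF rng, of "\<gamma> n"] lo t u by auto
  have "normalized_spacing \<gamma> n = y * (r / l)"
    unfolding normalized_spacing_def y_def D_def r_def using l by simp
  moreover have "\<bar>r / l - 1\<bar> \<le> \<epsilon>"
  proof -
    have "r / l - 1 = (r - l) / l" using l by (simp add: field_simps)
    thus ?thesis using rl l by (simp add: abs_divide field_simps)
  qed
  hence "\<bar>y * (r / l - 1)\<bar> \<le> 2 * \<epsilon>" unfolding abs_mult using y0 y2 by (intro mult_mono) auto
  hence "\<bar>y * (r / l) - y\<bar> \<le> 2 * \<epsilon>" by (simp add: algebra_simps)
  moreover have "\<bar>q - 1\<bar> \<le> 7 * \<epsilon>" if "\<bar>q - y\<bar> \<le> 2 * \<epsilon>" for q using that y5 by linarith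
  ultimately show "\<bar>normalized_spacing \<gamma> n - 1\<bar> \<le> 7 * \<epsilon>" by simp
qed

text \<open>Good gaps cover \<open>[-T, T]\<close> up to measure \<open>5 \<epsilon> T\<close> and
  are not too long, so there are at least \<open>(1 - 8 \<epsilon>) X\<close> of them, where
  \<open>X = T ln T / \<pi>\<close>. The number of all zeros is at most
  \<open>(1 + \<epsilon>) X\<close>. The second conjunct falls out of the same count and later turns
  the bound into a proportion.\<close>

lemma bad_count_aux:
  assumes e: "\<epsilon> > 0" "\<epsilon> \<le> 1/40"
  shows "\<forall>\<^sub>F T in at_top. real (card {n. \<bar>\<gamma> n\<bar> \<le> T \<and> \<bar>normalized_spacing \<gamma> n - 1\<bar> > 7 * \<epsilon>}) \<le> 10 * \<epsilon> * (T * ln T / pi)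
     \<and> real (card {n. \<bar>\<gamma> n\<bar> \<le> T}) \<ge> 1/2 * (T * ln T / pi)"
proof -
  have "((\<lambda>T::real. 20 / ln T / T) \<longlongrightarrow> 0) at_top" by real_asymp
  hence "\<forall>\<^sub>F T::real in at_top. 20 / ln T / T < \<epsilon>" using e by (intro order_tendstoD) auto
  moreover have "((\<lambda>T::real. pi / (T * ln T)) \<longlongrightarrow> 0) at_top" by real_asymp
  hence "\<forall>\<^sub>F T::real in at_top. pi / (T * ln T) < \<epsilon>" using e by (intro order_tendstoD) auto
  moreover have "\<forall>\<^sub>F T in at_top. T > (1::real)" by (rule eventually_gt_at_top)
  moreover have "\<forall>\<^sub>F T in at_top. \<forall>t. \<epsilon> * T \<le> \<bar>t\<bar> \<and> \<bar>t\<bar> \<le> 2 * T \<longrightarrow>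
    \<bar>g t - ln T / 2\<bar> \<le> \<epsilon> * ln T \<and> \<bar>ln (\<bar>t\<bar> / (2 * pi)) - ln T\<bar> \<le> \<epsilon> * ln T" using e by (intro g_uniform) auto
  moreover have "\<forall>\<^sub>F T in at_top. real (card {n. \<bar>\<gamma> n\<bar> \<le> T}) \<le> (1 + \<epsilon>) * (T * ln T / pi)"
    using e by (intro card_upper) auto
  moreover have "\<forall>\<^sub>F T in at_top. \<exists>B\<in>lmeasurable. measure lebesgue B \<le> \<epsilon> * T \<and>
        (\<forall>t v. \<bar>t\<bar> \<le> T \<and> t \<notin> B \<and> \<bar>v - t\<bar> \<le> 20 / ln T \<longrightarrow> \<bar>S v - S t\<bar> \<le> \<epsilon>)" using e by (intro S_flat) auto
  ultimately show ?thesis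
  proof eventually_elim
    case (elim T)
    have T: "T > 1" "T > 0" using elim by auto
    have uT: "20 / ln T \<le> \<epsilon> * T" using elim(1) T by (simp add: divide_simps) (simp add: algebra_simps)
    have "\<epsilon> * T \<le> 1 * T" using e T by (intro mult_right_mono) auto
    hence uT': "20 / ln T \<le> T" using uT by linarith
    obtain B where B: "B \<in> lmeasurable" "measure lebesgue B \<le> \<epsilon> * T"
       "\<And>t v. \<bar>t\<bar> \<le> T \<Longrightarrow> t \<notin> B \<Longrightarrow> \<bar>v - t\<bar> \<le> 20 / ln T \<Longrightarrow> \<bar>S v - S t\<bar> \<le> \<epsilon>" using elim(6) by blast
    define X where "X = T * ln T / pi"
    have X: "X > 0" using T by (simp add: X_def)
    have X1: "1 \<le> \<epsilon> * X" using elim(2) T by (simp add: X_def field_simps)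
    define P where "P = {t. 2 * \<epsilon> * T \<le> \<bar>t\<bar> \<and> \<bar>t\<bar> \<le> T \<and> t \<notin> B}"
    define G where "G = {n. \<exists>t\<in>P. \<gamma> n \<le> t \<and> t \<le> \<gamma> (n + 1)}"
    have good: "\<gamma> (n + 1) - \<gamma> n \<le> (1 + 5 * \<epsilon>) * (2 * pi / ln T)" "\<bar>normalized_spacing \<gamma> n - 1\<bar> \<le> 7 * \<epsilon>" if "n \<in> G" for n
    proof -
      obtain t where t: "t \<in> P" "\<gamma> n \<le> t" "t \<le> \<gamma> (n + 1)" using \<open>n \<in> G\<close> by (auto simp: G_def)
      have tt: "2 * \<epsilon> * T \<le> \<bar>t\<bar>" "\<bar>t\<bar> \<le> T" "t \<notin> B" using t by (auto simp: P_def)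
      have fl: "\<bar>S v - S t\<bar> \<le> \<epsilon>" if "\<bar>v - t\<bar> \<le> 20 / ln T" for v using B(3) tt that by blast
      have gu: "\<bar>g t - ln T / 2\<bar> \<le> \<epsilon> * ln T \<and> \<bar>ln (\<bar>t\<bar> / (2 * pi)) - ln T\<bar> \<le> \<epsilon> * ln T"
        if "\<epsilon> * T \<le> \<bar>t\<bar>" "\<bar>t\<bar> \<le> 2 * T" for t using elim(4) that by blast
      show "\<gamma> (n + 1) - \<gamma> n \<le> (1 + 5 * \<epsilon>) * (2 * pi / ln T)" "\<bar>normalized_spacing \<gamma> n - 1\<bar> \<le> 7 * \<epsilon>"
        using good_index[of \<epsilon> T t n] e T uT uT' gu fl tt t by auto
    qed
    define N where "N = {n. \<bar>\<gamma> n\<bar> \<le> T}"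
    have finN: "finite N" unfolding N_def by (rule finite_index)
    \<comment> \<open>A gap that meets \<open>[-T, T]\<close> but has its left end outside contains
      \<open>- T\<close>, and at most one gap does so with left end below
      \<open>- T\<close>.\<close>
    have GN: "\<exists>m. G - N \<subseteq> {m}"
    proof (cases "G - N = {}")
      case False
      then obtain m where m: "m \<in> G - N" by auto
      have edge: "\<gamma> n < - T \<and> - T \<le> \<gamma> (n + 1)" if "n \<in> G - N" for n
      proof -
        from that obtain t where "\<bar>t\<bar> \<le> T" "\<gamma> n \<le> t" "t \<le> \<gamma> (n + 1)" "\<not> \<bar>\<gamma> n\<bar> \<le> T"
          by (auto simp: G_def P_def N_def)
        thus ?thesis by auto
      qed
      have "n = m" if "n \<in> G - N" for n
      proof (rule ccontr)
        assume "n \<noteq> m"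
        hence "n + 1 \<le> m \<or> m + 1 \<le> n" by linarith
        hence "\<gamma> (n + 1) \<le> \<gamma> m \<or> \<gamma> (m + 1) \<le> \<gamma> n" by (simp only: gamma_le_iff)
        thus False using edge[OF m] edge[OF that] by linarith
      qed
      thus ?thesis by blast
    qed auto
    then obtain m where m: "G - N \<subseteq> {m}" by blast
    have finG: "finite G" by (rule finite_subset[of _ "N \<union> {m}"]) (use m finN in auto)
    have "card G \<le> card ((G \<inter> N) \<union> {m})" by (intro card_mono) (use m finN in auto)
    also have "\<dots> \<le> card (G \<inter> N) + 1" by (rule order_trans[OF card_Un_le]) simp
    finally have cG: "real (card G) \<le> real (card (G \<inter> N)) + 1" by linarith
    \<comment> \<open>Lengths are compared: every point with
      \<open>2 \<epsilon> T \<le> |t| \<le> T\<close> lies in \<open>B\<close> or in a good gap,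
      namely in the gap that contains it.\<close>
    have meas: "2 * (T - 2 * \<epsilon> * T) \<le> \<epsilon> * T + real (card G) * ((1 + 5 * \<epsilon>) * (2 * pi / ln T))"
    proof -
      let ?I = "\<lambda>n. {\<gamma> n .. \<gamma> (n + 1)}"
      have eT: "2 * \<epsilon> * T \<le> T" "2 * \<epsilon> * T > 0" using e T by auto
      have "{-T..-(2 * \<epsilon> * T)} \<union> {2 * \<epsilon> * T..T} \<subseteq> B \<union> (\<Union>n\<in>G. ?I n)"
      proof
        fix t assume "t \<in> {-T..-(2 * \<epsilon> * T)} \<union> {2 * \<epsilon> * T..T}"
        hence "-T \<le> t \<and> t \<le> -(2 * \<epsilon> * T) \<or> 2 * \<epsilon> * T \<le> t \<and> t \<le> T" by (simp only: Un_iff atLeastAtMost_iff)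
        hence tt: "2 * \<epsilon> * T \<le> \<bar>t\<bar>" "\<bar>t\<bar> \<le> T" using eT by linarith+
        obtain n where n: "\<gamma> n \<le> t" "t < \<gamma> (n + 1)" by (rule gamma_cover)
        show "t \<in> B \<union> (\<Union>n\<in>G. ?I n)"
        proof (cases "t \<in> B")
          case False
          hence "n \<in> G" unfolding G_def P_def using tt n by force
          thus ?thesis using n by force
        qed auto
      qed
      hence "measure lebesgue ({-T..-(2 * \<epsilon> * T)} \<union> {2 * \<epsilon> * T..T}) \<le> measure lebesgue (B \<union> (\<Union>n\<in>G. ?I n))"
        using B finG by (intro measure_mono_fmeasurable fmeasurable.Un fmeasurable.finite_UN) auto
      also have "\<dots> \<le> measure lebesgue B + measure lebesgue (\<Union>n\<in>G. ?I n)"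
        using B finG by (intro measure_Un_le) (auto dest: fmeasurableD)
      also have "measure lebesgue (\<Union>n\<in>G. ?I n) \<le> (\<Sum>n\<in>G. measure lebesgue (?I n))"
        using finG by (intro measure_UNION_le) auto
      also have "\<dots> \<le> (\<Sum>n\<in>G. (1 + 5 * \<epsilon>) * (2 * pi / ln T))"
        using good(1) gamma_le_iff by (intro sum_mono) auto
      also have "\<dots> = real (card G) * ((1 + 5 * \<epsilon>) * (2 * pi / ln T))" by simp
      also have "measure lebesgue ({-T..-(2 * \<epsilon> * T)} \<union> {2 * \<epsilon> * T..T}) = measure lebesgue {-T..-(2 * \<epsilon> * T)} + measure lebesgue {2 * \<epsilon> * T..T}"
        using eT by (intro measure_Un2 [THEN trans]) (auto simp: Diff_triv)
      also have "\<dots> = 2 * (T - 2 * \<epsilon> * T)" using eT by simp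
      finally show ?thesis using B(2) by linarith
    qed
    have lowG: "(1 - 8 * \<epsilon>) * X \<le> real (card G)"
    proof -
      have "T * (2 - 5 * \<epsilon>) \<le> real (card G) * ((1 + 5 * \<epsilon>) * (2 * pi / ln T))" using meas by (simp add: algebra_simps)
      hence "T * (2 - 5 * \<epsilon>) * (ln T / (2 * pi)) \<le> real (card G) * ((1 + 5 * \<epsilon>) * (2 * pi / ln T)) * (ln T / (2 * pi))"
        using T by (intro mult_right_mono) auto
      also have "\<dots> = real (card G) * (1 + 5 * \<epsilon>)" using T by (simp add: field_simps)
      finally have a: "(1 - 5 / 2 * \<epsilon>) * X \<le> real (card G) * (1 + 5 * \<epsilon>)" by (simp add: X_def field_simps)
      \<comment> \<open>The left side is
        \<open>1 - 3 \<epsilon> - 40 \<epsilon>\<^sup>2\<close>.\<close>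
      have "(1 - 8 * \<epsilon>) * (1 + 5 * \<epsilon>) \<le> 1 - 5 / 2 * \<epsilon>" using e by (simp add: algebra_simps) 
      hence "(1 - 8 * \<epsilon>) * (1 + 5 * \<epsilon>) * X \<le> (1 - 5 / 2 * \<epsilon>) * X" using X by (intro mult_right_mono) auto
      hence "((1 - 8 * \<epsilon>) * X) * (1 + 5 * \<epsilon>) \<le> real (card G) * (1 + 5 * \<epsilon>)" using a by (simp add: algebra_simps)
      thus ?thesis using e by (simp add: mult_le_cancel_right)
    qed
    have "real (card {n. \<bar>\<gamma> n\<bar> \<le> T \<and> \<bar>normalized_spacing \<gamma> n - 1\<bar> > 7 * \<epsilon>}) \<le> real (card (N - (G \<inter> N)))"
      using finN by (intro of_nat_mono card_mono) (auto simp: N_def dest!: good(2))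
    also have "\<dots> = real (card N) - real (card (G \<inter> N))"
      using finN by (subst card_Diff_subset) (auto simp: of_nat_diff card_mono)
    also have "\<dots> \<le> (1 + \<epsilon>) * X - ((1 - 8 * \<epsilon>) * X - 1)"
    proof -
      have "real (card N) \<le> (1 + \<epsilon>) * X" using elim(5) unfolding N_def X_def .
      thus ?thesis using cG lowG by linarith
    qed
    also have "\<dots> \<le> 10 * \<epsilon> * X" using X1 by (simp add: algebra_simps)
    finally have 1: "real (card {n. \<bar>\<gamma> n\<bar> \<le> T \<and> \<bar>normalized_spacing \<gamma> n - 1\<bar> > 7 * \<epsilon>}) \<le> 10 * \<epsilon> * X" .
    have "card (G \<inter> N) \<le> card N" using finN by (intro card_mono) auto
    hence "real (card N) \<ge> (1 - 8 * \<epsilon>) * X - \<epsilon> * X" using cG lowG X1 by linarith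
    also have "(1 - 8 * \<epsilon>) * X - \<epsilon> * X = (1 - 9 * \<epsilon>) * X" by (simp add: algebra_simps)
    finally have "(1 - 9 * \<epsilon>) * X \<le> real (card N)" .
    moreover have "1/2 * X \<le> (1 - 9 * \<epsilon>) * X" using e X by (intro mult_right_mono) auto
    ultimately show ?case using 1 unfolding X_def N_def by simp
  qed
qed

lemma bad_count:
  assumes e: "\<epsilon> > 0"
  shows "\<forall>\<^sub>F T in at_top. real (card {n. \<bar>\<gamma> n\<bar> \<le> T \<and> \<bar>normalized_spacing \<gamma> n - 1\<bar> > \<epsilon>}) \<le> \<epsilon> * real (card {n. \<bar>\<gamma> n\<bar> \<le> T})"
proof -
  \<comment> \<open>With at most \<open>10 d X\<close> bad gaps and at least \<open>X / 2\<close>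
    zeros, where \<open>X = T ln T / \<pi>\<close>, the proportion is at most \<open>20 d\<close>.
    The second bound is the range in which the count is available.\<close>
  define d where "d = min (\<epsilon> / 20) (1 / 40)"
  have d: "d > 0" "d \<le> 1/40" "20 * d \<le> \<epsilon>" using e by (auto simp: d_def)
  show ?thesis using bad_count_aux[OF d(1,2)]
  proof eventually_elim
    case (elim T)
    have "card {n. \<bar>\<gamma> n\<bar> \<le> T \<and> \<bar>normalized_spacing \<gamma> n - 1\<bar> > \<epsilon>} \<le> card {n. \<bar>\<gamma> n\<bar> \<le> T \<and> \<bar>normalized_spacing \<gamma> n - 1\<bar> > 7 * d}"
      using d finite_index[of T] by (intro card_mono) auto
    hence "real (card {n. \<bar>\<gamma> n\<bar> \<le> T \<and> \<bar>normalized_spacing \<gamma> n - 1\<bar> > \<epsilon>}) \<le> 10 * d * (T * ln T / pi)"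
      using elim by linarith
    also have "\<dots> = 20 * d * (1/2 * (T * ln T / pi))" by simp
    also have "\<dots> \<le> 20 * d * real (card {n. \<bar>\<gamma> n\<bar> \<le> T})" using elim d by (intro mult_left_mono) auto
    also have "\<dots> \<le> \<epsilon> * real (card {n. \<bar>\<gamma> n\<bar> \<le> T})" using d by (intro mult_right_mono) auto
    finally show ?case .
  qed
qed

lemma card_at_top: "filterlim (\<lambda>T. real (card {n. \<bar>\<gamma> n\<bar> \<le> T})) at_top at_top"
proof -
  have "filterlim (\<lambda>T::real. 1/2 * (T * ln T / pi)) at_top at_top" by real_asymp
  moreover have "\<forall>\<^sub>F T in at_top. real (card {n. \<bar>\<gamma> n\<bar> \<le> T}) \<ge> 1/2 * (T * ln T / pi)"
    using bad_count_aux[of "1/40"] by (auto elim: eventually_mono)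
  ultimately show ?thesis by (rule filterlim_at_top_mono)
qed

end

subsection \<open>Weak convergence\<close>

lemma integral_spacing_distribution:
  fixes f :: "real ^ 'k::{finite, linorder} \<Rightarrow> real"
  assumes f: "continuous_on UNIV f" and fin: "finite (spacing_indices CARD('k) \<gamma> T)"
  shows "integral\<^sup>L (spacing_distribution \<gamma> T) f =
    (\<Sum>n\<in>spacing_indices CARD('k) \<gamma> T. f (spacing_vector \<gamma> n)) / real (card (spacing_indices CARD('k) \<gamma> T))"
proof -
  have "integral\<^sup>L (spacing_distribution \<gamma> T) f = (\<integral>n. f (spacing_vector \<gamma> n) \<partial>uniform_count_measure (spacing_indices CARD('k) \<gamma> T))"
    unfolding spacing_distribution_def
  proof (rule integral_distr)
    show "spacing_vector \<gamma> \<in> uniform_count_measure (spacing_indices CARD('k) \<gamma> T) \<rightarrow>\<^sub>M borel"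
      by (simp add: measurable_def space_uniform_count_measure sets_uniform_count_measure)
    show "f \<in> borel_measurable borel" using f by (rule borel_measurable_continuous_onI)
  qed
  also have "\<dots> = (\<Sum>n\<in>spacing_indices CARD('k) \<gamma> T. f (spacing_vector \<gamma> n)) / real (card (spacing_indices CARD('k) \<gamma> T))"
    using fin by (rule integral_uniform_count_measure)
  finally show ?thesis .
qed

lemma card_lt_CARD: "card {j :: 'k::{finite, linorder}. j < i} < CARD('k)"
  by (intro psubset_card_mono) auto

text \<open>A vector is far from \<open>(1, ..., 1)\<close> only if one of its \<open>k\<close>
  entries is a bad gap, that is, if \<open>n\<close> lies in one of \<open>k\<close> translates of
  the bad set or so close to the upper end that \<open>n + j\<close> leaves the range. Hence the
  proportion of such vectors tends to 0, and a bounded continuous \<open>f\<close> averages to its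
  value at \<open>(1, ..., 1)\<close>.\<close>

lemma spacing_converges_weakly:
  assumes mono: "strict_mono \<gamma>" and fin: "\<And>T. finite {n. \<bar>\<gamma> n\<bar> \<le> T}"
    and top: "filterlim (\<lambda>T. real (card {n. \<bar>\<gamma> n\<bar> \<le> T})) at_top at_top"
    and bad: "\<And>\<epsilon>. \<epsilon> > 0 \<Longrightarrow> \<forall>\<^sub>F T in at_top.
      real (card {n. \<bar>\<gamma> n\<bar> \<le> T \<and> \<bar>normalized_spacing \<gamma> n - 1\<bar> > \<epsilon>}) \<le> \<epsilon> * real (card {n. \<bar>\<gamma> n\<bar> \<le> T})"
  shows "converges_weakly (spacing_distribution \<gamma>) (return borel (\<chi> i :: 'k::{finite, linorder}. (1::real)))"
  unfolding converges_weakly_def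
proof (intro allI impI)
  fix f :: "(real, 'k) vec \<Rightarrow> real"
  assume "continuous_on UNIV f \<and> bounded (range f)"
  hence cf: "continuous_on UNIV f" and bf: "bounded (range f)" by auto
  define o1 where "o1 = (\<chi> i :: 'k. (1::real))"
  define k where "k = CARD('k)"
  have k: "k > 0" by (simp add: k_def)
  obtain M where M: "M > 0" "\<And>x. \<bar>f x\<bar> \<le> M" using bf unfolding bounded_pos by auto
  have "integral\<^sup>L (return borel o1) f = f o1"
    using borel_measurable_continuous_onI[OF cf] by (intro integral_return) auto
  moreover have "((\<lambda>T. integral\<^sup>L (spacing_distribution \<gamma> T :: (real, 'k) vec measure) f) \<longlongrightarrow> f o1) at_top"
  proof (rule tendstoI)
    fix e :: real assume e: "e > 0"
    have "isCont f o1" using cf by (simp add: continuous_on_eq_continuous_at)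
    then obtain d where d: "d > 0" "\<And>x. dist x o1 < d \<Longrightarrow> dist (f x) (f o1) < e / 4"
      unfolding continuous_at_eps_delta using e by (metis divide_pos_pos zero_less_numeral)
    \<comment> \<open>The first bound brings vectors with good entries within distance
      \<open>d\<close> in the sum norm; the second makes the share of the others, weighted by
      \<open>2 M\<close>, small against \<open>e\<close>.\<close>
    define \<epsilon> where "\<epsilon> = min (d / (2 * k)) (e / (16 * k * M))"
    have eps: "\<epsilon> > 0" "real k * \<epsilon> < d" "k * \<epsilon> * (16 * M) \<le> e"
      using d e k M by (auto simp: \<epsilon>_def min_less_iff_disj min_def field_simps)
    \<comment> \<open>The summand \<open>2 k\<close> ensures that at least half of the indices
      remain after discarding those with a zero at height 0; the other one absorbs the
      \<open>k\<^sup>2\<close> boundary vectors.\<close>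
    have "\<forall>\<^sub>F T in at_top. real (card {n. \<bar>\<gamma> n\<bar> \<le> T}) > 2 * real k + 16 * M * real k * real k / e"
      using top unfolding filterlim_at_top_dense by blast
    with bad[OF eps(1)]
    show "\<forall>\<^sub>F T in at_top. dist (integral\<^sup>L (spacing_distribution \<gamma> T :: (real, 'k) vec measure) f) (f o1) < e"
    proof eventually_elim
      case (elim T)
      define N where "N = {n. \<bar>\<gamma> n\<bar> \<le> T}"
      define J where "J = spacing_indices k \<gamma> T"
      define Bd where "Bd = {n. \<bar>\<gamma> n\<bar> \<le> T \<and> \<bar>normalized_spacing \<gamma> n - 1\<bar> > \<epsilon>}"
      have finN: "finite N" unfolding N_def by (rule fin)
      have JN: "J \<subseteq> N" unfolding J_def N_def spacing_indices_def by auto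
      have finJ: "finite J" using JN finN by (rule finite_subset)
      have finB: "finite Bd" by (rule finite_subset[OF _ finN]) (auto simp: Bd_def N_def)
      have inj: "inj \<gamma>" using mono by (rule strict_mono_imp_inj_on)
      \<comment> \<open>For each offset \<open>j < k\<close> at most one index is discarded, because
        \<open>\<gamma>\<close> is injective.\<close>
      have cJ: "real (card N) \<le> real (card J) + real k"
      proof -
        have "N \<subseteq> J \<union> (\<Union>j<k. {n. \<gamma> (n + int j) = 0})"
          unfolding N_def J_def spacing_indices_def by auto
        moreover have one: "\<exists>m. {n. \<gamma> (n + int j) = 0} \<subseteq> {m}" for j
        proof (cases "\<exists>n. \<gamma> (n + int j) = 0")
          case True
          then obtain m where m: "\<gamma> (m + int j) = 0" by auto
          have "n = m" if "\<gamma> (n + int j) = 0" for n using injD[OF inj, of "n + int j" "m + int j"] m that by simp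
          thus ?thesis by auto
        qed auto
        have c1: "finite {n. \<gamma> (n + int j) = 0} \<and> card {n. \<gamma> (n + int j) = 0} \<le> 1" for j
        proof -
          obtain m where "{n. \<gamma> (n + int j) = 0} \<subseteq> {m}" using one by blast
          thus ?thesis using card_mono[of "{m}"] finite_subset by fastforce
        qed
        ultimately have "card N \<le> card (J \<union> (\<Union>j<k. {n. \<gamma> (n + int j) = 0}))"
          using finJ c1 by (intro card_mono) auto
        also have "\<dots> \<le> card J + card (\<Union>j<k. {n. \<gamma> (n + int j) = 0})" by (rule card_Un_le)
        also have "card (\<Union>j<k. {n. \<gamma> (n + int j) = 0}) \<le> (\<Sum>j<k. card {n. \<gamma> (n + int j) = 0})"
          by (intro card_UN_le) auto
        also have "\<dots> \<le> (\<Sum>j<k. 1)" using c1 by (intro sum_mono) auto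
        finally show ?thesis by simp
      qed
      have M16: "16 * M * real k * real k / e \<ge> 0" using M e by simp
      have J0: "real (card J) \<ge> real (card N) / 2" "real (card J) > 0"
        using cJ elim(2) M16 k unfolding N_def by auto
      define V where "V = {n\<in>J. \<exists>j<k. \<bar>normalized_spacing \<gamma> (n + int j) - 1\<bar> > \<epsilon>}"
      have finV: "finite V" using finJ by (rule finite_subset[rotated]) (auto simp: V_def)
      \<comment> \<open>Besides the translates of \<open>Bd\<close> there are, for each
        \<open>j\<close>, at most \<open>j\<close> indices within distance \<open>j\<close> of the
        maximum of \<open>N\<close>, whose entry \<open>n + j\<close> falls outside the counted
        range.\<close>
      have cV: "real (card V) \<le> real k * (\<epsilon> * real (card N) + real k)"
      proof -
        have "V \<subseteq> (\<Union>j<k. (\<lambda>m. m - int j) ` Bd \<union> {n\<in>N. n + int j \<notin> N})"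
        proof
          fix n assume "n \<in> V"
          then obtain j where j: "n \<in> N" "j < k" "\<bar>normalized_spacing \<gamma> (n + int j) - 1\<bar> > \<epsilon>" using JN by (auto simp: V_def)
          have "n \<in> (\<lambda>m. m - int j) ` Bd \<union> {n\<in>N. n + int j \<notin> N}"
          proof (cases "n + int j \<in> N")
            case True
            hence "n + int j \<in> Bd" using j by (auto simp: Bd_def N_def)
            thus ?thesis by (auto intro!: image_eqI[of _ _ "n + int j"])
          qed (use j in auto)
          thus "n \<in> (\<Union>j<k. (\<lambda>m. m - int j) ` Bd \<union> {n\<in>N. n + int j \<notin> N})" using j by blast
        qed
        hence "card V \<le> card (\<Union>j<k. (\<lambda>m. m - int j) ` Bd \<union> {n\<in>N. n + int j \<notin> N})"
          using finB finN by (intro card_mono) auto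
        also have "\<dots> \<le> (\<Sum>j<k. card ((\<lambda>m. m - int j) ` Bd \<union> {n\<in>N. n + int j \<notin> N}))"
          by (intro card_UN_le) auto
        also have "\<dots> \<le> (\<Sum>j<k. card Bd + k)"
        proof (intro sum_mono)
          fix j assume j: "j \<in> {..<k}"
          have "card {n\<in>N. n + int j \<notin> N} \<le> k"
          proof (cases "N = {}")
            case False
            define q where "q = Max N"
            have q: "q \<in> N" "\<And>n. n \<in> N \<Longrightarrow> n \<le> q" unfolding q_def using finN False by auto
            have "{n\<in>N. n + int j \<notin> N} \<subseteq> {q - int j<..q}"
            proof
              fix n assume n: "n \<in> {n\<in>N. n + int j \<notin> N}"
              have "n + int j > q"
              proof (rule ccontr)
                assume "\<not> n + int j > q"
                hence "n \<le> n + int j" "n + int j \<le> q" by auto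
                hence "\<gamma> n \<le> \<gamma> (n + int j)" "\<gamma> (n + int j) \<le> \<gamma> q" using strict_mono_less_eq[OF mono] by auto
                hence "n + int j \<in> N" using n q(1) by (auto simp: N_def)
                thus False using n by auto
              qed
              thus "n \<in> {q - int j<..q}" using q(2) n by auto
            qed
            hence "card {n\<in>N. n + int j \<notin> N} \<le> card {q - int j<..q}" by (intro card_mono) auto
            thus ?thesis using j by simp
          qed auto
          moreover have "card ((\<lambda>m. m - int j) ` Bd) \<le> card Bd" using finB by (rule card_image_le)
          ultimately show "card ((\<lambda>m. m - int j) ` Bd \<union> {n\<in>N. n + int j \<notin> N}) \<le> card Bd + k"
            using card_Un_le[of "(\<lambda>m. m - int j) ` Bd" "{n\<in>N. n + int j \<notin> N}"] by linarith
        qed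
        finally have "real (card V) \<le> real (k * (card Bd + k))" by (subst of_nat_le_iff) simp
        also have "\<dots> = real k * (real (card Bd) + real k)" by simp
        also have "\<dots> \<le> real k * (\<epsilon> * real (card N) + real k)"
          using elim(1) unfolding Bd_def N_def by (intro mult_left_mono add_right_mono) auto
        finally show ?thesis .
      qed
      have good: "\<bar>f (spacing_vector \<gamma> n) - f o1\<bar> \<le> e / 4" if "n \<in> J - V" for n
      proof -
        have ns: "\<bar>normalized_spacing \<gamma> (n + int j) - 1\<bar> \<le> \<epsilon>" if "j < k" for j
        proof (rule ccontr)
          assume "\<not> ?thesis"
          hence "n \<in> V" unfolding V_def using that \<open>n \<in> J - V\<close> by force
          thus False using \<open>n \<in> J - V\<close> by blast
        qed
        have "dist (spacing_vector \<gamma> n :: (real, 'k) vec) o1 \<le> (\<Sum>i\<in>UNIV. \<bar>(spacing_vector \<gamma> n - o1 :: (real, 'k) vec) $ i\<bar>)"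
          unfolding dist_norm by (rule norm_le_l1_cart)
        also have "\<dots> \<le> (\<Sum>i\<in>(UNIV::'k set). \<epsilon>)"
        proof (rule sum_mono)
          fix i :: 'k
          show "\<bar>(spacing_vector \<gamma> n - o1) $ i\<bar> \<le> \<epsilon>"
            using ns[of "card {j. j < i}"] card_lt_CARD[of i] by (simp add: spacing_vector_def o1_def k_def)
        qed
        also have "\<dots> < d" using eps by (simp add: k_def)
        finally show ?thesis using d(2) by (force simp: dist_real_def)
      qed
      have "\<bar>(\<Sum>n\<in>J. f (spacing_vector \<gamma> n)) - real (card J) * f o1\<bar> = \<bar>\<Sum>n\<in>J. f (spacing_vector \<gamma> n) - f o1\<bar>"
        by (simp add: sum_subtractf)
      also have "\<dots> \<le> (\<Sum>n\<in>J. \<bar>f (spacing_vector \<gamma> n) - f o1\<bar>)" by (rule sum_abs)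
      also have "\<dots> = (\<Sum>n\<in>J - V. \<bar>f (spacing_vector \<gamma> n) - f o1\<bar>) + (\<Sum>n\<in>V. \<bar>f (spacing_vector \<gamma> n) - f o1\<bar>)"
        using finJ by (intro sum.subset_diff) (auto simp: V_def)
      also have "\<dots> \<le> (\<Sum>n\<in>J - V. e / 4) + (\<Sum>n\<in>V. 2 * M)"
      proof (intro add_mono sum_mono good)
        fix n show "\<bar>f (spacing_vector \<gamma> n) - f o1\<bar> \<le> 2 * M"
          using M(2)[of "spacing_vector \<gamma> n"] M(2)[of o1] by linarith
      qed
      also have "\<dots> \<le> real (card J) * (e / 4) + real (card V) * (2 * M)"
        using finJ e by (auto intro!: mult_right_mono card_mono)
      also have "real (card V) * (2 * M) \<le> real k * (\<epsilon> * real (card N) + real k) * (2 * M)"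
        using cV M by (intro mult_right_mono) auto
      also have "\<dots> = k * \<epsilon> * (16 * M) * (real (card N) / 8) + 2 * M * real k * real k"
        by (simp add: algebra_simps)
      also have "\<dots> \<le> e * (real (card N) / 8) + e * (real (card N) / 8)"
      proof (intro add_mono mult_right_mono eps)
        have "16 * M * real k * real k / e \<le> real (card N)" using elim(2) unfolding N_def by auto
        thus "2 * M * real k * real k \<le> e * (real (card N) / 8)" using e by (simp add: field_simps)
      qed auto
      also have "e * (real (card N) / 8) + e * (real (card N) / 8) \<le> real (card J) * (e / 2)"
        using mult_right_mono[OF J0(1), of "e / 2"] e by (simp add: algebra_simps)
      finally have "\<bar>(\<Sum>n\<in>J. f (spacing_vector \<gamma> n)) - real (card J) * f o1\<bar> \<le> real (card J) * (3 * e / 4)"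
        by (simp add: algebra_simps)
      hence "\<bar>(\<Sum>n\<in>J. f (spacing_vector \<gamma> n)) / real (card J) - f o1\<bar> \<le> 3 * e / 4"
        using J0(2) by (simp add: abs_le_iff field_simps)
      thus ?case using integral_spacing_distribution[OF cf, of \<gamma> T] finJ e
        unfolding dist_real_def J_def k_def by simp
    qed
  qed
  ultimately show "((\<lambda>T. integral\<^sup>L (spacing_distribution \<gamma> T) f) \<longlongrightarrow> integral\<^sup>L (return borel (\<chi> i :: 'k. (1::real))) f) at_top"
    unfolding o1_def by simp
qed

subsection \<open>The zeros of A\<close>

text \<open>\<open>\<phi>\<close> is the continuous argument of \<open>\<xi>\<close> on the line of
  real part \<open>1/2 + h\<close>, relative to its real value on the real axis, and
  \<open>S\<close> is that of \<open>(s - 1) \<zeta>(s)\<close>. The factor \<open>r\<close> is a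
  ratio of moduli, which has no influence on the zeros.\<close>

locale xi_phase =
  fixes h :: real and \<phi> S :: "real \<Rightarrow> real"
  assumes h: "xi_admissible h"
    and phi_deriv: "\<And>t. (\<phi> has_real_derivative
        Re (deriv riemann_xi (Complex (1/2 + h) t) / riemann_xi (Complex (1/2 + h) t))) (at t)"
    and phi_rep: "\<And>t. \<exists>r>0. riemann_xi (Complex (1/2 + h) t) =
        riemann_xi (of_real (1/2 + h)) * (of_real r * exp (\<i> * of_real (\<phi> t)))"
    and S_deriv: "\<And>t. (S has_real_derivative
        Re (deriv zeta_reg (Complex (1/2 + h) t) / zeta_reg (Complex (1/2 + h) t))) (at t)"
    and S_0: "S 0 = 0"

lemma zeta_reg_analytic: "A \<subseteq> {s. Re s > -1} \<Longrightarrow> zeta_reg analytic_on A"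
  by (rule analytic_on_subset[of _ "{s. Re s > -1}"])
     (simp_all add: analytic_on_open open_halfspace_Re_gt holomorphic_zeta_reg)

lemma exp_polar: "exp z = of_real (exp (Re z)) * exp (\<i> * of_real (Im z))"
  by (subst exp_eq_polar, subst cis_conv_exp) (rule refl)

lemma xi_phase_exists:
  assumes h: "xi_admissible h" shows "\<exists>\<phi> S. xi_phase h \<phi> S"
proof -
  define a where "a = 1/2 + h"
  have a: "a > 1/2" using h by (simp add: a_def xi_admissible_def)
  have Y: "zeta_reg (Complex a t) \<noteq> 0" for t
    by (rule zeta_reg_nonzero_admissible[OF h]) (simp add: a_def)
  hence X: "riemann_xi (Complex a t) \<noteq> 0" for t using a by (simp add: riemann_xi_nonzero_iff)
  obtain F where F: "F 0 = 0" "\<And>t. (F has_vector_derivative (\<i> * (deriv riemann_xi (Complex a t) / riemann_xi (Complex a t)))) (at t)"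
    "\<And>t. riemann_xi (Complex a t) = riemann_xi (of_real a) * exp (F t)"
    using vertical_phase[OF riemann_xi_analytic X] by blast
  have an: "zeta_reg analytic_on {s. Re s = a}" by (rule zeta_reg_analytic) (use a in auto)
  obtain G where G: "G 0 = 0" "\<And>t. (G has_vector_derivative (\<i> * (deriv zeta_reg (Complex a t) / zeta_reg (Complex a t)))) (at t)"
      "\<And>t. zeta_reg (Complex a t) = zeta_reg (of_real a) * exp (G t)"
    using vertical_phase[OF an Y] by blast
  have "xi_phase h (\<lambda>t. Im (F t)) (\<lambda>t. Im (G t))"
    unfolding xi_phase_def a_def[symmetric]
  proof (intro conjI allI h)
    fix t
    show "((\<lambda>t. Im (F t)) has_real_derivative Re (deriv riemann_xi (Complex a t) / riemann_xi (Complex a t))) (at t)"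
      using has_real_derivative_Im[OF F(2)[of t]] by (simp only: Re_i_times Im_i_times)
    show "((\<lambda>t. Im (G t)) has_real_derivative Re (deriv zeta_reg (Complex a t) / zeta_reg (Complex a t))) (at t)"
      using has_real_derivative_Im[OF G(2)[of t]] by (simp only: Re_i_times Im_i_times)
    show "\<exists>r>0. riemann_xi (Complex a t) = riemann_xi (of_real a) * (of_real r * exp (\<i> * of_real (Im (F t))))"
      by (rule exI[of _ "exp (Re (F t))"]) (simp only: F(3)[of t] exp_polar[of "F t"] exp_gt_zero)
  qed (rule G(1)[THEN arg_cong[where f = Im], simplified])
  thus ?thesis by blast
qed

text \<open>Order automorphisms of the integers are translations. This is applied to the reindexing
  between an arbitrary enumeration of the zeros and the one given by the phase.\<close>

lemma strict_mono_surj_int: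
  fixes f :: "int \<Rightarrow> int"
  assumes mono: "strict_mono f" and surj: "surj f"
  shows "f n = n + f 0"
proof -
  have step: "f (m + 1) = f m + 1" for m
  proof -
    have "f m < f (m + 1)" using strict_mono_less[OF mono] by simp
    obtain k where k: "f k = f m + 1" using surj by (metis surjD)
    have "m < k" using k strict_mono_less[OF mono, of m k] by simp
    hence "f (m + 1) \<le> f k" using strict_mono_less_eq[OF mono] by simp
    thus ?thesis using k \<open>f m < f (m + 1)\<close> by simp
  qed
  show ?thesis
  proof (induction n rule: int_induct[where k = 0])
    case (step1 i) thus ?case using step[of i] by simp
  next
    case (step2 i) thus ?case using step[of "i - 1"] by simp
  qed simp
qed

text \<open>On \<open>[T / 2, T]\<close> the derivative \<open>g\<close> is at least
  \<open>ln T / 8\<close>, since \<open>ln t \<ge> ln T / 2\<close> there. The main term thus gains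
  at least \<open>T ln T / 16\<close> on this interval, and \<open>S\<close> can take back only half
  of it.\<close>

lemma phase_unbounded:
  fixes \<phi> S g :: "real \<Rightarrow> real"
  assumes der: "\<And>t. ((\<lambda>t. \<phi> t - S t) has_real_derivative g t) (at t)"
    and g: "\<forall>\<^sub>F t in at_top. \<bar>g t - ln t / 2\<bar> \<le> 1/4 * ln t" and S: "\<forall>\<^sub>F t in at_top. \<bar>S t\<bar> \<le> 1/32 * (t * ln t)"
  shows "\<exists>t. y \<le> \<phi> t"
proof -
  define \<theta> where "\<theta> = (\<lambda>t. \<phi> t - S t)"
  have der': "(\<theta> has_real_derivative g t) (at t)" for t unfolding \<theta>_def by (rule der)
  obtain T0 where T0: "\<And>t. t \<ge> T0 \<Longrightarrow> \<bar>g t - ln t / 2\<bar> \<le> 1/4 * ln t" using g by (auto simp: eventually_at_top_linorder)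
  define T1 where "T1 = max T0 2"
  have gT: "g t \<ge> 1/4 * ln t" if "t \<ge> T1" for t 
  proof -
    have "\<bar>g t - ln t / 2\<bar> \<le> 1/4 * ln t" using T0[of t] that by (simp add: T1_def)
    thus ?thesis by linarith
  qed
  have "filterlim (\<lambda>T::real. T * ln T / 32) at_top at_top" by real_asymp
  hence "\<forall>\<^sub>F T in at_top. T * ln T / 32 \<ge> y - \<theta> T1" unfolding filterlim_at_top by blast
  moreover have "\<forall>\<^sub>F T in at_top. T > 2 * T1" by (rule eventually_gt_at_top)
  ultimately have "\<forall>\<^sub>F T in at_top. y \<le> \<phi> T" using S
  proof eventually_elim
    case (elim T)
    have T: "T > 4" using elim by (simp add: T1_def)
    obtain z where z: "T / 2 < z" "z < T" "\<theta> T - \<theta> (T / 2) = (T - T / 2) * g z"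
      using MVT2[of "T / 2" T \<theta> g] der' T by (metis field_sum_of_halves less_add_same_cancel2 half_gt_zero order_less_trans zero_less_numeral)
    have "ln T = 2 * ln (sqrt T)" using T by (simp add: ln_sqrt)
    moreover have "sqrt T \<le> T / 2"
    proof -
      have "sqrt T * 2 \<le> sqrt T * sqrt T" using T real_le_rsqrt[of 2 T] by (intro mult_left_mono) auto
      thus ?thesis using T by simp
    qed
    hence "ln (sqrt T) \<le> ln z" using z T by (intro ln_mono) auto
    moreover have "1/4 * ln z \<le> g z" by (rule gT) (use z elim in simp)
    ultimately have "1/4 * (ln T / 2) \<le> g z" by linarith
    hence "T / 2 * (1/4 * (ln T / 2)) \<le> T / 2 * g z" using T by (intro mult_left_mono) auto
    hence 1: "\<theta> T - \<theta> (T / 2) \<ge> T * ln T / 16" using z(3) by simp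
    obtain w where w: "T1 < w" "w < T / 2" "\<theta> (T / 2) - \<theta> T1 = (T / 2 - T1) * g w"
      using MVT2[of T1 "T / 2" \<theta> g] der' elim(2) by (metis mult.commute pos_less_divide_eq zero_less_numeral)
    have "ln w \<ge> 0" using w by (simp add: T1_def)
    hence "g w \<ge> 0" using gT[of w] w by linarith
    hence "(T / 2 - T1) * g w \<ge> 0" using w by (intro mult_nonneg_nonneg) auto
    hence "\<theta> (T / 2) \<ge> \<theta> T1" using w(3) by linarith
    hence "\<theta> T \<ge> T * ln T / 16 + \<theta> T1" using 1 by linarith
    moreover have "S T \<ge> - (T * ln T / 32)" using elim(3) by (simp add: abs_le_iff)
    ultimately have "\<phi> T \<ge> T * ln T / 32 + \<theta> T1" unfolding \<theta>_def by simp
    thus ?case using elim(1) by linarith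
  qed
  thus ?thesis using eventually_happens'[OF trivial_limit_at_top_linorder] by blast
qed

section \<open>From the phase of xi to the limiting distribution\<close>

context xi_phase
begin

definition "a = 1/2 + h"

lemma a_gt: "a > 1/2" using h by (simp add: a_def xi_admissible_def)

lemma zeta_reg_line_nonzero: "zeta_reg (Complex a t) \<noteq> 0"
  by (rule zeta_reg_nonzero_admissible[OF h]) (simp add: a_def)

lemma A_fun_line_zero_iff: "A_fun h \<theta> (Complex (1/2) t) = 0 \<longleftrightarrow> cos (\<theta> + \<phi> t) = 0"
proof -
  obtain r where r: "r > 0" "riemann_xi (Complex a t) = riemann_xi (of_real a) * (of_real r * exp (\<i> * of_real (\<phi> t)))"
    using phi_rep[of t] unfolding a_def by blast
  define c where "c = Re (riemann_xi (of_real a))"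
  have "cnj (riemann_xi (of_real a)) = riemann_xi (of_real a)" using cnj_riemann_xi[of "of_real a"] by simp
  hence c: "riemann_xi (of_real a) = of_real c" by (simp add: c_def complex_eq_iff)
  have "zeta_reg (of_real a) \<noteq> 0" by (rule zeta_reg_nonzero_admissible[OF h]) (simp add: a_def)
  hence "riemann_xi (of_real a) \<noteq> 0" using a_gt by (simp add: riemann_xi_nonzero_iff)
  hence c0: "c \<noteq> 0" using c by auto
  have "exp (\<i> * of_real \<theta>) * riemann_xi (Complex a t) = of_real (c * r) * exp (\<i> * of_real (\<theta> + \<phi> t))"
    unfolding r(2) c by (simp add: algebra_simps exp_add)
  hence "Re (exp (\<i> * of_real \<theta>) * riemann_xi (Complex a t)) = c * r * cos (\<theta> + \<phi> t)"
    by (simp only: exp_Euler) (simp add: cos_of_real sin_of_real flip: of_real_add)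
  thus ?thesis unfolding A_fun_critical_line a_def[symmetric] using c0 r by simp
qed

lemma phi_mono:
  assumes "x \<le> y" shows "\<phi> x \<le> \<phi> y"
proof (rule DERIV_nonneg_imp_nondecreasing[OF assms])
  fix t
  show "\<exists>d. (\<phi> has_real_derivative d) (at t) \<and> d \<ge> 0"
    by (rule exI, rule conjI, rule phi_deriv, rule Re_xi_log_deriv_nonneg[OF h])
qed

text \<open>If the phase were constant on an interval, then for a suitable \<open>\<theta>\<close>
  the function \<open>A\<close> would vanish on a segment of the critical line, hence identically,
  although it has no zeros off that line.\<close>

lemma phi_strict_mono: "strict_mono \<phi>"
proof (rule strict_monoI)
  fix x y :: real assume xy: "x < y"
  show "\<phi> x < \<phi> y"
  proof (rule ccontr)
    assume "\<not> \<phi> x < \<phi> y"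
    hence eq: "\<phi> x = \<phi> y" using phi_mono[of x y] xy by simp
    define \<theta> where "\<theta> = pi / 2 - \<phi> x"
    have z: "A_fun h \<theta> (Complex (1/2) t) = 0" if "t \<in> {x..y}" for t
    proof -
      have "\<phi> t = \<phi> x" using phi_mono[of x t] phi_mono[of t y] that eq by auto
      thus ?thesis unfolding A_fun_line_zero_iff \<theta>_def by simp
    qed
    have "A_fun h \<theta> 1 = 0"
    proof (rule analytic_continuation[where f = "A_fun h \<theta>" and S = UNIV and U = "Complex (1/2) ` {x..y}" and \<xi> = "Complex (1/2) x"])
      show "Complex (1/2) x islimpt Complex (1/2) ` {x..y}"
        unfolding islimpt_approachable
      proof (intro allI impI)
        fix e :: real assume e: "e > 0"
        define d where "d = min (e / 2) (y - x)"
        have d: "d > 0" "d < e" "x + d \<le> y" using e xy by (auto simp: d_def)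
        have "dist (Complex (1/2) (x + d)) (Complex (1/2) x) = d" using d by (simp add: dist_norm cmod_def)
        thus "\<exists>x'\<in>Complex (1/2) ` {x..y}. x' \<noteq> Complex (1/2) x \<and> dist x' (Complex (1/2) x) < e"
          using d by (intro bexI[of _ "Complex (1/2) (x + d)"]) auto
      qed
    qed (rule holomorphic_A_fun open_UNIV connected_UNIV subset_UNIV UNIV_I z | use z in blast)+
    thus False using A_fun_nonzero_off_line[OF h, of 1 \<theta>] by simp
  qed
qed

text \<open>The derivative of the argument of \<open>\<pi> powr (- s / 2) Gamma (s / 2 + 1)\<close>
  along the line, the part of the phase governed by Stirling's formula.\<close>

definition g :: "real \<Rightarrow> real" where
  "g t = Re (Digamma (Complex a t / 2 + 1)) / 2 - ln pi / 2"

lemma phi_S_deriv: "((\<lambda>t. \<phi> t - S t) has_real_derivative g t) (at t)"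
proof -
  have "deriv riemann_xi (Complex a t) / riemann_xi (Complex a t)
    = - of_real (ln pi) / 2 + Digamma (Complex a t / 2 + 1) / 2 + deriv zeta_reg (Complex a t) / zeta_reg (Complex a t)"
    using a_gt by (intro riemann_xi_log_deriv zeta_reg_line_nonzero) auto
  hence "Re (deriv riemann_xi (Complex a t) / riemann_xi (Complex a t)) - Re (deriv zeta_reg (Complex a t) / zeta_reg (Complex a t)) = g t"
    by (simp add: g_def)
  thus ?thesis using DERIV_diff[OF phi_deriv[of t] S_deriv[of t]] unfolding a_def[symmetric] by simp
qed

lemma g_bound:
  assumes t: "\<bar>t\<bar> \<ge> a + 2" shows "\<bar>g t - ln \<bar>t\<bar> / 2\<bar> \<le> 2 + ln 2 + ln pi"
proof -
  define z where "z = Complex a t / 2 + 1"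
  have t2: "\<bar>t\<bar> \<ge> 2" using t a_gt by simp
  have Re: "Re z = a / 2 + 1" and Im: "Im z = t / 2" by (auto simp: z_def)
  have lo: "norm z \<ge> \<bar>t\<bar> / 2" using abs_Im_le_cmod[of z] Im by simp
  have up: "norm z \<le> \<bar>t\<bar>" using cmod_le[of z] t a_gt unfolding Re Im by (simp add: field_simps)
  have n1: "norm z \<ge> 1" using lo t2 by simp
  have "\<bar>Re (Digamma z) - ln (norm z)\<bar> \<le> 4 / norm z" using a_gt n1 Re by (intro Re_Digamma_bound) auto
  also have "\<dots> \<le> 4 / 1" using n1 by (intro frac_le) auto
  finally have 1: "\<bar>Re (Digamma z) - ln (norm z)\<bar> \<le> 4" by simp
  have "ln (\<bar>t\<bar> / 2) \<le> ln (norm z)" using lo t2 by (intro ln_mono) auto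
  moreover have "ln (\<bar>t\<bar> / 2) = ln \<bar>t\<bar> - ln 2" using t2 by (subst ln_div) auto
  ultimately have 2: "ln \<bar>t\<bar> - ln 2 \<le> ln (norm z)" by simp
  have 3: "ln (norm z) \<le> ln \<bar>t\<bar>" using up n1 by (intro ln_mono) auto
  have "ln pi \<ge> 0" using pi_ge_two by (intro ln_ge_zero) simp
  moreover have "ln (2::real) \<ge> 0" by simp
  moreover have "2 * (g t - ln \<bar>t\<bar> / 2) = Re (Digamma z) - ln \<bar>t\<bar> - ln pi" by (simp add: g_def z_def field_simps)
  moreover have "\<bar>x\<bar> \<le> 2 + l2 + p" if "2 * x = R - L - p" "\<bar>R - m\<bar> \<le> 4" "L - l2 \<le> m" "m \<le> L" "p \<ge> 0" "l2 \<ge> 0" for x R L m p l2 :: real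
    using that by linarith
  ultimately show ?thesis using 1 2 3 by blast
qed

lemma g_asymp:
  assumes e: "\<epsilon> > 0"
  shows "\<forall>\<^sub>F t in at_top. \<bar>g t - ln t / 2\<bar> \<le> \<epsilon> * ln t \<and> \<bar>g (-t) - ln t / 2\<bar> \<le> \<epsilon> * ln t"
proof -
  have "filterlim (\<lambda>t::real. \<epsilon> * ln t) at_top at_top" using e by real_asymp
  hence "\<forall>\<^sub>F t in at_top. \<epsilon> * ln t \<ge> 2 + ln 2 + ln pi" unfolding filterlim_at_top by blast
  moreover have "\<forall>\<^sub>F t in at_top. t \<ge> a + 2" by (rule eventually_ge_at_top)
  ultimately show ?thesis
  proof eventually_elim
    case (elim t)
    thus ?case using g_bound[of t] g_bound[of "-t"] a_gt by auto
  qed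
qed

text \<open>The phase increases strictly from minus to plus infinity, so each integer yields exactly
  one zero. For an arbitrary enumeration the numbering differs from this one by a translation, which
  only changes the constant \<open>c\<close> of \<open>phase_zeros\<close>.\<close>

theorem A_fun_limiting:
  assumes S_small: "\<And>\<epsilon>. \<epsilon> > 0 \<Longrightarrow> \<forall>\<^sub>F t in at_top. \<bar>S t\<bar> \<le> \<epsilon> * (t * ln t) \<and> \<bar>S (-t)\<bar> \<le> \<epsilon> * (t * ln t)"
    and S_flat: "\<And>\<epsilon> C. \<epsilon> > 0 \<Longrightarrow> C > 0 \<Longrightarrow> \<forall>\<^sub>F T in at_top. \<exists>B\<in>lmeasurable. measure lebesgue B \<le> \<epsilon> * T \<and>
        (\<forall>t v. \<bar>t\<bar> \<le> T \<and> t \<notin> B \<and> \<bar>v - t\<bar> \<le> C / ln T \<longrightarrow> \<bar>S v - S t\<bar> \<le> \<epsilon>)"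
  shows "limiting_joint_spacing_distribution (A_fun h \<theta>) (return borel (\<chi> i :: 'k::{finite, linorder}. (1 :: real)))"
proof -
  have up: "\<exists>t. y \<le> \<phi> t" for y
  proof (rule phase_unbounded[OF phi_S_deriv])
    show "\<forall>\<^sub>F t in at_top. \<bar>g t - ln t / 2\<bar> \<le> 1/4 * ln t"
      by (rule eventually_mono[OF g_asymp[of "1/4"]]) auto
    show "\<forall>\<^sub>F t in at_top. \<bar>S t\<bar> \<le> 1/32 * (t * ln t)"
      by (rule eventually_mono[OF S_small[of "1/32"]]) auto
  qed
  \<comment> \<open>The same growth lemma for the reflected phase
    \<open>- \<phi> (- t)\<close>.\<close>
  have dn: "\<exists>t. \<phi> t \<le> y" for y
  proof -
    have "\<exists>t. - y \<le> (\<lambda>t. - \<phi> (-t)) t"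
    proof (rule phase_unbounded[where S = "\<lambda>t. - S (-t)" and g = "\<lambda>t. g (-t)"])
      show "((\<lambda>t. - \<phi> (-t) - - S (-t)) has_real_derivative g (-t)) (at t)" for t
      proof -
        have "((\<lambda>t. \<phi> (-t) - S (-t)) has_real_derivative g (-t) * (-1)) (at t)"
          by (rule DERIV_chain2[OF phi_S_deriv]) (auto intro!: derivative_eq_intros)
        from DERIV_minus[OF this] show ?thesis by (simp add: algebra_simps)
      qed
      show "\<forall>\<^sub>F t in at_top. \<bar>g (-t) - ln t / 2\<bar> \<le> 1/4 * ln t" by (rule eventually_mono[OF g_asymp[of "1/4"]]) auto
      show "\<forall>\<^sub>F t in at_top. \<bar>- S (-t)\<bar> \<le> 1/32 * (t * ln t)" by (rule eventually_mono[OF S_small[of "1/32"]]) auto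
    qed
    thus ?thesis by auto
  qed
  have cont: "isCont \<phi> t" for t using phi_deriv by (rule DERIV_isCont)
  have surj: "\<exists>t. \<phi> t = y" for y
  proof -
    obtain t1 t2 where t: "\<phi> t1 \<le> y" "y \<le> \<phi> t2" using up dn by blast
    show ?thesis
    proof (cases "t1 \<le> t2")
      case True
      thus ?thesis using IVT[of \<phi> t1 y t2] t cont by blast
    next
      case False
      hence "\<phi> t2 \<le> \<phi> t1" by (intro phi_mono) auto
      thus ?thesis using t by (intro exI[of _ t1]) auto
    qed
  qed
  define c where "c = pi / 2 - \<theta>"
  have zero_iff: "A_fun h \<theta> s = 0 \<longleftrightarrow> (\<exists>t n. s = Complex (1/2) t \<and> \<phi> t = pi * of_int n + c)" for s
  proof (cases "Re s = 1/2")
    case True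
    hence s: "s = Complex (1/2) (Im s)" by (simp add: complex_eq_iff)
    have "A_fun h \<theta> s = 0 \<longleftrightarrow> (\<exists>n. \<theta> + \<phi> (Im s) = of_int n * pi + pi / 2)"
      by (subst s, subst A_fun_line_zero_iff, rule cos_zero_iff_int2)
    also have "\<dots> \<longleftrightarrow> (\<exists>n. \<phi> (Im s) = pi * of_int n + c)" by (simp add: c_def algebra_simps)
    finally show ?thesis using s by (metis complex.sel(2))
  next
    case False
    thus ?thesis using A_fun_nonzero_off_line[OF h False] by auto
  qed
  have exists: "\<exists>\<gamma>. enumerates_zeros (A_fun h \<theta>) \<gamma>"
  proof -
    define \<gamma> where "\<gamma> = (\<lambda>n::int. SOME t. \<phi> t = pi * of_int n + c)"
    have \<gamma>: "\<phi> (\<gamma> n) = pi * of_int n + c" for n unfolding \<gamma>_def by (rule someI_ex) (rule surj)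
    have "strict_mono \<gamma>"
    proof (rule strict_monoI)
      fix m n :: int assume "m < n"
      hence "\<phi> (\<gamma> m) < \<phi> (\<gamma> n)" unfolding \<gamma> by simp
      thus "\<gamma> m < \<gamma> n" using strict_mono_less[OF phi_strict_mono] by simp
    qed
    moreover have "{s. A_fun h \<theta> s = 0} = range (\<lambda>n. Complex (1/2) (\<gamma> n))"
    proof -
      have "t = \<gamma> n" if "\<phi> t = pi * of_int n + c" for t n
        using that strict_mono_eq[OF phi_strict_mono] unfolding \<gamma>[symmetric] by simp
      thus ?thesis using \<gamma> unfolding zero_iff by blast
    qed
    ultimately show ?thesis unfolding enumerates_zeros_def by blast
  qed
  have conv: "converges_weakly (spacing_distribution \<gamma>) (return borel (\<chi> i :: 'k. (1::real)))"
    if en: "enumerates_zeros (A_fun h \<theta>) \<gamma>" for \<gamma>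
  proof -
    have m\<gamma>: "strict_mono \<gamma>" and zs: "{s. A_fun h \<theta> s = 0} = range (\<lambda>n. Complex (1/2) (\<gamma> n))"
      using en unfolding enumerates_zeros_def by auto
    have "\<exists>k. \<phi> (\<gamma> n) = pi * of_int k + c" for n
    proof -
      have "A_fun h \<theta> (Complex (1/2) (\<gamma> n)) = 0" using zs by blast
      thus ?thesis unfolding zero_iff by auto
    qed
    then obtain f where f: "\<And>n. \<phi> (\<gamma> n) = pi * of_int (f n) + c" by metis
    have "strict_mono f"
    proof (rule strict_monoI)
      fix m n :: int assume "m < n"
      hence "\<phi> (\<gamma> m) < \<phi> (\<gamma> n)" using strict_mono_less[OF m\<gamma>] strict_mono_less[OF phi_strict_mono] by simp
      thus "f m < f n" unfolding f by simp
    qed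
    moreover have "surj f"
      unfolding surj_def
    proof
      fix k :: int
      obtain t where t: "\<phi> t = pi * of_int k + c" using surj by blast
      hence "A_fun h \<theta> (Complex (1/2) t) = 0" unfolding zero_iff by blast
      hence "Complex (1/2) t \<in> range (\<lambda>n. Complex (1/2) (\<gamma> n))" using zs by blast
      then obtain n where "t = \<gamma> n" by auto
      hence "pi * of_int (f n) + c = pi * of_int k + c" using f t by metis
      thus "\<exists>n. k = f n" by auto
    qed
    ultimately have fn: "f n = n + f 0" for n by (rule strict_mono_surj_int)
    interpret phase_zeros \<phi> S g \<gamma> "pi * of_int (f 0) + c"
    proof (rule phase_zeros.intro[OF phi_strict_mono phi_S_deriv g_asymp S_small S_flat])
      show "\<phi> (\<gamma> n) = pi * of_int n + (pi * of_int (f 0) + c)" for n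
        unfolding f fn[of n] by (simp add: algebra_simps)
    qed assumption+
    show ?thesis by (rule spacing_converges_weakly[OF m\<gamma> finite_index card_at_top bad_count])
  qed
  show ?thesis unfolding limiting_joint_spacing_distribution_def
    using exists conv by (auto intro: prob_space_return)
qed

lemma S_small_pointwise:
  assumes b: "b \<ge> 1/2" "b < a" and nz: "\<forall>s. Re s > b \<longrightarrow> zeta_reg s \<noteq> 0" and e: "\<epsilon> > 0"
  shows "\<forall>\<^sub>F T in at_top. \<forall>t v. \<bar>t\<bar> \<le> 2 * T \<and> \<bar>v\<bar> \<le> 2 * T \<longrightarrow> \<bar>S v - S t\<bar> \<le> \<epsilon> * ln T * \<bar>v - t\<bar>"
proof -
  obtain A where A: "\<And>s. Re s \<ge> a \<Longrightarrow> norm (deriv zeta_reg s / zeta_reg s) \<le> A + (\<epsilon> / 2) * ln (1 + norm s)"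
    using zeta_reg_log_deriv_small[OF nz[rule_format] b, of "\<epsilon> / 2"] e by auto
  have "\<forall>\<^sub>F T in at_top. A + (\<epsilon> / 2) * ln (1 + (a + 2 * T)) \<le> \<epsilon> * ln T"
    using e a_gt by real_asymp
  moreover have "\<forall>\<^sub>F T in at_top. T > (0::real)" by (rule eventually_gt_at_top)
  ultimately show ?thesis
  proof eventually_elim
    case (elim T)
    have der: "\<bar>Re (deriv zeta_reg (Complex a u) / zeta_reg (Complex a u))\<bar> \<le> \<epsilon> * ln T" if "\<bar>u\<bar> \<le> 2 * T" for u
    proof -
      have "norm (Complex a u) \<le> a + 2 * T" using cmod_le[of "Complex a u"] that a_gt by simp
      hence "ln (1 + norm (Complex a u)) \<le> ln (1 + (a + 2 * T))" by (intro ln_mono) (auto intro: add_pos_nonneg)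
      hence "(\<epsilon> / 2) * ln (1 + norm (Complex a u)) \<le> (\<epsilon> / 2) * ln (1 + (a + 2 * T))" using e by (intro mult_left_mono) auto
      thus ?thesis using A[of "Complex a u"] elim(1) abs_Re_le_cmod[of "deriv zeta_reg (Complex a u) / zeta_reg (Complex a u)"] by auto
    qed
    show ?case
    proof (intro allI impI)
      fix t v assume tv: "\<bar>t\<bar> \<le> 2 * T \<and> \<bar>v\<bar> \<le> 2 * T"
      have "norm (S v - S t) \<le> \<epsilon> * ln T * norm (v - t)"
      proof (rule field_differentiable_bound[where S = "{- (2 * T)..2 * T}"])
        show "(S has_field_derivative Re (deriv zeta_reg (Complex a u) / zeta_reg (Complex a u))) (at u within {- (2 * T)..2 * T})" for u
          using S_deriv[of u] unfolding a_def[symmetric] by (rule has_field_derivative_at_within)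
        show "norm (Re (deriv zeta_reg (Complex a u) / zeta_reg (Complex a u))) \<le> \<epsilon> * ln T" if "u \<in> {- (2 * T)..2 * T}" for u
          using der[of u] that by (simp add: abs_le_iff)
      qed (use tv in auto)
      thus "\<bar>S v - S t\<bar> \<le> \<epsilon> * ln T * \<bar>v - t\<bar>" by simp
    qed
  qed
qed

text \<open>The logarithmic derivative is small at every height, so the exceptional set is empty;
  smallness by \<open>\<epsilon> / C\<close> compensates for the window length
  \<open>C / ln T\<close>.\<close>

theorem A_fun_limiting_pointwise:
  assumes b: "b \<ge> 1/2" "b < a" and nz: "\<forall>s. Re s > b \<longrightarrow> zeta_reg s \<noteq> 0"
  shows "limiting_joint_spacing_distribution (A_fun h \<theta>) (return borel (\<chi> i :: 'k::{finite, linorder}. (1 :: real)))"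
proof (rule A_fun_limiting)
  fix \<epsilon> :: real assume e: "\<epsilon> > 0"
  show "\<forall>\<^sub>F t in at_top. \<bar>S t\<bar> \<le> \<epsilon> * (t * ln t) \<and> \<bar>S (-t)\<bar> \<le> \<epsilon> * (t * ln t)"
    using S_small_pointwise[OF b nz e] eventually_gt_at_top[of 0]
  proof eventually_elim
    case (elim T)
    have "\<bar>S T - S 0\<bar> \<le> \<epsilon> * ln T * \<bar>T - 0\<bar>" "\<bar>S (-T) - S 0\<bar> \<le> \<epsilon> * ln T * \<bar>-T - 0\<bar>"
      by (rule elim(1)[rule_format]; use elim(2) in simp)+
    thus ?case using elim(2) S_0 by (simp add: mult_ac)
  qed
  fix C :: real assume C: "C > 0"
  have l: "filterlim (\<lambda>T::real. T - C / ln T) at_top at_top" by real_asymp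
  hence "\<forall>\<^sub>F T in at_top. T - C / ln T \<ge> 0" unfolding filterlim_at_top by blast
  moreover have "\<epsilon> / C > 0" using e C by simp
  from S_small_pointwise[OF b nz this] eventually_gt_at_top[of "1::real"]
  have "\<forall>\<^sub>F T in at_top. (\<forall>t v. \<bar>t\<bar> \<le> 2 * T \<and> \<bar>v\<bar> \<le> 2 * T \<longrightarrow> \<bar>S v - S t\<bar> \<le> \<epsilon> / C * ln T * \<bar>v - t\<bar>) \<and> T > 1"
    by eventually_elim auto
  ultimately show "\<forall>\<^sub>F T in at_top. \<exists>B\<in>lmeasurable. measure lebesgue B \<le> \<epsilon> * T \<and>
        (\<forall>t v. \<bar>t\<bar> \<le> T \<and> t \<notin> B \<and> \<bar>v - t\<bar> \<le> C / ln T \<longrightarrow> \<bar>S v - S t\<bar> \<le> \<epsilon>)"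
  proof eventually_elim
    case (elim T)
    have "\<bar>S v - S t\<bar> \<le> \<epsilon>" if tv: "\<bar>t\<bar> \<le> T" "\<bar>v - t\<bar> \<le> C / ln T" for t v
    proof -
      have "\<bar>t\<bar> \<le> 2 * T \<and> \<bar>v\<bar> \<le> 2 * T" using tv elim by linarith
      hence "\<bar>S v - S t\<bar> \<le> \<epsilon> / C * ln T * \<bar>v - t\<bar>" using elim(2) by blast
      also have "\<dots> \<le> \<epsilon> / C * ln T * (C / ln T)" using tv e C elim(2) by (intro mult_left_mono) auto
      also have "\<dots> = \<epsilon>" using C elim(2) by simp
      finally show ?thesis .
    qed
    thus ?case using e elim(2) by (intro bexI[of _ "{}"]) auto
  qed
qed

end

subsection \<open>The logarithm of zeta up to the line of real part 1\<close>

text \<open>On the boundary of a closed half plane only a derivative from within is available.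
  Vertical motion stays inside the half plane, so this still yields a full derivative in
  \<open>t\<close>.\<close>

lemma has_vector_derivative_vertical_within:
  assumes "(f has_field_derivative f') (at (Complex x t) within {s. Re s \<ge> c})" "x \<ge> c"
  shows "((\<lambda>t. f (Complex x t)) has_vector_derivative (\<i> * f')) (at t)"
proof -
  have "(Complex x has_vector_derivative \<i>) (at t)"
    by (auto simp: has_vector_derivative_complex_iff has_real_derivative_iff_has_vector_derivative[symmetric] intro!: derivative_eq_intros)
  moreover have "(f has_field_derivative f') (at (Complex x t) within range (Complex x))"
    by (rule DERIV_subset[OF assms(1)]) (use assms(2) in auto)
  ultimately show ?thesis
    using field_vector_diff_chain_within[of "Complex x" \<i> t UNIV f f'] by (simp add: o_def)
qed

lemma has_vector_derivative_horizontal_within: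
  assumes "(f has_field_derivative f') (at (Complex x t) within {s. Re s \<ge> c})"
  shows "((\<lambda>x. f (Complex x t)) has_vector_derivative f') (at x within {c..})"
proof -
  have "((\<lambda>x. Complex x t) has_vector_derivative 1) (at x within {c..})"
    by (auto simp: has_vector_derivative_complex_iff has_real_derivative_iff_has_vector_derivative[symmetric] intro!: derivative_eq_intros)
  moreover have "(f has_field_derivative f') (at (Complex x t) within (\<lambda>x. Complex x t) ` {c..})"
    by (rule DERIV_subset[OF assms(1)]) auto
  ultimately show ?thesis
    using field_vector_diff_chain_within[of "\<lambda>x. Complex x t" 1 x "{c..}" f f'] by (simp add: o_def)
qed

lemma has_vector_derivative_Re: "(F has_vector_derivative D) net \<Longrightarrow> ((\<lambda>t. Re (F t)) has_vector_derivative Re D) net"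
  by (rule bounded_linear.has_vector_derivative[OF bounded_linear_Re])

lemma has_vector_derivative_Im: "(F has_vector_derivative D) net \<Longrightarrow> ((\<lambda>t. Im (F t)) has_vector_derivative Im D) net"
  by (rule bounded_linear.has_vector_derivative[OF bounded_linear_Im])

text \<open>\<open>L\<close> is the logarithm of \<open>(s - 1) \<zeta>(s)\<close> on the closed
  half plane, and \<open>K\<close> is a primitive of \<open>L\<close>. Integrals of \<open>L\<close>
  along the sides of a rectangle become differences of \<open>K\<close> at its corners, so contour
  integrals are avoided.\<close>

locale zeta_log =
  fixes L K :: "complex \<Rightarrow> complex"
  assumes L_1: "L 1 = 0"
    and L_deriv: "\<And>s. Re s \<ge> 1 \<Longrightarrow> (L has_field_derivative deriv zeta_reg s / zeta_reg s) (at s within {s. Re s \<ge> 1})"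
    and exp_L: "\<And>s. Re s \<ge> 1 \<Longrightarrow> exp (L s) = zeta_reg s"
    and K_deriv: "\<And>s. Re s \<ge> 1 \<Longrightarrow> (K has_field_derivative L s) (at s within {s. Re s \<ge> 1})"

lemma zeta_log_exists: "\<exists>L K. zeta_log L K"
proof -
  let ?H = "{s. 1 \<le> Re s}"
  have cvx: "convex ?H" using convex_halfspace_Re_ge by simp
  have an: "zeta_reg analytic_on ?H" by (rule zeta_reg_analytic) auto
  have nz: "\<forall>s\<in>?H. zeta_reg s \<noteq> 0" using zeta_reg_nonzero by auto
  have an': "(\<lambda>s. deriv zeta_reg s / zeta_reg s) analytic_on ?H"
    by (rule analytic_on_divide[OF analytic_deriv[OF an] an]) (use nz in auto)
  obtain L0 where L0: "\<And>s. s \<in> ?H \<Longrightarrow> (L0 has_field_derivative deriv zeta_reg s / zeta_reg s) (at s within ?H)"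
  proof (rule holomorphic_convex_primitive[OF cvx finite.emptyI])
    show "continuous_on ?H (\<lambda>s. deriv zeta_reg s / zeta_reg s)"
      by (rule holomorphic_on_imp_continuous_on[OF analytic_imp_holomorphic[OF an']])
    show "(\<lambda>s. deriv zeta_reg s / zeta_reg s) field_differentiable at x" if "x \<in> interior ?H - {}" for x
      using that interior_subset by (intro analytic_on_imp_differentiable_at[OF an']) blast
  qed blast
  define L where "L = (\<lambda>s. L0 s - L0 1)"
  have L: "(L has_field_derivative deriv zeta_reg s / zeta_reg s) (at s within ?H)" if "s \<in> ?H" for s
    unfolding L_def using DERIV_diff[OF L0[OF that] DERIV_const] by simp
  have dz: "(zeta_reg has_field_derivative deriv zeta_reg s) (at s within ?H)" if "s \<in> ?H" for s
  proof -
    have "zeta_reg analytic_on {s}" by (rule analytic_on_subset[OF an]) (use that in auto)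
    from analytic_derivI[OF this] show ?thesis by (rule has_field_derivative_at_within)
  qed
  have "\<exists>c. \<forall>s\<in>?H. zeta_reg s * exp (- L s) = c"
  proof (rule has_field_derivative_zero_constant[OF cvx])
    fix s assume s: "s \<in> ?H"
    have "((\<lambda>s. zeta_reg s * exp (- L s)) has_field_derivative
        deriv zeta_reg s * exp (- L s) + (exp (- L s) * - (deriv zeta_reg s / zeta_reg s)) * zeta_reg s) (at s within ?H)"
      by (rule DERIV_mult[OF dz[OF s] DERIV_chain2[OF DERIV_exp DERIV_minus[OF L[OF s]]]])
    thus "((\<lambda>s. zeta_reg s * exp (- L s)) has_field_derivative 0) (at s within ?H)" using nz s by simp
  qed
  then obtain c where c: "\<And>s. s \<in> ?H \<Longrightarrow> zeta_reg s * exp (- L s) = c" by blast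
  have "c = 1" using c[of 1] by (simp add: L_def zeta_reg_1)
  hence expL: "exp (L s) = zeta_reg s" if "s \<in> ?H" for s using c[OF that] by (simp add: exp_minus field_simps)
  obtain K where K: "\<And>s. s \<in> ?H \<Longrightarrow> (K has_field_derivative L s) (at s within ?H)"
  proof (rule holomorphic_convex_primitive[OF cvx finite.emptyI])
    show "continuous_on ?H L" by (rule DERIV_continuous_on[OF L])
    show "L field_differentiable at x" if "x \<in> interior ?H - {}" for x
    proof -
      have x: "x \<in> interior ?H" using that by blast
      have "(L has_field_derivative deriv zeta_reg x / zeta_reg x) (at x)"
        using L[OF subsetD[OF interior_subset x]] unfolding at_within_interior[OF x] .
      thus ?thesis unfolding field_differentiable_def by blast
    qed
  qed blast
  have "zeta_log L K"
    by unfold_locales (use L K expL in \<open>auto simp: L_def\<close>)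
  thus ?thesis by blast
qed

text \<open>Provides the comparison line: at real part 2 the Dirichlet series is bounded and bounded
  away from 0, Cauchy's inequality on discs of radius \<open>1/2\<close> bounds its derivative, and
  the factor \<open>s - 1\<close> adds at most 1.\<close>

lemma zeta_reg_log_deriv_bound_2:
  obtains C where "C \<ge> 0" "\<And>t. norm (deriv zeta_reg (Complex 2 t) / zeta_reg (Complex 2 t)) \<le> C"
proof
  let ?C = "1 + zeta_real 2 * (2 * zeta_real (3/2))"
  show "?C \<ge> 0" using zeta_real_ge_1[of 2] zeta_real_ge_1[of "3/2"] by (intro add_nonneg_nonneg mult_nonneg_nonneg) auto
  fix t
  define s where "s = Complex 2 t"
  define f where "f = (\<lambda>s. zeta_reg s / (s - 1))"
  have f: "f holomorphic_on {s. Re s > 1}" unfolding f_def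
    by (intro holomorphic_intros holomorphic_on_subset[OF holomorphic_zeta_reg]) auto
  have Re: "Re z \<ge> 3/2" if "z \<in> cball s (1/2)" for z
    using that abs_Re_le_cmod[of "s - z"] by (auto simp: dist_norm s_def)
  have fz: "f z = zeta_series z" if "Re z > 1" for z
    using that by (auto simp: f_def zeta_reg_conv_series)
  have "norm ((deriv ^^ 1) f s) \<le> fact 1 * zeta_real (3/2) / (1/2) ^ 1"
  proof (rule Cauchy_inequality)
    show "f holomorphic_on ball s (1/2)"
      by (rule holomorphic_on_subset[OF f]) (use Re ball_subset_cball in fastforce)
    show "continuous_on (cball s (1/2)) f"
      by (rule continuous_on_subset[OF holomorphic_on_imp_continuous_on[OF f]]) (use Re in fastforce)
    fix z assume "norm (s - z) = 1/2"
    hence z: "Re z \<ge> 3/2" by (intro Re) (simp add: dist_norm)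
    have "norm (f z) \<le> zeta_real (Re z)" using z by (simp add: fz norm_zeta_series_le)
    also have "\<dots> \<le> zeta_real (3/2)" using z by (intro zeta_real_antimono) auto
    finally show "norm (f z) \<le> zeta_real (3/2)" .
  qed simp
  hence f': "norm (deriv f s) \<le> 2 * zeta_real (3/2)" by simp
  have fs: "1 \<le> zeta_real 2 * norm (f s)" using norm_zeta_series_ge[of s] fz[of s] by (simp add: s_def)
  hence f0: "f s \<noteq> 0" by auto
  have s1: "s \<noteq> 1" by (simp add: s_def complex_eq_iff)
  have df: "(f has_field_derivative deriv f s) (at s)"
    by (rule holomorphic_derivI[OF f open_halfspace_Re_gt]) (simp add: s_def)
  have "((\<lambda>w. (w - 1) * f w) has_field_derivative (f s + (s - 1) * deriv f s)) (at s)"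
    by (rule derivative_eq_intros df refl)+ simp
  hence "(zeta_reg has_field_derivative (f s + (s - 1) * deriv f s)) (at s)"
  proof (rule has_field_derivative_transform_within_open[of _ _ _ "- {1}"])
    show "(w - 1) * f w = zeta_reg w" if "w \<in> - {1}" for w using that by (simp add: f_def)
  qed (use s1 in auto)
  hence "deriv zeta_reg s / zeta_reg s = (f s + (s - 1) * deriv f s) / ((s - 1) * f s)"
    using s1 by (simp add: DERIV_imp_deriv f_def)
  also have "\<dots> = 1 / (s - 1) + deriv f s / f s" using s1 f0 by (simp add: field_simps)
  also have "norm \<dots> \<le> norm (1 / (s - 1)) + norm (deriv f s / f s)" by (rule norm_triangle_ineq)
  also have "norm (1 / (s - 1)) \<le> 1"
    using abs_Re_le_cmod[of "s - 1"] by (simp add: norm_divide s_def divide_simps)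
  also have "norm (deriv f s / f s) \<le> zeta_real 2 * (2 * zeta_real (3/2))"
  proof -
    have "norm (deriv f s / f s) \<le> norm (deriv f s) * (zeta_real 2)"
      using fs f0 mult_left_mono[OF fs, of "norm (deriv f s)"] by (simp add: norm_divide divide_simps mult_ac)
    also have "\<dots> \<le> (2 * zeta_real (3/2)) * zeta_real 2" using f' zeta_real_ge_1[of 2] by (intro mult_right_mono) auto
    finally show ?thesis by (simp add: mult_ac)
  qed
  finally show "norm (deriv zeta_reg (Complex 2 t) / zeta_reg (Complex 2 t)) \<le> ?C" by (simp add: s_def)
qed

text \<open>On every line of real part at least 1 the phase of \<open>\<xi>\<close> is monotone
  unconditionally. Subtracting its Stirling part, of size about \<open>ln t / 2\<close>, leaves a
  one-sided bound for the zeta part; the constants are absorbed because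
  \<open>ln (t + 3) \<ge> 1\<close>.\<close>

lemma Re_zeta_reg_log_deriv_ge:
  assumes y: "y \<in> {1..2}" and t: "t \<ge> 0"
  shows "Re (deriv zeta_reg (Complex y t) / zeta_reg (Complex y t)) \<ge> - (5/2 * ln (t + 3))"
proof -
  have adm: "xi_admissible (y - 1/2)" using y by (auto simp: xi_admissible_def)
  have nz: "zeta_reg (Complex y t) \<noteq> 0" using y by (intro zeta_reg_nonzero) auto
  define z where "z = Complex y t / 2 + 1"
  have Re: "Re z = y / 2 + 1" and Im: "Im z = t / 2" by (auto simp: z_def)
  have n1: "norm z \<ge> 1" using abs_Re_le_cmod[of z] y unfolding Re by auto
  have n2: "norm z \<le> t + 3" using cmod_le[of z] y t unfolding Re Im by auto
  have "\<bar>Re (Digamma z) - ln (norm z)\<bar> \<le> 4 / norm z" using Re y n1 by (intro Re_Digamma_bound) auto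
  also have "\<dots> \<le> 4 / 1" using n1 by (intro frac_le) auto
  finally have 1: "\<bar>Re (Digamma z) - ln (norm z)\<bar> \<le> 4" by simp
  have 2: "ln (norm z) \<le> ln (t + 3)" using n1 n2 by (intro ln_mono) auto
  have "ln (exp 1) \<le> ln (t + 3)" using exp_le t by (intro ln_mono) auto
  hence 3: "ln (t + 3) \<ge> 1" by simp
  have 4: "ln pi \<ge> 0" using pi_ge_two by (intro ln_ge_zero) simp
  have "deriv riemann_xi (Complex y t) / riemann_xi (Complex y t)
    = - of_real (ln pi) / 2 + Digamma z / 2 + deriv zeta_reg (Complex y t) / zeta_reg (Complex y t)"
    unfolding z_def using y by (intro riemann_xi_log_deriv nz) auto
  moreover have "Re (deriv riemann_xi (Complex y t) / riemann_xi (Complex y t)) \<ge> 0"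
    using Re_xi_log_deriv_nonneg[OF adm, of t] by simp
  ultimately have "- ln pi / 2 + Re (Digamma z) / 2 + Re (deriv zeta_reg (Complex y t) / zeta_reg (Complex y t)) \<ge> 0" by simp
  thus ?thesis using 1 2 3 4 by argo
qed

text \<open>Replaces the logarithmic singularity at real part 1 by one that is integrable with an
  explicit primitive.\<close>

lemma neg_ln_le_inverse_sqrt: assumes "x > 0" shows "- ln x \<le> 2 / sqrt x"
proof -
  have "ln (1 / sqrt x) \<le> 1 / sqrt x - 1" using assms by (intro ln_le_minus_one) auto
  moreover have "ln (1 / sqrt x) = - (ln x / 2)" using assms by (simp add: ln_div ln_sqrt)
  moreover have "2 / sqrt x = 2 * (1 / sqrt x)" by simp
  ultimately show ?thesis by linarith
qed

text \<open>The lower bound rests on \<open>|\<zeta>(s)| \<ge> 1 / \<zeta>(y)\<close> and on the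
  simple pole of \<open>\<zeta>\<close> at 1. It degenerates only like \<open>y - 1\<close>, so its
  logarithm remains integrable up to the line. The factor 27 is the cube of
  \<open>1 + y \<le> 3\<close>.\<close>

lemma ln_norm_zeta_reg_bound:
  obtains A where "A \<ge> 0" "\<And>y t. 1 < y \<Longrightarrow> y \<le> 2 \<Longrightarrow> t \<ge> 1 \<Longrightarrow>
    \<bar>ln (norm (zeta_reg (Complex y t)))\<bar> \<le> A * ln (t + 3) + 2 / sqrt (y - 1)"
proof -
  obtain C where C: "C \<ge> 1" "\<And>s. Re s \<ge> 0 \<Longrightarrow> norm (zeta_reg s) \<le> C * (1 + norm s) ^ 3"
    by (rule zeta_reg_bound) (metis One_nat_def numeral_3_eq_3)
  define A where "A = ln (27 * C) + 3"
  have lC: "ln C \<ge> 0" using C by simp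
  have l27: "ln (27 * C) \<ge> ln C" using C by (intro ln_mono) auto
  show ?thesis
  proof
    show "A \<ge> 0" using lC l27 by (simp add: A_def)
    fix y t :: real assume y: "1 < y" "y \<le> 2" and t: "t \<ge> 1"
    define s where "s = Complex y t"
    have "ln (exp 1) \<le> ln (t + 3)" using exp_le t by (intro ln_mono) auto
    hence l1: "ln (t + 3) \<ge> 1" by simp
    have l27': "ln (27 * C) \<le> ln (27 * C) * ln (t + 3)" using l1 l27 lC by (simp add: mult_le_cancel_left1)
    have Y0: "zeta_reg s \<noteq> 0" using y by (intro zeta_reg_nonzero) (auto simp: s_def)
    have ns: "norm s \<le> t + 2" using cmod_le[of s] y t by (simp add: s_def)
    have "norm (zeta_reg s) \<le> C * (1 + norm s) ^ 3" using y by (intro C) (simp add: s_def)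
    also have "\<dots> \<le> C * (t + 3) ^ 3" using C ns by (intro mult_left_mono power_mono) auto
    finally have "ln (norm (zeta_reg s)) \<le> ln (C * (t + 3) ^ 3)" using Y0 by (intro ln_mono) auto
    also have "\<dots> = ln C + 3 * ln (t + 3)" using C t by (simp add: ln_mult ln_realpow)
    also have "\<dots> \<le> A * ln (t + 3)" using l27 l27' by (simp add: A_def algebra_simps)
    finally have up: "ln (norm (zeta_reg s)) \<le> A * ln (t + 3)" .
    have z1: "zeta_real y \<ge> 1" using y by (intro zeta_real_ge_1)
    have "zeta_real y = norm (zeta_reg (of_real y)) / (y - 1)"
    proof -
      have "zeta_series (of_real y) = of_real (zeta_real y)"
      proof -
        have "of_nat (Suc n) powr (- of_real y) = complex_of_real (real (Suc n) powr (-y))" for n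
          using powr_of_real[of "real (Suc n)" "-y"] by (simp del: of_nat_Suc powr_minus)
        moreover have "summable (\<lambda>n. real (Suc n) powr (-y))" using y by (intro summable_powr_shift) auto
        ultimately show ?thesis unfolding zeta_series_def zeta_real_def by (simp only: suminf_of_real)
      qed
      hence "zeta_reg (of_real y) = of_real ((y - 1) * zeta_real y)" using zeta_reg_conv_series[of "of_real y"] y by simp
      hence "norm (zeta_reg (of_real y)) = (y - 1) * zeta_real y" using y z1 by (simp add: norm_mult del: of_real_mult)
      thus ?thesis using y by simp
    qed
    also have "\<dots> \<le> (C * (1 + norm (of_real y :: complex)) ^ 3) / (y - 1)" using y C(2)[of "of_real y"] by (intro divide_right_mono) auto
    also have "\<dots> \<le> (C * 3 ^ 3) / (y - 1)" using y C(1) by (intro divide_right_mono mult_left_mono power_mono) auto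
    finally have zy: "zeta_real y \<le> 27 * C / (y - 1)" by (simp add: mult.commute)
    have "1 \<le> norm (s - 1)" using abs_Im_le_cmod[of "s - 1"] t by (simp add: s_def)
    hence "norm (zeta_series s) \<le> norm (zeta_reg s)"
      using zeta_reg_conv_series[of s] y mult_right_mono[of 1 "norm (s - 1)" "norm (zeta_series s)"] by (simp add: s_def norm_mult)
    hence "zeta_real y * norm (zeta_series s) \<le> zeta_real y * norm (zeta_reg s)" using z1 by (intro mult_left_mono) auto
    moreover have "1 \<le> zeta_real y * norm (zeta_series s)" using norm_zeta_series_ge[of s] y by (simp add: s_def)
    moreover have "zeta_real y * norm (zeta_reg s) \<le> 27 * C / (y - 1) * norm (zeta_reg s)" using zy by (intro mult_right_mono) auto
    ultimately have "1 \<le> 27 * C / (y - 1) * norm (zeta_reg s)" by linarith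
    hence "ln 1 \<le> ln (27 * C / (y - 1) * norm (zeta_reg s))" using Y0 by (intro ln_mono) auto
    hence "0 \<le> ln (27 * C / (y - 1)) + ln (norm (zeta_reg s))" using Y0 y C by (subst (asm) ln_mult) auto
    moreover have "ln (27 * C / (y - 1)) = ln (27 * C) - ln (y - 1)" using y C(1) by (simp add: ln_div)
    moreover have "- ln (y - 1) \<le> 2 / sqrt (y - 1)" using y by (intro neg_ln_le_inverse_sqrt) auto
    moreover have "ln (27 * C) \<le> A * ln (t + 3)" using l27' l1 by (simp add: A_def algebra_simps)
    moreover have "2 / sqrt (y - 1) \<ge> 0" using y by simp
    ultimately show "\<bar>ln (norm (zeta_reg (Complex y t)))\<bar> \<le> A * ln (t + 3) + 2 / sqrt (y - 1)"
      using up unfolding s_def by linarith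
  qed
qed

context zeta_log
begin

lemma Re_L: assumes "Re s \<ge> 1" shows "Re (L s) = ln (norm (zeta_reg s))"
proof -
  have "norm (zeta_reg s) = exp (Re (L s))" using exp_L[OF assms] by (metis norm_exp_eq_Re)
  thus ?thesis by simp
qed

lemma L_vertical: "x \<ge> 1 \<Longrightarrow> ((\<lambda>t. L (Complex x t)) has_vector_derivative (\<i> * (deriv zeta_reg (Complex x t) / zeta_reg (Complex x t)))) (at t)"
  by (rule has_vector_derivative_vertical_within[OF L_deriv]) auto

lemma K_vertical: "x \<ge> 1 \<Longrightarrow> ((\<lambda>t. K (Complex x t)) has_vector_derivative (\<i> * L (Complex x t))) (at t)"
  by (rule has_vector_derivative_vertical_within[OF K_deriv]) auto

lemma K_horizontal: "x \<ge> 1 \<Longrightarrow> ((\<lambda>x. K (Complex x t)) has_vector_derivative L (Complex x t)) (at x within {1..})"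
  by (rule has_vector_derivative_horizontal_within[OF K_deriv]) auto

lemma K_horizontal_at: assumes "x > 1" shows "((\<lambda>x. K (Complex x t)) has_vector_derivative L (Complex x t)) (at x)"
proof -
  have i: "x \<in> interior {1..}" using assms by simp
  from K_horizontal[of x t] show ?thesis unfolding at_within_interior[OF i] using assms by simp
qed

lemma continuous_K_horizontal: "y \<ge> 1 \<Longrightarrow> continuous_on {y..2} (\<lambda>x. K (Complex x t))"
  by (rule continuous_on_vector_derivative[of _ _ "\<lambda>x. L (Complex x t)"])
     (auto intro: has_vector_derivative_within_subset[OF K_horizontal])

lemma Re_K_bound:
  obtains A where "A \<ge> 0" "\<And>y t. 1 \<le> y \<Longrightarrow> y \<le> 2 \<Longrightarrow> t \<ge> 1 \<Longrightarrow>
    \<bar>Re (K (Complex 2 t)) - Re (K (Complex y t))\<bar> \<le> A * ln (t + 3)"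
proof -
  obtain A where A: "A \<ge> 0" "\<And>y t. 1 < y \<Longrightarrow> y \<le> 2 \<Longrightarrow> t \<ge> 1 \<Longrightarrow>
    \<bar>ln (norm (zeta_reg (Complex y t)))\<bar> \<le> A * ln (t + 3) + 2 / sqrt (y - 1)"
    using ln_norm_zeta_reg_bound by blast
  show ?thesis
  proof
    show "A + 4 \<ge> 0" using A by simp
    fix y t :: real assume y: "1 \<le> y" "y \<le> 2" and t: "t \<ge> 1"
    have "ln (exp 1) \<le> ln (t + 3)" using exp_le t by (intro ln_mono) auto
    hence l1: "ln (t + 3) \<ge> 1" by simp
    \<comment> \<open>A primitive of the majorant of \<open>|ln |zeta_reg||\<close> along the
      horizontal segment; it stays finite down to \<open>x = 1\<close>.\<close>
    define H where "H = (\<lambda>x. A * ln (t + 3) * x + 4 * sqrt (x - 1))"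
    show "\<bar>Re (K (Complex 2 t)) - Re (K (Complex y t))\<bar> \<le> (A + 4) * ln (t + 3)"
    proof (cases "y = 2")
      case True
      thus ?thesis using A l1 by simp
    next
      case False
      have "norm (Re (K (Complex 2 t)) - Re (K (Complex y t))) \<le> H 2 - H y"
      proof (rule differentiable_bound_general)
        show "y < 2" using False y by simp
        show "continuous_on {y..2} (\<lambda>x. Re (K (Complex x t)))"
          by (intro continuous_intros continuous_K_horizontal y)
        show "continuous_on {y..2} H" unfolding H_def by (intro continuous_intros)
        fix x assume x: "y < x" "x < 2"
        show "((\<lambda>x. Re (K (Complex x t))) has_vector_derivative Re (L (Complex x t))) (at x)"
          using x y by (intro has_vector_derivative_Re K_horizontal_at) auto
        have "(H has_real_derivative (A * ln (t + 3) + 2 / sqrt (x - 1))) (at x)"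
          unfolding H_def using x y by (auto intro!: derivative_eq_intros simp: field_simps)
        thus "(H has_vector_derivative (A * ln (t + 3) + 2 / sqrt (x - 1))) (at x)"
          by (simp add: has_real_derivative_iff_has_vector_derivative)
        show "norm (Re (L (Complex x t))) \<le> A * ln (t + 3) + 2 / sqrt (x - 1)"
          using A(2)[of x t] x y t by (simp add: Re_L)
      qed
      moreover have "H 2 - H y \<le> (A + 4) * ln (t + 3)"
      proof -
        have "A * ln (t + 3) * (2 - y) \<le> A * ln (t + 3) * 1" using A l1 y by (intro mult_left_mono) auto
        moreover have "sqrt (y - 1) \<ge> 0" using y by simp
        moreover have "H 2 - H y = A * ln (t + 3) * (2 - y) + 4 - 4 * sqrt (y - 1)" by (simp add: H_def algebra_simps)
        moreover have "(A + 4) * ln (t + 3) = A * ln (t + 3) * 1 + 4 * ln (t + 3)" by (simp add: algebra_simps)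
        ultimately show ?thesis using l1 by linarith
      qed
      ultimately show ?thesis by simp
    qed
  qed
qed

lemma Im_L_deriv: "y \<ge> 1 \<Longrightarrow> ((\<lambda>t. Im (L (Complex y t))) has_real_derivative
    Re (deriv zeta_reg (Complex y t) / zeta_reg (Complex y t))) (at t)"
  using has_real_derivative_Im[OF L_vertical[of y t]] by (simp only: Im_i_times)

text \<open>The mean of \<open>Im L\<close> over a unit interval, compared with the line of real
  part 2, is controlled by \<open>Re K\<close>, so some point of each unit interval has a moderate
  value. The derivative is bounded only from below: such a point to the right of \<open>t\<close>
  gives the upper bound at \<open>t\<close>, and one to the left gives the lower bound.\<close>

lemma Im_L_bound:
  obtains C where "C \<ge> 0" "\<And>y t. 1 \<le> y \<Longrightarrow> y \<le> 2 \<Longrightarrow> t \<ge> 2 \<Longrightarrow> \<bar>Im (L (Complex y t))\<bar> \<le> C * t"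
proof -
  obtain A where A: "A \<ge> 0" "\<And>y t. 1 \<le> y \<Longrightarrow> y \<le> 2 \<Longrightarrow> t \<ge> 1 \<Longrightarrow>
    \<bar>Re (K (Complex 2 t)) - Re (K (Complex y t))\<bar> \<le> A * ln (t + 3)" using Re_K_bound by blast
  obtain C2 where C2: "C2 \<ge> 0" "\<And>t. norm (deriv zeta_reg (Complex 2 t) / zeta_reg (Complex 2 t)) \<le> C2"
    using zeta_reg_log_deriv_bound_2 by blast
  define c where "c = \<bar>Im (L (Complex 2 0))\<bar>"
  have S2: "\<bar>Im (L (Complex 2 t))\<bar> \<le> c + C2 * t" if "t \<ge> 0" for t
  proof -
    have "norm (Im (L (Complex 2 t)) - Im (L (Complex 2 0))) \<le> C2 * norm (t - 0)"
    proof (rule field_differentiable_bound[where S = UNIV])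
      show "((\<lambda>t. Im (L (Complex 2 t))) has_field_derivative Re (deriv zeta_reg (Complex 2 u) / zeta_reg (Complex 2 u))) (at u)" for u
        by (rule Im_L_deriv) simp
      show "norm (Re (deriv zeta_reg (Complex 2 u) / zeta_reg (Complex 2 u))) \<le> C2" for u
        using C2(2)[of u] abs_Re_le_cmod order_trans unfolding real_norm_def by blast
    qed auto
    thus ?thesis using that unfolding c_def by simp
  qed
  define C where "C = c + C2 * 2 + 2 * A * 4 + 5/2 * 4"
  show ?thesis
  proof
    show "C \<ge> 0" using A C2 by (simp add: C_def c_def)
    fix y t :: real assume y: "1 \<le> y" "y \<le> 2" and t: "t \<ge> 2"
    define m where "m = 5/2 * ln (t + 4)"
    have m0: "m \<ge> 0" using t by (simp add: m_def)
    have low: "Im (L (Complex y v)) - Im (L (Complex y u)) \<ge> - m" if "0 \<le> u" "u < v" "v \<le> u + 1" "v \<le> t + 1" for u v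
    proof -
      obtain z where z: "u < z" "z < v" "Im (L (Complex y v)) - Im (L (Complex y u)) = (v - u) * Re (deriv zeta_reg (Complex y z) / zeta_reg (Complex y z))"
        using MVT2[of u v "\<lambda>t. Im (L (Complex y t))", OF \<open>u < v\<close> Im_L_deriv[OF y(1)]] by blast
      have "ln (z + 3) \<le> ln (t + 4)" using z that by (intro ln_mono) auto
      hence "- Re (deriv zeta_reg (Complex y z) / zeta_reg (Complex y z)) \<le> m"
      proof -
        have "- (5/2 * ln (z + 3)) \<le> Re (deriv zeta_reg (Complex y z) / zeta_reg (Complex y z))"
          using y z that by (intro Re_zeta_reg_log_deriv_ge) auto
        thus ?thesis using \<open>ln (z + 3) \<le> ln (t + 4)\<close> unfolding m_def by argo
      qed
      hence "(v - u) * - Re (deriv zeta_reg (Complex y z) / zeta_reg (Complex y z)) \<le> (v - u) * m"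
        using that by (intro mult_left_mono) auto
      also have "\<dots> \<le> 1 * m" using that m0 by (intro mult_right_mono) auto
      finally show ?thesis unfolding z(3) by simp
    qed
    \<comment> \<open>The vertical derivative of \<open>K\<close> is \<open>i L\<close>, so the
      derivative of the difference of the values of \<open>Re K\<close> is the difference of the
      arguments. The mean value theorem finds a point at which it equals its mean.\<close>
    have D: "\<exists>z. u < z \<and> z < u + 1 \<and> \<bar>Im (L (Complex y z)) - Im (L (Complex 2 z))\<bar> \<le> 2 * A * ln (t + 4)" if u: "1 \<le> u" "u \<le> t" for u
    proof -
      have dK: "((\<lambda>t. Re (K (Complex 2 t)) - Re (K (Complex y t))) has_real_derivative
          (Im (L (Complex y z)) - Im (L (Complex 2 z)))) (at z)" for z
        using has_vector_derivative_Re[OF has_vector_derivative_diff[OF K_vertical[of 2 z] K_vertical[of y z]]] y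
        unfolding has_real_derivative_iff_has_vector_derivative by simp
      have "u < u + 1" by simp
      then obtain z where z: "u < z" "z < u + 1" "(Re (K (Complex 2 (u + 1))) - Re (K (Complex y (u + 1)))) - (Re (K (Complex 2 u)) - Re (K (Complex y u)))
          = (u + 1 - u) * (Im (L (Complex y z)) - Im (L (Complex 2 z)))"
        using MVT2[of u "u + 1" "\<lambda>t. Re (K (Complex 2 t)) - Re (K (Complex y t))", OF _ dK] by blast
      have "A * ln (u + 1 + 3) \<le> A * ln (t + 4)" "A * ln (u + 3) \<le> A * ln (t + 4)"
        using A u by (auto intro!: mult_left_mono ln_mono)
      hence "\<bar>Im (L (Complex y z)) - Im (L (Complex 2 z))\<bar> \<le> 2 * A * ln (t + 4)"
        using A(2)[of y "u + 1"] A(2)[of y u] y u z(3) by simp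
      thus ?thesis using z by blast
    qed
    have ln4: "ln (t + 4) \<le> 4 * t" using ln_le_minus_one[of "t + 4"] t by linarith
    have b: "\<bar>Im (L (Complex y z))\<bar> \<le> c + C2 * (t + 1) + 2 * A * ln (t + 4)"
      if "1 \<le> z" "z \<le> t + 1" "\<bar>Im (L (Complex y z)) - Im (L (Complex 2 z))\<bar> \<le> 2 * A * ln (t + 4)" for z
    proof -
      have "C2 * z \<le> C2 * (t + 1)" using C2 that by (intro mult_left_mono) auto
      thus ?thesis using S2[of z] that by linarith
    qed
    have fin: "c + C2 * (t + 1) + 2 * A * ln (t + 4) + m \<le> C * t"
    proof -
      have "A * ln (t + 4) \<le> A * (4 * t)" using A ln4 by (intro mult_left_mono)
      moreover have "m \<le> 5/2 * (4 * t)" using ln4 unfolding m_def by simp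
      moreover have "c * 1 \<le> c * t" using t by (intro mult_left_mono) (auto simp: c_def)
      moreover have "C2 * (t + 1) \<le> C2 * (2 * t)" using t C2 by (intro mult_left_mono) auto
      ultimately show ?thesis unfolding C_def by (simp add: algebra_simps)
    qed
    obtain z where z: "t < z" "z < t + 1" "\<bar>Im (L (Complex y z)) - Im (L (Complex 2 z))\<bar> \<le> 2 * A * ln (t + 4)"
      using D[of t] t by auto
    have "Im (L (Complex y t)) \<le> Im (L (Complex y z)) + m" using low[of t z] z t by simp
    hence up: "Im (L (Complex y t)) \<le> C * t" using b[of z] z t fin by linarith
    obtain w where w: "t - 1 < w" "w < t" "\<bar>Im (L (Complex y w)) - Im (L (Complex 2 w))\<bar> \<le> 2 * A * ln (t + 4)"
      using D[of "t - 1"] t by auto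
    have "Im (L (Complex y t)) \<ge> Im (L (Complex y w)) - m" using low[of w t] w t by simp
    hence "Im (L (Complex y t)) \<ge> - (C * t)" using b[of w] w t fin by linarith
    thus "\<bar>Im (L (Complex y t))\<bar> \<le> C * t" using up by linarith
  qed
qed

lemma Im_K_bound:
  obtains C where "C \<ge> 0" "\<And>t. t \<ge> 2 \<Longrightarrow> \<bar>Im (K (Complex 2 t)) - Im (K (Complex 1 t))\<bar> \<le> C * t"
proof -
  obtain C where C: "C \<ge> 0" "\<And>y t. 1 \<le> y \<Longrightarrow> y \<le> 2 \<Longrightarrow> t \<ge> 2 \<Longrightarrow> \<bar>Im (L (Complex y t))\<bar> \<le> C * t"
    using Im_L_bound by blast
  show ?thesis
  proof
    fix t :: real assume t: "t \<ge> 2"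
    have "norm (Im (K (Complex 2 t)) - Im (K (Complex 1 t))) \<le> C * t * 2 - C * t * 1"
    proof (rule differentiable_bound_general)
      show "continuous_on {1..2} (\<lambda>x. Im (K (Complex x t)))"
        by (intro continuous_intros continuous_K_horizontal) simp
      show "continuous_on {1..2} (\<lambda>x. C * t * x)" by (intro continuous_intros)
      fix x :: real assume x: "1 < x" "x < 2"
      show "((\<lambda>x. Im (K (Complex x t))) has_vector_derivative Im (L (Complex x t))) (at x)"
        using x by (intro has_vector_derivative_Im K_horizontal_at) auto
      show "((\<lambda>x. C * t * x) has_vector_derivative C * t) (at x)"
        unfolding has_real_derivative_iff_has_vector_derivative[symmetric] by (auto intro!: derivative_eq_intros)
      show "norm (Im (L (Complex x t))) \<le> C * t" using C(2)[of x t] x t by simp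
    qed simp
    thus "\<bar>Im (K (Complex 2 t)) - Im (K (Complex 1 t))\<bar> \<le> C * t" by simp
  qed (rule C(1))
qed

end

abbreviation zeta_1_line :: "real \<Rightarrow> complex" where
  "zeta_1_line t \<equiv> riemann_zeta (Complex 1 t)"

lemma zeta_1_line_eq: "zeta_1_line t = zeta_reg (Complex 1 t) / (\<i> * of_real t)"
proof -
  have "Complex 1 t - 1 = \<i> * of_real t" by (simp add: complex_eq_iff)
  thus ?thesis by (simp add: zeta_reg_conv)
qed

lemma zeta_1_line_nonzero: "t \<noteq> 0 \<Longrightarrow> zeta_1_line t \<noteq> 0"
  using zeta_reg_nonzero[of "Complex 1 t"] by (simp add: zeta_1_line_eq)

lemma continuous_on_zeta_1_line: "0 \<notin> A \<Longrightarrow> continuous_on A zeta_1_line"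
proof -
  assume "0 \<notin> A"
  have c: "continuous_on {s. Re s > -1} zeta_reg" by (rule holomorphic_on_imp_continuous_on[OF holomorphic_zeta_reg])
  have "continuous_on A (\<lambda>t. zeta_reg (Complex 1 t))"
    by (rule continuous_on_compose2[OF c continuous_on_Complex]) auto
  thus ?thesis unfolding zeta_1_line_eq using \<open>0 \<notin> A\<close> by (intro continuous_intros) auto
qed

text \<open>Cauchy's theorem on the rectangle between real parts 1 and 2, with \<open>K\<close> in
  place of the contour integral: the vertical integrals of \<open>ln |zeta_reg|\<close> differ by
  values of \<open>Im K\<close> at the corners, which are \<open>O(d)\<close>. At real part 2 the
  logarithm of \<open>|\<zeta>|\<close> is bounded from below, and the factors \<open>s - 1\<close>
  on the two lines compare favourably.\<close>

lemma integral_ln_zeta_1_line: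
  obtains C where "C \<ge> 0" "\<And>c d. 2 \<le> c \<Longrightarrow> c \<le> d \<Longrightarrow> integral {c..d} (\<lambda>t. - ln (norm (zeta_1_line t))) \<le> C * d"
proof -
  obtain L K where LK: "zeta_log L K" using zeta_log_exists by blast
  interpret zeta_log L K by (rule LK)
  obtain C where C: "C \<ge> 0" "\<And>t. t \<ge> 2 \<Longrightarrow> \<bar>Im (K (Complex 2 t)) - Im (K (Complex 1 t))\<bar> \<le> C * t"
    using Im_K_bound by blast
  define c2 where "c2 = ln (zeta_real 2)"
  have c2: "c2 \<ge> 0" using zeta_real_ge_1[of 2] by (simp add: c2_def)
  show ?thesis
  proof
    show "2 * C + c2 \<ge> 0" using C c2 by simp
    fix c d :: real assume cd: "2 \<le> c" "c \<le> d"
    let ?f = "\<lambda>t. Re (L (Complex 2 t)) - Re (L (Complex 1 t))"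
    have int: "(?f has_integral (Im (K (Complex 2 d)) - Im (K (Complex 1 d))) - (Im (K (Complex 2 c)) - Im (K (Complex 1 c)))) {c..d}"
    proof (rule fundamental_theorem_of_calculus[OF cd(2)])
      fix t
      show "((\<lambda>t. Im (K (Complex 2 t)) - Im (K (Complex 1 t))) has_vector_derivative ?f t) (at t within {c..d})"
      proof (rule has_vector_derivative_at_within)
        have "((\<lambda>t. K (Complex 2 t)) has_vector_derivative \<i> * L (Complex 2 t)) (at t)"
          "((\<lambda>t. K (Complex 1 t)) has_vector_derivative \<i> * L (Complex 1 t)) (at t)" by (rule K_vertical, simp)+
        from has_vector_derivative_diff[OF this[THEN has_vector_derivative_Im]]
        show "((\<lambda>t. Im (K (Complex 2 t)) - Im (K (Complex 1 t))) has_vector_derivative ?f t) (at t)" by simp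
      qed
    qed
    have "integral {c..d} (\<lambda>t. - ln (norm (zeta_1_line t))) \<le> integral {c..d} (\<lambda>t. ?f t + c2)"
    proof (rule integral_le)
      show "(\<lambda>t. - ln (norm (zeta_1_line t))) integrable_on {c..d}"
        using cd zeta_1_line_nonzero by (intro integrable_continuous_real continuous_intros continuous_on_zeta_1_line) auto
      show "(\<lambda>t. ?f t + c2) integrable_on {c..d}"
        using has_integral_integrable[OF int] by (intro integrable_add) auto
      fix t assume t: "t \<in> {c..d}"
      have t0: "t > 0" using t cd by simp
      define s where "s = Complex 2 t"
      have "1 \<le> zeta_real 2 * norm (zeta_series s)" using norm_zeta_series_ge[of s] by (simp add: s_def)
      hence z: "norm (zeta_series s) > 0" "ln 1 \<le> ln (zeta_real 2 * norm (zeta_series s))" by (auto intro: ccontr)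
      have 1: "- c2 \<le> ln (norm (zeta_series s))"
        using z zeta_real_ge_1[of 2] by (simp add: c2_def ln_mult)
      have "t \<le> norm (s - 1)" using abs_Im_le_cmod[of "s - 1"] t0 by (simp add: s_def)
      hence 2: "ln t \<le> ln (norm (s - 1))" using t0 by (intro ln_mono) auto
      have "zeta_reg s = (s - 1) * zeta_series s" by (rule zeta_reg_conv_series) (simp add: s_def)
      hence 3: "Re (L (Complex 2 t)) = ln (norm (s - 1)) + ln (norm (zeta_series s))"
      proof -
        have "Re (L s) = ln (norm (zeta_reg s))" by (rule Re_L) (simp add: s_def)
        also have "\<dots> = ln (norm (s - 1)) + ln (norm (zeta_series s))"
          using z(1) t0 \<open>t \<le> norm (s - 1)\<close> unfolding \<open>zeta_reg s = _\<close> norm_mult by (intro ln_mult_pos) linarith+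
        finally show ?thesis by (simp add: s_def)
      qed
      have 4: "Re (L (Complex 1 t)) = ln t + ln (norm (zeta_1_line t))"
        using zeta_reg_nonzero[of "Complex 1 t"] t0 by (simp add: Re_L zeta_1_line_eq norm_divide norm_mult ln_div)
      show "- ln (norm (zeta_1_line t)) \<le> ?f t + c2" using 1 2 3 4 by simp
    qed
    also have "\<dots> = (Im (K (Complex 2 d)) - Im (K (Complex 1 d))) - (Im (K (Complex 2 c)) - Im (K (Complex 1 c))) + c2 * (d - c)"
      using integral_unique[OF has_integral_add[OF int has_integral_const_real[of c2 c d]]] cd by simp
    also have "\<dots> \<le> C * d + C * c + c2 * (d - c)" using C(2)[of c] C(2)[of d] cd by simp
    also have "\<dots> \<le> C * d + C * d + c2 * d" using cd c2 C by (intro add_mono mult_left_mono) auto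
    finally show "integral {c..d} (\<lambda>t. - ln (norm (zeta_1_line t))) \<le> (2 * C + c2) * d" by (simp add: algebra_simps)
  qed
qed

subsection \<open>Mean squares of Dirichlet polynomials\<close>

lemma norm_sum_cis_square:
  fixes x \<theta> :: "nat \<Rightarrow> real"
  shows "(norm (\<Sum>n\<in>A. of_real (x n) * cis (\<theta> n)))\<^sup>2 = (\<Sum>m\<in>A. \<Sum>n\<in>A. x m * x n * cos (\<theta> m - \<theta> n))"
proof -
  have "(norm (\<Sum>n\<in>A. of_real (x n) * cis (\<theta> n)))\<^sup>2
    = (\<Sum>n\<in>A. x n * cos (\<theta> n)) * (\<Sum>n\<in>A. x n * cos (\<theta> n)) + (\<Sum>n\<in>A. x n * sin (\<theta> n)) * (\<Sum>n\<in>A. x n * sin (\<theta> n))"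
    unfolding cmod_power2 by (simp add: power2_eq_square)
  also have "\<dots> = (\<Sum>m\<in>A. \<Sum>n\<in>A. x m * x n * cos (\<theta> m - \<theta> n))"
    by (simp add: sum_product sum.distrib[symmetric] cos_diff algebra_simps)
  finally show ?thesis .
qed

lemma integral_cos_bound:
  fixes \<mu> :: real
  assumes "\<mu> \<noteq> 0" "a \<le> b"
  shows "\<bar>integral {a..b} (\<lambda>t. cos (t * \<mu>))\<bar> \<le> 2 / \<bar>\<mu>\<bar>"
proof -
  have "((\<lambda>t. cos (t * \<mu>)) has_integral (sin (b * \<mu>) / \<mu> - sin (a * \<mu>) / \<mu>)) {a..b}"
    using assms by (intro fundamental_theorem_of_calculus)
      (auto intro!: derivative_eq_intros simp: has_real_derivative_iff_has_vector_derivative[symmetric])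
  hence "integral {a..b} (\<lambda>t. cos (t * \<mu>)) = (sin (b * \<mu>) - sin (a * \<mu>)) / \<mu>"
    by (simp add: integral_unique diff_divide_distrib)
  moreover have "\<bar>sin (b * \<mu>) - sin (a * \<mu>)\<bar> \<le> 2" using abs_sin_le_one[of "b * \<mu>"] abs_sin_le_one[of "a * \<mu>"] by linarith
  ultimately show ?thesis using assms by (simp add: abs_divide divide_right_mono)
qed

text \<open>From \<open>ln (n / m) \<ge> (n - m) / n\<close>: the factor \<open>n\<close> cancels,
  so the off-diagonal sum splits into sums over \<open>m\<close> and over the difference
  \<open>n - m\<close>.\<close>

lemma inverse_ln_diff_bound:
  assumes "0 < m" "m < (n::nat)"
  shows "2 / (real m * real n * \<bar>ln (real n) - ln (real m)\<bar>) \<le> 2 / (real m * real (n - m))"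
proof -
  have "ln (real m / real n) \<le> real m / real n - 1" using assms by (intro ln_le_minus_one) auto
  hence "ln (real n) - ln (real m) \<ge> real (n - m) / real n" using assms by (simp add: ln_div field_simps of_nat_diff)
  moreover have "real (n - m) / real n > 0" using assms by simp
  ultimately have "real (n - m) / real n \<le> \<bar>ln (real n) - ln (real m)\<bar>" by linarith
  hence "real m * real n * (real (n - m) / real n) \<le> real m * real n * \<bar>ln (real n) - ln (real m)\<bar>"
    by (intro mult_left_mono) auto
  hence "real m * real (n - m) \<le> real m * real n * \<bar>ln (real n) - ln (real m)\<bar>" using assms by simp
  thus ?thesis using assms by (intro divide_left_mono mult_pos_pos) auto
qed

text \<open>The diagonal of the expanded square yields the main term. Off the diagonal the integral
  of the cosine is bounded independently of the interval, and each half of the remaining double sum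
  is at most a square of a harmonic sum.\<close>

theorem dirichlet_polynomial_mean_square:
  fixes c :: "nat \<Rightarrow> real"
  assumes ab: "a \<le> b" and c: "\<And>n. n \<in> {1..N} \<Longrightarrow> \<bar>c n\<bar> \<le> M"
  shows "integral {a..b} (\<lambda>t. (norm (\<Sum>n=1..N. of_real (c n / n) * cis (- t * ln n)))\<^sup>2)
    \<le> (b - a) * (\<Sum>n=1..N. (c n / n)\<^sup>2) + 4 * M\<^sup>2 * (harm N)\<^sup>2"
proof -
  define x where "x = (\<lambda>n. c n / real n)"
  define q where "q = (\<lambda>m n. if m < n then 1 / (real m * real (n - m)) else 0)"
  have int: "(\<lambda>t. x m * x n * cos (t * (ln (real n) - ln (real m)))) integrable_on {a..b}" for m n
    by (intro integrable_continuous_real continuous_intros)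
  have "integral {a..b} (\<lambda>t. (norm (\<Sum>n=1..N. of_real (c n / n) * cis (- t * ln n)))\<^sup>2)
    = integral {a..b} (\<lambda>t. \<Sum>m=1..N. \<Sum>n=1..N. x m * x n * cos (t * (ln (real n) - ln (real m))))"
    unfolding norm_sum_cis_square x_def by (simp add: algebra_simps)
  also have "\<dots> = (\<Sum>m=1..N. \<Sum>n=1..N. integral {a..b} (\<lambda>t. x m * x n * cos (t * (ln (real n) - ln (real m)))))"
    using int by (simp add: integral_sum integrable_sum del: integral_mult_right)
  also have "\<dots> \<le> (\<Sum>m=1..N. \<Sum>n=1..N. (if m = n then (b - a) * (x n)\<^sup>2 else 0) + 2 * M\<^sup>2 * (q m n + q n m))"
  proof (intro sum_mono)
    fix m n assume mn: "m \<in> {1..N}" "n \<in> {1..N}"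
    define I where "I = integral {a..b} (\<lambda>t. cos (t * (ln (real n) - ln (real m))))"
    have J: "integral {a..b} (\<lambda>t. x m * x n * cos (t * (ln (real n) - ln (real m)))) = x m * x n * I"
      unfolding I_def by simp
    show "integral {a..b} (\<lambda>t. x m * x n * cos (t * (ln (real n) - ln (real m))))
      \<le> (if m = n then (b - a) * (x n)\<^sup>2 else 0) + 2 * M\<^sup>2 * (q m n + q n m)"
    proof (cases "m = n")
      case True
      thus ?thesis unfolding J I_def using ab by (simp add: q_def power2_eq_square)
    next
      case False
      have ln0: "ln (real n) - ln (real m) \<noteq> 0" using False mn by simp
      have xx: "\<bar>x m * x n\<bar> \<le> M\<^sup>2 / (real m * real n)"
        unfolding x_def using mn c[OF mn(1)] c[OF mn(2)]
        by (auto simp: abs_mult power2_eq_square intro!: divide_right_mono mult_mono)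
      have "x m * x n * I \<le> \<bar>x m * x n\<bar> * \<bar>I\<bar>" by (simp add: abs_mult[symmetric])
      also have "\<dots> \<le> M\<^sup>2 / (real m * real n) * (2 / \<bar>ln (real n) - ln (real m)\<bar>)"
        unfolding I_def by (intro mult_mono xx integral_cos_bound ln0 ab) auto
      also have "\<dots> = M\<^sup>2 * (2 / (real m * real n * \<bar>ln (real n) - ln (real m)\<bar>))" by simp
      also have "\<dots> \<le> M\<^sup>2 * (2 * (q m n + q n m))"
      proof (intro mult_left_mono)
        show "2 / (real m * real n * \<bar>ln (real n) - ln (real m)\<bar>) \<le> 2 * (q m n + q n m)"
        proof (cases "m < n")
          case True
          thus ?thesis using inverse_ln_diff_bound[of m n] mn by (simp add: q_def)
        next
          case False
          hence "n < m" using \<open>m \<noteq> n\<close> by simp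
          thus ?thesis using inverse_ln_diff_bound[of n m] mn by (simp add: q_def mult.commute abs_minus_commute)
        qed
      qed simp
      finally show ?thesis unfolding J using False by (simp add: algebra_simps)
    qed
  qed
  also have "\<dots> = (b - a) * (\<Sum>n=1..N. (x n)\<^sup>2) + 2 * M\<^sup>2 * (2 * (\<Sum>m=1..N. \<Sum>n=1..N. q m n))"
  proof -
    have "(\<Sum>m=1..N. \<Sum>n=1..N. q n m) = (\<Sum>m=1..N. \<Sum>n=1..N. q m n)" by (rule sum.swap)
    moreover have "(\<Sum>m=1..N. \<Sum>n=1..N. if m = n then (b - a) * (x n)\<^sup>2 else 0) = (b - a) * (\<Sum>n=1..N. (x n)\<^sup>2)"
      unfolding sum_distrib_left by (rule sum.cong[OF refl]) simp
    ultimately show ?thesis by (simp add: sum.distrib sum_distrib_left[symmetric])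
  qed
  also have "(\<Sum>m=1..N. \<Sum>n=1..N. q m n) \<le> (\<Sum>m=1..N. inverse (real m) * harm N)"
  proof (intro sum_mono)
    fix m assume m: "m \<in> {1..N}"
    have "(\<Sum>n=1..N. q m n) = (\<Sum>n\<in>{m<..N}. inverse (real m) * inverse (real (n - m)))"
      using m by (intro sum.mono_neutral_cong_right) (auto simp: q_def field_simps)
    also have "\<dots> = (\<Sum>k=1..N - m. inverse (real m) * inverse (real k))"
      using m by (intro sum.reindex_bij_witness[of _ "\<lambda>k. k + m" "\<lambda>n. n - m"]) auto
    also have "\<dots> = inverse (real m) * harm (N - m)" by (simp add: harm_def sum_distrib_left)
    also have "\<dots> \<le> inverse (real m) * harm N" by (intro mult_left_mono harm_mono) auto
    finally show "(\<Sum>n=1..N. q m n) \<le> inverse (real m) * harm N" .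
  qed
  also have "(\<Sum>m=1..N. inverse (real m) * harm N) = (harm N)\<^sup>2"
    by (simp add: harm_def sum_distrib_right power2_eq_square)
  finally show ?thesis by (simp add: x_def mult_left_mono)
qed

subsection \<open>Moments of zeta on the line of real part 1\<close>

lemma harm_le_ln: assumes "N > 0" shows "harm N \<le> 1 + ln (real N)"
  using euler_mascheroni_sequence_decreasing[of 1 N] assms by (simp add: harm_def)

text \<open>The remainder of Euler-Maclaurin summation, with the decay \<open>N powr (- 1/2)\<close>
  extracted uniformly for \<open>Re s \<ge> 1/2\<close>. The room to the left of real part 1 is used
  to differentiate by Cauchy's inequality.\<close>

lemma riemann_zeta_approx:
  obtains C where "C \<ge> 0" "\<And>s N. Re s \<ge> 1/2 \<Longrightarrow> s \<noteq> 1 \<Longrightarrow>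
    norm (riemann_zeta s - (\<Sum>n<Suc N. of_nat (Suc n) powr (-s))) \<le>
      real (Suc N) powr (- 1/2) + real (Suc N) powr (1 - Re s) / norm (s - 1) + C * (norm s * norm (s + 1)) * real (Suc N) powr (- 1/2)"
proof
  define C where "C = (\<Sum>n. real (Suc n) powr (-2))"
  have sm: "summable (\<lambda>n. real (Suc n) powr (-2))" by (rule summable_powr_shift) simp
  show C0: "C \<ge> 0" unfolding C_def by (rule suminf_nonneg[OF sm]) auto
  fix s :: complex and N
  assume s: "Re s \<ge> 1/2" "s \<noteq> 1"
  let ?X = "real (Suc N)" and ?P = "\<Sum>n<Suc N. of_nat (Suc n) powr (-s)"
  define R where "R = (\<Sum>n. zeta_term (Suc (n + N)) s)"
  define D where "D = norm ((s - 1) * s * (s + 1)) * ?X powr (-1/2)"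
  have tm: "norm (zeta_term (Suc (n + N)) s) \<le> D * real (Suc n) powr (-2)" for n
  proof -
    have "real (Suc (n + N)) powr (- Re s - 2) \<le> real (Suc (n + N)) powr (-1/2 + -2)" using s by (intro powr_mono) auto
    also have "\<dots> = real (Suc (n + N)) powr (-1/2) * real (Suc (n + N)) powr (-2)" by (rule powr_add)
    also have "\<dots> \<le> ?X powr (-1/2) * real (Suc n) powr (-2)" by (intro mult_mono powr_mono2') auto
    finally have 1: "real (Suc (n + N)) powr (- Re s - 2) \<le> ?X powr (-1/2) * real (Suc n) powr (-2)" .
    have "norm (zeta_term (Suc (n + N)) s) \<le> norm ((s - 1) * s * (s + 1)) / 8 * real (Suc (n + N)) powr (- Re s - 2)"
      using s by (intro zeta_term_bound) auto
    also have "\<dots> \<le> norm ((s - 1) * s * (s + 1)) * (?X powr (-1/2) * real (Suc n) powr (-2))"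
      by (intro mult_mono 1) auto
    finally show ?thesis by (simp add: D_def mult_ac)
  qed
  have smD: "summable (\<lambda>n. D * real (Suc n) powr (-2))" by (intro summable_mult sm)
  have "norm R \<le> (\<Sum>n. D * real (Suc n) powr (-2))" unfolding R_def
    by (rule order_trans[OF summable_norm suminf_le[OF tm _ smD]])
       (auto intro!: summable_comparison_test[OF _ smD] exI[of _ 0] tm simp del: of_nat_Suc powr_minus)
  also have "\<dots> = D * C" unfolding C_def by (rule suminf_mult[OF sm])
  finally have "norm R / norm (s - 1) \<le> D * C / norm (s - 1)" by (intro divide_right_mono) auto
  also have "\<dots> = C * (norm s * norm (s + 1)) * ?X powr (-1/2)" using s by (simp add: D_def norm_mult)
  finally have R: "norm (R / (s - 1)) \<le> C * (norm s * norm (s + 1)) * ?X powr (-1/2)" by (simp add: norm_divide)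
  have "zeta_reg s = (s - 1) * (?P - of_nat (Suc N) powr (-s) / 2) + of_nat (Suc N) powr (1 - s) + R"
    unfolding R_def using s by (intro zeta_reg_approx) auto
  hence "riemann_zeta s - ?P = - (of_nat (Suc N) powr (-s) / 2) + of_nat (Suc N) powr (1 - s) / (s - 1) + R / (s - 1)"
    using s by (simp add: zeta_reg_conv add_divide_distrib del: of_nat_Suc)
  hence "norm (riemann_zeta s - ?P) \<le> norm (of_nat (Suc N) powr (-s) / 2 :: complex) + norm (of_nat (Suc N) powr (1 - s) / (s - 1)) + norm (R / (s - 1))"
    using norm_triangle_ineq[of "- (of_nat (Suc N) powr (-s) / 2) + of_nat (Suc N) powr (1 - s) / (s - 1)" "R / (s - 1)"]
      norm_triangle_ineq[of "- (of_nat (Suc N) powr (-s) / 2)" "of_nat (Suc N) powr (1 - s) / (s - 1)"] by (simp del: of_nat_Suc)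
  also have "norm (of_nat (Suc N) powr (-s) / 2 :: complex) \<le> ?X powr (-1/2)"
  proof -
    have "?X powr (- Re s) \<le> ?X powr (-1/2)" using s by (intro powr_mono) auto
    moreover have "norm (of_nat (Suc N) powr (-s) / 2 :: complex) = ?X powr (- Re s) / 2"
      unfolding norm_divide norm_of_nat_powr by simp
    ultimately show ?thesis using powr_ge_zero[of ?X "-1/2"] by linarith
  qed
  also have "norm (of_nat (Suc N) powr (1 - s) / (s - 1)) = ?X powr (1 - Re s) / norm (s - 1)"
    unfolding norm_divide norm_of_nat_powr by simp
  finally show "norm (riemann_zeta s - ?P) \<le> ?X powr (- 1/2) + ?X powr (1 - Re s) / norm (s - 1) + C * (norm s * norm (s + 1)) * ?X powr (- 1/2)"
    using R by simp
qed

lemma holomorphic_riemann_zeta: "riemann_zeta holomorphic_on {s. Re s > 0} - {1}"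
proof -
  have "(\<lambda>s. zeta_reg s / (s - 1)) holomorphic_on {s. Re s > 0} - {1}"
    by (intro holomorphic_intros holomorphic_on_subset[OF holomorphic_zeta_reg]) auto
  thus ?thesis by (rule holomorphic_transform) (auto simp: zeta_reg_conv)
qed

lemma of_nat_powr_1_line: "n > 0 \<Longrightarrow> of_nat n powr (- Complex 1 t) = of_real (1 / real n) * cis (- t * ln (real n))"
proof -
  assume n: "n > 0"
  have "Ln (of_nat n) = of_real (ln (real n))" using n by (metis Ln_of_nat)
  hence "of_nat n powr (- Complex 1 t) = exp (- Complex 1 t * of_real (ln (real n)))" using n by (simp add: powr_def)
  also have "\<dots> = of_real (exp (- ln (real n))) * cis (- t * ln (real n))"
    by (subst exp_eq_polar) simp
  also have "exp (- ln (real n)) = 1 / real n" using n by (simp add: exp_minus inverse_eq_divide)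
  finally show ?thesis .
qed

text \<open>The remainder is of size \<open>T\<^sup>2 N powr (- 1/2)\<close> plus the pole term,
  which decays like \<open>1 / T\<close>. The length \<open>N\<close> of order \<open>T ^ 8\<close>
  brings the former down to \<open>T powr (-2)\<close>, while \<open>ln N\<close> remains of order
  \<open>ln T\<close>, which leaves room for the loss in the derivative.\<close>

lemma zeta_1_line_approx:
  assumes \<delta>: "\<delta> > 0"
  shows "\<forall>\<^sub>F T in at_top. \<forall>t\<in>{\<delta> * T..2 * T}.
    norm (zeta_1_line t - (\<Sum>n=1..Suc (nat \<lceil>T ^ 8\<rceil>). of_real (1 / real n) * cis (- t * ln (real n)))) \<le> 1 \<and>
    norm (deriv riemann_zeta (Complex 1 t) + (\<Sum>n=1..Suc (nat \<lceil>T ^ 8\<rceil>). of_real (ln (real n) / real n) * cis (- t * ln (real n)))) \<le> 1"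
proof -
  obtain C where C: "C \<ge> 0" "\<And>s N. Re s \<ge> 1/2 \<Longrightarrow> s \<noteq> 1 \<Longrightarrow>
    norm (riemann_zeta s - (\<Sum>n<Suc N. of_nat (Suc n) powr (-s))) \<le>
      real (Suc N) powr (- 1/2) + real (Suc N) powr (1 - Re s) / norm (s - 1) + C * (norm s * norm (s + 1)) * real (Suc N) powr (- 1/2)"
    using riemann_zeta_approx by metis
  define E where "E = (\<lambda>T. (T ^ 8) powr (-1/2) + 3 / (\<delta> * T - 1) + C * ((2 * T + 3) * (2 * T + 3)) * (T ^ 8) powr (-1/2))"
  have "\<forall>\<^sub>F T in at_top. E T * ln (T ^ 8 + 2) \<le> 1"
  proof -
    have "((\<lambda>T. ((T ^ 8) powr (-1/2) + 3 / (\<delta> * T - 1) + C * ((2 * T + 3) * (2 * T + 3)) * (T ^ 8) powr (-1/2)) * ln (T ^ 8 + 2)) \<longlongrightarrow> 0) at_top"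
      using \<delta> by real_asymp
    hence "\<forall>\<^sub>F T in at_top. E T * ln (T ^ 8 + 2) < 1" unfolding E_def by (rule order_tendstoD) simp
    thus ?thesis by (rule eventually_mono) simp
  qed
  moreover have "\<forall>\<^sub>F T in at_top. \<delta> * T > 2" using \<delta> by real_asymp
  moreover have "\<forall>\<^sub>F T in at_top. T > (2::real)" by (rule eventually_gt_at_top)
  ultimately show ?thesis
  proof eventually_elim
    case (elim T)
    define N where "N = nat \<lceil>T ^ 8\<rceil>"
    define X where "X = real (Suc N)"
    define P where "P = (\<lambda>s. \<Sum>n<Suc N. of_nat (Suc n) powr (-s) :: complex)"
    have X1: "X \<ge> T ^ 8" using real_nat_ceiling_ge[of "T ^ 8"] unfolding X_def N_def of_nat_Suc by linarith
    have T0: "T ^ 8 \<ge> 2 ^ 8" using elim by (intro power_mono) auto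
    have X2: "X \<le> T ^ 8 + 2" using T0 unfolding X_def N_def by simp linarith
    have Xp: "X powr (-1/2) \<le> (T ^ 8) powr (-1/2)" using X1 T0 by (intro powr_mono2') auto
    have lnX: "2 \<le> ln X" "ln X \<le> ln (T ^ 8 + 2)"
    proof -
      have "exp 2 \<le> (3::real) * 3" using mult_mono[OF exp_le exp_le] by (simp add: exp_add[symmetric])
      hence "ln (exp 2) \<le> ln X" using X1 T0 by (intro ln_mono) auto
      thus "2 \<le> ln X" by simp
      show "ln X \<le> ln (T ^ 8 + 2)" using X1 X2 T0 by (intro ln_mono) auto
    qed
    \<comment> \<open>A disc so small that \<open>X powr r = e\<close>: the pole term does not grow
      on it, and Cauchy's inequality for the derivative costs only a factor
      \<open>ln X\<close>.\<close>
    define r where "r = 1 / ln X"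
    have r: "0 < r" "r \<le> 1/2" using lnX by (auto simp: r_def field_simps)
    have E0: "E T \<ge> 0" unfolding E_def using elim C by (intro add_nonneg_nonneg mult_nonneg_nonneg) auto
    have E1: "E T \<le> 1"
    proof -
      have "E T * 1 \<le> E T * ln (T ^ 8 + 2)" using E0 lnX by (intro mult_left_mono) auto
      thus ?thesis using elim by simp
    qed
    show ?case
    proof
      fix t assume t: "t \<in> {\<delta> * T..2 * T}"
      define s where "s = Complex 1 t"
      have box: "Re w \<ge> 1 - r \<and> norm w \<le> 2 * T + 2 \<and> norm (w - 1) \<ge> \<delta> * T - 1" if "norm (s - w) \<le> r" for w
      proof -
        have "\<bar>Re (s - w)\<bar> \<le> r" "\<bar>Im (s - w)\<bar> \<le> r" using that abs_Re_le_cmod abs_Im_le_cmod order_trans by blast+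
        hence a: "Re w \<ge> 1 - r" "Im w \<ge> t - r" by (auto simp: s_def abs_le_iff)
        have "norm s \<le> 1 + 2 * T" using cmod_le[of s] t elim \<delta> by (simp add: s_def)
        moreover have "norm w \<le> norm s + norm (s - w)" using norm_triangle_ineq4[of s "s - w"] by simp
        moreover have "norm (w - 1) \<ge> Im w" using abs_Im_le_cmod[of "w - 1"] by simp
        ultimately show ?thesis using a that r t by auto
      qed
      have err: "norm (riemann_zeta w - P w) \<le> E T" if "norm (s - w) \<le> r" for w
      proof -
        note b = box[OF that]
        have d: "\<delta> * T - 1 > 0" using elim by simp
        have w1: "w \<noteq> 1" using b d by auto
        have "norm (riemann_zeta w - P w) \<le> X powr (-1/2) + X powr (1 - Re w) / norm (w - 1) + C * (norm w * norm (w + 1)) * X powr (-1/2)"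
          unfolding P_def X_def using b r w1 by (intro C) auto
        also have "\<dots> \<le> (T ^ 8) powr (-1/2) + 3 / (\<delta> * T - 1) + C * ((2 * T + 3) * (2 * T + 3)) * (T ^ 8) powr (-1/2)"
        proof (intro add_mono Xp)
          have "X powr (1 - Re w) \<le> X powr r" using b X1 T0 by (intro powr_mono) auto
          also have "\<dots> = exp 1" using lnX X1 T0 by (simp add: powr_def r_def)
          also have "\<dots> \<le> 3" by (rule exp_le)
          finally show "X powr (1 - Re w) / norm (w - 1) \<le> 3 / (\<delta> * T - 1)" using b d by (intro frac_le) auto
          have "norm (w + 1) \<le> 2 * T + 3" using norm_triangle_ineq[of w 1] b by simp
          thus "C * (norm w * norm (w + 1)) * X powr (-1/2) \<le> C * ((2 * T + 3) * (2 * T + 3)) * (T ^ 8) powr (-1/2)"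
            using b C(1) Xp elim by (intro mult_mono mult_nonneg_nonneg) auto
        qed
        finally show ?thesis by (simp add: E_def)
      qed
      have hol: "(\<lambda>w. riemann_zeta w - P w) holomorphic_on {s. Re s > 0} - {1}"
        unfolding P_def by (intro holomorphic_intros holomorphic_riemann_zeta)
      have sub: "cball s r \<subseteq> {s. Re s > 0} - {1}"
      proof
        fix w assume "w \<in> cball s r"
        hence "norm (s - w) \<le> r" by (simp add: dist_norm)
        from box[OF this] show "w \<in> {s. Re s > 0} - {1}" using r elim by auto
      qed
      have "norm ((deriv ^^ 1) (\<lambda>w. riemann_zeta w - P w) s) \<le> fact 1 * E T / r ^ 1"
      proof (rule Cauchy_inequality)
        show "(\<lambda>w. riemann_zeta w - P w) holomorphic_on ball s r"
          by (rule holomorphic_on_subset[OF hol]) (use sub ball_subset_cball in blast)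
        show "continuous_on (cball s r) (\<lambda>w. riemann_zeta w - P w)"
          by (rule holomorphic_on_imp_continuous_on[OF holomorphic_on_subset[OF hol sub]])
      qed (use r err in auto)
      hence "norm (deriv (\<lambda>w. riemann_zeta w - P w) s) \<le> E T * ln X" by (simp add: r_def)
      also have "\<dots> \<le> E T * ln (T ^ 8 + 2)" using E0 lnX by (intro mult_left_mono) auto
      finally have d1: "norm (deriv (\<lambda>w. riemann_zeta w - P w) s) \<le> 1" using elim by simp
      have dP: "(P has_field_derivative - (\<Sum>n<Suc N. of_real (ln (real (Suc n))) * of_nat (Suc n) powr (-s))) (at s)"
      proof -
        have "((\<lambda>s. of_nat (Suc n) powr (-s)) has_field_derivative - (of_real (ln (real (Suc n))) * of_nat (Suc n) powr (-s))) (at s)" for n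
        proof -
          have l: "Ln (of_nat (Suc n)) = of_real (ln (real (Suc n)))" by (rule Ln_of_nat) simp
          show ?thesis unfolding powr_def l
            by (auto intro!: derivative_eq_intros simp: l simp del: of_nat_Suc)
        qed
        hence "(P has_field_derivative (\<Sum>n<Suc N. - (of_real (ln (real (Suc n))) * of_nat (Suc n) powr (-s)))) (at s)"
          unfolding P_def by (rule DERIV_sum)
        thus ?thesis by (simp only: sum_negf)
      qed
      have "s \<in> {s. Re s > 0} - {1}" using sub r by (metis centre_in_cball less_imp_le subsetD)
      hence dz: "(riemann_zeta has_field_derivative deriv riemann_zeta s) (at s)"
        by (intro holomorphic_derivI[OF holomorphic_riemann_zeta]) (auto intro: open_halfspace_Re_gt)
      have deq: "deriv (\<lambda>w. riemann_zeta w - P w) s = deriv riemann_zeta s + (\<Sum>n<Suc N. of_real (ln (real (Suc n))) * of_nat (Suc n) powr (-s))"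
        using DERIV_imp_deriv[OF DERIV_diff[OF dz dP]] by simp
      have p: "of_nat (Suc n) powr (-s) = of_real (1 / real (Suc n)) * cis (- t * ln (real (Suc n)))" for n
        unfolding s_def by (rule of_nat_powr_1_line) simp
      have e1: "(\<Sum>n=1..Suc N. of_real (1 / real n) * cis (- t * ln (real n))) = P s"
        unfolding P_def p by (simp only: One_nat_def sum.atLeast1_atMost_eq)
      have e2: "(\<Sum>n=1..Suc N. of_real (ln (real n) / real n) * cis (- t * ln (real n)))
          = (\<Sum>n<Suc N. of_real (ln (real (Suc n))) * of_nat (Suc n) powr (-s))"
        unfolding p One_nat_def sum.atLeast1_atMost_eq by (rule sum.cong[OF refl]) (simp del: of_nat_Suc)
      show "norm (zeta_1_line t - (\<Sum>n=1..Suc (nat \<lceil>T ^ 8\<rceil>). of_real (1 / real n) * cis (- t * ln (real n)))) \<le> 1 \<and>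
        norm (deriv riemann_zeta (Complex 1 t) + (\<Sum>n=1..Suc (nat \<lceil>T ^ 8\<rceil>). of_real (ln (real n) / real n) * cis (- t * ln (real n)))) \<le> 1"
        unfolding N_def[symmetric] e1 e2 deq[symmetric, unfolded s_def] 
        using d1 err[of s] r E1 by (simp add: s_def deq[unfolded s_def])
    qed
  qed
qed

lemma norm_square_le_of_approx:
  fixes z p :: complex assumes "norm (z - p) \<le> 1" shows "(norm z)\<^sup>2 \<le> 2 * (norm p)\<^sup>2 + 2"
proof -
  have "norm z \<le> norm p + norm (z - p)" using norm_triangle_ineq[of p "z - p"] by simp
  hence "(norm z)\<^sup>2 \<le> (norm p + 1)\<^sup>2" using assms by (intro power_mono) auto
  also have "\<dots> \<le> 2 * (norm p)\<^sup>2 + 2" using zero_le_power2[of "norm p - 1"] by (simp add: power2_eq_square algebra_simps)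
  finally show ?thesis .
qed

lemma continuous_on_deriv_zeta_1_line: "0 \<notin> A \<Longrightarrow> continuous_on A (\<lambda>t. deriv riemann_zeta (Complex 1 t))"
proof -
  assume A: "0 \<notin> A"
  have "continuous_on ({s. Re s > 0} - {1}) (deriv riemann_zeta)"
    by (intro holomorphic_on_imp_continuous_on holomorphic_deriv holomorphic_riemann_zeta)
       (auto intro: open_halfspace_Re_gt)
  thus ?thesis by (rule continuous_on_compose2[OF _ continuous_on_Complex]) (use A in \<open>auto simp: complex_eq_iff\<close>)
qed

lemma summable_ln_square: "summable (\<lambda>n. (ln (real n) / real n)\<^sup>2)"
proof (rule summable_comparison_test_bigo)
  show "summable (\<lambda>n. norm (real n powr (-3/2)))" by (simp add: summable_real_powr_iff)
  show "(\<lambda>n. (ln (real n) / real n)\<^sup>2) \<in> O(\<lambda>n. real n powr (-3/2))" by real_asymp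
qed

text \<open>The constant must not depend on \<open>\<delta>\<close>: only the point from which on the bound holds does.\<close>

lemma mean_square_from_dirichlet:
  fixes F :: "real \<Rightarrow> complex" and c :: "nat \<Rightarrow> real"
  assumes \<delta>: "\<delta> > 0" "\<delta> < 1" and cont: "\<And>T. T > 0 \<Longrightarrow> continuous_on {\<delta> * T..2 * T} F"
    and approx: "\<forall>\<^sub>F T in at_top. \<forall>t\<in>{\<delta> * T..2 * T}.
       norm (F t - (\<Sum>n=1..Suc (nat \<lceil>T ^ 8\<rceil>). of_real (c n / real n) * cis (- t * ln (real n)))) \<le> 1"
    and c: "\<And>n. n \<ge> 1 \<Longrightarrow> \<bar>c n\<bar> \<le> 1 + ln (real n)"
    and sm: "summable (\<lambda>n. (c n / real n)\<^sup>2)"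
  shows "\<forall>\<^sub>F T in at_top. integral {\<delta> * T..2 * T} (\<lambda>t. (norm (F t))\<^sup>2) \<le> (4 * (\<Sum>n. (c n / real n)\<^sup>2) + 5) * T"
proof -
  \<comment> \<open>The off-diagonal terms are at most \<open>4 M ^ 4\<close> with
    \<open>M = 1 + ln (T ^ 8 + 2)\<close>, hence at most \<open>T / 2\<close>.\<close>
  have "\<forall>\<^sub>F T in at_top. 8 * (1 + ln (T ^ 8 + 2)) ^ 4 \<le> (T::real)" by real_asymp
  moreover have "\<forall>\<^sub>F T in at_top. T > (1::real)" by (rule eventually_gt_at_top)
  ultimately show ?thesis using approx
  proof eventually_elim
    case (elim T)
    define X where "X = Suc (nat \<lceil>T ^ 8\<rceil>)"
    define P where "P = (\<lambda>t. \<Sum>n=1..X. of_real (c n / real n) * cis (- t * ln (real n)))"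
    define M where "M = 1 + ln (T ^ 8 + 2)"
    define Q where "Q = (\<Sum>n. (c n / real n)\<^sup>2)"
    have ab: "\<delta> * T \<le> 2 * T" using \<delta> elim by (intro mult_right_mono) auto
    have T1: "T ^ 8 \<ge> 1" using elim by simp
    have X: "1 \<le> real X" "real X \<le> T ^ 8 + 2" using T1 unfolding X_def by (simp, linarith)
    have lnX: "ln (real X) \<le> ln (T ^ 8 + 2)" using X by (intro ln_mono) auto
    have "integral {\<delta> * T..2 * T} (\<lambda>t. (norm (F t))\<^sup>2) \<le> integral {\<delta> * T..2 * T} (\<lambda>t. 2 * (norm (P t))\<^sup>2 + 2)"
    proof (rule integral_le)
      show "(\<lambda>t. (norm (F t))\<^sup>2) integrable_on {\<delta> * T..2 * T}"
        using cont elim by (intro integrable_continuous_real continuous_intros) auto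
      show "(\<lambda>t. 2 * (norm (P t))\<^sup>2 + 2) integrable_on {\<delta> * T..2 * T}"
        unfolding P_def by (intro integrable_continuous_real continuous_intros)
      show "(norm (F t))\<^sup>2 \<le> 2 * (norm (P t))\<^sup>2 + 2" if "t \<in> {\<delta> * T..2 * T}" for t
        unfolding P_def X_def using elim(3) that by (intro norm_square_le_of_approx) blast
    qed
    also have "\<dots> = 2 * integral {\<delta> * T..2 * T} (\<lambda>t. (norm (P t))\<^sup>2) + 2 * (2 * T - \<delta> * T)"
    proof -
      have "(\<lambda>t. 2 * (norm (P t))\<^sup>2) integrable_on {\<delta> * T..2 * T}"
        unfolding P_def by (intro integrable_continuous_real continuous_intros)
      thus ?thesis using ab by (subst integral_add) auto
    qed
    also have "integral {\<delta> * T..2 * T} (\<lambda>t. (norm (P t))\<^sup>2) \<le> (2 * T - \<delta> * T) * (\<Sum>n=1..X. (c n / n)\<^sup>2) + 4 * M\<^sup>2 * (harm X)\<^sup>2"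
      unfolding P_def
    proof (rule dirichlet_polynomial_mean_square[OF ab])
      fix n assume n: "n \<in> {1..X}"
      have "ln (real n) \<le> ln (real X)" using n by (intro ln_mono) auto
      moreover have "\<bar>c n\<bar> \<le> 1 + ln (real n)" using n by (intro c) auto
      ultimately show "\<bar>c n\<bar> \<le> M" using lnX unfolding M_def by linarith
    qed
    also have "(2 * T - \<delta> * T) * (\<Sum>n=1..X. (c n / n)\<^sup>2) \<le> (2 * T) * Q"
      unfolding Q_def using \<delta> elim ab by (intro mult_mono sum_le_suminf[OF sm] sum_nonneg) auto
    also have "4 * M\<^sup>2 * (harm X)\<^sup>2 \<le> 4 * M\<^sup>2 * M\<^sup>2"
      using harm_le_ln[of X] lnX by (intro mult_left_mono power_mono) (auto simp: X_def M_def harm_nonneg)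
    also have "4 * M\<^sup>2 * M\<^sup>2 \<le> T / 2" using elim(1) by (simp add: M_def power4_eq_xxxx power2_eq_square mult_ac)
    finally have "integral {\<delta> * T..2 * T} (\<lambda>t. (norm (F t))\<^sup>2) \<le> 2 * (2 * T * Q + T / 2) + 2 * (2 * T - \<delta> * T)" by simp
    also have "\<dots> \<le> (4 * Q + 5) * T" using \<delta> elim(2) by (simp add: algebra_simps)
    finally show ?case by (simp add: Q_def)
  qed
qed

lemma zeta_1_line_moments:
  obtains C where "C > 0" "\<And>\<delta>. \<delta> > 0 \<Longrightarrow> \<delta> < 1 \<Longrightarrow> \<forall>\<^sub>F T in at_top.
     integral {\<delta> * T..2 * T} (\<lambda>t. (norm (zeta_1_line t))\<^sup>2) \<le> C * T \<and>
     integral {\<delta> * T..2 * T} (\<lambda>t. (norm (deriv riemann_zeta (Complex 1 t)))\<^sup>2) \<le> C * T"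
proof
  define C1 C2 where "C1 = 4 * (\<Sum>n. (1 / real n)\<^sup>2) + 5" and "C2 = 4 * (\<Sum>n. (- ln (real n) / real n)\<^sup>2) + 5"
  have s1: "summable (\<lambda>n. (1 / real n)\<^sup>2)" using inverse_power_summable[of 2] by (simp add: power_divide inverse_eq_divide)
  have s2: "summable (\<lambda>n. (- ln (real n) / real n)\<^sup>2)" using summable_ln_square by simp
  have "C1 > 0" "C2 > 0" unfolding C1_def C2_def by (intro add_nonneg_pos mult_nonneg_nonneg suminf_nonneg s1 s2; simp)+
  thus "max C1 C2 > 0" by simp
  fix \<delta> :: real assume \<delta>: "\<delta> > 0" "\<delta> < 1"
  have n0: "0 \<notin> {\<delta> * T..2 * T}" if "T > 0" for T using that \<delta> by (auto simp: mult_le_0_iff)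
  have "\<forall>\<^sub>F T in at_top. integral {\<delta> * T..2 * T} (\<lambda>t. (norm (zeta_1_line t))\<^sup>2) \<le> C1 * T"
    unfolding C1_def
  proof (rule mean_square_from_dirichlet[OF \<delta> continuous_on_zeta_1_line[OF n0] _ _ s1])
    show "\<forall>\<^sub>F T in at_top. \<forall>t\<in>{\<delta> * T..2 * T}. norm (zeta_1_line t - (\<Sum>n=1..Suc (nat \<lceil>T ^ 8\<rceil>). of_real (1 / real n) * cis (- t * ln (real n)))) \<le> 1"
      by (rule eventually_mono[OF zeta_1_line_approx[OF \<delta>(1)]]) blast
  qed auto
  moreover have "\<forall>\<^sub>F T in at_top. integral {\<delta> * T..2 * T} (\<lambda>t. (norm (deriv riemann_zeta (Complex 1 t)))\<^sup>2) \<le> C2 * T"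
    unfolding C2_def
  proof (rule mean_square_from_dirichlet[OF \<delta> continuous_on_deriv_zeta_1_line[OF n0] _ _ s2])
    show "\<forall>\<^sub>F T in at_top. \<forall>t\<in>{\<delta> * T..2 * T}. norm (deriv riemann_zeta (Complex 1 t) - (\<Sum>n=1..Suc (nat \<lceil>T ^ 8\<rceil>). of_real (- ln (real n) / real n) * cis (- t * ln (real n)))) \<le> 1"
    proof -
      have "(\<Sum>n=1..X. of_real (- ln (real n) / real n) * cis (- t * ln (real n)))
        = - (\<Sum>n=1..X. of_real (ln (real n) / real n) * cis (- t * ln (real n)))" for X t
        unfolding sum_negf[symmetric] by (rule sum.cong) simp_all
      thus ?thesis unfolding diff_conv_add_uminus minus_minus
        by (intro eventually_mono[OF zeta_1_line_approx[OF \<delta>(1)]]) (simp only: minus_minus, blast)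
    qed
  qed auto
  moreover have "\<forall>\<^sub>F T in at_top. T > (0::real)" by (rule eventually_gt_at_top)
  ultimately show "\<forall>\<^sub>F T in at_top.
     integral {\<delta> * T..2 * T} (\<lambda>t. (norm (zeta_1_line t))\<^sup>2) \<le> max C1 C2 * T \<and>
     integral {\<delta> * T..2 * T} (\<lambda>t. (norm (deriv riemann_zeta (Complex 1 t)))\<^sup>2) \<le> max C1 C2 * T"
  proof eventually_elim
    case (elim T)
    have "C1 * T \<le> max C1 C2 * T" "C2 * T \<le> max C1 C2 * T" using elim by (auto intro!: mult_right_mono)
    thus ?case using elim by linarith
  qed
qed

subsection \<open>Local variation of the argument of zeta\<close>

lemma markov_interval:
  fixes f :: "real \<Rightarrow> real"
  assumes f: "continuous_on {c..d} f" "\<And>t. t \<in> {c..d} \<Longrightarrow> f t \<ge> 0"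
  shows "{t\<in>{c..d}. k \<le> f t} \<in> lmeasurable" (is "?A \<in> _")
    and "k * measure lebesgue {t\<in>{c..d}. k \<le> f t} \<le> integral {c..d} f"
proof -
  have "closed ?A" by (intro continuous_on_closed_Collect_le f continuous_intros closed_atLeastAtMost)
  moreover have "bounded ?A" by (rule bounded_subset[OF bounded_closed_interval[of c d]]) auto
  ultimately show A: "?A \<in> lmeasurable" by (intro lmeasurable_compact) (simp add: compact_eq_bounded_closed)
  have Int: "?A \<inter> {c..d} = ?A" by auto
  have "indicat_real ?A integrable_on {c..d}" using A unfolding integrable_on_indicator Int .
  hence "integral {c..d} (\<lambda>t. k * indicat_real ?A t) \<le> integral {c..d} f"
  proof (intro integral_le)
    show "(\<lambda>t. k * indicat_real ?A t) integrable_on {c..d}" if "indicat_real ?A integrable_on {c..d}"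
      by (rule integrable_on_mult_right[OF that])
    show "f integrable_on {c..d}" by (rule integrable_continuous_real[OF f(1)])
    show "k * indicat_real ?A t \<le> f t" if "t \<in> {c..d}" for t using f(2)[OF that] by (simp add: indicator_def)
  qed
  moreover have "integral {c..d} (indicat_real ?A) = measure lebesgue ?A"
    by (rule Equivalence_Lebesgue_Henstock_Integration.integral_indicator[of ?A "{c..d}", unfolded Int, OF A])
  ultimately show "k * measure lebesgue ?A \<le> integral {c..d} f" by simp
qed

text \<open>Markov's inequality on both half lines at once, with a factor 2. The resulting set is
  symmetric, which matches the oddness of \<open>S\<close>.\<close>

lemma markov_abs:
  fixes f :: "real \<Rightarrow> real"
  assumes f: "continuous_on {c..d} f" "\<And>t. t \<in> {c..d} \<Longrightarrow> f t \<ge> 0" and k: "k \<ge> 0"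
  shows "{t. \<bar>t\<bar> \<in> {c..d} \<and> k \<le> f \<bar>t\<bar>} \<in> lmeasurable" (is "?A \<in> _")
    and "k * measure lebesgue {t. \<bar>t\<bar> \<in> {c..d} \<and> k \<le> f \<bar>t\<bar>} \<le> 2 * integral {c..d} f"
proof -
  define P where "P = {t\<in>{c..d}. k \<le> f t}"
  define Q where "Q = {t\<in>{-d..-c}. k \<le> f (-t)}"
  have f': "continuous_on {-d..-c} (\<lambda>t. f (-t))"
    by (rule continuous_on_compose2[OF f(1)]) (auto intro!: continuous_intros)
  have P: "P \<in> lmeasurable" "k * measure lebesgue P \<le> integral {c..d} f"
    unfolding P_def by (rule markov_interval[OF f]; assumption)+
  have Q: "Q \<in> lmeasurable" "k * measure lebesgue Q \<le> integral {c..d} f"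
  proof -
    have nn: "f (-t) \<ge> 0" if "t \<in> {-d..-c}" for t using that by (intro f(2)) auto
    show "Q \<in> lmeasurable" unfolding Q_def by (rule markov_interval[OF f' nn])
    have "k * measure lebesgue Q \<le> integral {-d..-c} (\<lambda>t. f (-t))" unfolding Q_def by (rule markov_interval[OF f' nn])
    thus "k * measure lebesgue Q \<le> integral {c..d} f" by (simp add: Henstock_Kurzweil_Integration.integral_reflect_real)
  qed
  have "closed {t. \<bar>t\<bar> \<in> {c..d} \<and> k \<le> f \<bar>t\<bar>}"
  proof -
    have c: "closed ((\<lambda>t. \<bar>t\<bar>) -` {c..d})" by (intro closed_vimage closed_atLeastAtMost continuous_intros)
    have "closed {t \<in> (\<lambda>t. \<bar>t\<bar>) -` {c..d}. k \<le> f \<bar>t\<bar>}"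
      by (intro continuous_on_closed_Collect_le continuous_on_const c continuous_on_compose2[OF f(1)]) (auto intro!: continuous_intros)
    thus ?thesis by simp
  qed
  moreover have sub: "?A \<subseteq> P \<union> Q" unfolding P_def Q_def by (auto simp: abs_if split: if_splits)
  moreover have bd: "bounded (P \<union> Q)" unfolding P_def Q_def
    by (intro bounded_Un[THEN iffD2] conjI; rule bounded_subset[OF bounded_closed_interval]; blast)
  ultimately show A: "?A \<in> lmeasurable"
    by (intro lmeasurable_compact) (simp only: compact_eq_bounded_closed bounded_subset[OF bd sub])
  have "measure lebesgue ?A \<le> measure lebesgue (P \<union> Q)"
    using sub A P Q by (intro measure_mono_fmeasurable) (auto intro: fmeasurableD)
  also have "\<dots> \<le> measure lebesgue P + measure lebesgue Q" using P Q by (intro measure_Un_le fmeasurableD)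
  finally have "k * measure lebesgue ?A \<le> k * (measure lebesgue P + measure lebesgue Q)" using k by (rule mult_left_mono)
  thus "k * measure lebesgue ?A \<le> 2 * integral {c..d} f" using P Q by (simp add: algebra_simps)
qed

section \<open>Variation over short windows\<close>

lemma antiderivative_real:
  fixes f :: "real \<Rightarrow> real"
  assumes f: "continuous_on UNIV f"
  obtains F where "\<And>t. (F has_real_derivative f t) (at t)"
proof -
  have c: "continuous_on UNIV (\<lambda>t. complex_of_real (f t))" by (intro continuous_intros f)
  obtain G where G: "\<And>t. (G has_vector_derivative complex_of_real (f t)) (at t)"
    using antiderivative_real_line[OF c] by auto
  have "((\<lambda>t. Re (G t)) has_real_derivative f t) (at t)" for t
    using has_vector_derivative_Re[OF G[of t]] by (simp add: has_real_derivative_iff_has_vector_derivative)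
  thus ?thesis by (rule that)
qed

text \<open>Every value of \<open>f\<close> is counted over a length of at most \<open>2 u\<close>.
  In place of an exchange of integrals, a second primitive \<open>H\<close> reduces the left side to
  two windows at the ends, which the monotonicity of \<open>F\<close> estimates.\<close>

lemma window_integral_bound:
  fixes F f :: "real \<Rightarrow> real"
  assumes F: "\<And>t. (F has_real_derivative f t) (at t)" and f: "\<And>t. f t \<ge> 0" and pq: "p \<le> q" "u \<ge> 0"
  shows "integral {p..q} (\<lambda>t. F (t + u) - F (t - u)) \<le> 2 * u * (F (q + u) - F (p - u))"
proof (cases "u = 0")
  case False
  hence u: "u > 0" using pq by simp
  have mono: "F x \<le> F y" if "x \<le> y" for x y
    by (rule DERIV_nonneg_imp_nondecreasing[OF that]) (use F f in blast)
  have "continuous_on UNIV F" by (rule DERIV_continuous_on[OF has_field_derivative_at_within[OF F]])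
  then obtain H where H: "\<And>t. (H has_real_derivative F t) (at t)" using antiderivative_real by blast
  have "((\<lambda>t. F (t + u) - F (t - u)) has_integral ((H (q + u) - H (q - u)) - (H (p + u) - H (p - u)))) {p..q}"
  proof (rule fundamental_theorem_of_calculus[OF pq(1)])
    fix t
    have "((\<lambda>t. H (t + u)) has_real_derivative F (t + u) * 1) (at t)" "((\<lambda>t. H (t - u)) has_real_derivative F (t - u) * 1) (at t)"
      by (rule DERIV_chain2[OF H], (auto intro!: derivative_eq_intros)[1])+
    from DERIV_diff[OF this] show "((\<lambda>t. H (t + u) - H (t - u)) has_vector_derivative F (t + u) - F (t - u)) (at t within {p..q})"
      by (simp add: has_real_derivative_iff_has_vector_derivative has_vector_derivative_at_within)
  qed
  hence eq: "integral {p..q} (\<lambda>t. F (t + u) - F (t - u)) = (H (q + u) - H (q - u)) - (H (p + u) - H (p - u))"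
    by (rule integral_unique)
  have up: "H (q + u) - H (q - u) \<le> 2 * u * F (q + u)"
  proof -
    obtain z where z: "z < q + u" "H (q + u) - H (q - u) = (q + u - (q - u)) * F z"
      using MVT2[of "q - u" "q + u" H F] u H by auto
    have "2 * u * F z \<le> 2 * u * F (q + u)" using z u by (intro mult_left_mono mono) auto
    thus ?thesis using z(2) by simp
  qed
  have lo: "H (p + u) - H (p - u) \<ge> 2 * u * F (p - u)"
  proof -
    obtain z where z: "p - u < z" "H (p + u) - H (p - u) = (p + u - (p - u)) * F z"
      using MVT2[of "p - u" "p + u" H F] u H by auto
    have "2 * u * F (p - u) \<le> 2 * u * F z" using z u by (intro mult_left_mono mono) auto
    thus ?thesis using z(2) by simp
  qed
  have "2 * u * (F (q + u) - F (p - u)) = 2 * u * F (q + u) - 2 * u * F (p - u)" by (simp add: algebra_simps)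
  thus ?thesis using eq up lo by linarith
qed simp

text \<open>Applied twice, with the same \<open>F\<close>: first to zeta itself, to keep its modulus
  away from 0 throughout the window, then to the phase \<open>S\<close>.\<close>

lemma window_variation:
  fixes g :: "real \<Rightarrow> 'a::real_normed_vector" and F f :: "real \<Rightarrow> real"
  assumes F: "\<And>t. (F has_real_derivative f t) (at t)" and f: "\<And>t. f t \<ge> 0" and K: "K \<ge> 0"
    and g: "\<And>w. \<bar>w - t\<bar> \<le> u \<Longrightarrow> (g has_vector_derivative g' w) (at w)" "\<And>w. \<bar>w - t\<bar> \<le> u \<Longrightarrow> norm (g' w) \<le> K * f w"
    and v: "\<bar>v - t\<bar> \<le> u"
  shows "norm (g v - g t) \<le> K * (F (t + u) - F (t - u))"
proof -
  have mono: "F x \<le> F y" if "x \<le> y" for x y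
    by (rule DERIV_nonneg_imp_nondecreasing[OF that]) (use F f in blast)
  have main: "norm (g y - g x) \<le> K * (F (t + u) - F (t - u))" if xy: "x < y" "t - u \<le> x" "y \<le> t + u" for x y
  proof -
    have "norm (g y - g x) \<le> K * F y - K * F x"
    proof (rule differentiable_bound_general[OF xy(1)])
      show "continuous_on {x..y} g"
        by (rule continuous_on_vector_derivative[of _ _ g']) (rule has_vector_derivative_at_within[OF g(1)], use xy in auto)
      have "continuous_on UNIV F" by (rule DERIV_continuous_on[OF has_field_derivative_at_within[OF F]])
      thus "continuous_on {x..y} (\<lambda>z. K * F z)" by (intro continuous_intros) (rule continuous_on_subset, auto)
      fix z assume z: "x < z" "z < y"
      show "(g has_vector_derivative g' z) (at z)" using z xy by (intro g) auto
      show "((\<lambda>z. K * F z) has_vector_derivative K * f z) (at z)"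
        unfolding has_real_derivative_iff_has_vector_derivative[symmetric] by (rule DERIV_cmult[OF F])
      show "norm (g' z) \<le> K * f z" using z xy by (intro g) auto
    qed
    also have "\<dots> = K * (F y - F x)" by (simp add: algebra_simps)
    also have "\<dots> \<le> K * (F (t + u) - F (t - u))" using K mono[of y "t + u"] mono[of "t - u" x] xy by (intro mult_left_mono) auto
    finally show ?thesis .
  qed
  consider "v < t" | "v = t" | "t < v" by linarith
  thus ?thesis
  proof cases
    case 1 thus ?thesis using main[of v t] v by (simp add: norm_minus_commute)
  next
    case 2 thus ?thesis using K v mono[of "t - u" "t + u"] by simp
  next
    case 3 thus ?thesis using main[of t v] v by simp
  qed
qed

text \<open>The logarithmic derivatives differ by \<open>1 / (s - 1) = 1 / (i t)\<close>, which is
  purely imaginary.\<close>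

lemma Re_zeta_reg_log_deriv_1_line:
  assumes "t \<noteq> 0"
  shows "Re (deriv zeta_reg (Complex 1 t) / zeta_reg (Complex 1 t)) = Re (deriv riemann_zeta (Complex 1 t) / zeta_1_line t)"
proof -
  define s where "s = Complex 1 t"
  have s: "Re s > 0" "s \<noteq> 1" using assms by (auto simp: s_def complex_eq_iff)
  have z0: "riemann_zeta s \<noteq> 0" unfolding s_def by (rule zeta_1_line_nonzero[OF assms])
  have dz: "(riemann_zeta has_field_derivative deriv riemann_zeta s) (at s)"
    using s by (intro holomorphic_derivI[OF holomorphic_riemann_zeta]) (auto intro: open_halfspace_Re_gt)
  have "((\<lambda>w. (w - 1) * riemann_zeta w) has_field_derivative (riemann_zeta s + (s - 1) * deriv riemann_zeta s)) (at s)"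
    by (rule derivative_eq_intros dz refl)+ simp
  hence "(zeta_reg has_field_derivative (riemann_zeta s + (s - 1) * deriv riemann_zeta s)) (at s)"
  proof (rule has_field_derivative_transform_within_open[of _ _ _ "{s. Re s > 0} - {1}"])
    show "open ({s. Re s > 0} - {1})" by (auto intro: open_halfspace_Re_gt)
    show "(w - 1) * riemann_zeta w = zeta_reg w" if "w \<in> {s. Re s > 0} - {1}" for w using that by (simp add: zeta_reg_conv)
  qed (use s in auto)
  hence "deriv zeta_reg s / zeta_reg s = (riemann_zeta s + (s - 1) * deriv riemann_zeta s) / ((s - 1) * riemann_zeta s)"
    using s by (simp add: DERIV_imp_deriv zeta_reg_conv)
  also have "\<dots> = 1 / (s - 1) + deriv riemann_zeta s / riemann_zeta s" using s z0 by (simp add: field_simps)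
  finally have "Re (deriv zeta_reg s / zeta_reg s) = Re (1 / (s - 1)) + Re (deriv riemann_zeta s / riemann_zeta s)" by simp
  moreover have "s - 1 = \<i> * of_real t" by (simp add: s_def complex_eq_iff)
  ultimately show ?thesis by (simp add: s_def Re_divide)
qed

lemma zeta_reg_log_deriv_cnj:
  "Re (deriv zeta_reg (Complex 1 (-t)) / zeta_reg (Complex 1 (-t))) = Re (deriv zeta_reg (Complex 1 t) / zeta_reg (Complex 1 t))"
proof -
  define s where "s = Complex 1 t"
  have cs: "Complex 1 (-t) = cnj s" by (simp add: s_def complex_eq_iff)
  have "(zeta_reg has_field_derivative deriv zeta_reg s) (at (cnj (cnj s)))"
    using holomorphic_derivI[OF holomorphic_zeta_reg open_halfspace_Re_gt, of s] by (simp add: s_def)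
  hence "(cnj \<circ> zeta_reg \<circ> cnj has_field_derivative cnj (deriv zeta_reg s)) (at (cnj s))"
    by (rule has_field_derivative_cnj_cnj)
  hence "(zeta_reg has_field_derivative cnj (deriv zeta_reg s)) (at (cnj s))"
  proof (rule has_field_derivative_transform_within_open[OF _ open_halfspace_Re_gt[of "-1"]])
    show "cnj s \<in> {s. Re s > -1}" by (simp add: s_def)
    fix w assume "w \<in> {s. Re s > -1}"
    thus "(cnj \<circ> zeta_reg \<circ> cnj) w = zeta_reg w" using cnj_zeta_reg[of w] by simp
  qed
  hence "deriv zeta_reg (cnj s) = cnj (deriv zeta_reg s)" by (rule DERIV_imp_deriv)
  moreover have "zeta_reg (cnj s) = cnj (zeta_reg s)" by (rule cnj_zeta_reg) (simp add: s_def)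
  ultimately show ?thesis unfolding cs s_def[symmetric] by (simp flip: complex_cnj_divide)
qed

lemma zeta_phase_odd:
  fixes S :: "real \<Rightarrow> real"
  assumes S: "\<And>t. (S has_real_derivative Re (deriv zeta_reg (Complex 1 t) / zeta_reg (Complex 1 t))) (at t)" and S0: "S 0 = 0"
  shows "S (-t) = - S t"
proof -
  have "((\<lambda>t. S t + S (-t)) has_real_derivative 0) (at t)" for t
  proof -
    have "((\<lambda>t. S (-t)) has_real_derivative Re (deriv zeta_reg (Complex 1 (-t)) / zeta_reg (Complex 1 (-t))) * (-1)) (at t)"
      by (rule DERIV_chain2[OF S]) (auto intro!: derivative_eq_intros)
    from DERIV_add[OF S[of t] this] show ?thesis unfolding zeta_reg_log_deriv_cnj by simp
  qed
  hence "S t + S (-t) = S 0 + S (-0)" by (intro DERIV_isconst_all[of "\<lambda>t. S t + S (-t)"]) auto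
  thus ?thesis using S0 by simp
qed

text \<open>\<open>S\<close> has the same derivative as \<open>Im L\<close> on the line and the same
  value 0 at height 0, so the linear bound for \<open>Im L\<close> carries over.\<close>

lemma zeta_phase_small:
  fixes S :: "real \<Rightarrow> real"
  assumes S: "\<And>t. (S has_real_derivative Re (deriv zeta_reg (Complex 1 t) / zeta_reg (Complex 1 t))) (at t)" and S0: "S 0 = 0"
    and e: "\<epsilon> > 0"
  shows "\<forall>\<^sub>F t in at_top. \<bar>S t\<bar> \<le> \<epsilon> * (t * ln t) \<and> \<bar>S (-t)\<bar> \<le> \<epsilon> * (t * ln t)"
proof -
  obtain L K where LK: "zeta_log L K" using zeta_log_exists by blast
  obtain C where C: "C \<ge> 0" "\<And>y t. 1 \<le> y \<Longrightarrow> y \<le> 2 \<Longrightarrow> t \<ge> 2 \<Longrightarrow> \<bar>Im (L (Complex y t))\<bar> \<le> C * t"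
    using zeta_log.Im_L_bound[OF LK] by blast
  have "((\<lambda>t. S t - Im (L (Complex 1 t))) has_real_derivative 0) (at t)" for t
    using DERIV_diff[OF S[of t] zeta_log.Im_L_deriv[OF LK, of 1 t]] by simp
  hence "S t - Im (L (Complex 1 t)) = S 0 - Im (L (Complex 1 0))" for t
    by (intro DERIV_isconst_all[of "\<lambda>t. S t - Im (L (Complex 1 t))"]) auto
  moreover have "Complex 1 0 = 1" by (simp add: complex_eq_iff)
  ultimately have SL: "S t = Im (L (Complex 1 t))" for t using S0 zeta_log.L_1[OF LK] by simp
  have "\<forall>\<^sub>F t in at_top. C * t \<le> \<epsilon> * (t * ln t)" using e by real_asymp
  moreover have "\<forall>\<^sub>F t in at_top. t \<ge> (2::real)" by (rule eventually_ge_at_top)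
  ultimately show ?thesis
  proof eventually_elim
    case (elim t)
    have "\<bar>S t\<bar> \<le> C * t" unfolding SL using elim by (intro C) auto
    hence "\<bar>S t\<bar> \<le> \<epsilon> * (t * ln t)" using elim(1) by linarith
    thus ?case unfolding zeta_phase_odd[OF S S0, of t] by simp
  qed
qed

text \<open>Three sets are removed: small \<open>|t|\<close>, the set \<open>B1\<close> where
  \<open>|\<zeta>|\<close> may be small, and the set \<open>B2\<close> where the integral of
  \<open>1 + |\<zeta>'|\<^sup>2\<close> over the window is not small. Elsewhere
  \<open>|\<zeta>|\<close> exceeds \<open>\<eta>\<close> at the centre, stays above
  \<open>\<eta> / 2\<close> in the window, and \<open>|S'|\<close> is at most
  \<open>|\<zeta>' / \<zeta>|\<close>.\<close>

lemma zeta_phase_flat: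
  fixes S :: "real \<Rightarrow> real"
  assumes S: "\<And>t. (S has_real_derivative Re (deriv zeta_reg (Complex 1 t) / zeta_reg (Complex 1 t))) (at t)" and S0: "S 0 = 0"
    and e: "\<epsilon> > 0" and A: "A > 0"
  shows "\<forall>\<^sub>F T in at_top. \<exists>B\<in>lmeasurable. measure lebesgue B \<le> \<epsilon> * T \<and>
        (\<forall>t v. \<bar>t\<bar> \<le> T \<and> t \<notin> B \<and> \<bar>v - t\<bar> \<le> A / ln T \<longrightarrow> \<bar>S v - S t\<bar> \<le> \<epsilon>)"
proof -
  obtain C1 where C1: "C1 > 0" "\<And>\<delta>. \<delta> > 0 \<Longrightarrow> \<delta> < 1 \<Longrightarrow> \<forall>\<^sub>F T in at_top.
     integral {\<delta> * T..2 * T} (\<lambda>t. (norm (zeta_1_line t))\<^sup>2) \<le> C1 * T \<and>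
     integral {\<delta> * T..2 * T} (\<lambda>t. (norm (deriv riemann_zeta (Complex 1 t)))\<^sup>2) \<le> C1 * T"
    using zeta_1_line_moments by blast
  obtain C2 where C2: "C2 \<ge> 0" "\<And>c d. 2 \<le> c \<Longrightarrow> c \<le> d \<Longrightarrow> integral {c..d} (\<lambda>t. - ln (norm (zeta_1_line t))) \<le> C2 * d"
    using integral_ln_zeta_1_line by blast
  \<comment> \<open>The removed interval \<open>[- 2 \<delta> T, 2 \<delta> T]\<close> then has
    length at most \<open>\<epsilon> T / 4\<close>.\<close>
  define \<delta> where "\<delta> = min (1/4) (\<epsilon> / 16)"
  have \<delta>: "\<delta> > 0" "\<delta> \<le> 1/4" "16 * \<delta> \<le> \<epsilon>" using e by (auto simp: \<delta>_def min_def field_simps)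
  \<comment> \<open>Markov's inequality with this level leaves measure at most
    \<open>2 (C1 + C2) T / \<Lambda> = \<epsilon> T / 4\<close> for \<open>B1\<close>.\<close>
  define \<Lambda> where "\<Lambda> = 8 * (C1 + C2) / \<epsilon>"
  have \<Lambda>: "\<Lambda> > 0" using C1 C2 e by (simp add: \<Lambda>_def add_pos_nonneg)
  define \<eta> where "\<eta> = exp (- \<Lambda>)"
  have \<eta>: "0 < \<eta>" "\<eta> < 1" using \<Lambda> by (auto simp: \<eta>_def)
  \<comment> \<open>The bound \<open>\<eta> / 2\<close> keeps \<open>|\<zeta>|\<close> above
    \<open>\<eta> / 2\<close> in the window, and
    \<open>2 / \<eta> * \<kappa> \<le> \<epsilon>\<close> is the final estimate for the variation of
    \<open>S\<close>.\<close>
  define \<kappa> where "\<kappa> = \<eta> * min \<epsilon> 1 / 2"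
  have \<kappa>: "\<kappa> > 0" "\<kappa> \<le> \<eta> / 2" "2 / \<eta> * \<kappa> \<le> \<epsilon>" using \<eta> e by (auto simp: \<kappa>_def min_def field_simps)
  \<comment> \<open>The mean of the window integrals is of order \<open>1 / ln T\<close>, whereas
    the level \<open>\<kappa>\<close> is fixed; so \<open>B2\<close> eventually has measure at most
    \<open>\<epsilon> T / 4\<close>.\<close>
  have "\<forall>\<^sub>F T in at_top. 4 * (A / ln T) * ((C1 + 2) * T) \<le> \<kappa> * (\<epsilon> * T / 4)"
    using \<kappa> e by real_asymp
  moreover have "\<forall>\<^sub>F T in at_top. A / ln T \<le> \<delta> * T" using \<delta> by real_asymp
  moreover have "\<forall>\<^sub>F T in at_top. 2 \<le> \<delta> * T" using \<delta> by real_asymp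
  moreover have "\<forall>\<^sub>F T in at_top. T > (1::real)" by (rule eventually_gt_at_top)
  ultimately show ?thesis using C1(2)[of \<delta>] \<delta>
  proof -
    assume ev: "\<forall>\<^sub>F T in at_top. 4 * (A / ln T) * ((C1 + 2) * T) \<le> \<kappa> * (\<epsilon> * T / 4)"
      "\<forall>\<^sub>F T in at_top. A / ln T \<le> \<delta> * T" "\<forall>\<^sub>F T in at_top. 2 \<le> \<delta> * T" "\<forall>\<^sub>F T in at_top. T > (1::real)"
    have mo: "\<forall>\<^sub>F T in at_top.
     integral {\<delta> * T..2 * T} (\<lambda>t. (norm (zeta_1_line t))\<^sup>2) \<le> C1 * T \<and>
     integral {\<delta> * T..2 * T} (\<lambda>t. (norm (deriv riemann_zeta (Complex 1 t)))\<^sup>2) \<le> C1 * T" using \<delta> by (intro C1) auto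
    show ?thesis using ev mo
    proof eventually_elim
      case (elim T)
      define u where "u = A / ln T"
      have u: "0 < u" "u \<le> \<delta> * T" using elim A by (auto simp: u_def)
      have T: "T > 0" "\<delta> * T > 0" "\<delta> * T \<le> T / 4" using elim \<delta> by (auto simp: mult_right_mono)
      define p where "p = 2 * (\<delta> * T)"
      have pT: "p \<le> T" "4 \<le> p" "p - u \<ge> \<delta> * T" "T + u \<le> 2 * T" using T u(2) \<open>2 \<le> \<delta> * T\<close> unfolding p_def by linarith+
      \<comment> \<open>The maximum keeps the argument away from the pole at height 0 and makes
        \<open>f\<close> continuous on the whole line. Since \<open>x \<le> 1 + x\<^sup>2\<close>,
        the function dominates \<open>|\<zeta>'|\<close> while its integral is controlled by the
        mean square.\<close>
      define f where "f = (\<lambda>t. 1 + (norm (deriv riemann_zeta (Complex 1 (max t (\<delta> * T)))))\<^sup>2)"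
      have fc: "continuous_on UNIV f"
      proof -
        have "continuous_on UNIV (\<lambda>t. deriv riemann_zeta (Complex 1 (max t (\<delta> * T))))"
        proof (rule continuous_on_compose2[OF continuous_on_deriv_zeta_1_line[of "{\<delta> * T..}"]])
          show "0 \<notin> {\<delta> * T..}" using T(2) by (simp only: atLeast_iff not_le)
          show "continuous_on UNIV (\<lambda>t. max t (\<delta> * T))" by (intro continuous_intros)
        qed (simp add: image_subset_iff)
        thus ?thesis unfolding f_def by (intro continuous_intros)
      qed
      have f0: "f t \<ge> 0" for t by (simp add: f_def)
      obtain F where F: "\<And>t. (F has_real_derivative f t) (at t)" using antiderivative_real[OF fc] by blast
      have Fmono: "F x \<le> F y" if "x \<le> y" for x y
        by (rule DERIV_nonneg_imp_nondecreasing[OF that]) (use F f0 in blast)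
      have Fc: "continuous_on S F" for S by (rule DERIV_continuous_on[OF has_field_derivative_at_within[OF F]])
      have Fint: "F (T + u) - F (p - u) \<le> (C1 + 2) * T"
      proof -
        have "F (T + u) - F (p - u) \<le> F (2 * T) - F (\<delta> * T)" using Fmono pT by (intro diff_mono) auto
        also have "\<dots> = integral {\<delta> * T..2 * T} f"
        proof (rule integral_unique[symmetric], rule fundamental_theorem_of_calculus)
          show "\<delta> * T \<le> 2 * T" using T by linarith
          show "(F has_vector_derivative f t) (at t within {\<delta> * T..2 * T})" for t
            unfolding has_real_derivative_iff_has_vector_derivative[symmetric] by (rule has_field_derivative_at_within[OF F])
        qed
        also have "\<dots> = integral {\<delta> * T..2 * T} (\<lambda>t. 1 + (norm (deriv riemann_zeta (Complex 1 t)))\<^sup>2)"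
          by (rule integral_cong) (simp add: f_def max.absorb1)
        also have "\<dots> = (2 * T - \<delta> * T) + integral {\<delta> * T..2 * T} (\<lambda>t. (norm (deriv riemann_zeta (Complex 1 t)))\<^sup>2)"
        proof (subst integral_add)
          have n0: "0 \<notin> {\<delta> * T..2 * T}" using T(2) by (metis atLeastAtMost_iff not_le)
          show "(\<lambda>t. (norm (deriv riemann_zeta (Complex 1 t)))\<^sup>2) integrable_on {\<delta> * T..2 * T}"
            by (intro integrable_continuous_real continuous_intros continuous_on_deriv_zeta_1_line n0)
          have "\<delta> * T \<le> 2 * T" using T by linarith
          thus "integral {\<delta> * T..2 * T} (\<lambda>t. 1) + integral {\<delta> * T..2 * T} (\<lambda>t. (norm (deriv riemann_zeta (Complex 1 t)))\<^sup>2)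
            = (2 * T - \<delta> * T) + integral {\<delta> * T..2 * T} (\<lambda>t. (norm (deriv riemann_zeta (Complex 1 t)))\<^sup>2)"
            by (simp del: mult_le_cancel_right)
        qed (rule integrable_const_ivl)
        also have "\<dots> \<le> 2 * T + C1 * T" using elim T by simp
        finally show ?thesis by (simp add: algebra_simps)
      qed
      \<comment> \<open>Adding \<open>|\<zeta>|\<^sup>2\<close> makes the integrand nonnegative,
        because \<open>ln x \<le> x\<^sup>2\<close>, so Markov's inequality applies although only
        the mean of \<open>- ln |\<zeta>|\<close> is known to be bounded.\<close>
      define k where "k = (\<lambda>t. (norm (zeta_1_line t))\<^sup>2 - ln (norm (zeta_1_line t)))"
      have k0: "k t \<ge> 0" if "t > 0" for t
      proof -
        let ?x = "norm (zeta_1_line t)"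
        have "?x > 0" using zeta_1_line_nonzero[of t] that by simp
        hence "ln ?x \<le> ?x - 1" by (rule ln_le_minus_one)
        also have "\<dots> \<le> ?x\<^sup>2" using zero_le_power2[of "?x - 1/2"] by (simp add: power2_eq_square algebra_simps)
        finally show ?thesis by (simp add: k_def)
      qed
      have kc: "continuous_on {p..T} k" unfolding k_def
        using pT zeta_1_line_nonzero by (intro continuous_intros continuous_on_zeta_1_line) auto
      have kint: "integral {p..T} k \<le> (C1 + C2) * T"
      proof -
        have i: "(\<lambda>t. (norm (zeta_1_line t))\<^sup>2) integrable_on {c..d}" if "c > 0" for c d
          using that by (intro integrable_continuous_real continuous_intros continuous_on_zeta_1_line) auto
        have "integral {p..T} k = integral {p..T} (\<lambda>t. (norm (zeta_1_line t))\<^sup>2 + - ln (norm (zeta_1_line t)))" by (simp add: k_def)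
        also have "\<dots> = integral {p..T} (\<lambda>t. (norm (zeta_1_line t))\<^sup>2) + integral {p..T} (\<lambda>t. - ln (norm (zeta_1_line t)))"
          using pT zeta_1_line_nonzero
          by (intro integral_add i integrable_continuous_real continuous_intros continuous_on_zeta_1_line) auto
        also have "integral {p..T} (\<lambda>t. - ln (norm (zeta_1_line t))) \<le> C2 * T" using pT by (intro C2) auto
        also have "integral {p..T} (\<lambda>t. (norm (zeta_1_line t))\<^sup>2) \<le> integral {\<delta> * T..2 * T} (\<lambda>t. (norm (zeta_1_line t))\<^sup>2)"
          using pT T u by (intro integral_subset_le i) auto
        also have "\<dots> \<le> C1 * T" using elim by simp
        finally show ?thesis by (simp add: algebra_simps)
      qed
      define G where "G = (\<lambda>t. F (t + u) - F (t - u))"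
      have Gc: "continuous_on {p..T} G" unfolding G_def
        by (intro continuous_intros continuous_on_compose2[OF Fc[of UNIV]]) auto
      have G0: "G t \<ge> 0" for t using Fmono[of "t - u" "t + u"] u by (simp add: G_def)
      define B1 where "B1 = {t. \<bar>t\<bar> \<in> {p..T} \<and> \<Lambda> \<le> k \<bar>t\<bar>}"
      define B2 where "B2 = {t. \<bar>t\<bar> \<in> {p..T} \<and> \<kappa> \<le> G \<bar>t\<bar>}"
      have B1: "B1 \<in> lmeasurable" "\<Lambda> * measure lebesgue B1 \<le> 2 * integral {p..T} k"
      proof -
        have nn: "k t \<ge> 0" if "t \<in> {p..T}" for t using that pT by (intro k0) auto
        show "B1 \<in> lmeasurable" "\<Lambda> * measure lebesgue B1 \<le> 2 * integral {p..T} k"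
          unfolding B1_def by (rule markov_abs[OF kc nn less_imp_le[OF \<Lambda>]]; assumption)+
      qed
      have B2: "B2 \<in> lmeasurable" "\<kappa> * measure lebesgue B2 \<le> 2 * integral {p..T} G"
        unfolding B2_def by (rule markov_abs[OF Gc G0 less_imp_le[OF \<kappa>(1)]])+
      have m1: "measure lebesgue B1 \<le> \<epsilon> * T / 4"
      proof -
        have "\<Lambda> * measure lebesgue B1 \<le> 2 * ((C1 + C2) * T)" using B1 kint by linarith
        also have "\<dots> = \<Lambda> * (\<epsilon> * T / 4)" using e by (simp add: \<Lambda>_def)
        finally show ?thesis using \<Lambda> by simp
      qed
      have m2: "measure lebesgue B2 \<le> \<epsilon> * T / 4"
      proof -
        have "integral {p..T} G \<le> 2 * u * (F (T + u) - F (p - u))"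
          unfolding G_def using window_integral_bound[OF F f0 pT(1)] u by simp
        also have "\<dots> \<le> 2 * u * ((C1 + 2) * T)" using Fint u by (intro mult_left_mono) auto
        finally have "\<kappa> * measure lebesgue B2 \<le> 4 * u * ((C1 + 2) * T)" using B2 by simp
        also have "\<dots> \<le> \<kappa> * (\<epsilon> * T / 4)" using elim by (simp add: u_def)
        finally show ?thesis using \<kappa> by simp
      qed
      define B where "B = {-p..p} \<union> (B1 \<union> B2)"
      have Bm: "B \<in> lmeasurable" unfolding B_def using B1 B2 by (intro fmeasurable.Un) auto
      have "measure lebesgue B \<le> measure lebesgue {-p..p} + (measure lebesgue B1 + measure lebesgue B2)"
        unfolding B_def using B1 B2
        by (intro order_trans[OF measure_Un_le] add_left_mono fmeasurableD) (auto intro: fmeasurableD)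
      also have "measure lebesgue {-p..p} = 2 * p" using pT by simp
      also have "2 * p + (measure lebesgue B1 + measure lebesgue B2) \<le> \<epsilon> * T"
      proof -
        have "16 * \<delta> * T \<le> \<epsilon> * T" using \<delta> T by (intro mult_right_mono) auto
        moreover have "8 * p = 16 * \<delta> * T" by (simp add: p_def)
        moreover have "\<epsilon> * T \<ge> 0" using e T by simp
        ultimately show ?thesis using m1 m2 by linarith
      qed
      finally have Bm': "measure lebesgue B \<le> \<epsilon> * T" .
      have pos: "\<bar>S v - S t\<bar> \<le> \<epsilon>" if t: "t \<in> {p..T}" "t \<notin> B" and v: "\<bar>v - t\<bar> \<le> u" for t v
      proof -
        have kt: "k t < \<Lambda>" "G t < \<kappa>" using t pT by (auto simp: B_def B1_def B2_def)
        have w: "w \<ge> \<delta> * T" "w > 0" if "\<bar>w - t\<bar> \<le> u" for w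
        proof -
          show "w \<ge> \<delta> * T" using that t pT by (auto simp: abs_le_iff)
          thus "w > 0" using T by simp
        qed
        have big: "norm (zeta_1_line t) > \<eta>"
        proof (rule ccontr)
          assume "\<not> ?thesis"
          moreover have "norm (zeta_1_line t) > 0" using zeta_1_line_nonzero[of t] t pT by simp
          ultimately have "ln (norm (zeta_1_line t)) \<le> ln \<eta>" using \<eta> by (intro ln_mono) auto
          hence "ln (norm (zeta_1_line t)) \<le> - \<Lambda>" by (simp add: \<eta>_def)
          moreover have "(norm (zeta_1_line t))\<^sup>2 \<ge> 0" by simp
          ultimately have "k t \<ge> \<Lambda>" unfolding k_def by linarith
          thus False using kt by simp
        qed
        have dz: "(zeta_1_line has_vector_derivative \<i> * deriv riemann_zeta (Complex 1 w)) (at w)" if "\<bar>w - t\<bar> \<le> u" for w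
        proof (rule has_vector_derivative_vertical)
          have "Complex 1 w \<noteq> 1" using w[OF that] by (auto simp: complex_eq_iff)
          thus "(riemann_zeta has_field_derivative deriv riemann_zeta (Complex 1 w)) (at (Complex 1 w))"
            by (intro holomorphic_derivI[OF holomorphic_riemann_zeta]) (auto intro: open_halfspace_Re_gt)
        qed
        have zf: "norm (deriv riemann_zeta (Complex 1 w)) \<le> f w" if "\<bar>w - t\<bar> \<le> u" for w
        proof -
          have "max w (\<delta> * T) = w" using w[OF that] by simp
          moreover have "x \<le> 1 + x\<^sup>2" for x :: real using zero_le_power2[of "x - 1/2"] by (simp add: power2_eq_square algebra_simps)
          ultimately show ?thesis unfolding f_def by simp
        qed
        have near: "norm (zeta_1_line w) \<ge> \<eta> / 2" if "\<bar>w - t\<bar> \<le> u" for w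
        proof -
          have "norm (zeta_1_line w - zeta_1_line t) \<le> 1 * (F (t + u) - F (t - u))"
            by (rule window_variation[OF F f0 _ dz _ that]) (use zf in \<open>auto simp: norm_mult\<close>)
          hence "norm (zeta_1_line w - zeta_1_line t) \<le> \<eta> / 2" using kt \<kappa> by (simp add: G_def)
          moreover have "norm (zeta_1_line t) \<le> norm (zeta_1_line w) + norm (zeta_1_line w - zeta_1_line t)"
            using norm_triangle_ineq4[of "zeta_1_line w" "zeta_1_line w - zeta_1_line t"] by simp
          ultimately show ?thesis using big by linarith
        qed
        have "norm (S v - S t) \<le> 2 / \<eta> * (F (t + u) - F (t - u))"
        proof (rule window_variation[OF F f0 _ _ _ v])
          show "2 / \<eta> \<ge> 0" using \<eta> by simp
          fix x assume x: "\<bar>x - t\<bar> \<le> u"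
          show "(S has_vector_derivative Re (deriv zeta_reg (Complex 1 x) / zeta_reg (Complex 1 x))) (at x)"
            using S[of x] by (simp add: has_real_derivative_iff_has_vector_derivative)
          have "norm (Re (deriv zeta_reg (Complex 1 x) / zeta_reg (Complex 1 x))) \<le> norm (deriv riemann_zeta (Complex 1 x) / zeta_1_line x)"
            using w[OF x] by (subst Re_zeta_reg_log_deriv_1_line) (auto simp only: real_norm_def abs_Re_le_cmod)
          also have "\<dots> \<le> f x / (\<eta> / 2)" unfolding norm_divide
            using zf[OF x] near[OF x] \<eta> f0 by (intro frac_le) auto
          finally show "norm (Re (deriv zeta_reg (Complex 1 x) / zeta_reg (Complex 1 x))) \<le> 2 / \<eta> * f x" by (simp add: field_simps)
        qed
        also have "\<dots> \<le> 2 / \<eta> * \<kappa>" using kt \<eta> by (intro mult_left_mono) (auto simp: G_def)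
        finally show ?thesis using \<kappa> by simp
      qed
      have "\<bar>S v - S t\<bar> \<le> \<epsilon>" if t: "\<bar>t\<bar> \<le> T" "t \<notin> B" and v: "\<bar>v - t\<bar> \<le> A / ln T" for t v
      proof (cases "t \<ge> 0")
        case True
        hence "t \<in> {p..T}" using t by (auto simp: B_def)
        thus ?thesis using pos t v by (simp add: u_def)
      next
        \<comment> \<open>\<open>B\<close> is symmetric and \<open>S\<close> is odd, so negative
          \<open>t\<close> reduces to positive \<open>t\<close>.\<close>
        case False
        hence "- t \<in> {p..T}" using t by (auto simp: B_def)
        moreover have "- t \<notin> B" using t(2) by (auto simp: B_def B1_def B2_def)
        moreover have "\<bar>- v - - t\<bar> \<le> u" using v by (simp add: u_def abs_minus_commute)
        ultimately have "\<bar>S (-v) - S (-t)\<bar> \<le> \<epsilon>" by (rule pos)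
        thus ?thesis unfolding zeta_phase_odd[OF S S0] by simp
      qed
      thus ?case using Bm Bm' by blast
    qed
  qed
qed

subsection \<open>The limiting distribution\<close>

lemma A_fun_pos_limiting:
  assumes "h > 0" "h \<ge> 1/2 \<or> riemann_hypothesis"
  shows "limiting_joint_spacing_distribution (A_fun h \<theta>) (return borel (\<chi> i :: 'k::{finite, linorder}. (1 :: real)))"
proof -
  have adm: "xi_admissible h" using assms by (simp add: xi_admissible_def)
  obtain \<phi> S where "xi_phase h \<phi> S" using xi_phase_exists[OF adm] by blast
  interpret xi_phase h \<phi> S by fact
  consider "h > 1/2" | "h = 1/2" | "h < 1/2" by linarith
  thus ?thesis
  proof cases
    case 1
    show ?thesis
    proof (rule A_fun_limiting_pointwise[of 1])
      show "1 < a" using 1 by (simp add: a_def)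
      show "\<forall>s. Re s > 1 \<longrightarrow> zeta_reg s \<noteq> 0" using zeta_reg_nonzero_gt_1 by blast
    qed simp
  next
    case 2
    hence one: "1/2 + h = 1" by simp
    have S': "(S has_real_derivative Re (deriv zeta_reg (Complex 1 t) / zeta_reg (Complex 1 t))) (at t)" for t
      using S_deriv[of t] unfolding one .
    show ?thesis by (rule A_fun_limiting[OF zeta_phase_small[OF S' S_0] zeta_phase_flat[OF S' S_0]])
  next
    case 3
    hence RH: riemann_hypothesis using assms by simp
    show ?thesis
    proof (rule A_fun_limiting_pointwise[of "1/2"])
      show "1/2 < a" by (rule a_gt)
      show "\<forall>s. Re s > 1/2 \<longrightarrow> zeta_reg s \<noteq> 0" using zeta_reg_nonzero_RH[OF RH] by blast
    qed simp
  qed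
qed

section \<open>Negative shifts and the function B\<close>

lemma A_fun_uminus: "A_fun (-h) \<theta> = A_fun h (-\<theta>)"
  by (rule ext) (simp add: A_fun_def algebra_simps)

lemma A_fun_limiting_distribution:
  assumes "h \<noteq> 0" "\<bar>h\<bar> \<ge> 1/2 \<or> riemann_hypothesis"
  shows "limiting_joint_spacing_distribution (A_fun h \<theta>) (return borel (\<chi> i :: 'k::{finite, linorder}. (1 :: real)))"
proof (cases "h > 0")
  case True
  thus ?thesis using assms by (intro A_fun_pos_limiting) auto
next
  case False
  hence "limiting_joint_spacing_distribution (A_fun (-h) (-\<theta>)) (return borel (\<chi> i :: 'k. (1 :: real)))"
    using assms by (intro A_fun_pos_limiting) auto
  thus ?thesis by (simp add: A_fun_uminus)
qed

text \<open>The shifted angle may leave the interval \<open>[0, 2 \<pi>)\<close>; for this reason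
  the result for \<open>A\<close> is established for all real \<open>\<theta>\<close>.\<close>

lemma B_fun_eq_A_fun: "B_fun h \<theta> = A_fun h (\<theta> + pi / 2)"
  by (rule ext) (simp add: A_fun_def B_fun_def cos_add sin_add)

theorem theorem4p1:
  shows "(\<forall>h \<theta> :: real. \<bar>h\<bar> \<ge> 1 / 2 \<and> 0 \<le> \<theta> \<and> \<theta> < 2 * pi \<longrightarrow>
            limiting_joint_spacing_distribution (A_fun h \<theta>)
              (return borel (\<chi> i :: 'k::{finite, linorder}. (1 :: real))) \<and>
            limiting_joint_spacing_distribution (B_fun h \<theta>)
              (return borel (\<chi> i :: 'k. (1 :: real)))) \<and>
         (riemann_hypothesis \<longrightarrow>
           (\<forall>h \<theta> :: real. 0 < \<bar>h\<bar> \<and> \<bar>h\<bar> < 1 / 2 \<and> 0 \<le> \<theta> \<and> \<theta> < 2 * pi \<longrightarrow>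
            limiting_joint_spacing_distribution (A_fun h \<theta>)
              (return borel (\<chi> i :: 'k. (1 :: real))) \<and>
            limiting_joint_spacing_distribution (B_fun h \<theta>)
              (return borel (\<chi> i :: 'k. (1 :: real)))))"
  unfolding B_fun_eq_A_fun by (intro conjI allI impI A_fun_limiting_distribution) auto

end
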